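(* Suppose the setting and standing assumptions (A1)–(A5) of the context hold, that $f^x_U(\overline U)$ has only positive eigenvalues, and that $\epsilon>0$ is sufficiently small (depending only on the system and $\overline U$). Let $V=f^x(U)$ come from a steady and self-similar entropy solution with values in $\mathcal P_\epsilon$. Then $V$ (as a function of $\xi=y/x$ in each of the half-planes $x>0$ and $x<0$) is of bounded variation. More specifically, $V=V_S+V_L$, where $V_S$ is a saltus (jump) function of bounded variation and $V_L$ is Lipschitz, so that $V$ is a special function of bounded variation. The total variation of $V_S$ and the Lipschitz constant of $V_L$ are bounded by constants that are independent of $V$ and depend only on the system and $\epsilon$.
   Context: System. Let $f^x,f^y:\mathcal P\to\mathbb R^m$ ($\mathcal P\subset\mathbb R^m$) be smooth fluxes of the system $U_t+f^x(U)_x+f^y(U)_y=0$, and let $\eta,\psi^x,\psi^y:\mathcal P\to\mathbb R$ be smooth with $\eta_{UU}$ positive definite, $\psi^x_U=\eta_Uf^x_U$, $\psi^y_U=\eta_Uf^y_U$ (subscripts $U$ denote derivatives). An entropy solution is $U\in L^\infty$ satisfying the system in the sense of distributions and $\eta(U)_t+\psi^x(U)_x+\psi^y(U)_y\le 0$ in the sense of distributions. (A1) The system is $U_t+f^x(U)_x+f^y(U)_y=0$ with smooth fluxes $f^x,f^y:\mathcal P\to\mathbb R^m$ and smooth $\eta,\psi^x,\psi^y:\mathcal P\to\mathbb R$ such that $\eta_{UU}$ is positive definite, $\psi^x_U=\eta_Uf^x_U$ and $\psi^y_U=\eta_Uf^y_U$, and $U$ is a steady and self-similar entropy solution: an entropy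 solution independent of $t$ and constant along rays from the origin of the $(x,y)$-plane. In each of the half-planes $x>0$ and $x<0$, $U$ is thus a function of $\xi=y/x$, and in the sense of distributions $(f^y(U)-\xi f^x(U))_\xi+f^x(U)=0$, with $(\psi^y(U)-\xi\psi^x(U))_\xi+\psi^x(U)\le 0$ for $x>0$ and $\ge 0$ for $x<0$. (A2) $U$ takes values in the closed ball of small radius $\epsilon$ around a fixed background state $\overline U$ ($\epsilon$ may be reduced finitely many times). (A3) On this ball, $f^x_U(U)$ is nonsingular and the generalized eigenvalues of the pair $(f^x_U(U),f^y_U(U))$, i.e. the $\lambda$ with $\det(f^y_U-\lambda f^x_U)=0$, are real, semisimple and of constant multiplicity, and there are fewer than $m$ distinct ones. (A4) Each simple eigenvalue is either genuinely nonlinear or linearly degenerate on the whole phase space (definitions below). Eigenvalues of multiplicity $\ge2$ are automatically linearly degenerate. (A5) The eigenvalues of $f^x_U(\overline U)$ are all positive or all negative. Change of variables. $V:=f^x(U)$ is a diffeomorphism near $\overline U$; $\overline V:=f^x(\overline U)$, $f(V):=f^y(U(V))$, $e(V):=\psi^x(U(V))$, $q(V):=\psi^y(U(V))$. The phase space for $V$ is again denoted $\mathcal P_\epsilon$, a small ball around $\overline V$. The eigenvalues of $f_V(V)$ are the generalized eigenvalues above; the distinct ones are $\lambda^1(V)<\dots<\lambda^n(V)$, smooth, with multiplicities $p_\alpha$ and eigenspaces $R^\alpha(V)=\ker(f_V(V)-\lambda^\alpha(V)I)$. $\lambda^\alpha$ is linearly degenerate if $\lambda^\alpha_V(V)r=0$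 for all $V\in\mathcal P_\epsilon$, $r\in R^\alpha(V)$; it is genuinely nonlinear if $p_\alpha=1$ and $\lambda^\alpha_V(V)r\neq0$ for all $V\in\mathcal P_\epsilon$, $0\ne r\in R^\alpha(V)$. In each half-plane a version of $V$ is fixed such that for all $\xi_1<\xi_2$: $(f(V)-\xi V)|_{\xi_1}^{\xi_2}=-\int_{\xi_1}^{\xi_2}V\,d\eta$, and $(q(V)-\xi e(V))|_{\xi_1}^{\xi_2}\le-\int_{\xi_1}^{\xi_2}e(V)\,d\eta$ for $x>0$, $\ge$ for $x<0$. A special function of bounded variation is a BV function whose derivative measure has vanishing Cantor part. *)

theory Defs
  imports "HOL-Analysis.Analysis" "HOL-Computational_Algebra.Polynomial"
begin

section \<open>Smooth functions\<close>

text \<open>Meant for open \<open>S\<close>: \<open>Ck_on k f S\<close> says that all iterated directional derivatives of order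
  at most \<open>k\<close> exist as Frechet derivatives and are continuous.\<close>

primrec Ck_on :: "nat \<Rightarrow> ('a::real_normed_vector \<Rightarrow> 'b::real_normed_vector) \<Rightarrow> 'a set \<Rightarrow> bool" where
  "Ck_on 0 f S \<longleftrightarrow> continuous_on S f"
| "Ck_on (Suc k) f S \<longleftrightarrow>
     (\<forall>x\<in>S. f differentiable (at x)) \<and> (\<forall>v. Ck_on k (\<lambda>x. frechet_derivative f (at x) v) S)"

definition smooth_on :: "('a::real_normed_vector \<Rightarrow> 'b::real_normed_vector) \<Rightarrow> 'a set \<Rightarrow> bool" where
  "smooth_on f S \<longleftrightarrow> (\<forall>k. Ck_on k f S)"


section \<open>Systems with a convex entropy and their entropy solutions\<close>

definition entropy_system ::
  "(real^'m) set \<Rightarrow> (real^'m \<Rightarrow> real^'m) \<Rightarrow> (real^'m \<Rightarrow> real^'m) \<Rightarrow>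
   (real^'m \<Rightarrow> real) \<Rightarrow> (real^'m \<Rightarrow> real) \<Rightarrow> (real^'m \<Rightarrow> real) \<Rightarrow> bool" where
  "entropy_system P fx fy \<eta> \<psi>x \<psi>y \<longleftrightarrow>
     open P \<and> smooth_on fx P \<and> smooth_on fy P \<and>
     smooth_on \<eta> P \<and> smooth_on \<psi>x P \<and> smooth_on \<psi>y P \<and>
     (\<forall>U\<in>P. \<forall>v. v \<noteq> 0 \<longrightarrow>
        frechet_derivative (\<lambda>W. frechet_derivative \<eta> (at W) v) (at U) v > 0) \<and>
     (\<forall>U\<in>P. \<forall>v. frechet_derivative \<psi>x (at U) v =
        frechet_derivative \<eta> (at U) (frechet_derivative fx (at U) v)) \<and>
     (\<forall>U\<in>P. \<forall>v. frechet_derivative \<psi>y (at U) v =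
        frechet_derivative \<eta> (at U) (frechet_derivative fy (at U) v))"

text \<open>Points of space-time are triples \<open>(t, x, y)\<close>.\<close>

definition test_function :: "(real \<times> real \<times> real \<Rightarrow> real) \<Rightarrow> bool" where
  "test_function \<phi> \<longleftrightarrow> smooth_on \<phi> UNIV \<and> compact (closure {z. \<phi> z \<noteq> 0})"

definition d_t :: "(real \<times> real \<times> real \<Rightarrow> real) \<Rightarrow> real \<times> real \<times> real \<Rightarrow> real" where
  "d_t \<phi> z = frechet_derivative \<phi> (at z) (1, 0, 0)"

definition d_x :: "(real \<times> real \<times> real \<Rightarrow> real) \<Rightarrow> real \<times> real \<times> real \<Rightarrow> real" where
  "d_x \<phi> z = frechet_derivative \<phi> (at z) (0, 1, 0)"

definition d_y :: "(real \<times> real \<times> real \<Rightarrow> real) \<Rightarrow> real \<times> real \<times> real \<Rightarrow> real" where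
  "d_y \<phi> z = frechet_derivative \<phi> (at z) (0, 0, 1)"

text \<open>Elements of \<open>L\<^sup>\<infinity>\<close> are represented by functions, so all pointwise conditions on \<open>U\<close> are
  imposed almost everywhere.  The Bochner integrals below are genuine as soon as \<open>U\<close> takes almost
  all its values in a compact subset of \<open>P\<close>.\<close>

definition entropy_solution ::
  "(real^'m) set \<Rightarrow> (real^'m \<Rightarrow> real^'m) \<Rightarrow> (real^'m \<Rightarrow> real^'m) \<Rightarrow>
   (real^'m \<Rightarrow> real) \<Rightarrow> (real^'m \<Rightarrow> real) \<Rightarrow> (real^'m \<Rightarrow> real) \<Rightarrow>
   (real \<times> real \<times> real \<Rightarrow> real^'m) \<Rightarrow> bool" where
  "entropy_solution P fx fy \<eta> \<psi>x \<psi>y U \<longleftrightarrow>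
     U \<in> borel_measurable lebesgue \<and>
     (\<exists>M. AE z in lebesgue. norm (U z) \<le> M) \<and>
     (AE z in lebesgue. U z \<in> P) \<and>
     (\<forall>\<phi>. test_function \<phi> \<longrightarrow>
        (LINT z|lebesgue. d_t \<phi> z *\<^sub>R U z + d_x \<phi> z *\<^sub>R fx (U z) + d_y \<phi> z *\<^sub>R fy (U z)) = 0) \<and>
     (\<forall>\<phi>. test_function \<phi> \<and> (\<forall>z. \<phi> z \<ge> 0) \<longrightarrow>
        (LINT z|lebesgue. d_t \<phi> z * \<eta> (U z) + d_x \<phi> z * \<psi>x (U z) + d_y \<phi> z * \<psi>y (U z)) \<ge> 0)"

definition steady :: "(real \<times> real \<times> real \<Rightarrow> 'a) \<Rightarrow> bool" where
  "steady U \<longleftrightarrow> (\<forall>\<tau>. AE (t, x, y) in lebesgue. U (t + \<tau>, x, y) = U (t, x, y))"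

definition self_similar :: "(real \<times> real \<times> real \<Rightarrow> 'a) \<Rightarrow> bool" where
  "self_similar U \<longleftrightarrow> (\<forall>s>0. AE (t, x, y) in lebesgue. U (t, s * x, s * y) = U (t, x, y))"


section \<open>Generalized eigenvalues\<close>

definition cmat :: "real^'m^'m \<Rightarrow> complex^'m^'m" where
  "cmat A = (\<chi> i j. complex_of_real (A $ i $ j))"

text \<open>The generalized eigenvalues of the pair \<open>(A, B)\<close>, including the non-real ones; for
  \<open>A = mat 1\<close> they are the ordinary eigenvalues of \<open>B\<close>.\<close>

definition gen_eigenvalues :: "real^'m^'m \<Rightarrow> real^'m^'m \<Rightarrow> complex set" where
  "gen_eigenvalues A B = {z. det (cmat B - (\<chi> i j. z * cmat A $ i $ j)) = 0}"

text \<open>\<open>det (B - \<lambda> A)\<close> as a polynomial in \<open>\<lambda>\<close>.\<close>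

definition gen_charpoly :: "real^'m^'m \<Rightarrow> real^'m^'m \<Rightarrow> real poly" where
  "gen_charpoly A B = det (\<chi> i j. [: B $ i $ j, - (A $ i $ j) :])"

definition gen_eigenspace :: "real^'m^'m \<Rightarrow> real^'m^'m \<Rightarrow> real \<Rightarrow> (real^'m) set" where
  "gen_eigenspace A B \<mu> = {v. B *v v = \<mu> *\<^sub>R (A *v v)}"


section \<open>The variable \<open>V = f\<^sup>x(U)\<close>\<close>

text \<open>A function of \<open>U\<close> rewritten as a function of \<open>V\<close>, with \<open>U(V)\<close> the inverse of \<open>fx\<close> on
  the ball \<open>ball Ub \<delta>\<close>: \<open>f = in_V fx Ub \<delta> fy\<close>, \<open>e = in_V fx Ub \<delta> \<psi>x\<close>, \<open>q = in_V fx Ub \<delta> \<psi>y\<close>.\<close>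

definition in_V ::
  "(real^'m \<Rightarrow> real^'m) \<Rightarrow> real^'m \<Rightarrow> real \<Rightarrow> (real^'m \<Rightarrow> 'b) \<Rightarrow> real^'m \<Rightarrow> 'b" where
  "in_V fx Ub \<delta> g V = g (inv_into (ball Ub \<delta>) fx V)"

text \<open>On \<open>ball Ub \<delta>\<close> the Jacobian of \<open>fx\<close> is nonsingular, \<open>fx\<close> is a change of variables, and the
  generalized eigenvalues are real and semisimple with constant multiplicities.  The distinct ones
  are \<open>lam 1 < \<dots> < lam n\<close>, as functions of \<open>V\<close>, with multiplicities \<open>p 1, \<dots>, p n\<close>; semisimplicity is
  the equality of algebraic and geometric multiplicity.\<close>

definition constant_multiplicity ::
  "(real^'m \<Rightarrow> real^'m) \<Rightarrow> (real^'m \<Rightarrow> real^'m) \<Rightarrow> real^'m \<Rightarrow> real \<Rightarrow>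
   nat \<Rightarrow> (nat \<Rightarrow> real^'m \<Rightarrow> real) \<Rightarrow> (nat \<Rightarrow> nat) \<Rightarrow> bool" where
  "constant_multiplicity fx fy Ub \<delta> n lam p \<longleftrightarrow>
     inj_on fx (ball Ub \<delta>) \<and>
     (\<forall>\<alpha>\<in>{1..n}. smooth_on (lam \<alpha>) (fx ` ball Ub \<delta>)) \<and>
     (\<forall>U\<in>ball Ub \<delta>.
        det (jacobian fx (at U)) \<noteq> 0 \<and>
        gen_eigenvalues (jacobian fx (at U)) (jacobian fy (at U)) =
          (\<lambda>\<alpha>. complex_of_real (lam \<alpha> (fx U))) ` {1..n} \<and>
        strict_mono_on {1..n} (\<lambda>\<alpha>. lam \<alpha> (fx U)) \<and>
        (\<forall>\<alpha>\<in>{1..n}.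
           order (lam \<alpha> (fx U)) (gen_charpoly (jacobian fx (at U)) (jacobian fy (at U))) = p \<alpha> \<and>
           dim (gen_eigenspace (jacobian fx (at U)) (jacobian fy (at U)) (lam \<alpha> (fx U))) = p \<alpha>))"

definition eigenspace ::
  "(real^'m \<Rightarrow> real^'m) \<Rightarrow> (real^'m \<Rightarrow> real) \<Rightarrow> real^'m \<Rightarrow> (real^'m) set" where
  "eigenspace f l V = {r. frechet_derivative f (at V) r = l V *\<^sub>R r}"

definition linearly_degenerate ::
  "(real^'m \<Rightarrow> real^'m) \<Rightarrow> (real^'m \<Rightarrow> real) \<Rightarrow> (real^'m) set \<Rightarrow> bool" where
  "linearly_degenerate f l W \<longleftrightarrow>
     (\<forall>V\<in>W. \<forall>r\<in>eigenspace f l V. frechet_derivative l (at V) r = 0)"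

text \<open>To be used for simple eigenvalues \<open>l\<close> only.\<close>

definition genuinely_nonlinear ::
  "(real^'m \<Rightarrow> real^'m) \<Rightarrow> (real^'m \<Rightarrow> real) \<Rightarrow> (real^'m) set \<Rightarrow> bool" where
  "genuinely_nonlinear f l W \<longleftrightarrow>
     (\<forall>V\<in>W. \<forall>r\<in>eigenspace f l V. r \<noteq> 0 \<longrightarrow> frechet_derivative l (at V) r \<noteq> 0)"

text \<open>\<open>V\<close> is a version of \<open>fx(U)\<close> as a function of \<open>\<xi> = y/x\<close> in the half-plane \<open>\<sigma> x > 0\<close>, where
  \<open>\<sigma>\<close> is \<open>1\<close> or \<open>-1\<close>; it takes values in \<open>W\<close> and satisfies the integrated equation and the
  integrated entropy inequality (whose direction depends on \<open>\<sigma>\<close>) for every pair of points.\<close>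

definition version_in_half_plane ::
  "(real^'m \<Rightarrow> real^'m) \<Rightarrow> (real^'m \<Rightarrow> real^'m) \<Rightarrow> (real^'m \<Rightarrow> real) \<Rightarrow> (real^'m \<Rightarrow> real) \<Rightarrow>
   (real^'m) set \<Rightarrow> (real \<times> real \<times> real \<Rightarrow> real^'m) \<Rightarrow> real \<Rightarrow>
   (real \<Rightarrow> real^'m) \<Rightarrow> bool" where
  "version_in_half_plane fx f e q W U \<sigma> V \<longleftrightarrow>
     V \<in> borel_measurable lebesgue \<and>
     (AE (t, x, y) in lebesgue. \<sigma> * x > 0 \<longrightarrow> V (y / x) = fx (U (t, x, y))) \<and>
     range V \<subseteq> W \<and>
     (\<forall>\<xi>\<^sub>1 \<xi>\<^sub>2. \<xi>\<^sub>1 < \<xi>\<^sub>2 \<longrightarrow>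
        (f (V \<xi>\<^sub>2) - \<xi>\<^sub>2 *\<^sub>R V \<xi>\<^sub>2) - (f (V \<xi>\<^sub>1) - \<xi>\<^sub>1 *\<^sub>R V \<xi>\<^sub>1) =
          - integral {\<xi>\<^sub>1..\<xi>\<^sub>2} V \<and>
        \<sigma> * ((q (V \<xi>\<^sub>2) - \<xi>\<^sub>2 * e (V \<xi>\<^sub>2)) - (q (V \<xi>\<^sub>1) - \<xi>\<^sub>1 * e (V \<xi>\<^sub>1))) \<le>
          \<sigma> * (- integral {\<xi>\<^sub>1..\<xi>\<^sub>2} (\<lambda>\<xi>. e (V \<xi>))))"


section \<open>Functions of bounded variation on the real line\<close>

definition total_variation :: "(real \<Rightarrow> 'a::real_normed_vector) \<Rightarrow> ennreal" where
  "total_variation g =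
     (SUP (k, s) \<in> {(k::nat, s::nat \<Rightarrow> real). mono s}.
        \<Sum>i<k. ennreal (norm (g (s (Suc i)) - g (s i))))"

definition bounded_variation :: "(real \<Rightarrow> 'a::real_normed_vector) \<Rightarrow> bool" where
  "bounded_variation g \<longleftrightarrow> total_variation g < \<infinity>"

text \<open>A saltus function of bounded variation: up to a constant it is the sum of its countably many
  jumps, where \<open>a s\<close> is the jump from \<open>s-\<close> to \<open>s\<close> and \<open>b s\<close> the jump from \<open>s\<close> to \<open>s+\<close>.\<close>

definition saltus :: "(real \<Rightarrow> 'a::banach) \<Rightarrow> bool" where
  "saltus g \<longleftrightarrow>
     (\<exists>S c a b. countable S \<and>
        (\<lambda>s. norm (a s)) summable_on S \<and> (\<lambda>s. norm (b s)) summable_on S \<and>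
        (\<forall>\<xi>. g \<xi> = c + (\<Sum>\<^sub>\<infinity>s\<in>{s\<in>S. s \<le> \<xi>}. a s) + (\<Sum>\<^sub>\<infinity>s\<in>{s\<in>S. s < \<xi>}. b s)))"

definition vector_measure :: "(real set \<Rightarrow> 'a::real_normed_vector) \<Rightarrow> bool" where
  "vector_measure \<mu> \<longleftrightarrow>
     (\<forall>A::nat \<Rightarrow> real set. range A \<subseteq> sets borel \<and> disjoint_family A \<longrightarrow>
        (\<lambda>i. \<mu> (A i)) sums \<mu> (\<Union>i. A i))"

text \<open>Functions of bounded variation have one-sided limits everywhere, so the limits below are
  meaningful for them.\<close>

definition derivative_measure ::
  "(real \<Rightarrow> 'a::real_normed_vector) \<Rightarrow> (real set \<Rightarrow> 'a) \<Rightarrow> bool" where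
  "derivative_measure g \<mu> \<longleftrightarrow> vector_measure \<mu> \<and>
     (\<forall>a b. a < b \<longrightarrow> \<mu> {a<..b} = Lim (at_right b) g - Lim (at_right a) g)"

text \<open>The decomposition of \<open>\<mu>\<close> into an absolutely continuous part \<open>\<mu>a\<close>, a jump part \<open>\<mu>j\<close>
  concentrated on a countable set, and a Cantor part \<open>\<mu>c\<close>, singular but without atoms.\<close>

definition measure_decomposition ::
  "(real set \<Rightarrow> 'a::real_normed_vector) \<Rightarrow> (real set \<Rightarrow> 'a) \<Rightarrow> (real set \<Rightarrow> 'a) \<Rightarrow>
   (real set \<Rightarrow> 'a) \<Rightarrow> bool" where
  "measure_decomposition \<mu> \<mu>a \<mu>j \<mu>c \<longleftrightarrow>
     vector_measure \<mu>a \<and> vector_measure \<mu>j \<and> vector_measure \<mu>c \<and>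
     (\<forall>B\<in>sets borel. \<mu> B = \<mu>a B + \<mu>j B + \<mu>c B) \<and>
     (\<forall>B\<in>sets borel. B \<in> null_sets lborel \<longrightarrow> \<mu>a B = 0) \<and>
     (\<exists>J. countable J \<and> (\<forall>B\<in>sets borel. B \<inter> J = {} \<longrightarrow> \<mu>j B = 0)) \<and>
     (\<exists>N\<in>null_sets lborel. \<forall>B\<in>sets borel. B \<inter> N = {} \<longrightarrow> \<mu>c B = 0) \<and>
     (\<forall>s. \<mu>c {s} = 0)"

definition special_bounded_variation :: "(real \<Rightarrow> 'a::real_normed_vector) \<Rightarrow> bool" where
  "special_bounded_variation g \<longleftrightarrow> bounded_variation g \<and>
     (\<exists>\<mu> \<mu>a \<mu>j \<mu>c. derivative_measure g \<mu> \<and> measure_decomposition \<mu> \<mu>a \<mu>j \<mu>c \<and>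
        (\<forall>B\<in>sets borel. \<mu>c B = 0))"

end

theory Submission
  imports Defs
begin

text \<open>The entropy Hessian symmetrizes the pencil \<open>f\<^sup>y\<^sub>U - \<xi> f\<^sup>x\<^sub>U\<close>, and since the eigenvalues of
  \<open>f\<^sup>x\<^sub>U\<close> are positive, it turns \<open>f\<^sup>x\<^sub>U\<close> into a positive definite form.  While \<open>\<xi>\<close> stays away from the
  eigenvalues, \<open>f\<^sup>y - \<xi> f\<^sup>x\<close> is injective near \<open>Ub\<close> and the solution is constant.  Near an eigenvalue
  \<open>\<lambda>\<close>, two values of the solution differ, up to a Lipschitz error, by a jump along the eigenspace.

  If \<open>\<lambda>\<close> is linearly degenerate, which is automatic for multiple eigenvalues, \<open>\<lambda>\<close> does not change along
  such a jump, so the solution is constant wherever \<open>\<xi>\<close> differs from \<open>\<lambda>\<close>.  If \<open>\<lambda>\<close> is genuinely nonlinear,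
  the entropy inequality fixes the sign of the jumps.  In one half-plane they are Lax shocks, and there
  are at most two.  In the other one the solution is constant between \<open>\<xi>\<close> and \<open>\<lambda>(\<xi>)\<close>, so \<open>\<lambda>(\<xi>)\<close> is
  monotone with range in a short interval, and its jumps dominate those of the solution.\<close>

section \<open>Functions controlled by their jumps\<close>

text \<open>No continuity of V in \<xi> is known in advance, so the equation cannot be
  differentiated. It is replaced by a comparison of two points: with the speed frozen at y, the
  states at x and y satisfy the Rankine-Hugoniot relation and the entropy inequality up to C M |y -
  x|, where M bounds the oscillation on the segment. Algebra at a single state turns this into
  estimates for the jump, and a contraction on short steps takes the place of Gronwall's inequality.

  The analysis lives in U and not in V: the Hessian of the entropy maps right null vectors of the
  pencil to left ones, and positivity makes their pairing through the Jacobian of the x-flux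
  definite. This fixes the signs of the first and second order terms of a jump and of its cubic
  entropy dissipation.

  The outcome is one inequality: increments are at most D (y - x) plus the masses of two summable
  families of atoms. Together with constancy for large |\<xi>| it yields bounded variation, the
  saltus part, the Lipschitz part and the vanishing of the Cantor part.\<close>

definition jump_function :: "(real \<Rightarrow> 'a::banach) \<Rightarrow> (real \<Rightarrow> 'a) \<Rightarrow> real \<Rightarrow> 'a" where
  "jump_function a b \<xi> = infsum a {..\<xi>} + infsum b {..<\<xi>}"

lemma nonneg_summable_tail:
  fixes f :: "'b \<Rightarrow> real"
  assumes "f summable_on UNIV" "\<And>x. f x \<ge> 0" "e > 0"
  obtains T where "finite T" "\<And>S. S \<inter> T = {} \<Longrightarrow> infsum f S < e"
proof -
  have "(sum f \<longlongrightarrow> infsum f UNIV) (finite_subsets_at_top UNIV)"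
    using assms(1) by (rule infsum_tendsto)
  then have "\<forall>\<^sub>F T in finite_subsets_at_top UNIV. dist (sum f T) (infsum f UNIV) < e"
    using assms(3) by (rule tendstoD)
  then obtain T where T: "finite T" "dist (sum f T) (infsum f UNIV) < e"
    by (metis eventually_finite_subsets_at_top subset_refl top_greatest)
  have "infsum f S < e" if "S \<inter> T = {}" for S
  proof -
    have sm: "f summable_on A" for A
      using assms(1) by (rule summable_on_subset_banach) auto
    have "infsum f S + sum f T = infsum f (S \<union> T)"
      using that T(1) sm by (subst infsum_Un_disjoint) auto
    also have "\<dots> \<le> infsum f UNIV"
      by (rule infsum_mono2) (use sm assms(2) in auto)
    finally show ?thesis using T(2) by (simp add: dist_real_def)
  qed
  then show ?thesis using T(1) that by blast
qed

text \<open>The atom at \<open>s\<close> itself may be large. Only finitely many other atoms carry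
  mass that matters, and these stay at a positive distance from \<open>s\<close>.\<close>

lemma nonneg_summable_near:
  fixes f :: "real \<Rightarrow> real"
  assumes "f summable_on UNIV" "\<And>x. f x \<ge> 0" "e > 0"
  obtains d where "d > 0" "\<And>S. S \<subseteq> {s-d<..<s+d} - {s} \<Longrightarrow> infsum f S < e"
proof -
  obtain T where T: "finite T" "\<And>S. S \<inter> T = {} \<Longrightarrow> infsum f S < e"
    by (rule nonneg_summable_tail[OF assms]) (use that in blast)
  obtain d where d: "d > 0" "\<forall>x\<in>T. x \<noteq> s \<longrightarrow> d \<le> dist s x"
    using finite_set_avoid[OF T(1), of s] by blast
  show ?thesis
  proof (rule that[OF d(1)])
    fix S assume "S \<subseteq> {s-d<..<s+d} - {s}"
    then have "S \<inter> T = {}" using d(2) by (force simp: dist_real_def)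
    then show "infsum f S < e" by (rule T(2))
  qed
qed

lemma right_limit_exists:
  fixes V :: "real \<Rightarrow> 'a::banach"
  assumes "\<And>e. e > 0 \<Longrightarrow> \<exists>d>0. \<forall>x y. s < x \<and> x < y \<and> y < s + d \<longrightarrow> norm (V y - V x) < e"
  shows "\<exists>L. (V \<longlongrightarrow> L) (at_right s)"
proof -
  have "cauchy_filter (filtermap V (at_right s))"
    unfolding cauchy_filter_metric_filtermap
  proof (intro allI impI)
    fix e :: real assume "e > 0"
    then obtain d where d: "d > 0" "\<forall>x y. s < x \<and> x < y \<and> y < s + d \<longrightarrow> norm (V y - V x) < e"
      using assms by blast
    show "\<exists>P. eventually P (at_right s) \<and> (\<forall>x y. P x \<and> P y \<longrightarrow> dist (V x) (V y) < e)"
    proof (intro exI[of _ "\<lambda>x. s < x \<and> x < s + d"] conjI allI impI)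
      show "\<forall>\<^sub>F x in at_right s. s < x \<and> x < s + d"
        using d(1) by (auto simp: eventually_at_right_field intro!: exI[of _ "s+d"])
    next
      fix x y assume *: "(s < x \<and> x < s + d) \<and> (s < y \<and> y < s + d)"
      show "dist (V x) (V y) < e"
        using * d(2)[rule_format, of x y] d(2)[rule_format, of y x] \<open>e > 0\<close>
        by (cases x y rule: linorder_cases) (auto simp: dist_norm norm_minus_commute)
    qed
  qed
  moreover have "complete (UNIV :: 'a set)" by (rule complete_UNIV)
  moreover have "filtermap V (at_right s) \<noteq> bot" by (simp add: filtermap_bot_iff)
  ultimately show ?thesis
    unfolding complete_uniform filterlim_def by (auto dest!: spec[of _ "filtermap V (at_right s)"])
qed

text \<open>Increments are bounded by a Lipschitz part and by the atoms of two purely atomic measures;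
  \<open>a\<close> dominates the jumps from \<open>s-\<close> to \<open>s\<close> and \<open>b\<close> those from \<open>s\<close> to \<open>s+\<close>.\<close>

locale jump_control =
  fixes C :: real and a b :: "real \<Rightarrow> real" and V :: "real \<Rightarrow> 'a::banach"
  assumes C: "C \<ge> 0"
    and a: "a summable_on UNIV" "\<And>s. a s \<ge> 0"
    and b: "b summable_on UNIV" "\<And>s. b s \<ge> 0"
    and control: "\<And>x y. x < y \<Longrightarrow>
      norm (V y - V x) \<le> C * (y - x) + infsum a {x<..y} + infsum b {x..<y}"
begin

lemma sum_a: "a summable_on S" and sum_b: "b summable_on S"
  using a(1) b(1) by (auto intro: summable_on_subset_banach)

lemma mono_a: "S \<subseteq> S' \<Longrightarrow> infsum a S \<le> infsum a S'"
  and mono_b: "S \<subseteq> S' \<Longrightarrow> infsum b S \<le> infsum b S'"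
  by (auto intro!: infsum_mono2 sum_a sum_b a b)

lemma right_limit: "\<exists>L. (V \<longlongrightarrow> L) (at_right s)"
proof (rule right_limit_exists)
  fix e :: real assume e: "e > 0"
  obtain d1 where d1: "d1 > 0" "\<And>S. S \<subseteq> {s-d1<..<s+d1} - {s} \<Longrightarrow> infsum a S < e/3"
    using nonneg_summable_near[OF a, of "e/3" s] e by auto
  obtain d2 where d2: "d2 > 0" "\<And>S. S \<subseteq> {s-d2<..<s+d2} - {s} \<Longrightarrow> infsum b S < e/3"
    using nonneg_summable_near[OF b, of "e/3" s] e by auto
  \<comment> \<open>Each of the three terms of \<open>control\<close> gets \<open>e / 3\<close>;
    \<open>C + 1\<close> keeps the quotient meaningful for \<open>C = 0\<close>.\<close>
  define d where "d = min (min d1 d2) (e / (3 * (C + 1)))"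
  have "norm (V y - V x) < e" if *: "s < x" "x < y" "y < s + d" for x y
  proof -
    have "infsum a {x<..y} < e/3" by (rule d1(2)) (use * d_def in auto)
    moreover have "infsum b {x..<y} < e/3" by (rule d2(2)) (use * d_def in auto)
    moreover have "C * (y - x) \<le> e/3"
    proof -
      have "C * (y - x) \<le> C * (e / (3 * (C+1)))"
        using * C by (intro mult_left_mono) (auto simp: d_def)
      also have "\<dots> \<le> e/3" using C e by (simp add: field_simps)
      finally show ?thesis .
    qed
    ultimately show ?thesis using control[OF *(2)] by linarith
  qed
  moreover have "d > 0" using d1 d2 e C by (auto simp: d_def)
  ultimately show "\<exists>d>0. \<forall>x y. s < x \<and> x < y \<and> y < s + d \<longrightarrow> norm (V y - V x) < e" by blast
qed

end

lemma infsum_uminus_real_set: "infsum f (uminus ` S) = infsum (\<lambda>x. f (- x)) S" for S :: "real set"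
  by (subst infsum_reindex) (auto simp: inj_on_def o_def)

lemma summable_uminus_real:
  fixes f :: "real \<Rightarrow> real" assumes "f summable_on UNIV" shows "(\<lambda>x. f (- x)) summable_on UNIV"
  using summable_on_reindex[of uminus "UNIV :: real set" f] assms
  by (simp add: o_def inj_on_def)

context jump_control begin

text \<open>Reflection exchanges the two kinds of half-open intervals, hence jumps into a point with
  jumps out of it, so \<open>a\<close> and \<open>b\<close> change places. Facts about one side
  follow from those about the other.\<close>

lemma reflect: "jump_control C (\<lambda>x. b (- x)) (\<lambda>x. a (- x)) (\<lambda>x. V (- x))"
proof
  show "(\<lambda>x. b (- x)) summable_on UNIV" "(\<lambda>x. a (- x)) summable_on UNIV"
    using a(1) b(1) by (auto intro: summable_uminus_real)
next
  fix x y :: real assume "x < y"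
  have "norm (V (- y) - V (- x)) = norm (V (- x) - V (- y))" by (rule norm_minus_commute)
  also have "\<dots> \<le> C * (- x - - y) + infsum a {- y<..- x} + infsum b {- y..<- x}"
    by (rule control) (use \<open>x < y\<close> in auto)
  also have "{- y<..- x} = uminus ` {x..<y}" by simp
  also have "{- y..<- x} = uminus ` {x<..y}" by simp
  finally show "norm (V (- y) - V (- x))
      \<le> C * (y - x) + (\<Sum>\<^sub>\<infinity>s\<in>{x<..y}. b (- s)) + (\<Sum>\<^sub>\<infinity>s\<in>{x..<y}. a (- s))"
    unfolding infsum_uminus_real_set by simp
qed (use C a b in auto)

lemma left_limit: "\<exists>L. (V \<longlongrightarrow> L) (at_left s)"
proof -
  obtain L where "((\<lambda>x. V (- x)) \<longlongrightarrow> L) (at_right (- s))"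
    using jump_control.right_limit[OF reflect] by blast
  then show ?thesis
    using filterlim_at_left_to_right[of V "nhds L" s] by blast
qed

definition left_jump where "left_jump s = V s - Lim (at_left s) V"
definition right_jump where "right_jump s = Lim (at_right s) V - V s"

lemma left_jump: "(V \<longlongrightarrow> V s - left_jump s) (at_left s)"
  and right_jump: "(V \<longlongrightarrow> V s + right_jump s) (at_right s)"
  unfolding left_jump_def right_jump_def
  using left_limit[of s] right_limit[of s] by (auto simp: tendsto_Lim)

text \<open>Only finitely many jumps are removed at a time, so that each removal is a question about
  one-sided limits at a single point; \<open>lipschitz_part\<close> lets the finite set
  grow.\<close>

definition remainder where
  "remainder T \<xi> = V \<xi> - (\<Sum>s\<in>T. (if s \<le> \<xi> then left_jump s else 0) + (if s < \<xi> then right_jump s else 0))"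

text \<open>Away from \<open>T\<close> the removed step functions are constant on a one-sided
  neighbourhood of \<open>s\<close>, so the remainder inherits the jump of \<open>V\<close>.\<close>

lemma remainder_left:
  assumes "finite T" "s \<notin> T"
  shows "(remainder T \<longlongrightarrow> remainder T s - left_jump s) (at_left s)"
proof -
  have *: "((\<lambda>\<xi>. (if t \<le> \<xi> then left_jump t else 0) + (if t < \<xi> then right_jump t else 0)) \<longlongrightarrow>
      (if t \<le> s then left_jump t else 0) + (if t < s then right_jump t else 0)) (at_left s)"
    if "t \<in> T" for t
  proof (rule tendsto_eventually)
    have "t \<noteq> s" using that assms by auto
    then consider "t < s" | "s < t" by linarith
    then show "\<forall>\<^sub>F \<xi> in at_left s. (if t \<le> \<xi> then left_jump t else 0) + (if t < \<xi> then right_jump t else 0) =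
        (if t \<le> s then left_jump t else 0) + (if t < s then right_jump t else 0)"
      unfolding eventually_at_left_field
      by cases (rule exI[of _ t], force, rule exI[of _ "s - 1"], force)
  qed
  have "(remainder T \<longlongrightarrow> (V s - left_jump s) -
     (\<Sum>t\<in>T. (if t \<le> s then left_jump t else 0) + (if t < s then right_jump t else 0))) (at_left s)"
    unfolding remainder_def by (intro tendsto_diff left_jump tendsto_sum *)
  then show ?thesis by (simp add: remainder_def algebra_simps)
qed

lemma remainder_right:
  assumes "finite T" "s \<notin> T"
  shows "(remainder T \<longlongrightarrow> remainder T s + right_jump s) (at_right s)"
proof -
  have *: "((\<lambda>\<xi>. (if t \<le> \<xi> then left_jump t else 0) + (if t < \<xi> then right_jump t else 0)) \<longlongrightarrow>
      (if t \<le> s then left_jump t else 0) + (if t < s then right_jump t else 0)) (at_right s)"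
    if "t \<in> T" for t
  proof (rule tendsto_eventually)
    have "t \<noteq> s" using that assms by auto
    then consider "t < s" | "s < t" by linarith
    then show "\<forall>\<^sub>F \<xi> in at_right s. (if t \<le> \<xi> then left_jump t else 0) + (if t < \<xi> then right_jump t else 0) =
        (if t \<le> s then left_jump t else 0) + (if t < s then right_jump t else 0)"
      unfolding eventually_at_right_field
      by cases (rule exI[of _ "s + 1"], force, rule exI[of _ t], force)
  qed
  have "(remainder T \<longlongrightarrow> (V s + right_jump s) -
     (\<Sum>t\<in>T. (if t \<le> s then left_jump t else 0) + (if t < s then right_jump t else 0))) (at_right s)"
    unfolding remainder_def by (intro tendsto_diff right_jump tendsto_sum *)
  then show ?thesis by (simp add: remainder_def algebra_simps)
qed

lemma remainder_insert:
  assumes "finite T" "s \<notin> T"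
  shows "remainder (insert s T) \<xi> = remainder T \<xi> -
    ((if s \<le> \<xi> then left_jump s else 0) + (if s < \<xi> then right_jump s else 0))"
  using assms by (simp add: remainder_def algebra_simps)

text \<open>Removing the jump at \<open>s\<close> strikes the atom at \<open>s\<close> from the
  bound. On either side of \<open>s\<close> this is the old bound, taken to the limit along points
  that have not reached \<open>s\<close>; the two sides fit together because the new remainder is
  continuous at \<open>s\<close>.\<close>

lemma remainder_control:
  assumes "finite T" "x < y"
  shows "norm (remainder T y - remainder T x)
    \<le> C * (y - x) + infsum a ({x<..y} - T) + infsum b ({x..<y} - T)"
  using assms
proof (induction T arbitrary: x y rule: finite_induct)
  case empty
  then show ?case using control by (simp add: remainder_def)
next
  case (insert s T)
  let ?R = "remainder T"
  let ?B = "\<lambda>x y. C * (y - x) + infsum a ({x<..y} - insert s T) + infsum b ({x..<y} - insert s T)"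
  \<comment> \<open>For \<open>z < s\<close> neither half-open interval contains \<open>s\<close>,
    so the induction hypothesis passes to the left limit without the atom.\<close>
  have up: "norm (?R s - left_jump s - ?R x) \<le> ?B x s" if "x < s" for x
  proof (rule tendsto_upperbound)
    show "((\<lambda>z. norm (?R z - ?R x)) \<longlongrightarrow> norm (?R s - left_jump s - ?R x)) (at_left s)"
      by (intro tendsto_intros remainder_left insert.hyps)
    have "norm (?R z - ?R x) \<le> ?B x s" if "x < z" "z < s" for z
    proof -
      have "norm (?R z - ?R x) \<le> C * (z - x) + infsum a ({x<..z} - T) + infsum b ({x..<z} - T)"
        by (rule insert.IH) fact
      also have "\<dots> \<le> ?B x s"
        using that C by (intro add_mono mult_left_mono mono_a mono_b) auto
      finally show ?thesis .
    qed
    then show "\<forall>\<^sub>F z in at_left s. norm (?R z - ?R x) \<le> ?B x s"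
      using that by (auto simp: eventually_at_left_field intro: exI[of _ x])
  qed simp
  have down: "norm (?R y - (?R s + right_jump s)) \<le> ?B s y" if "s < y" for y
  proof (rule tendsto_upperbound)
    show "((\<lambda>z. norm (?R y - ?R z)) \<longlongrightarrow> norm (?R y - (?R s + right_jump s))) (at_right s)"
      by (intro tendsto_intros remainder_right insert.hyps)
    have "norm (?R y - ?R z) \<le> ?B s y" if "s < z" "z < y" for z
    proof -
      have "norm (?R y - ?R z) \<le> C * (y - z) + infsum a ({z<..y} - T) + infsum b ({z..<y} - T)"
        by (rule insert.IH) fact
      also have "\<dots> \<le> ?B s y"
        using that C by (intro add_mono mult_left_mono mono_a mono_b) auto
      finally show ?thesis .
    qed
    then show "\<forall>\<^sub>F z in at_right s. norm (?R y - ?R z) \<le> ?B s y"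
      using that by (auto simp: eventually_at_right_field intro: exI[of _ y])
  qed simp
  note [simp] = remainder_insert[OF insert.hyps]
  consider "y < s \<or> s < x" | "x < s" "s < y" | "x = s" | "y = s" by linarith
  then show ?case
  proof cases
    case 1
    have "{x<..y} - insert s T = {x<..y} - T" "{x..<y} - insert s T = {x..<y} - T" using 1 by auto
    then show ?thesis using 1 insert.IH[OF insert.prems] insert.prems by auto
  next
    case 2
    have "norm (?R y - (?R s + right_jump s) + (?R s - left_jump s - ?R x)) \<le> ?B s y + ?B x s"
      using up[OF 2(1)] down[OF 2(2)] by (intro norm_triangle_le) linarith
    also have "?B s y + ?B x s = C * (y - x) + (infsum a ({x<..s} - insert s T) + infsum a ({s<..y} - insert s T))
       + (infsum b ({x..<s} - insert s T) + infsum b ({s..<y} - insert s T))"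
      by (simp add: algebra_simps)
    also have "infsum a ({x<..s} - insert s T) + infsum a ({s<..y} - insert s T) = infsum a ({x<..y} - insert s T)"
      by (subst infsum_Un_disjoint[symmetric]) (use 2 in \<open>auto intro!: sum_a arg_cong[of _ _ "infsum a"]\<close>)
    also have "infsum b ({x..<s} - insert s T) + infsum b ({s..<y} - insert s T) = infsum b ({x..<y} - insert s T)"
      by (subst infsum_Un_disjoint[symmetric]) (use 2 in \<open>auto intro!: sum_b arg_cong[of _ _ "infsum b"]\<close>)
    finally show ?thesis using 2 by (simp add: algebra_simps)
  next
    case 3
    then show ?thesis using down[of y] insert.prems by (simp add: algebra_simps)
  next
    case 4
    then show ?thesis using up[of x] insert.prems by (simp add: algebra_simps)
  qed
qed

end

context jump_control begin

text \<open>As \<open>z\<close> increases to \<open>s\<close>, every contribution to the control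
  bound vanishes except the atom of \<open>a\<close> at \<open>s\<close>.\<close>

lemma norm_left_jump: "norm (left_jump s) \<le> a s"
proof (rule field_le_epsilon)
  fix e :: real assume e: "e > 0"
  obtain d1 where d1: "d1 > 0" "\<And>S. S \<subseteq> {s-d1<..<s+d1} - {s} \<Longrightarrow> infsum a S < e/3"
    using nonneg_summable_near[OF a, of "e/3" s] e by auto
  obtain d2 where d2: "d2 > 0" "\<And>S. S \<subseteq> {s-d2<..<s+d2} - {s} \<Longrightarrow> infsum b S < e/3"
    using nonneg_summable_near[OF b, of "e/3" s] e by auto
  define d where "d = min (min d1 d2) (e / (3 * (C + 1)))"
  have d: "d > 0" using d1 d2 e C by (auto simp: d_def)
  have "norm (V s - V z) \<le> a s + e" if *: "s - d < z" "z < s" for z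
  proof -
    have "C * (s - z) \<le> C * (e / (3 * (C+1)))"
      using * C by (intro mult_left_mono) (auto simp: d_def)
    also have "\<dots> \<le> e/3" using C e by (simp add: field_simps)
    finally have "C * (s - z) \<le> e/3" .
    moreover have "infsum b {z..<s} < e/3" by (rule d2(2)) (use * d_def in auto)
    moreover have "infsum a {z<..s} = infsum a ({z<..<s} \<union> {s})"
      using * by (intro arg_cong[of _ _ "infsum a"]) auto
    moreover have "\<dots> = infsum a {z<..<s} + a s"
      by (subst infsum_Un_disjoint) (auto intro: sum_a)
    moreover have "infsum a {z<..<s} < e/3" by (rule d1(2)) (use * d_def in auto)
    ultimately show ?thesis using control[OF *(2)] by linarith
  qed
  then have "\<forall>\<^sub>F z in at_left s. norm (V s - V z) \<le> a s + e"
    using d by (auto simp: eventually_at_left_field intro!: exI[of _ "s-d"])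
  moreover have "((\<lambda>z. norm (V s - V z)) \<longlongrightarrow> norm (V s - (V s - left_jump s))) (at_left s)"
    by (intro tendsto_intros left_jump)
  ultimately have "norm (V s - (V s - left_jump s)) \<le> a s + e"
    by (intro tendsto_upperbound[of "\<lambda>z. norm (V s - V z)"]) auto
  then show "norm (left_jump s) \<le> a s + e" by simp
qed

lemma norm_right_jump: "norm (right_jump s) \<le> b s"
proof -
  interpret R: jump_control C "\<lambda>x. b (- x)" "\<lambda>x. a (- x)" "\<lambda>x. V (- x)" by (rule reflect)
  have "((\<lambda>x. V (- x)) \<longlongrightarrow> V s + right_jump s) (at_left (- s))"
    using right_jump[of s] unfolding at_right_minus[of s] filterlim_filtermap .
  then have "V s + right_jump s = V s - R.left_jump (- s)"
    using R.left_jump[of "- s"] by (simp add: tendsto_unique[OF trivial_limit_at_left_real])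
  then show ?thesis using R.norm_left_jump[of "- s"] by simp
qed

lemma abs_summable_left_jump: "(\<lambda>s. norm (left_jump s)) summable_on S"
  and abs_summable_right_jump: "(\<lambda>s. norm (right_jump s)) summable_on S"
proof -
  have *: "(\<lambda>s. norm (a s)) summable_on S" "(\<lambda>s. norm (b s)) summable_on S" using sum_a[of S] sum_b[of S] a(2) b(2) by simp_all
  show "(\<lambda>s. norm (left_jump s)) summable_on S"
    by (rule Infinite_Sum.abs_summable_on_comparison_test[OF *(1)]) (use norm_left_jump a(2) in simp)
  show "(\<lambda>s. norm (right_jump s)) summable_on S"
    by (rule Infinite_Sum.abs_summable_on_comparison_test[OF *(2)]) (use norm_right_jump b(2) in simp)
qed

lemma summable_left_jump: "left_jump summable_on S"
  and summable_right_jump: "right_jump summable_on S"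
  using abs_summable_summable abs_summable_left_jump abs_summable_right_jump by blast+

lemma infsum_left_jump_le: "norm (infsum left_jump S) \<le> infsum a S"
  and infsum_right_jump_le: "norm (infsum right_jump S) \<le> infsum b S"
  using norm_infsum_bound[OF abs_summable_left_jump, of S] norm_infsum_bound[OF abs_summable_right_jump, of S]
    infsum_mono[OF abs_summable_left_jump sum_a norm_left_jump, of S]
    infsum_mono[OF abs_summable_right_jump sum_b norm_right_jump, of S]
  by linarith+

lemma jump_function_diff:
  assumes "x < y"
  shows "jump_function left_jump right_jump y - jump_function left_jump right_jump x =
    infsum left_jump {x<..y} + infsum right_jump {x..<y}"
proof -
  have "infsum left_jump {..y} = infsum left_jump {..x} + infsum left_jump {x<..y}"
    by (subst infsum_Un_disjoint[symmetric])
      (use assms in \<open>auto intro!: summable_left_jump arg_cong[of _ _ "infsum left_jump"]\<close>)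
  moreover have "infsum right_jump {..<y} = infsum right_jump {..<x} + infsum right_jump {x..<y}"
    by (subst infsum_Un_disjoint[symmetric])
      (use assms in \<open>auto intro!: summable_right_jump arg_cong[of _ _ "infsum right_jump"]\<close>)
  ultimately show ?thesis by (simp add: jump_function_def)
qed

text \<open>For a fixed pair of points a finite \<open>T\<close> carries all but a small part of
  both masses. The increment of \<open>remainder T\<close> is free of the atoms in \<open>T\<close>
  by \<open>remainder_control\<close>, and it differs from the increment in question only by the
  jumps outside \<open>T\<close>.\<close>

lemma lipschitz_part: "C-lipschitz_on UNIV (\<lambda>\<xi>. V \<xi> - jump_function left_jump right_jump \<xi>)"
proof -
  let ?W = "\<lambda>\<xi>. V \<xi> - jump_function left_jump right_jump \<xi>"
  have *: "norm (?W y - ?W x) \<le> C * (y - x)" if "x < y" for x y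
  proof (rule field_le_epsilon)
    fix e :: real assume e: "e > 0"
    \<comment> \<open>Four tails occur in the end, two from \<open>remainder_control\<close> and two
      from the jumps outside \<open>T\<close>; hence \<open>e / 4\<close>.\<close>
    obtain T1 where T1: "finite T1" "\<And>S. S \<inter> T1 = {} \<Longrightarrow> infsum a S < e/4"
      using nonneg_summable_tail[OF a, of "e/4"] e by auto
    obtain T2 where T2: "finite T2" "\<And>S. S \<inter> T2 = {} \<Longrightarrow> infsum b S < e/4"
      using nonneg_summable_tail[OF b, of "e/4"] e by auto
    define T where "T = T1 \<union> T2"
    have T: "finite T" "\<And>S. infsum a (S - T) < e/4" "\<And>S. infsum b (S - T) < e/4"
      unfolding T_def by (use T1(1) T2(1) in simp, rule T1(2), blast, rule T2(2), blast)
    have R: "remainder T y - remainder T x =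
        V y - V x - sum left_jump ({x<..y} \<inter> T) - sum right_jump ({x..<y} \<inter> T)"
    proof -
      have "(\<Sum>s\<in>T. if s \<le> y then left_jump s else 0) - (\<Sum>s\<in>T. if s \<le> x then left_jump s else 0)
          = (\<Sum>s\<in>T. if s \<in> {x<..y} then left_jump s else 0)"
        unfolding sum_subtractf[symmetric] using \<open>x < y\<close> by (intro sum.cong) auto
      moreover have "(\<Sum>s\<in>T. if s < y then right_jump s else 0) - (\<Sum>s\<in>T. if s < x then right_jump s else 0)
          = (\<Sum>s\<in>T. if s \<in> {x..<y} then right_jump s else 0)"
        unfolding sum_subtractf[symmetric] using \<open>x < y\<close> by (intro sum.cong) auto
      moreover have "(\<Sum>s\<in>T. if s \<in> {x<..y} then left_jump s else 0) = sum left_jump ({x<..y} \<inter> T)"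
        "(\<Sum>s\<in>T. if s \<in> {x..<y} then right_jump s else 0) = sum right_jump ({x..<y} \<inter> T)"
        using T(1) sum.inter_restrict[of T left_jump "{x<..y}"] sum.inter_restrict[of T right_jump "{x..<y}"]
        by (simp_all add: Int_commute)
      ultimately show ?thesis unfolding remainder_def sum.distrib by (simp add: algebra_simps)
    qed
    have sl: "infsum left_jump S = sum left_jump (S \<inter> T) + infsum left_jump (S - T)" for S
    proof -
      have "infsum left_jump ((S \<inter> T) \<union> (S - T)) = infsum left_jump (S \<inter> T) + infsum left_jump (S - T)"
        by (rule infsum_Un_disjoint) (auto intro: summable_left_jump)
      moreover have "(S \<inter> T) \<union> (S - T) = S" by auto
      ultimately show ?thesis using T(1) by simp
    qed
    have sr: "infsum right_jump S = sum right_jump (S \<inter> T) + infsum right_jump (S - T)" for S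
    proof -
      have "infsum right_jump ((S \<inter> T) \<union> (S - T)) = infsum right_jump (S \<inter> T) + infsum right_jump (S - T)"
        by (rule infsum_Un_disjoint) (auto intro: summable_right_jump)
      moreover have "(S \<inter> T) \<union> (S - T) = S" by auto
      ultimately show ?thesis using T(1) by simp
    qed
    have "?W y - ?W x = (remainder T y - remainder T x)
        - infsum left_jump ({x<..y} - T) - infsum right_jump ({x..<y} - T)"
      using jump_function_diff[OF that] sl[of "{x<..y}"] sr[of "{x..<y}"] unfolding R
      by (simp add: algebra_simps)
    also have "norm \<dots> \<le> norm (remainder T y - remainder T x)
        + norm (infsum left_jump ({x<..y} - T)) + norm (infsum right_jump ({x..<y} - T))"
      by (intro order_trans[OF norm_triangle_ineq4] add_mono order_refl)
    finally show "norm (?W y - ?W x) \<le> C * (y - x) + e"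
      using remainder_control[OF T(1) that] infsum_left_jump_le[of "{x<..y} - T"]
        infsum_right_jump_le[of "{x..<y} - T"] T(2)[of "{x<..y}"] T(3)[of "{x..<y}"] by linarith
  qed
  show ?thesis
  proof (rule lipschitz_onI)
    fix x y :: real
    show "dist (?W x) (?W y) \<le> C * dist x y"
      using *[of x y] *[of y x] by (cases x y rule: linorder_cases) (auto simp: dist_norm norm_minus_commute)
  qed (rule C)
qed

lemma saltus_jump_function: "saltus (jump_function left_jump right_jump)"
proof -
  define S where "S = {s. left_jump s \<noteq> 0} \<union> {s. right_jump s \<noteq> 0}"
  have "countable S"
    using abs_summable_countable[OF abs_summable_left_jump, of UNIV]
      abs_summable_countable[OF abs_summable_right_jump, of UNIV] by (auto simp: S_def)
  moreover have "infsum left_jump {..\<xi>} = infsum left_jump {s\<in>S. s \<le> \<xi>}"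
    "infsum right_jump {..<\<xi>} = infsum right_jump {s\<in>S. s < \<xi>}" for \<xi>
    by (auto intro!: infsum_cong_neutral simp: S_def)
  ultimately show ?thesis
    unfolding saltus_def jump_function_def
    by (intro exI[of _ S] exI[of _ 0] exI[of _ left_jump] exI[of _ right_jump])
      (simp add: abs_summable_left_jump abs_summable_right_jump)
qed

end

text \<open>\<open>\<phi>\<close> plays the part of a variation function: its increments dominate
  those of \<open>g\<close>, and they telescope.\<close>

lemma total_variation_le:
  fixes g :: "real \<Rightarrow> 'a::real_normed_vector"
  assumes "\<And>x y. x \<le> y \<Longrightarrow> norm (g y - g x) \<le> \<phi> y - \<phi> x" and "\<And>x y. \<phi> y - \<phi> x \<le> K"
  shows "total_variation g \<le> ennreal K"
  unfolding total_variation_def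
proof (rule SUP_least)
  fix p :: "nat \<times> (nat \<Rightarrow> real)" assume "p \<in> {(k, s). mono s}"
  then obtain k s where p: "p = (k, s)" and s: "mono s" by auto
  have "(\<Sum>i<k. ennreal (norm (g (s (Suc i)) - g (s i)))) = ennreal (\<Sum>i<k. norm (g (s (Suc i)) - g (s i)))"
    by (rule sum_ennreal) auto
  also have "\<dots> \<le> ennreal (\<Sum>i<k. \<phi> (s (Suc i)) - \<phi> (s i))"
    by (intro ennreal_leI sum_mono assms(1)) (auto intro: monoD[OF s])
  also have "(\<Sum>i<k. \<phi> (s (Suc i)) - \<phi> (s i)) = \<phi> (s k) - \<phi> (s 0)"
    by (rule sum_lessThan_telescope)
  also have "ennreal \<dots> \<le> ennreal K" by (intro ennreal_leI assms(2))
  finally show "(case p of (k, s) \<Rightarrow> \<Sum>i<k. ennreal (norm (g (s (Suc i)) - g (s i)))) \<le> ennreal K"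
    unfolding p by simp
qed

context jump_control begin

lemma infsum_diff:
  assumes "x \<le> y"
  shows "infsum a {..y} - infsum a {..x} = infsum a {x<..y}"
    "infsum b {..<y} - infsum b {..<x} = infsum b {x..<y}"
proof -
  have "infsum a {..y} = infsum a {..x} + infsum a {x<..y}"
    by (subst infsum_Un_disjoint[symmetric])
      (use assms in \<open>auto intro!: sum_a arg_cong[of _ _ "infsum a"]\<close>)
  moreover have "infsum b {..<y} = infsum b {..<x} + infsum b {x..<y}"
    by (subst infsum_Un_disjoint[symmetric])
      (use assms in \<open>auto intro!: sum_b arg_cong[of _ _ "infsum b"]\<close>)
  ultimately show "infsum a {..y} - infsum a {..x} = infsum a {x<..y}"
    "infsum b {..<y} - infsum b {..<x} = infsum b {x..<y}" by simp_all
qed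

lemma infsum_oscillation:
  "infsum a {..y} - infsum a {..x} \<le> infsum a UNIV" "infsum b {..<y} - infsum b {..<x} \<le> infsum b UNIV"
  using mono_a[of "{..y}" UNIV] mono_b[of "{..<y}" UNIV] infsum_nonneg[of "{..x}" a]
    infsum_nonneg[of "{..<x}" b] a b by auto

lemma total_variation_jump_function:
  "total_variation (jump_function left_jump right_jump) \<le> ennreal (infsum a UNIV + infsum b UNIV)"
proof (rule total_variation_le)
  fix x y :: real assume "x \<le> y"
  show "norm (jump_function left_jump right_jump y - jump_function left_jump right_jump x)
     \<le> (infsum a {..y} + infsum b {..<y}) - (infsum a {..x} + infsum b {..<x})"
  proof (cases "x = y")
    case False
    then have "x < y" using \<open>x \<le> y\<close> by simp
    show ?thesis
      unfolding jump_function_diff[OF \<open>x < y\<close>]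
      using norm_triangle_ineq[of "infsum left_jump {x<..y}" "infsum right_jump {x..<y}"]
        infsum_left_jump_le[of "{x<..y}"] infsum_right_jump_le[of "{x..<y}"] infsum_diff[OF \<open>x \<le> y\<close>]
      by linarith
  qed simp
next
  fix x y
  show "infsum a {..y} + infsum b {..<y} - (infsum a {..x} + infsum b {..<x}) \<le> infsum a UNIV + infsum b UNIV"
    using infsum_oscillation[of y x] by linarith
qed

end

section \<open>Derivative measures of Lipschitz functions and of jump functions\<close>

lemma measure_interval_measure_Int_sums:
  fixes F :: "real \<Rightarrow> real"
  assumes "\<And>x y. x \<le> y \<Longrightarrow> F x \<le> F y" "continuous_on UNIV F"
    and "range A \<subseteq> sets borel" "disjoint_family A"
  shows "(\<lambda>i. measure (interval_measure F) (A i \<inter> {c<..d})) sums measure (interval_measure F) ((\<Union>i. A i) \<inter> {c<..d})"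
proof -
  have rc: "continuous (at_right x) F" for x
    by (rule continuous_at_imp_continuous_at_within) (use assms(2) in \<open>simp add: continuous_on_eq_continuous_at\<close>)
  \<comment> \<open>The cut with a bounded interval makes the measure finite, so that the
    real-valued \<open>measure\<close> is countably additive.\<close>
  have "emeasure (interval_measure F) {c<..d} < \<infinity>"
    using emeasure_interval_measure_Ioc_eq[OF assms(1) rc] by simp
  moreover have "emeasure (interval_measure F) (\<Union>i. A i \<inter> {c<..d}) \<le> emeasure (interval_measure F) {c<..d}"
    by (rule emeasure_mono) auto
  ultimately have "emeasure (interval_measure F) (\<Union>i. A i \<inter> {c<..d}) < \<infinity>"
    by (rule le_less_trans[rotated])
  then have "emeasure (interval_measure F) (\<Union>i. A i \<inter> {c<..d}) \<noteq> \<infinity>" by simp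
  then have "(\<lambda>i. measure (interval_measure F) (A i \<inter> {c<..d})) sums measure (interval_measure F) (\<Union>i. A i \<inter> {c<..d})"
    using assms(3,4) by (intro measure_UNION) (auto simp: disjoint_family_on_def)
  then show ?thesis by (simp add: Int_UN_distrib2 Int_commute)
qed

text \<open>The Stieltjes measures of \<open>h + K x\<close> and \<open>K x - h\<close> add up to \<open>2 K\<close> times Lebesgue measure,
  so both are absolutely continuous.\<close>

lemma lipschitz_derivative_measure_real:
  fixes h :: "real \<Rightarrow> real"
  assumes lip: "K-lipschitz_on UNIV h" and M: "M \<ge> 0"
    and const: "\<And>x. x \<le> - M \<Longrightarrow> h x = h (- M)" "\<And>x. x \<ge> M \<Longrightarrow> h x = h M"
  obtains \<mu> :: "real set \<Rightarrow> real" where "vector_measure \<mu>" "\<And>a b. a < b \<Longrightarrow> \<mu> {a<..b} = h b - h a"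
    "\<And>B. B \<in> sets borel \<Longrightarrow> B \<in> null_sets lborel \<Longrightarrow> \<mu> B = 0"
proof -
  have K: "K \<ge> 0" using lip by (rule lipschitz_on_nonneg)
  have hK: "\<bar>h y - h x\<bar> \<le> K * (y - x)" if "x \<le> y" for x y
    using lipschitz_onD[OF lip, of y x] that by (simp add: dist_real_def)
  have hc: "continuous_on UNIV h" using lip by (rule lipschitz_on_continuous_on)
  define F where "F x = h x + K * x" for x
  define G where "G x = K * x - h x" for x
  have F: "F x \<le> F y" and G: "G x \<le> G y" if "x \<le> y" for x y
    using hK[OF that] by (auto simp: F_def G_def algebra_simps abs_le_iff)
  have Fc: "continuous_on UNIV F" and Gc: "continuous_on UNIV G"
    unfolding F_def G_def by (intro continuous_intros hc)+
  have idc: "continuous_on UNIV (\<lambda>x::real. x)" by (rule continuous_on_id)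
  have rc: "continuous (at_right x) H" if "continuous_on UNIV H" for H :: "real \<Rightarrow> real" and x
    by (rule continuous_at_imp_continuous_at_within) (use that in \<open>simp add: continuous_on_eq_continuous_at\<close>)
  \<comment> \<open>\<open>h\<close> is constant outside this interval, so the cut loses
    nothing.\<close>
  let ?I = "{-M<..M}"
  let ?\<nu> = "\<lambda>H B. measure (interval_measure H) (B \<inter> ?I)"
  have Ioc: "?\<nu> H {a<..b} = H (max (-M) (min M b)) - H (max (-M) (min M a))"
    if "\<And>x y. x \<le> y \<Longrightarrow> H x \<le> H y" "continuous_on UNIV H" "a \<le> b" for H a b
  proof -
    have "{a<..b} \<inter> ?I = {max (-M) (min M a)<..max (-M) (min M b)}"
      using M that(3) by (auto simp: max_def min_def)
    then show ?thesis
      using measure_interval_measure_Ioc[of "max (-M) (min M a)" "max (-M) (min M b)" H] that rc by auto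
  qed
  have sums: "(\<lambda>i. ?\<nu> H (A i)) sums ?\<nu> H (\<Union>i. A i)"
    if "\<And>x y. x \<le> y \<Longrightarrow> H x \<le> H y" "continuous_on UNIV H" "range A \<subseteq> sets borel" "disjoint_family A" for H A
    using measure_interval_measure_Int_sums[OF that] .
  \<comment> \<open>\<open>F\<close> is \<open>h\<close> plus \<open>K * x\<close>, so taking away
    \<open>K\<close> times the length leaves the derivative of \<open>h\<close>.\<close>
  define \<mu> where "\<mu> B = ?\<nu> F B - K * ?\<nu> (\<lambda>x. x) B" for B
  have "vector_measure \<mu>"
    unfolding vector_measure_def \<mu>_def
    by (auto intro!: sums_diff sums_mult sums F Fc idc)
  moreover have "\<mu> {a<..b} = h b - h a" if "a < b" for a b
  proof -
    have hh: "h (max (-M) (min M x)) = h x" for x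
      using const[of x] M by (auto simp: max_def min_def)
    have 1: "?\<nu> F {a<..b} = F (max (-M) (min M b)) - F (max (-M) (min M a))"
      by (rule Ioc[OF F Fc less_imp_le[OF that]])
    have 2: "?\<nu> (\<lambda>x. x) {a<..b} = max (-M) (min M b) - max (-M) (min M a)"
      by (rule Ioc[OF _ idc less_imp_le[OF that]])
    show ?thesis
      unfolding \<mu>_def 1 2 by (simp add: F_def hh algebra_simps)
  qed
  moreover have "\<mu> B = 0" if B: "B \<in> sets borel" "B \<in> null_sets lborel" for B
  proof -
    have "?\<nu> F B + ?\<nu> G B = 2 * K * ?\<nu> (\<lambda>x. x) B"
    proof -
      \<comment> \<open>Half-open intervals generate the Borel sets and are stable under
        intersection, so the identity is checked on them and carried to complements and disjoint
        unions.\<close>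
      have sB: "B \<in> sigma_sets UNIV (range (\<lambda>(a, b). {a <.. b::real}))"
        using B(1) unfolding borel_sigma_sets_Ioc by simp
      have iB: "Int_stable (range (\<lambda>(a, b). {a <.. b::real}))"
      proof (rule Int_stableI)
        fix A B assume "A \<in> range (\<lambda>(a, b). {a <.. b::real})" "B \<in> range (\<lambda>(a, b). {a <.. b::real})"
        then obtain a b c d where "A = {a<..b}" "B = {c<..d}" by auto
        then show "A \<inter> B \<in> range (\<lambda>(a, b). {a <.. b::real})"
          by (intro image_eqI[of _ _ "(max a c, min b d)"]) auto
      qed
      show ?thesis
        using iB subset_Pow_Union[THEN order_trans, OF Pow_mono[OF subset_UNIV]] sB
      proof (induction rule: sigma_sets_induct_disjoint)
        case (basic S)
        then obtain a b where S: "S = {a<..b}" by auto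
        show ?case
        proof (cases "a \<le> b")
          case True
          have 1: "?\<nu> F {a<..b} = F (max (-M) (min M b)) - F (max (-M) (min M a))"
            by (rule Ioc[OF F Fc True])
          have 2: "?\<nu> G {a<..b} = G (max (-M) (min M b)) - G (max (-M) (min M a))"
            by (rule Ioc[OF G Gc True])
          have 3: "?\<nu> (\<lambda>x. x) {a<..b} = max (-M) (min M b) - max (-M) (min M a)"
            by (rule Ioc[OF _ idc True])
          show ?thesis unfolding S 1 2 3 by (simp add: F_def G_def algebra_simps)
        qed (simp add: S)
      next
        case (compl S)
        have Sb: "S \<in> sets borel" using compl(1) unfolding borel_sigma_sets_Ioc by simp
        have *: "?\<nu> H (UNIV - S) = ?\<nu> H UNIV - ?\<nu> H S"
          if H: "\<And>x y. x \<le> y \<Longrightarrow> H x \<le> H y" "continuous_on UNIV H" for H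
        proof -
          have "emeasure (interval_measure H) ?I \<noteq> \<infinity>"
            using emeasure_interval_measure_Ioc_eq[of H, OF H(1) rc[OF H(2)]] by simp
          then have "measure (interval_measure H) (?I - S \<inter> ?I) = measure (interval_measure H) ?I - measure (interval_measure H) (S \<inter> ?I)"
            using Sb by (intro measure_Diff) auto
          moreover have "(UNIV - S) \<inter> ?I = ?I - S \<inter> ?I" by auto
          ultimately show ?thesis by simp
        qed
        have U: "?\<nu> F UNIV + ?\<nu> G UNIV = 2 * K * ?\<nu> (\<lambda>x. x) UNIV"
        proof -
          have m: "- M \<le> M" using M by simp
          have "?\<nu> F {-M<..M} = F (max (-M) (min M M)) - F (max (-M) (min M (-M)))"
            by (rule Ioc[OF F Fc m])
          moreover have "?\<nu> G {-M<..M} = G (max (-M) (min M M)) - G (max (-M) (min M (-M)))"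
            by (rule Ioc[OF G Gc m])
          moreover have "?\<nu> (\<lambda>x. x) {-M<..M} = max (-M) (min M M) - max (-M) (min M (-M))"
            by (rule Ioc[OF _ idc m])
          ultimately show ?thesis using M by (simp del: Int_greaterThanAtMost) (simp add: F_def G_def algebra_simps)
        qed
        show ?case
        proof -
          have 1: "?\<nu> F (UNIV - S) = ?\<nu> F UNIV - ?\<nu> F S" by (rule *[OF F Fc])
          have 2: "?\<nu> G (UNIV - S) = ?\<nu> G UNIV - ?\<nu> G S" by (rule *[OF G Gc])
          have 3: "?\<nu> (\<lambda>x. x) (UNIV - S) = ?\<nu> (\<lambda>x. x) UNIV - ?\<nu> (\<lambda>x. x) S"
            by (rule *[OF _ idc])
          show ?thesis unfolding 1 2 3 using U compl(2) by (simp add: algebra_simps)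
        qed
      next
        case (union A)
        have Ab: "range A \<subseteq> sets borel" using union(2) unfolding borel_sigma_sets_Ioc by auto
        have "(\<lambda>i. ?\<nu> F (A i) + ?\<nu> G (A i)) sums (?\<nu> F (\<Union>i. A i) + ?\<nu> G (\<Union>i. A i))"
          by (intro sums_add sums F Fc G Gc Ab union)
        moreover have "(\<lambda>i. 2 * K * ?\<nu> (\<lambda>x. x) (A i)) sums (2 * K * ?\<nu> (\<lambda>x. x) (\<Union>i. A i))"
          by (intro sums_mult sums idc Ab union)
        ultimately show ?case using union(3) sums_unique2 by simp
      qed simp
    qed
    moreover have "?\<nu> (\<lambda>x. x) B = 0"
    proof -
      have "emeasure lborel (B \<inter> ?I) \<le> emeasure lborel B" by (rule emeasure_mono) (use B in auto)
      then have "emeasure lborel (B \<inter> ?I) = 0" using B(2) by auto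
      then show ?thesis by (simp add: measure_def lborel_eq_real)
    qed
    \<comment> \<open>Two nonnegative numbers with sum zero both vanish.\<close>
    moreover have "?\<nu> F B \<ge> 0" "?\<nu> G B \<ge> 0" by (rule measure_nonneg)+
    ultimately show ?thesis by (simp add: \<mu>_def add_nonneg_eq_0_iff)
  qed
  ultimately show ?thesis using that by blast
qed

lemma lipschitz_derivative_measure:
  fixes h :: "real \<Rightarrow> 'a::euclidean_space"
  assumes lip: "K-lipschitz_on UNIV h" and M: "M \<ge> 0"
    and const: "\<And>x. x \<le> - M \<Longrightarrow> h x = h (- M)" "\<And>x. x \<ge> M \<Longrightarrow> h x = h M"
  obtains \<mu> :: "real set \<Rightarrow> 'a" where "vector_measure \<mu>" "\<And>a b. a < b \<Longrightarrow> \<mu> {a<..b} = h b - h a"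
    "\<And>B. B \<in> sets borel \<Longrightarrow> B \<in> null_sets lborel \<Longrightarrow> \<mu> B = 0"
proof -
  have "\<exists>\<mu> :: real set \<Rightarrow> real. vector_measure \<mu> \<and> (\<forall>a b. a < b \<longrightarrow> \<mu> {a<..b} = h b \<bullet> i - h a \<bullet> i) \<and>
    (\<forall>B. B \<in> sets borel \<longrightarrow> B \<in> null_sets lborel \<longrightarrow> \<mu> B = 0)" if i: "i \<in> Basis" for i
  proof -
    have "K-lipschitz_on UNIV (\<lambda>x. h x \<bullet> i)"
    proof (rule lipschitz_onI)
      fix x y
      have "\<bar>(h x - h y) \<bullet> i\<bar> \<le> norm (h x - h y)" using i by (rule Basis_le_norm)
      then show "dist (h x \<bullet> i) (h y \<bullet> i) \<le> K * dist x y"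
        using lipschitz_onD[OF lip, of x y] by (simp add: dist_real_def dist_norm inner_diff_left)
    qed (use lip lipschitz_on_nonneg in blast)
    moreover have "h x \<bullet> i = h (- M) \<bullet> i" if "x \<le> - M" for x
      using const(1)[OF that] by simp
    moreover have "h x \<bullet> i = h M \<bullet> i" if "x \<ge> M" for x
      using const(2)[OF that] by simp
    ultimately obtain \<mu> :: "real set \<Rightarrow> real" where "vector_measure \<mu>"
      "\<And>a b. a < b \<Longrightarrow> \<mu> {a<..b} = h b \<bullet> i - h a \<bullet> i"
      "\<And>B. B \<in> sets borel \<Longrightarrow> B \<in> null_sets lborel \<Longrightarrow> \<mu> B = 0"
      by (rule lipschitz_derivative_measure_real[OF _ M, of K "\<lambda>x. h x \<bullet> i"]) blast+
    then show ?thesis by blast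
  qed
  then obtain m :: "'a \<Rightarrow> real set \<Rightarrow> real" where m: "\<And>i. i \<in> Basis \<Longrightarrow> vector_measure (m i)"
      "\<And>i a b. i \<in> Basis \<Longrightarrow> a < b \<Longrightarrow> m i {a<..b} = h b \<bullet> i - h a \<bullet> i"
      "\<And>i B. i \<in> Basis \<Longrightarrow> B \<in> sets borel \<Longrightarrow> B \<in> null_sets lborel \<Longrightarrow> m i B = 0"
    by metis
  show ?thesis
  proof (rule that[of "\<lambda>B. \<Sum>i\<in>Basis. m i B *\<^sub>R i"])
    show "vector_measure (\<lambda>B. \<Sum>i\<in>Basis. m i B *\<^sub>R i)"
      unfolding vector_measure_def
    proof (intro allI impI)
      fix A :: "nat \<Rightarrow> real set" assume A: "range A \<subseteq> sets borel \<and> disjoint_family A"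
      show "(\<lambda>n. \<Sum>i\<in>Basis. m i (A n) *\<^sub>R i) sums (\<Sum>i\<in>Basis. m i (\<Union> (range A)) *\<^sub>R i)"
        using m(1) A unfolding vector_measure_def
        by (intro sums_sum bounded_linear.sums[OF bounded_linear_scaleR_left]) blast
    qed
  next
    fix a b :: real assume "a < b"
    then have "(\<Sum>i\<in>Basis. m i {a<..b} *\<^sub>R i) = (\<Sum>i\<in>Basis. ((h b - h a) \<bullet> i) *\<^sub>R i)"
      by (intro sum.cong) (auto simp: m(2) inner_diff_left)
    then show "(\<Sum>i\<in>Basis. m i {a<..b} *\<^sub>R i) = h b - h a" by (simp only: euclidean_representation)
  next
    fix B :: "real set" assume "B \<in> sets borel" "B \<in> null_sets lborel"
    then show "(\<Sum>i\<in>Basis. m i B *\<^sub>R i) = 0" by (simp add: m(3))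
  qed
qed

text \<open>A finite \<open>T\<close> carries almost all of the majorant \<open>c\<close>. Finitely
  many sets of the sequence already cover the part of \<open>T\<close> in the union, so the
  remaining sets contribute only a tail.\<close>

lemma vector_measure_infsum:
  fixes f :: "real \<Rightarrow> 'a::banach"
  assumes f: "\<And>s. norm (f s) \<le> c s" and c: "c summable_on UNIV"
  shows "vector_measure (infsum f)"
  unfolding vector_measure_def
proof (intro allI impI)
  fix A :: "nat \<Rightarrow> real set" assume A: "range A \<subseteq> sets borel \<and> disjoint_family A"
  have c0: "c s \<ge> 0" for s using f[of s] norm_ge_zero order_trans by blast
  have cs: "c summable_on S" for S using c by (rule summable_on_subset_banach) auto
  have fs: "(\<lambda>s. norm (f s)) summable_on S" for S
    by (rule Infinite_Sum.abs_summable_on_comparison_test[of c]) (use cs c0 f in simp_all)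
  have f_sum: "f summable_on S" for S using fs by (rule abs_summable_summable)
  have le: "norm (infsum f S) \<le> infsum c S" for S
    using norm_infsum_bound[OF fs, of S] infsum_mono[OF fs cs f, of S] by linarith
  have part: "(\<Sum>i<n. infsum f (A i)) = infsum f (\<Union>i<n. A i)" for n
    by (rule sum_infsum) (use A f_sum in \<open>auto simp: disjoint_family_on_def\<close>)
  show "(\<lambda>i. infsum f (A i)) sums infsum f (\<Union> (range A))"
    unfolding sums_def part
  proof (rule LIMSEQ_I)
    fix e :: real assume "e > 0"
    obtain T where T: "finite T" "\<And>S. S \<inter> T = {} \<Longrightarrow> infsum c S < e"
      using nonneg_summable_tail[OF c c0 \<open>e > 0\<close>] by blast
    have "\<exists>n. \<forall>m\<ge>n. T \<inter> (\<Union>i. A i) \<subseteq> (\<Union>i<m. A i)"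
    proof -
      have "\<forall>t \<in> T \<inter> (\<Union>i. A i). \<exists>i. t \<in> A i" by auto
      then obtain k where k: "\<And>t. t \<in> T \<inter> (\<Union>i. A i) \<Longrightarrow> t \<in> A (k t)" by metis
      have "T \<inter> (\<Union>i. A i) \<subseteq> (\<Union>i<m. A i)" if "m \<ge> Suc (Max (k ` (T \<inter> (\<Union>i. A i))))" for m
      proof
        fix t assume t: "t \<in> T \<inter> (\<Union>i. A i)"
        then have "k t \<le> Max (k ` (T \<inter> (\<Union>i. A i)))" using T(1) by (intro Max_ge) auto
        then show "t \<in> (\<Union>i<m. A i)" using k[OF t] that by (intro UN_I[of "k t"]) auto
      qed
      then show ?thesis by blast
    qed
    then obtain n where n: "\<And>m. m \<ge> n \<Longrightarrow> T \<inter> (\<Union>i. A i) \<subseteq> (\<Union>i<m. A i)" by blast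
    show "\<exists>n. \<forall>m\<ge>n. norm (infsum f (\<Union>i<m. A i) - infsum f (\<Union> (range A))) < e"
    proof (intro exI[of _ n] allI impI)
      fix m assume "m \<ge> n"
      let ?R = "(\<Union>i. A i) - (\<Union>i<m. A i)"
      have "infsum f (\<Union>(range A)) = infsum f ((\<Union>i<m. A i) \<union> ?R)"
        by (intro arg_cong[of _ _ "infsum f"]) auto
      also have "\<dots> = infsum f (\<Union>i<m. A i) + infsum f ?R"
        by (rule infsum_Un_disjoint) (use f_sum in auto)
      finally have "norm (infsum f (\<Union>i<m. A i) - infsum f (\<Union> (range A))) = norm (infsum f ?R)"
        by simp
      moreover have "?R \<inter> T = {}" using n[OF \<open>m \<ge> n\<close>] by blast
      ultimately show "norm (infsum f (\<Union>i<m. A i) - infsum f (\<Union> (range A))) < e"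
        using le[of ?R] T(2)[of ?R] by linarith
    qed
  qed
qed

context jump_control begin

lemma bounded_variation:
  assumes M: "M \<ge> 0" "\<And>x. x \<le> - M \<Longrightarrow> V x = V (- M)" "\<And>x. x \<ge> M \<Longrightarrow> V x = V M"
  shows "bounded_variation V"
proof -
  \<comment> \<open>A Lipschitz bound alone does not limit the variation over the whole line; since
    \<open>V\<close> is constant outside \<open>[- M, M]\<close>, arguments may be clamped to this
    interval.\<close>
  define cl where "cl x = max (- M) (min M x)" for x :: real
  have cl: "x \<le> y \<Longrightarrow> cl x \<le> cl y" "- M \<le> cl x" "cl x \<le> M" for x y using M(1) by (auto simp: cl_def)
  have Vcl: "V (cl x) = V x" for x using M(1) M(2)[of x] M(3)[of x] by (auto simp: cl_def max_def min_def)
  define \<phi> where "\<phi> x = C * cl x + (infsum a {..cl x} + infsum b {..<cl x})" for x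
  have "total_variation V \<le> ennreal (2 * C * M + (infsum a UNIV + infsum b UNIV))"
  proof (rule total_variation_le[where \<phi> = \<phi>])
    fix x y :: real assume "x \<le> y"
    show "norm (V y - V x) \<le> \<phi> y - \<phi> x"
    proof (cases "cl x = cl y")
      case True
      then have "V x = V y" by (metis Vcl)
      then show ?thesis using True by (simp add: \<phi>_def)
    next
      case False
      then have "cl x < cl y" using cl(1)[OF \<open>x \<le> y\<close>] by simp
      from control[OF this] infsum_diff[of "cl x" "cl y"] this show ?thesis
        unfolding Vcl by (simp add: \<phi>_def algebra_simps)
    qed
  next
    fix x y
    have "C * (cl y - cl x) \<le> C * (2 * M)"
      using C cl[of x] cl[of y] by (intro mult_left_mono) auto
    then show "\<phi> y - \<phi> x \<le> 2 * C * M + (infsum a UNIV + infsum b UNIV)"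
      using infsum_oscillation[of "cl y" "cl x"] by (simp add: \<phi>_def algebra_simps)
  qed
  then show ?thesis unfolding bounded_variation_def using order_le_less_trans by fastforce
qed

end

locale jump_control_euclidean = jump_control C a b V for C a b and V :: "real \<Rightarrow> 'a::euclidean_space"
begin

text \<open>The derivative of the Lipschitz part is absolutely continuous and that of the jump part
  is purely atomic, with mass \<open>left_jump s + right_jump s\<close> at \<open>s\<close>; the
  zero measure is left as Cantor part.\<close>

lemma special_bounded_variation:
  assumes M: "M \<ge> 0" "\<And>x. x \<le> - M \<Longrightarrow> V x = V (- M)" "\<And>x. x \<ge> M \<Longrightarrow> V x = V M"
    and ab: "\<And>s. \<not> (- M < s \<and> s < M) \<Longrightarrow> a s = 0 \<and> b s = 0"
  shows "special_bounded_variation V"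
proof -
  let ?J = "jump_function left_jump right_jump"
  define h where "h \<xi> = V \<xi> - ?J \<xi>" for \<xi>
  have lip: "C-lipschitz_on UNIV h" unfolding h_def by (rule lipschitz_part)
  have z: "left_jump s = 0" "right_jump s = 0" if "\<not> (- M < s \<and> s < M)" for s
    using norm_left_jump[of s] norm_right_jump[of s] ab[OF that] by auto
  \<comment> \<open>There are no jumps outside \<open>[- M, M]\<close>, so the jump function is
    constant on both sides, and with it \<open>h\<close>, as
    \<open>lipschitz_derivative_measure\<close> demands.\<close>
  have Jc: "?J x = ?J (- M)" if "x \<le> - M" for x
  proof -
    have "infsum left_jump {..y} = 0" "infsum right_jump {..<y} = 0" if "y \<le> - M" for y
      using that by (auto intro!: infsum_0 z)
    then show ?thesis using that by (simp add: jump_function_def)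
  qed
  have Jc': "?J x = ?J M" if "x \<ge> M" for x
  proof -
    have "infsum left_jump {..x} = infsum left_jump {..M}" "infsum right_jump {..<x} = infsum right_jump {..<M}"
      using that by (auto intro!: infsum_cong_neutral z)
    then show ?thesis by (simp add: jump_function_def)
  qed
  have "h x = h (- M)" if "x \<le> - M" for x using Jc[OF that] M(2)[OF that] by (simp add: h_def)
  moreover have "h x = h M" if "x \<ge> M" for x using Jc'[OF that] M(3)[OF that] by (simp add: h_def)
  ultimately obtain \<mu>a :: "real set \<Rightarrow> 'a" where \<mu>a: "vector_measure \<mu>a"
    "\<And>a b. a < b \<Longrightarrow> \<mu>a {a<..b} = h b - h a"
    "\<And>B. B \<in> sets borel \<Longrightarrow> B \<in> null_sets lborel \<Longrightarrow> \<mu>a B = 0"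
    using lipschitz_derivative_measure[OF lip M(1)] by blast
  let ?f = "\<lambda>s. left_jump s + right_jump s"
  define \<mu>j where "\<mu>j = infsum ?f"
  have fj: "norm (?f s) \<le> a s + b s" for s
    using norm_left_jump[of s] norm_right_jump[of s] by (intro norm_triangle_le) linarith
  have vj: "vector_measure \<mu>j"
    unfolding \<mu>j_def by (rule vector_measure_infsum[OF fj]) (intro summable_on_add a b)
  have \<mu>j_split: "\<mu>j S = infsum left_jump S + infsum right_jump S" for S
    unfolding \<mu>j_def by (rule infsum_add) (rule summable_left_jump summable_right_jump)+
  define \<mu> where "\<mu> B = \<mu>a B + \<mu>j B" for B
  have v\<mu>: "vector_measure \<mu>"
    using \<mu>a(1) vj unfolding vector_measure_def \<mu>_def by (auto intro!: sums_add)
  \<comment> \<open>Intervals \<open>{x<..y}\<close> go with right limits: at \<open>s\<close> the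
    jump from \<open>s\<close> to \<open>s+\<close> is already counted.\<close>
  have lim: "Lim (at_right s) V = h s + (infsum left_jump {..s} + infsum right_jump {..s})" for s
  proof -
    have "infsum right_jump {..s} = infsum right_jump {..<s} + right_jump s"
    proof -
      have "infsum right_jump ({..<s} \<union> {s}) = infsum right_jump {..<s} + infsum right_jump {s}"
        by (rule infsum_Un_disjoint) (auto intro: summable_right_jump)
      moreover have "{..<s} \<union> {s} = {..s}" by auto
      ultimately show ?thesis by simp
    qed
    then have "h s + (infsum left_jump {..s} + infsum right_jump {..s}) = V s + right_jump s"
      by (simp add: h_def jump_function_def)
    then show ?thesis using right_jump[of s] by (simp add: tendsto_Lim)
  qed
  have "derivative_measure V \<mu>"
    unfolding derivative_measure_def
  proof (intro conjI allI impI v\<mu>)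
    fix x y :: real assume "x < y"
    have 1: "infsum left_jump {..y} = infsum left_jump {..x} + infsum left_jump {x<..y}"
      by (subst infsum_Un_disjoint[symmetric])
        (use \<open>x < y\<close> in \<open>auto intro!: summable_left_jump arg_cong[of _ _ "infsum left_jump"]\<close>)
    have 2: "infsum right_jump {..y} = infsum right_jump {..x} + infsum right_jump {x<..y}"
      by (subst infsum_Un_disjoint[symmetric])
        (use \<open>x < y\<close> in \<open>auto intro!: summable_right_jump arg_cong[of _ _ "infsum right_jump"]\<close>)
    show "\<mu> {x<..y} = Lim (at_right y) V - Lim (at_right x) V"
      unfolding \<mu>_def \<mu>a(2)[OF \<open>x < y\<close>] lim \<mu>j_split 1 2 by (simp add: algebra_simps)
  qed
  moreover have "measure_decomposition \<mu> \<mu>a \<mu>j (\<lambda>_. 0)"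
    unfolding measure_decomposition_def
  proof (intro conjI)
    show "\<exists>J. countable J \<and> (\<forall>B\<in>sets borel. B \<inter> J = {} \<longrightarrow> \<mu>j B = 0)"
    proof (intro exI[of _ "{s. left_jump s \<noteq> 0} \<union> {s. right_jump s \<noteq> 0}"] conjI ballI impI)
      show "countable ({s. left_jump s \<noteq> 0} \<union> {s. right_jump s \<noteq> 0})"
        using abs_summable_countable[OF abs_summable_left_jump, of UNIV]
          abs_summable_countable[OF abs_summable_right_jump, of UNIV] by auto
    next
      fix B assume "B \<inter> ({s. left_jump s \<noteq> 0} \<union> {s. right_jump s \<noteq> 0}) = {}"
      then show "\<mu>j B = 0" unfolding \<mu>j_def by (intro infsum_0) auto
    qed
    show "\<exists>N\<in>null_sets lborel. \<forall>B\<in>sets borel. B \<inter> N = {} \<longrightarrow> (0::'a) = 0"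
      by (intro bexI[of _ "{}"]) auto
  qed (use \<mu>a vj in \<open>auto simp: \<mu>_def vector_measure_def\<close>)
  ultimately show ?thesis
    unfolding special_bounded_variation_def using bounded_variation[OF M] by auto
qed

end

section \<open>Second derivatives\<close>

text \<open>\<open>Ck_on\<close> supplies derivatives one direction at a time. If \<open>D i\<close>
  is the derivative of an operator-valued map evaluated at the basis vector \<open>i\<close>, this
  is the derivative of the map itself.\<close>

definition from_components :: "('a::euclidean_space \<Rightarrow> ('c::real_normed_vector \<Rightarrow>\<^sub>L 'b::real_normed_vector)) \<Rightarrow> ('c \<Rightarrow>\<^sub>L ('a \<Rightarrow>\<^sub>L 'b))" where
  "from_components D = (\<Sum>i\<in>Basis. Blinfun (\<lambda>b. blinfun_scaleR_left b o\<^sub>L blinfun_inner_left i) o\<^sub>L D i)"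

lemma has_derivative_from_components:
  assumes "\<And>i. i \<in> Basis \<Longrightarrow> ((\<lambda>x. blinfun_apply (h x) i) has_derivative blinfun_apply (D i)) (at x)"
  shows "(h has_derivative blinfun_apply (from_components D)) (at x)"
proof -
  let ?T = "\<lambda>i b. blinfun_scaleR_left b o\<^sub>L blinfun_inner_left i"
  have bl: "bounded_linear (?T i)" for i :: 'a by (intro bounded_linear_intros)
  have "h = (\<lambda>x. \<Sum>i\<in>Basis. ?T i (blinfun_apply (h x) i))"
  proof (rule ext, rule blinfun_eqI)
    fix x v
    have "blinfun_apply (h x) v = blinfun_apply (h x) (\<Sum>i\<in>Basis. (v \<bullet> i) *\<^sub>R i)"
      by (simp add: euclidean_representation)
    then show "blinfun_apply (h x) v = blinfun_apply (\<Sum>i\<in>Basis. ?T i (blinfun_apply (h x) i)) v"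
      by (simp add: blinfun.sum_right blinfun.scaleR_right blinfun.sum_left blinfun_inner_left.rep_eq)
  qed
  moreover have "((\<lambda>x. \<Sum>i\<in>Basis. ?T i (blinfun_apply (h x) i)) has_derivative (\<lambda>w. \<Sum>i\<in>Basis. ?T i (blinfun_apply (D i) w))) (at x)"
    by (intro has_derivative_sum bounded_linear.has_derivative[OF bl] assms)
  moreover have "(\<lambda>w. \<Sum>i\<in>Basis. ?T i (blinfun_apply (D i) w)) = blinfun_apply (from_components D)"
    by (intro ext) (simp add: from_components_def blinfun.sum_left bounded_linear_Blinfun_apply[OF bl])
  ultimately show ?thesis by simp
qed

lemma has_derivative_from_components':
  assumes "\<And>i. i \<in> Basis \<Longrightarrow> ((D i) has_derivative blinfun_apply (E i)) (at x)"
  shows "((\<lambda>x. from_components (\<lambda>i. D i x)) has_derivative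
    (\<lambda>w. from_components (\<lambda>i. blinfun_apply (E i) w))) (at x)"
  unfolding from_components_def
  by (intro has_derivative_sum assms
      bounded_linear.has_derivative[OF bounded_bilinear.bounded_linear_right[OF bounded_bilinear_blinfun_compose]])

lemma continuous_on_from_components:
  assumes "\<And>i. i \<in> Basis \<Longrightarrow> continuous_on S (D i)"
  shows "continuous_on S (\<lambda>x. from_components (\<lambda>i. D i x))"
  unfolding from_components_def by (intro continuous_intros assms)

lemma Ck_on_1:
  fixes f :: "'a::euclidean_space \<Rightarrow> 'b::real_normed_vector"
  assumes "Ck_on 1 f S"
  obtains f1 :: "'a \<Rightarrow> 'a \<Rightarrow>\<^sub>L 'b" where "\<And>x. x \<in> S \<Longrightarrow> (f has_derivative f1 x) (at x)" "continuous_on S f1"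
proof
  let ?f1 = "\<lambda>x. Blinfun (frechet_derivative f (at x))"
  have d: "(f has_derivative frechet_derivative f (at x)) (at x)" if "x \<in> S" for x
    using assms that by (simp add: frechet_derivative_works[symmetric])
  then have e: "blinfun_apply (?f1 x) = frechet_derivative f (at x)" if "x \<in> S" for x
    using that has_derivative_bounded_linear by (intro bounded_linear_Blinfun_apply) blast
  show "(f has_derivative ?f1 x) (at x)" if "x \<in> S" for x using d e that by simp
  show "continuous_on S ?f1"
  proof (rule continuous_on_blinfun_componentwise)
    fix i :: 'a assume "i \<in> Basis"
    have "continuous_on S (\<lambda>x. frechet_derivative f (at x) i)" using assms by simp
    then show "continuous_on S (\<lambda>x. blinfun_apply (?f1 x) i)" using e by (simp cong: continuous_on_cong)
  qed
qed

lemma Ck_on_Suc_components: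
  fixes f :: "'a::euclidean_space \<Rightarrow> 'b::real_normed_vector"
  assumes "Ck_on (Suc k) f S"
  obtains f1 :: "'a \<Rightarrow> 'a \<Rightarrow>\<^sub>L 'b" where "\<And>x. x \<in> S \<Longrightarrow> (f has_derivative f1 x) (at x)"
    "\<And>v. Ck_on k (\<lambda>x. frechet_derivative f (at x) v) S" "\<And>x v. x \<in> S \<Longrightarrow> frechet_derivative f (at x) v = f1 x v"
proof
  let ?f1 = "\<lambda>x. Blinfun (frechet_derivative f (at x))"
  have d: "(f has_derivative frechet_derivative f (at x)) (at x)" if "x \<in> S" for x
    using assms that by (simp add: frechet_derivative_works[symmetric])
  then have e: "blinfun_apply (?f1 x) = frechet_derivative f (at x)" if "x \<in> S" for x
    using that has_derivative_bounded_linear by (intro bounded_linear_Blinfun_apply) blast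
  show "(f has_derivative ?f1 x) (at x)" "frechet_derivative f (at x) v = ?f1 x v" if "x \<in> S" for x v
    using d e that by simp_all
  show "Ck_on k (\<lambda>x. frechet_derivative f (at x) v) S" for v using assms by simp
qed

lemma Ck_on_2:
  fixes f :: "'a::euclidean_space \<Rightarrow> 'b::real_normed_vector"
  assumes "Ck_on 2 f S" and S: "open S"
  obtains f1 :: "'a \<Rightarrow> 'a \<Rightarrow>\<^sub>L 'b" and f2 where "\<And>x. x \<in> S \<Longrightarrow> (f has_derivative f1 x) (at x)"
    "\<And>x. x \<in> S \<Longrightarrow> (f1 has_derivative blinfun_apply (f2 x)) (at x)" "continuous_on S f2"
proof -
  have "Ck_on (Suc 1) f S" using assms by (simp add: numeral_2_eq_2)
  then obtain f1 :: "'a \<Rightarrow> 'a \<Rightarrow>\<^sub>L 'b" where f1: "\<And>x. x \<in> S \<Longrightarrow> (f has_derivative f1 x) (at x)"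
    and c: "\<And>v. Ck_on 1 (\<lambda>x. frechet_derivative f (at x) v) S"
    and e: "\<And>x v. x \<in> S \<Longrightarrow> frechet_derivative f (at x) v = f1 x v"
    using Ck_on_Suc_components by blast
  have "\<exists>D :: 'a \<Rightarrow> 'a \<Rightarrow>\<^sub>L 'b. (\<forall>x\<in>S. ((\<lambda>x. blinfun_apply (f1 x) i) has_derivative blinfun_apply (D x)) (at x)) \<and> continuous_on S D" for i
  proof -
    obtain D :: "'a \<Rightarrow> 'a \<Rightarrow>\<^sub>L 'b" where D: "\<And>x. x \<in> S \<Longrightarrow> ((\<lambda>x. frechet_derivative f (at x) i) has_derivative blinfun_apply (D x)) (at x)" "continuous_on S D"
      using Ck_on_1[OF c[of i]] by blast
    have "((\<lambda>x. blinfun_apply (f1 x) i) has_derivative blinfun_apply (D x)) (at x)" if "x \<in> S" for x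
      by (rule has_derivative_transform_within_open[OF D(1)[OF that] S that]) (rule e)
    then show ?thesis using D(2) by (intro exI[of _ D] conjI ballI)
  qed
  then have "\<exists>D :: 'a \<Rightarrow> 'a \<Rightarrow> 'a \<Rightarrow>\<^sub>L 'b. \<forall>i. (\<forall>x\<in>S. ((\<lambda>x. blinfun_apply (f1 x) i) has_derivative blinfun_apply (D i x)) (at x)) \<and> continuous_on S (D i)"
    by (intro choice allI)
  then obtain D :: "'a \<Rightarrow> 'a \<Rightarrow> 'a \<Rightarrow>\<^sub>L 'b" where
    D': "\<forall>i. (\<forall>x\<in>S. ((\<lambda>x. blinfun_apply (f1 x) i) has_derivative blinfun_apply (D i x)) (at x)) \<and> continuous_on S (D i)" ..
  then have D: "\<And>i x. x\<in>S \<Longrightarrow> ((\<lambda>x. blinfun_apply (f1 x) i) has_derivative blinfun_apply (D i x)) (at x)" "\<And>i. continuous_on S (D i)"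
    by simp_all
  show ?thesis
    by (rule that[OF f1 _ continuous_on_from_components[of S D]])
      (use D in \<open>auto intro: has_derivative_from_components\<close>)
qed

text \<open>Third order is wanted for the entropy, whose Hessian has to have a continuous derivative
  of its own.\<close>

lemma Ck_on_3:
  fixes f :: "'a::euclidean_space \<Rightarrow> 'b::real_normed_vector"
  assumes "Ck_on 3 f S" and S: "open S"
  obtains f1 :: "'a \<Rightarrow> 'a \<Rightarrow>\<^sub>L 'b" and f2 f3 where "\<And>x. x \<in> S \<Longrightarrow> (f has_derivative f1 x) (at x)"
    "\<And>x. x \<in> S \<Longrightarrow> (f1 has_derivative blinfun_apply (f2 x)) (at x)"
    "\<And>x. x \<in> S \<Longrightarrow> (f2 has_derivative blinfun_apply (f3 x)) (at x)" "continuous_on S f3"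
proof -
  have "Ck_on (Suc 2) f S" using assms by (simp add: numeral_3_eq_3 numeral_2_eq_2)
  then obtain f1 :: "'a \<Rightarrow> 'a \<Rightarrow>\<^sub>L 'b" where f1: "\<And>x. x \<in> S \<Longrightarrow> (f has_derivative f1 x) (at x)"
    and c: "\<And>v. Ck_on 2 (\<lambda>x. frechet_derivative f (at x) v) S"
    and e: "\<And>x v. x \<in> S \<Longrightarrow> frechet_derivative f (at x) v = f1 x v"
    using Ck_on_Suc_components by blast
  have "\<exists>(D :: 'a \<Rightarrow> 'a \<Rightarrow>\<^sub>L 'b) E. (\<forall>x\<in>S. ((\<lambda>x. blinfun_apply (f1 x) i) has_derivative blinfun_apply (D x)) (at x)) \<and>
     (\<forall>x\<in>S. (D has_derivative blinfun_apply (E x)) (at x)) \<and> continuous_on S E" for i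
  proof -
    obtain D :: "'a \<Rightarrow> 'a \<Rightarrow>\<^sub>L 'b" and E where D: "\<And>x. x \<in> S \<Longrightarrow> ((\<lambda>x. frechet_derivative f (at x) i) has_derivative blinfun_apply (D x)) (at x)"
      "\<And>x. x \<in> S \<Longrightarrow> (D has_derivative blinfun_apply (E x)) (at x)" "continuous_on S E"
      using Ck_on_2[OF c[of i] S] by blast
    have "((\<lambda>x. blinfun_apply (f1 x) i) has_derivative blinfun_apply (D x)) (at x)" if "x \<in> S" for x
      by (rule has_derivative_transform_within_open[OF D(1)[OF that] S that]) (rule e)
    then show ?thesis using D(2,3) by (intro exI[of _ D] exI[of _ E] conjI ballI)
  qed
  note ex = this
  obtain D :: "'a \<Rightarrow> 'a \<Rightarrow> 'a \<Rightarrow>\<^sub>L 'b" where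
    "\<forall>i. \<exists>E. (\<forall>x\<in>S. ((\<lambda>x. blinfun_apply (f1 x) i) has_derivative blinfun_apply (D i x)) (at x)) \<and>
     (\<forall>x\<in>S. (D i has_derivative blinfun_apply (E x)) (at x)) \<and> continuous_on S E"
    using choice[OF allI[OF ex]] ..
  from choice[OF this] obtain E where
    D': "\<forall>i. (\<forall>x\<in>S. ((\<lambda>x. blinfun_apply (f1 x) i) has_derivative blinfun_apply (D i x)) (at x)) \<and>
     (\<forall>x\<in>S. (D i has_derivative blinfun_apply (E i x)) (at x)) \<and> continuous_on S (E i)" ..
  then have D: "\<And>i x. x\<in>S \<Longrightarrow> ((\<lambda>x. blinfun_apply (f1 x) i) has_derivative blinfun_apply (D i x)) (at x)"
    "\<And>i x. x \<in> S \<Longrightarrow> (D i has_derivative blinfun_apply (E i x)) (at x)" "\<And>i. continuous_on S (E i)"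
    by simp_all
  let ?f2 = "\<lambda>x. from_components (\<lambda>i. D i x)"
  define f3 :: "'a \<Rightarrow> 'a \<Rightarrow>\<^sub>L ('a \<Rightarrow>\<^sub>L 'a \<Rightarrow>\<^sub>L 'b)" where "f3 x = Blinfun (\<lambda>w. from_components (\<lambda>i. E i x w))" for x
  have d3: "(?f2 has_derivative (\<lambda>w. from_components (\<lambda>i. E i x w))) (at x)" if "x \<in> S" for x
    using D(2) that by (intro has_derivative_from_components') auto
  have f3: "blinfun_apply (f3 x) = (\<lambda>w. from_components (\<lambda>i. E i x w))" if "x \<in> S" for x
    unfolding f3_def using d3[OF that] has_derivative_bounded_linear by (intro bounded_linear_Blinfun_apply) blast
  show ?thesis
  proof (rule that[of f1 ?f2 f3])
    show "(f1 has_derivative blinfun_apply (?f2 x)) (at x)" if "x \<in> S" for x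
      using D(1) that by (intro has_derivative_from_components) auto
    show "(?f2 has_derivative blinfun_apply (f3 x)) (at x)" if "x \<in> S" for x
      using d3 f3 that by simp
    show "continuous_on S f3"
    proof (rule continuous_on_blinfun_componentwise)
      fix j :: 'a
      have "continuous_on S (\<lambda>x. from_components (\<lambda>i. E i x j))"
        by (intro continuous_on_from_components continuous_intros D(3))
      then show "continuous_on S (\<lambda>x. blinfun_apply (f3 x) j)" using f3 by (simp cong: continuous_on_cong)
    qed
  qed (rule f1)
qed

text \<open>The mean value theorem is applied to \<open>f (x + s v + t w) - f (x + s v)\<close> as a
  function of \<open>s\<close>. Its derivative is expanded at \<open>x\<close>, where the parts
  linear in \<open>s\<close> cancel and \<open>t\<close> times \<open>f2 w v\<close> is
  left.\<close>

lemma second_difference: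
  fixes f :: "'a::real_normed_vector \<Rightarrow> real" and f1 :: "'a \<Rightarrow> 'a \<Rightarrow>\<^sub>L real" and f2 :: "'a \<Rightarrow> ('a \<Rightarrow>\<^sub>L real)"
  assumes S: "\<And>k. norm k \<le> t * (norm v + norm w) \<Longrightarrow> x + k \<in> S"
    and f1: "\<And>y. y \<in> S \<Longrightarrow> (f has_derivative f1 y) (at y)" and t: "t > 0"
    and f2: "\<And>k. norm k \<le> t * (norm v + norm w) \<Longrightarrow> norm (f1 (x + k) - f1 x - f2 k) \<le> e * norm k"
    and e: "e \<ge> 0" and lin: "linear f2"
  shows "\<bar>f (x + t *\<^sub>R v + t *\<^sub>R w) - f (x + t *\<^sub>R v) - f (x + t *\<^sub>R w) + f x - t ^ 2 * blinfun_apply (f2 w) v\<bar>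
     \<le> 2 * e * t ^ 2 * (norm v + norm w) ^ 2"
proof -
  let ?n = "norm v + norm w"
  define \<phi> where "\<phi> s = f (x + (s *\<^sub>R v + t *\<^sub>R w)) - f (x + s *\<^sub>R v)" for s
  define \<phi>' where "\<phi>' s = f1 (x + (s *\<^sub>R v + t *\<^sub>R w)) v - f1 (x + s *\<^sub>R v) v" for s
  have k1: "norm (s *\<^sub>R v + t *\<^sub>R w) \<le> t * ?n" and k2: "norm (s *\<^sub>R v) \<le> t * ?n" if "0 \<le> s" "s \<le> t" for s
  proof -
    have "norm (s *\<^sub>R v) \<le> t * norm v" using that by (simp add: mult_right_mono)
    moreover have "norm (t *\<^sub>R w) = t * norm w" "0 \<le> t * norm w" using t by auto
    ultimately show "norm (s *\<^sub>R v + t *\<^sub>R w) \<le> t * ?n" "norm (s *\<^sub>R v) \<le> t * ?n"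
      using norm_triangle_ineq[of "s *\<^sub>R v" "t *\<^sub>R w"] unfolding distrib_left by linarith+
  qed
  have "DERIV \<phi> s :> \<phi>' s" if "0 \<le> s" "s \<le> t" for s
  proof -
    have "((\<lambda>s. f (x + (s *\<^sub>R v + t *\<^sub>R w))) has_derivative (\<lambda>h. f1 (x + (s *\<^sub>R v + t *\<^sub>R w)) (h *\<^sub>R v))) (at s)"
      by (rule has_derivative_compose[of "\<lambda>s. x + (s *\<^sub>R v + t *\<^sub>R w)" "\<lambda>h. h *\<^sub>R v" s UNIV f, OF _ f1[OF S[OF k1[OF that]]]]) (auto intro!: derivative_eq_intros)
    moreover have "((\<lambda>s. f (x + s *\<^sub>R v)) has_derivative (\<lambda>h. f1 (x + s *\<^sub>R v) (h *\<^sub>R v))) (at s)"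
      by (rule has_derivative_compose[of "\<lambda>s. x + s *\<^sub>R v" "\<lambda>h. h *\<^sub>R v" s UNIV f, OF _ f1[OF S[OF k2[OF that]]]]) (auto intro!: derivative_eq_intros)
    ultimately have "(\<phi> has_derivative (\<lambda>h. f1 (x + (s *\<^sub>R v + t *\<^sub>R w)) (h *\<^sub>R v) - f1 (x + s *\<^sub>R v) (h *\<^sub>R v))) (at s)"
      unfolding \<phi>_def by (rule has_derivative_diff)
    then show ?thesis
      unfolding has_field_derivative_def \<phi>'_def
      by (rule has_derivative_eq_rhs) (auto simp: blinfun.scaleR_right algebra_simps)
  qed
  then obtain s where s: "0 < s" "s < t" "\<phi> t - \<phi> 0 = (t - 0) * \<phi>' s"
    using MVT2[OF t, of \<phi> \<phi>'] by blast
  have "\<bar>\<phi>' s - t * f2 w v\<bar> \<le> 2 * e * t * ?n ^ 2"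
  proof -
    let ?k1 = "s *\<^sub>R v + t *\<^sub>R w" and ?k2 = "s *\<^sub>R v"
    let ?E = "\<lambda>k. f1 (x + k) - f1 x - f2 k"
    have "f2 ?k1 = f2 ?k2 + t *\<^sub>R f2 w" using lin by (simp add: linear_add linear_scale)
    then have "\<phi>' s - t * f2 w v = blinfun_apply (?E ?k1 - ?E ?k2) v"
      by (simp add: \<phi>'_def blinfun.diff_left blinfun.add_left blinfun.scaleR_left)
    then have "\<bar>\<phi>' s - t * f2 w v\<bar> \<le> norm (?E ?k1 - ?E ?k2) * norm v"
      using norm_blinfun[of "?E ?k1 - ?E ?k2" v] by simp
    also have "\<dots> \<le> (2 * e * t * ?n) * ?n"
    proof (intro mult_mono)
      have "norm (?E ?k1 - ?E ?k2) \<le> norm (?E ?k1) + norm (?E ?k2)" by (rule norm_triangle_ineq4)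
      also have "\<dots> \<le> e * norm ?k1 + e * norm ?k2" using s k1 k2 by (intro add_mono f2) auto
      also have "\<dots> \<le> e * (t * ?n) + e * (t * ?n)" using s k1 k2 e by (intro add_mono mult_left_mono) auto
      finally show "norm (?E ?k1 - ?E ?k2) \<le> 2 * e * t * ?n" by (simp add: algebra_simps)
    qed (use e t in auto)
    finally show ?thesis by (simp add: power2_eq_square algebra_simps)
  qed
  then have "t * \<bar>\<phi>' s - t * f2 w v\<bar> \<le> t * (2 * e * t * ?n ^ 2)" using t by (intro mult_left_mono) auto
  moreover have "t * \<bar>\<phi>' s - t * f2 w v\<bar> = \<bar>\<phi> t - \<phi> 0 - t ^ 2 * f2 w v\<bar>"
  proof -
    have "\<phi> t - \<phi> 0 - t ^ 2 * f2 w v = t * (\<phi>' s - t * f2 w v)"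
      using s(3) by (simp add: power2_eq_square algebra_simps)
    then show ?thesis using t by (simp only: abs_mult abs_of_pos)
  qed
  ultimately show ?thesis by (simp add: \<phi>_def power2_eq_square algebra_simps)
qed

text \<open>The second difference does not change when \<open>v\<close> and \<open>w\<close> are
  exchanged, so \<open>f2 w v\<close> and \<open>f2 v w\<close>, multiplied by \<open>t ^ 2\<close>,
  both lie within a small multiple of \<open>t ^ 2\<close> of the same number.\<close>

lemma symmetric_second_derivative_real:
  fixes f :: "'a::real_normed_vector \<Rightarrow> real" and f1 :: "'a \<Rightarrow> 'a \<Rightarrow>\<^sub>L real" and f2 :: "'a \<Rightarrow> ('a \<Rightarrow>\<^sub>L real)"
  assumes S: "open S" "x \<in> S" and f1: "\<And>y. y \<in> S \<Longrightarrow> (f has_derivative f1 y) (at y)"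
    and f2: "(f1 has_derivative f2) (at x)"
  shows "blinfun_apply (f2 v) w = blinfun_apply (f2 w) v"
proof -
  let ?n = "norm v + norm w"
  have lin: "linear f2" using f2 by (rule has_derivative_linear)
  have "\<bar>blinfun_apply (f2 v) w - blinfun_apply (f2 w) v\<bar> \<le> 0 + e" if "e > 0" for e
  proof -
    have n1: "?n + 1 > 0" by (intro add_nonneg_pos add_nonneg_nonneg) auto
    \<comment> \<open>The two expansions together leave an error \<open>4 * e' * ?n ^ 2\<close>;
      adding 1 keeps the denominator positive when \<open>v\<close> and \<open>w\<close>
      vanish.\<close>
    define e' where "e' = e / (4 * (?n + 1) ^ 2)"
    have e': "e' > 0" using that n1 by (simp add: e'_def)
    obtain d where d: "d > 0" "\<And>y. norm (y - x) < d \<Longrightarrow> norm (f1 y - f1 x - f2 (y - x)) \<le> e' * norm (y - x)"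
      using f2 e' unfolding has_derivative_at_alt by blast
    obtain r where r: "r > 0" "ball x r \<subseteq> S" using S openE by blast
    define t where "t = min d r / (2 * (?n + 1))"
    have t: "t > 0" using d r n1 by (simp add: t_def)
    have "t * ?n \<le> t * (?n + 1)" using t by (intro mult_left_mono) auto
    also have "\<dots> = min d r / 2"
    proof -
      have "m / (2 * N) * N = m / 2" if "N > 0" for m N :: real using that by simp
      from this[OF n1] show ?thesis unfolding t_def .
    qed
    finally have tn: "t * ?n < d" "t * ?n < r" using d r by auto
    have S': "x + k \<in> S" if "norm k \<le> t * ?n" for k
      using r(2) that tn by (auto simp: dist_norm)
    have k: "norm (f1 (x + k) - f1 x - f2 k) \<le> e' * norm k" if "norm k \<le> t * ?n" for k
      using d(2)[of "x + k"] that tn by simp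
    have "\<bar>f (x + t *\<^sub>R v + t *\<^sub>R w) - f (x + t *\<^sub>R v) - f (x + t *\<^sub>R w) + f x - t ^ 2 * blinfun_apply (f2 w) v\<bar>
       \<le> 2 * e' * t ^ 2 * ?n ^ 2"
      by (rule second_difference[OF S' f1 t k _ lin]) (use e' in auto)
    moreover have "\<bar>f (x + t *\<^sub>R w + t *\<^sub>R v) - f (x + t *\<^sub>R w) - f (x + t *\<^sub>R v) + f x - t ^ 2 * blinfun_apply (f2 v) w\<bar>
       \<le> 2 * e' * t ^ 2 * (norm w + norm v) ^ 2"
      by (rule second_difference[OF S' f1 t k _ lin]) (use e' in \<open>auto simp: add.commute\<close>)
    moreover have "f (x + t *\<^sub>R w + t *\<^sub>R v) = f (x + t *\<^sub>R v + t *\<^sub>R w)" by (simp add: algebra_simps)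
    ultimately have "\<bar>t ^ 2 * blinfun_apply (f2 v) w - t ^ 2 * blinfun_apply (f2 w) v\<bar> \<le> 4 * e' * t ^ 2 * ?n ^ 2"
      by (simp add: add.commute[of "norm w"])
    moreover have "\<bar>t ^ 2 * blinfun_apply (f2 v) w - t ^ 2 * blinfun_apply (f2 w) v\<bar>
       = t ^ 2 * \<bar>blinfun_apply (f2 v) w - blinfun_apply (f2 w) v\<bar>"
      using t by (simp add: abs_mult flip: right_diff_distrib)
    ultimately have "t ^ 2 * \<bar>blinfun_apply (f2 v) w - blinfun_apply (f2 w) v\<bar> \<le> t ^ 2 * (4 * e' * ?n ^ 2)"
      by (simp add: algebra_simps)
    then have "\<bar>blinfun_apply (f2 v) w - blinfun_apply (f2 w) v\<bar> \<le> 4 * e' * ?n ^ 2"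
      using t by (simp add: mult_le_cancel_left)
    also have "\<dots> \<le> 4 * e' * (?n + 1) ^ 2"
      using e' by (intro mult_left_mono power_mono) auto
    also have "\<dots> = e"
    proof -
      have "4 * (e / (4 * N\<^sup>2)) * N\<^sup>2 = e" if "N > 0" for N :: real using that by simp
      from this[OF n1] show ?thesis unfolding e'_def .
    qed
    finally show ?thesis by simp
  qed
  then have "\<bar>blinfun_apply (f2 v) w - blinfun_apply (f2 w) v\<bar> \<le> 0" by (rule field_le_epsilon)
  then show ?thesis by simp
qed

lemma symmetric_second_derivative:
  fixes f :: "'a::real_normed_vector \<Rightarrow> 'b::euclidean_space" and f1 :: "'a \<Rightarrow> 'a \<Rightarrow>\<^sub>L 'b" and f2 :: "'a \<Rightarrow> ('a \<Rightarrow>\<^sub>L 'b)"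
  assumes S: "open S" "x \<in> S" and f1: "\<And>y. y \<in> S \<Longrightarrow> (f has_derivative f1 y) (at y)"
    and f2: "(f1 has_derivative f2) (at x)"
  shows "blinfun_apply (f2 v) w = blinfun_apply (f2 w) v"
proof (rule euclidean_eqI)
  fix i :: 'b
  have "blinfun_apply (blinfun_inner_left i o\<^sub>L f2 v) w = blinfun_apply (blinfun_inner_left i o\<^sub>L f2 w) v"
  proof (rule symmetric_second_derivative_real[OF S])
    show "((\<lambda>y. f y \<bullet> i) has_derivative (blinfun_inner_left i o\<^sub>L f1 y)) (at y)" if "y \<in> S" for y
      using f1[OF that] by (auto intro!: derivative_eq_intros simp: blinfun_inner_left.rep_eq)
    show "((\<lambda>y. blinfun_inner_left i o\<^sub>L f1 y) has_derivative (\<lambda>v. blinfun_inner_left i o\<^sub>L f2 v)) (at x)"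
      by (rule bounded_linear.has_derivative[OF bounded_bilinear.bounded_linear_right[OF bounded_bilinear_blinfun_compose] f2])
  qed
  then show "blinfun_apply (f2 v) w \<bullet> i = blinfun_apply (f2 w) v \<bullet> i"
    by (simp add: blinfun_inner_left.rep_eq)
qed

section \<open>Symmetrizable pencils\<close>

lemma directional_difference_quotient:
  fixes f :: "'a::real_normed_vector \<Rightarrow> 'b::real_normed_vector"
  assumes "(f has_derivative f') (at z)"
  shows "((\<lambda>t. inverse t *\<^sub>R (f (z + t *\<^sub>R s) - f z)) \<longlongrightarrow> f' s) (at_right 0)"
proof -
  interpret bounded_linear f' using assms by (rule has_derivative_bounded_linear)
  have "((\<lambda>t. f (z + t *\<^sub>R s)) has_derivative (\<lambda>h. f' (h *\<^sub>R s))) (at 0)"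
    by (rule has_derivative_compose[of "\<lambda>t. z + t *\<^sub>R s" "\<lambda>h. h *\<^sub>R s" 0 UNIV f])
      (use assms in \<open>auto intro!: derivative_eq_intros\<close>)
  then have "((\<lambda>h. norm (f (z + (0 + h) *\<^sub>R s) - f (z + 0 *\<^sub>R s) - f' (h *\<^sub>R s)) / norm h) \<longlongrightarrow> 0) (at 0)"
    unfolding has_derivative_at by simp
  from tendsto_mono[OF at_le[OF subset_UNIV[of "{0<..}"]] this]
  have "((\<lambda>h. norm (f (z + h *\<^sub>R s) - f z - f' (h *\<^sub>R s)) / norm h) \<longlongrightarrow> 0) (at_right 0)"
    by simp
  moreover have "\<forall>\<^sub>F h in at_right 0. norm (f (z + h *\<^sub>R s) - f z - f' (h *\<^sub>R s)) / norm h =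
      norm (inverse h *\<^sub>R (f (z + h *\<^sub>R s) - f z) - f' s)"
  proof (rule eventually_at_right_less[THEN eventually_mono])
    fix h :: real assume h: "0 < h"
    have "inverse h *\<^sub>R (f (z + h *\<^sub>R s) - f z - f' (h *\<^sub>R s)) = inverse h *\<^sub>R (f (z + h *\<^sub>R s) - f z) - f' s"
      using h by (simp add: scaleR_diff_right scaleR)
    then have "norm (inverse h *\<^sub>R (f (z + h *\<^sub>R s) - f z) - f' s) = inverse h * norm (f (z + h *\<^sub>R s) - f z - f' (h *\<^sub>R s))"
      using h by (metis abs_of_pos norm_scaleR positive_imp_inverse_positive)
    then show "norm (f (z + h *\<^sub>R s) - f z - f' (h *\<^sub>R s)) / norm h =
      norm (inverse h *\<^sub>R (f (z + h *\<^sub>R s) - f z) - f' s)" using h by (simp add: divide_inverse_commute)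
  qed
  ultimately have "((\<lambda>h. norm (inverse h *\<^sub>R (f (z + h *\<^sub>R s) - f z) - f' s)) \<longlongrightarrow> 0) (at_right 0)"
    by (rule Lim_transform_eventually)
  then show ?thesis by (rule LIM_zero_cancel[OF tendsto_norm_zero_cancel])
qed

lemma isCont_eventually_dist:
  assumes "isCont f z" "e > 0"
  shows "\<forall>\<^sub>F u in nhds z. dist (f u) (f z) < e"
  using assms by (auto simp: isCont_def tendsto_at_iff_tendsto_nhds dest: tendstoD)

lemma eventually_nhds_cball:
  fixes z :: "'a::metric_space"
  assumes "\<forall>\<^sub>F u in nhds z. P u" "d > 0"
  obtains e where "e > 0" "e < d" "\<And>u. u \<in> cball z e \<Longrightarrow> P u"
proof -
  obtain r where r: "r > 0" "\<forall>u. dist u z < r \<longrightarrow> P u" using assms(1) unfolding eventually_nhds_metric by blast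
  show ?thesis
    by (rule that[of "min r d / 2"]) (use r assms(2) in \<open>auto simp: dist_commute\<close>)
qed

text \<open>A pencil \<open>Y - \<xi> X\<close> of Jacobians of \<open>fx\<close> and \<open>fy\<close>, with symmetrizer \<open>N\<close>, the Hessian of the
  entropy; \<open>n\<close> is the gradient of the entropy.\<close>

locale symmetrizable_pencil =
  fixes Ub :: "'a::euclidean_space" and \<delta> :: real and fx fy n :: "'a \<Rightarrow> 'a"
    and X Y N :: "'a \<Rightarrow> 'a \<Rightarrow>\<^sub>L 'a" and X2 Y2 N2 :: "'a \<Rightarrow> 'a \<Rightarrow>\<^sub>L ('a \<Rightarrow>\<^sub>L 'a)"
    and \<psi>x \<psi>y :: "'a \<Rightarrow> real"
  assumes \<delta>: "\<delta> > 0"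
    and fx: "\<And>u. u \<in> ball Ub \<delta> \<Longrightarrow> (fx has_derivative blinfun_apply (X u)) (at u)"
    and fy: "\<And>u. u \<in> ball Ub \<delta> \<Longrightarrow> (fy has_derivative blinfun_apply (Y u)) (at u)"
    and n: "\<And>u. u \<in> ball Ub \<delta> \<Longrightarrow> (n has_derivative blinfun_apply (N u)) (at u)"
    and X: "\<And>u. u \<in> ball Ub \<delta> \<Longrightarrow> (X has_derivative blinfun_apply (X2 u)) (at u)"
    and Y: "\<And>u. u \<in> ball Ub \<delta> \<Longrightarrow> (Y has_derivative blinfun_apply (Y2 u)) (at u)"
    and N: "\<And>u. u \<in> ball Ub \<delta> \<Longrightarrow> (N has_derivative blinfun_apply (N2 u)) (at u)"
    and X2: "continuous_on (ball Ub \<delta>) X2" and Y2: "continuous_on (ball Ub \<delta>) Y2"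
    and N2: "continuous_on (ball Ub \<delta>) N2"
    and \<psi>x: "\<And>u. u \<in> ball Ub \<delta> \<Longrightarrow> (\<psi>x has_derivative (\<lambda>v. n u \<bullet> blinfun_apply (X u) v)) (at u)"
    and \<psi>y: "\<And>u. u \<in> ball Ub \<delta> \<Longrightarrow> (\<psi>y has_derivative (\<lambda>v. n u \<bullet> blinfun_apply (Y u) v)) (at u)"
    and symX: "\<And>u v w. u \<in> ball Ub \<delta> \<Longrightarrow> N u v \<bullet> X u w = N u w \<bullet> X u v"
    and symY: "\<And>u v w. u \<in> ball Ub \<delta> \<Longrightarrow> N u v \<bullet> Y u w = N u w \<bullet> Y u v"
    and pos: "\<And>v. v \<noteq> 0 \<Longrightarrow> N Ub v \<bullet> X Ub v > 0"
begin

text \<open>\<open>G \<xi> u = G \<xi> v\<close> is the Rankine-Hugoniot condition for a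
  discontinuity along the ray y = \<xi> x. \<open>L\<close> and \<open>L2\<close> are the first two
  derivatives of \<open>G \<xi>\<close>, and \<open>H \<xi>\<close> is the matching entropy flux,
  whose derivative is \<open>n\<close> paired with \<open>L \<xi>\<close>.\<close>

definition G where "G \<xi> u = fy u - \<xi> *\<^sub>R fx u"
definition L where "L \<xi> u = Y u - \<xi> *\<^sub>R X u"
definition L2 where "L2 \<xi> u = Y2 u - \<xi> *\<^sub>R X2 u"
definition H where "H \<xi> u = \<psi>y u - \<xi> * \<psi>x u"

lemma G: "u \<in> ball Ub \<delta> \<Longrightarrow> (G \<xi> has_derivative blinfun_apply (L \<xi> u)) (at u)"
  unfolding G_def[abs_def] L_def
  by (auto intro!: derivative_eq_intros fx fy simp: blinfun.diff_left blinfun.scaleR_left)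

lemma L: "u \<in> ball Ub \<delta> \<Longrightarrow> (L \<xi> has_derivative blinfun_apply (L2 \<xi> u)) (at u)"
  unfolding L_def[abs_def] L2_def
  by (auto intro!: derivative_eq_intros X Y simp: blinfun.diff_left blinfun.scaleR_left)

lemma H: "u \<in> ball Ub \<delta> \<Longrightarrow> (H \<xi> has_derivative (\<lambda>v. n u \<bullet> blinfun_apply (L \<xi> u) v)) (at u)"
  unfolding H_def[abs_def] L_def
  by (auto intro!: derivative_eq_intros \<psi>x \<psi>y simp: blinfun.diff_left blinfun.scaleR_left inner_diff_right)

lemma symL: "u \<in> ball Ub \<delta> \<Longrightarrow> N u v \<bullet> L \<xi> u w = N u w \<bullet> L \<xi> u v"
  by (simp add: L_def blinfun.diff_left blinfun.scaleR_left inner_diff_right symX symY)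

lemma center [simp]: "Ub \<in> ball Ub \<delta>" using \<delta> by simp

lemma isCont_data:
  assumes "u \<in> ball Ub \<delta>"
  shows "isCont fx u" "isCont fy u" "isCont n u" "isCont X u" "isCont Y u" "isCont N u" "isCont X2 u" "isCont Y2 u" "isCont N2 u"
  using assms has_derivative_continuous[OF fx[OF assms]] has_derivative_continuous[OF fy[OF assms]]
    has_derivative_continuous[OF n[OF assms]] has_derivative_continuous[OF X[OF assms]]
    has_derivative_continuous[OF Y[OF assms]] has_derivative_continuous[OF N[OF assms]] X2 Y2 N2
  by (simp_all add: continuous_on_eq_continuous_at)

lemma positive_definite:
  obtains s where "s > 0" "\<And>v. s * norm v ^ 2 \<le> N Ub v \<bullet> X Ub v"
proof (cases "sphere (0::'a) 1 = {}")
  case True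
  have "v = 0" for v :: 'a
  proof (rule ccontr)
    assume "v \<noteq> 0"
    then have "v /\<^sub>R norm v \<in> sphere 0 1" by simp
    then show False using True by blast
  qed
  then show ?thesis by (intro that[of 1]) (metis norm_zero blinfun.zero_right inner_zero_left power2_eq_square mult_zero_right order_refl zero_less_one)+
next
  case False
  have "\<exists>v0\<in>sphere 0 1. \<forall>v\<in>sphere 0 1. N Ub v0 \<bullet> X Ub v0 \<le> N Ub v \<bullet> X Ub v"
    by (intro continuous_attains_inf compact_sphere False continuous_intros)
  then obtain v0 where v0: "norm v0 = 1" "\<And>v. norm v = 1 \<Longrightarrow> N Ub v0 \<bullet> X Ub v0 \<le> N Ub v \<bullet> X Ub v" by auto
  show ?thesis
  proof (rule that)
    show "N Ub v0 \<bullet> X Ub v0 > 0" using v0(1) by (intro pos) auto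
    fix v
    show "(N Ub v0 \<bullet> X Ub v0) * norm v ^ 2 \<le> N Ub v \<bullet> X Ub v"
    proof (cases "v = 0")
      case False
      have "N Ub v0 \<bullet> X Ub v0 \<le> N Ub (v /\<^sub>R norm v) \<bullet> X Ub (v /\<^sub>R norm v)"
        by (rule v0(2)) (use False in simp)
      also have "\<dots> = (N Ub v \<bullet> X Ub v) / norm v ^ 2"
        by (simp add: blinfun.scaleR_right divide_inverse power2_eq_square)
      finally show ?thesis using False by (simp add: field_simps)
    qed simp
  qed
qed

lemma sym2:
  assumes "u \<in> ball Ub \<delta>"
  shows "blinfun_apply (X2 u v) w = blinfun_apply (X2 u w) v" "blinfun_apply (Y2 u v) w = blinfun_apply (Y2 u w) v"
    "blinfun_apply (L2 \<xi> u v) w = blinfun_apply (L2 \<xi> u w) v"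
  using symmetric_second_derivative[OF open_ball assms fx X[OF assms]]
    symmetric_second_derivative[OF open_ball assms fy Y[OF assms]]
    symmetric_second_derivative[OF open_ball assms G L[OF assms]] by auto

end

locale pencil_eigenvalue = symmetrizable_pencil +
  fixes l :: "'a \<Rightarrow> real" and Dl :: "'a \<Rightarrow> 'a \<Rightarrow>\<^sub>L real" and p :: nat
  assumes l: "\<And>u. u \<in> ball Ub \<delta> \<Longrightarrow> (l has_derivative blinfun_apply (Dl u)) (at u)"
    and Dl: "continuous_on (ball Ub \<delta>) Dl"
    and dim_eigenspace: "\<And>u. u \<in> ball Ub \<delta> \<Longrightarrow> dim {v. blinfun_apply (Y u) v = l u *\<^sub>R blinfun_apply (X u) v} = p"
begin

definition E where "E u = {v. blinfun_apply (L (l u) u) v = 0}"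

lemma E_iff: "v \<in> E u \<longleftrightarrow> blinfun_apply (Y u) v = l u *\<^sub>R blinfun_apply (X u) v"
  by (simp add: E_def L_def blinfun.diff_left blinfun.scaleR_left)

lemma E_altdef: "E u = {v. blinfun_apply (Y u) v = l u *\<^sub>R blinfun_apply (X u) v}"
  using E_iff by auto

lemma dim_E: "u \<in> ball Ub \<delta> \<Longrightarrow> dim (E u) = p"
  by (simp add: E_altdef dim_eigenspace)

lemma subspace_E: "subspace (E u)"
  by (auto simp: E_def subspace_def blinfun.add_right blinfun.scaleR_right)

lemma isCont_l: "u \<in> ball Ub \<delta> \<Longrightarrow> isCont l u" "u \<in> ball Ub \<delta> \<Longrightarrow> isCont Dl u"
  using has_derivative_continuous[OF l] Dl by (simp_all add: continuous_on_eq_continuous_at)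

text \<open>Symmetry moves the pencil onto \<open>r\<close>: the symmetrizer maps right null vectors
  to left null vectors.\<close>

lemma left_null: "\<lbrakk>u \<in> ball Ub \<delta>; r \<in> E u\<rbrakk> \<Longrightarrow> N u r \<bullet> L (l u) u v = 0"
  by (subst symL) (auto simp: E_def)

text \<open>A complement on which \<open>L (l u) u\<close> is injective; jumps are split into a part
  along the eigenspace and a part that the pencil controls.\<close>

definition Ec where "Ec u = {w. \<forall>r\<in>E u. orthogonal r w}"

lemma subspace_Ec: "subspace (Ec u)"
  unfolding Ec_def by (rule subspace_orthogonal_to_vectors)

lemma decomp:
  obtains a b where "a \<in> E u" "b \<in> Ec u" "v = a + b"
proof -
  obtain a b where "a \<in> span (E u)" "\<And>w. w \<in> span (E u) \<Longrightarrow> orthogonal b w" "v = a + b"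
    using orthogonal_subspace_decomp_exists by blast
  moreover have "span (E u) = E u" using subspace_E span_eq_iff by blast
  ultimately show ?thesis
    by (intro that[of a b]) (auto simp: Ec_def orthogonal_commute)
qed

lemma dim_Ec: "dim (Ec u) + dim (E u) = DIM('a)"
  using dim_subspace_orthogonal_to_vectors[OF subspace_E[of u] subspace_UNIV] by (simp add: Ec_def)

lemma norm_decomp_le:
  assumes "a \<in> E u" "b \<in> Ec u"
  shows "norm a \<le> norm (a + b)"
proof -
  have "orthogonal a b" using assms by (auto simp: Ec_def)
  then have "norm (a + b) ^ 2 = norm a ^ 2 + norm b ^ 2" by (simp add: norm_add_Pythagorean)
  then have "norm a ^ 2 \<le> norm (a + b) ^ 2" by simp
  then show ?thesis by (rule power2_le_imp_le) simp
qed

lemma coercive: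
  obtains c where "c > 0" "\<And>b. b \<in> Ec u \<Longrightarrow> c * norm b \<le> norm (blinfun_apply (L (l u) u) b)"
proof -
  have "\<forall>b\<in>Ec u. blinfun_apply (L (l u) u) b = 0 \<longrightarrow> b = 0"
    by (auto simp: Ec_def E_def orthogonal_def)
  then have "\<exists>c>0. \<forall>b\<in>Ec u. norm (blinfun_apply (L (l u) u) b) \<ge> c * norm b"
    by (intro injective_imp_isometric closed_subspace subspace_Ec blinfun.bounded_linear_right)
  then show ?thesis using that by blast
qed

lemma isCont_L_eigenvalue:
  assumes "z \<in> ball Ub \<delta>"
  shows "isCont (\<lambda>u. L (l u) u) z"
  unfolding L_def using isCont_data[OF assms] isCont_l[OF assms] by (intro continuous_intros)

text \<open>Constancy of the dimension keeps the eigenspace from collapsing. Vectors of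
  \<open>E u\<close> have small components in \<open>Ec z\<close>, so \<open>E u\<close> meets
  \<open>Ec z\<close> only in 0, and by dimension the two span everything; splitting
  \<open>r\<close> along them produces \<open>r'\<close>.\<close>

lemma eigenspace_continuous:
  assumes z: "z \<in> ball Ub \<delta>" and w: "w > 0"
  shows "\<forall>\<^sub>F u in nhds z. \<forall>r\<in>E z. \<exists>r'\<in>E u. r' - r \<in> Ec z \<and> norm (r' - r) \<le> w * norm r"
proof -
  obtain c where c: "c > 0" "\<And>b. b \<in> Ec z \<Longrightarrow> c * norm b \<le> norm (blinfun_apply (L (l z) z) b)"
    using coercive by blast
  \<comment> \<open>The first entry leads to \<open>norm r' \<le> 2 * norm r\<close>, the second
    then to the bound with \<open>w\<close>.\<close>
  define e where "e = min (c / 2) (c * w / 2)"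
  have e: "e > 0" "e \<le> c / 2" "e \<le> c * w / 2" using c w by (auto simp: e_def)
  have ec: "e / c \<le> 1 / 2" "2 * e / c \<le> w" using e c(1) by (simp_all add: field_simps)
  have "\<forall>\<^sub>F u in nhds z. dist (L (l u) u) (L (l z) z) < e"
    by (rule isCont_eventually_dist[OF isCont_L_eigenvalue[OF z] e(1)])
  moreover have "\<forall>\<^sub>F u in nhds z. u \<in> ball Ub \<delta>" using z by (intro eventually_nhds_in_open) auto
  ultimately show ?thesis
  proof eventually_elim
    case (elim u)
    \<comment> \<open>\<open>L (l z) z\<close> sees only \<open>b\<close>, and
      \<open>L (l u) u\<close> annihilates \<open>v\<close>, so \<open>b\<close> is controlled by
      the difference of the two operators.\<close>
    have small: "norm b \<le> (e / c) * norm v" if v: "v \<in> E u" "v = a + b" "a \<in> E z" "b \<in> Ec z" for v a b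
    proof -
      have "blinfun_apply (L (l z) z) v = blinfun_apply (L (l z) z) b" "blinfun_apply (L (l u) u) v = 0"
        using v by (simp_all add: E_def blinfun.add_right)
      then have "blinfun_apply (L (l z) z) b = blinfun_apply (L (l z) z - L (l u) u) v"
        by (simp add: blinfun.diff_left)
      then have "c * norm b \<le> norm (blinfun_apply (L (l z) z - L (l u) u) v)" using c(2)[OF v(4)] by simp
      also have "\<dots> \<le> norm (L (l z) z - L (l u) u) * norm v" by (rule norm_blinfun)
      also have "\<dots> \<le> e * norm v"
        using elim(1) by (intro mult_right_mono) (auto simp: dist_norm norm_minus_commute)
      finally show ?thesis using c(1) by (simp add: field_simps)
    qed
    have "E u \<inter> Ec z = {0}"
    proof -
      have "v = 0" if "v \<in> E u" "v \<in> Ec z" for v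
      proof -
        have "norm v \<le> (e / c) * norm v" by (rule small[of v 0 v]) (use that subspace_0[OF subspace_E] in auto)
        also have "\<dots> \<le> 1 / 2 * norm v" by (intro mult_right_mono ec) simp
        finally show ?thesis by simp
      qed
      then show ?thesis using subspace_0[OF subspace_E] subspace_0[OF subspace_Ec] by auto
    qed
    then have "dim {x + y |x y. x \<in> E u \<and> y \<in> Ec z} = dim (E u) + dim (Ec z)"
      using dim_sums_Int[OF subspace_E[of u] subspace_Ec[of z]] by simp
    also have "\<dots> = DIM('a)" using dim_Ec[of z] dim_E[of u] dim_E[of z] elim z by simp
    finally have full: "span {x + y |x y. x \<in> E u \<and> y \<in> Ec z} = UNIV" by (simp add: dim_eq_full)
    have "subspace {x + y |x y. x \<in> E u \<and> y \<in> Ec z}" by (rule subspace_sums[OF subspace_E subspace_Ec])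
    then have "span {x + y |x y. x \<in> E u \<and> y \<in> Ec z} = {x + y |x y. x \<in> E u \<and> y \<in> Ec z}"
      by (simp only: span_eq_iff)
    then have U: "{x + y |x y. x \<in> E u \<and> y \<in> Ec z} = UNIV" using full by simp
    show ?case
    proof
      fix r assume r: "r \<in> E z"
      have "r \<in> {x + y |x y. x \<in> E u \<and> y \<in> Ec z}" unfolding U by simp
      then obtain r' b where rb: "r = r' + b" "r' \<in> E u" "b \<in> Ec z" by blast
      have b': "- b \<in> Ec z" using rb(3) subspace_neg[OF subspace_Ec] by blast
      have "norm (- b) \<le> (e / c) * norm r'" by (rule small[of r' r "- b"]) (use rb r b' in auto)
      then have 1: "norm b \<le> (e / c) * norm r'" by simp
      have "norm r' \<le> norm r + norm b" using rb(1) norm_triangle_ineq4[of r b] by simp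
      moreover have "norm b \<le> 1 / 2 * norm r'"
        using 1 mult_right_mono[OF ec(1) norm_ge_zero[of r']] by (rule order_trans)
      ultimately have "norm r' \<le> 2 * norm r" by simp
      then have "(e / c) * norm r' \<le> (e / c) * (2 * norm r)" using e c by (intro mult_left_mono) auto
      also have "\<dots> = (2 * e / c) * norm r" by simp
      also have "\<dots> \<le> w * norm r" by (intro mult_right_mono ec) simp
      finally have "norm b \<le> w * norm r" using 1 by simp
      then show "\<exists>r'\<in>E u. r' - r \<in> Ec z \<and> norm (r' - r) \<le> w * norm r"
        using rb b' by (intro bexI[of _ r']) auto
    qed
  qed
qed

text \<open>Differentiating \<open>(Y - l X) r = 0\<close> in the direction \<open>s\<close> and testing with a left null vector.\<close>

lemma eigenvalue_derivative:
  assumes z: "z \<in> ball Ub \<delta>" and "k \<in> E z" "r \<in> E z"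
  shows "N z k \<bullet> blinfun_apply (L2 (l z) z s) r = Dl z s * (N z k \<bullet> X z r)"
proof -
  \<comment> \<open>A path of eigenvectors tending to \<open>r\<close> stands in for a
    differentiable field of eigenvectors.\<close>
  have "\<exists>R. (R \<longlongrightarrow> r) (at_right (0::real)) \<and> (\<forall>\<^sub>F t in at_right 0. R t \<in> E (z + t *\<^sub>R s))"
  proof -
    have lim: "((\<lambda>t. z + t *\<^sub>R s) \<longlongrightarrow> z) (at_right (0::real))"
      by (rule tendsto_eq_intros | simp)+
    have *: "\<forall>\<^sub>F t in at_right (0::real). \<exists>w. w \<in> E (z + t *\<^sub>R s) \<and> norm (w - r) \<le> e * norm r" if "e > 0" for e
      using eventually_compose_filterlim[OF eigenspace_continuous[OF z that] lim]
      by (rule eventually_mono) (use assms in blast)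
    \<comment> \<open>\<open>eigenspace_continuous\<close> offers a different vector for every
      tolerance; the nearest one serves all tolerances at once.\<close>
    define nearest where "nearest t w \<longleftrightarrow> w \<in> E (z + t *\<^sub>R s) \<and>
      (\<forall>y\<in>E (z + t *\<^sub>R s). dist r w \<le> dist r y)" for t w
    have ex: "\<exists>w. nearest t w" for t
    proof -
      have cl: "closed (E (z + t *\<^sub>R s))" by (rule closed_subspace[OF subspace_E])
      have ne: "E (z + t *\<^sub>R s) \<noteq> {}" using subspace_0[OF subspace_E] by (metis empty_iff)
      show ?thesis
        by (rule distance_attains_inf[OF cl ne, of r]) (auto simp: nearest_def)
    qed
    define R where "R t = (SOME w. nearest t w)" for t
    have "nearest t (R t)" for t unfolding R_def by (rule someI_ex[OF ex])
    then have R: "R t \<in> E (z + t *\<^sub>R s)" "\<And>w. w \<in> E (z + t *\<^sub>R s) \<Longrightarrow> norm (R t - r) \<le> norm (w - r)" for t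
      by (auto simp: nearest_def dist_norm norm_minus_commute)
    have "(R \<longlongrightarrow> r) (at_right 0)"
    proof (rule tendstoI)
      fix e :: real assume e: "e > 0"
      have "e / (2 * (norm r + 1)) > 0" using e by (simp add: add_nonneg_pos)
      from *[OF this] show "\<forall>\<^sub>F t in at_right 0. dist (R t) r < e"
      proof eventually_elim
        case (elim t)
        then obtain w where w: "w \<in> E (z + t *\<^sub>R s)" "norm (w - r) \<le> e / (2 * (norm r + 1)) * norm r" by blast
        have "e / (2 * (norm r + 1)) * norm r \<le> e / (2 * (norm r + 1)) * (norm r + 1)"
          using e by (intro mult_left_mono) auto
        also have "\<dots> = e / 2"
        proof -
          have "e / (2 * K) * K = e / 2" if "K > 0" for K :: real using that by simp
          from this[of "norm r + 1"] show ?thesis by (simp add: add_nonneg_pos)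
        qed
        finally have "norm (R t - r) < e" using R(2)[OF w(1)] w(2) e by linarith
        then show ?case by (simp add: dist_norm)
      qed
    qed
    then show ?thesis using R(1) by (intro exI[of _ R]) auto
  qed
  then obtain R where R: "(R \<longlongrightarrow> r) (at_right (0::real))" "\<forall>\<^sub>F t in at_right 0. R t \<in> E (z + t *\<^sub>R s)" by blast
  let ?u = "\<lambda>t. z + t *\<^sub>R s"
  have ulim: "(?u \<longlongrightarrow> z) (at_right (0::real))"
    by (rule tendsto_eq_intros | simp)+
  \<comment> \<open>The limits in \<open>A\<close> and \<open>B\<close> belong to one quantity: on
    \<open>R t\<close> the operator \<open>L (l z) (?u t)\<close> acts as
    \<open>l (?u t) - l z\<close> times \<open>X (?u t)\<close>, and the term at \<open>z\<close> is
    annihilated by the left null vector.\<close>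
  have A: "((\<lambda>t. N z k \<bullet> blinfun_apply (inverse t *\<^sub>R (L (l z) (?u t) - L (l z) z)) (R t)) \<longlongrightarrow>
      N z k \<bullet> blinfun_apply (blinfun_apply (L2 (l z) z) s) r) (at_right 0)"
    by (intro tendsto_intros directional_difference_quotient L z R)
  have B: "((\<lambda>t. inverse t *\<^sub>R (l (?u t) - l z) * (N z k \<bullet> blinfun_apply (X (?u t)) (R t))) \<longlongrightarrow>
      blinfun_apply (Dl z) s * (N z k \<bullet> blinfun_apply (X z) r)) (at_right 0)"
    using isCont_data[OF z] ulim
    by (intro tendsto_intros directional_difference_quotient l z R isCont_tendsto_compose[of z X])
  have C: "\<forall>\<^sub>F t in at_right (0::real). N z k \<bullet> blinfun_apply (inverse t *\<^sub>R (L (l z) (?u t) - L (l z) z)) (R t)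
     = inverse t *\<^sub>R (l (?u t) - l z) * (N z k \<bullet> blinfun_apply (X (?u t)) (R t))"
    using R(2)
  proof eventually_elim
    case (elim t)
    have "blinfun_apply (L (l z) (?u t)) (R t) = (l (?u t) - l z) *\<^sub>R blinfun_apply (X (?u t)) (R t)"
      using elim by (simp add: E_iff L_def blinfun.diff_left blinfun.scaleR_left algebra_simps)
    moreover have "N z k \<bullet> blinfun_apply (L (l z) z) (R t) = 0" using left_null assms by blast
    ultimately show ?case by (simp add: blinfun.diff_left blinfun.scaleR_left inner_diff_right)
  qed
  show ?thesis
    by (rule tendsto_unique[OF trivial_limit_at_right_real Lim_transform_eventually[OF A C] B])
qed

lemma pos_near: "\<forall>\<^sub>F z in nhds Ub. z \<in> ball Ub \<delta> \<and> (\<forall>v. v \<noteq> 0 \<longrightarrow> N z v \<bullet> X z v > 0)"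
proof -
  obtain s where s: "s > 0" "\<And>v. s * norm v ^ 2 \<le> N Ub v \<bullet> X Ub v"
    by (rule positive_definite) blast
  define B where "B = norm (N Ub) + norm (X Ub) + 2"
  \<comment> \<open>On unit vectors the perturbation is at most
    \<open>2 * e * B \<le> s / 2\<close>, so half of \<open>s\<close> survives.\<close>
  define e where "e = min 1 (s / (4 * B))"
  have B: "B > 0" by (simp add: B_def add_nonneg_pos)
  then have e: "e > 0" "e \<le> 1" "e * B \<le> s / 4" using s
    by (auto simp: e_def min_def field_simps)
  have "\<forall>\<^sub>F z in nhds Ub. dist (N z) (N Ub) < e" "\<forall>\<^sub>F z in nhds Ub. dist (X z) (X Ub) < e"
    using isCont_data[OF center] e(1) by (auto intro: isCont_eventually_dist)
  moreover have "\<forall>\<^sub>F u in nhds Ub. u \<in> ball Ub \<delta>" by (intro eventually_nhds_in_open) (auto simp: \<delta>)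
  ultimately show ?thesis
  proof eventually_elim
    case (elim z)
    have unit: "N z v \<bullet> X z v > 0" if "norm v = 1" for v
    proof -
      have nx: "norm (X z) \<le> B" using elim(2) e norm_triangle_sub[of "X z" "X Ub"]
        by (simp add: dist_norm B_def) (smt (verit) norm_ge_zero)
      have "N Ub v \<bullet> X Ub v - N z v \<bullet> X z v = (N Ub - N z) v \<bullet> X z v + N Ub v \<bullet> (X Ub - X z) v"
        by (simp add: blinfun.diff_left inner_diff_left inner_diff_right)
      also have "\<dots> \<le> norm ((N Ub - N z) v) * norm (X z v) + norm (N Ub v) * norm ((X Ub - X z) v)"
        by (intro add_mono norm_cauchy_schwarz)
      also have "\<dots> \<le> e * B + B * e"
      proof (intro add_mono mult_mono)
        show "norm ((N Ub - N z) v) \<le> e" using norm_blinfun[of "N Ub - N z" v] elim(1) that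
          by (simp add: dist_norm norm_minus_commute)
        show "norm ((X Ub - X z) v) \<le> e" using norm_blinfun[of "X Ub - X z" v] elim(2) that
          by (simp add: dist_norm norm_minus_commute)
        show "norm (X z v) \<le> B" using norm_blinfun[of "X z" v] nx that by simp
        have "norm (N Ub v) \<le> norm (N Ub)" using norm_blinfun[of "N Ub" v] that by simp
        also have "\<dots> \<le> B" by (simp add: B_def)
        finally show "norm (N Ub v) \<le> B" .
      qed (use e B in auto)
      finally show ?thesis using s(2)[of v] that e(3) s(1) by (simp add: mult.commute)
    qed
    have "N z v \<bullet> X z v > 0" if "v \<noteq> 0" for v
    proof -
      have "N z (v /\<^sub>R norm v) \<bullet> X z (v /\<^sub>R norm v) > 0" by (rule unit) (use that in simp)
      then show ?thesis using that by (simp add: blinfun.scaleR_right zero_less_mult_iff)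
    qed
    then show ?case using elim by blast
  qed
qed

text \<open>By symmetry of the second derivatives, \<open>s\<close> and \<open>r\<close> may be exchanged in
  \<open>eigenvalue_derivative\<close>.\<close>

lemma multiple_imp_degenerate:
  assumes z: "z \<in> ball Ub \<delta>" and posz: "\<And>v. v \<noteq> 0 \<Longrightarrow> N z v \<bullet> X z v > 0" and p: "p \<ge> 2" and s: "s \<in> E z"
  shows "Dl z s = 0"
proof (cases "s = 0")
  case False
  have "\<not> E z \<subseteq> span {s}"
  proof
    assume "E z \<subseteq> span {s}"
    then have "dim (E z) \<le> card {s}" by (intro dim_le_card) auto
    then show False using dim_E[OF z] p by simp
  qed
  then obtain r0 where r0: "r0 \<in> E z" "r0 \<notin> span {s}" by blast
  \<comment> \<open>The component along \<open>s\<close> is projected out in the form given by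
    \<open>N z\<close> and \<open>X z\<close>. After the exchange of \<open>s\<close> and
    \<open>r\<close> the right-hand side then vanishes, while the pairing of \<open>r\<close> with
    itself stays positive.\<close>
  define r where "r = r0 - ((N z s \<bullet> X z r0) / (N z s \<bullet> X z s)) *\<^sub>R s"
  have "r \<noteq> 0"
  proof
    assume "r = 0"
    then have "r0 = ((N z s \<bullet> X z r0) / (N z s \<bullet> X z s)) *\<^sub>R s" by (simp add: r_def)
    then show False using r0(2) span_mul span_base by (metis singletonI)
  qed
  have r: "r \<in> E z" unfolding r_def using r0 s subspace_E by (intro subspace_diff subspace_mul)
  have "N z r \<bullet> X z s = N z s \<bullet> X z r" by (rule symX[OF z])
  also have "\<dots> = 0" using posz[OF False] by (simp add: r_def blinfun.diff_right blinfun.scaleR_right inner_diff_right)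
  finally have orth: "N z r \<bullet> X z s = 0" .
  have "Dl z s * (N z r \<bullet> X z r) = N z r \<bullet> blinfun_apply (L2 (l z) z s) r"
    using eigenvalue_derivative[OF z r r] by simp
  also have "\<dots> = N z r \<bullet> blinfun_apply (L2 (l z) z r) s" by (simp add: sym2[OF z])
  also have "\<dots> = Dl z r * (N z r \<bullet> X z s)" by (rule eigenvalue_derivative[OF z r s])
  finally show ?thesis using orth posz[OF \<open>r \<noteq> 0\<close>] by simp
qed (simp add: blinfun.zero_right)

end

section \<open>Expansions along a segment\<close>

lemma line_has_vector_derivative:
  fixes f :: "'a::real_normed_vector \<Rightarrow> 'b::real_normed_vector"
  assumes "(f has_derivative f') (at (x + \<tau> *\<^sub>R v))"
  shows "((\<lambda>\<tau>. f (x + \<tau> *\<^sub>R v)) has_vector_derivative f' v) (at \<tau>)"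
proof -
  interpret bounded_linear f' using assms by (rule has_derivative_bounded_linear)
  have "((\<lambda>\<tau>. f (x + \<tau> *\<^sub>R v)) has_derivative (\<lambda>h. f' (h *\<^sub>R v))) (at \<tau>)"
    by (rule has_derivative_compose[of "\<lambda>t. x + t *\<^sub>R v" "\<lambda>h. h *\<^sub>R v" \<tau> UNIV f])
      (use assms in \<open>auto intro!: derivative_eq_intros\<close>)
  then show ?thesis unfolding has_vector_derivative_def by (simp add: scaleR)
qed

lemma has_real_derivative_inner:
  fixes f g :: "real \<Rightarrow> 'a::real_inner"
  assumes "(f has_vector_derivative f') (at t)" "(g has_vector_derivative g') (at t)"
  shows "((\<lambda>t. f t \<bullet> g t) has_real_derivative f t \<bullet> g' + f' \<bullet> g t) (at t)"
  using bounded_bilinear.has_vector_derivative[OF bounded_bilinear_inner assms]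
  by (simp add: has_real_derivative_iff_has_vector_derivative)

lemma linearization:
  fixes f :: "'a::real_normed_vector \<Rightarrow> 'b::real_normed_vector" and f' :: "'a \<Rightarrow> 'a \<Rightarrow>\<^sub>L 'b"
  assumes S: "convex S" "a \<in> S" "b \<in> S"
    and f': "\<And>w. w \<in> S \<Longrightarrow> (f has_derivative blinfun_apply (f' w)) (at w)"
    and K: "\<And>w. w \<in> S \<Longrightarrow> norm (f' w - M) \<le> K"
  shows "norm (f b - f a - blinfun_apply M (b - a)) \<le> K * norm (b - a)"
proof -
  have "norm ((f b - M b) - (f a - M a)) \<le> K * norm (b - a)"
  proof (rule differentiable_bound[OF S(1) _ _ S(3,2)])
    fix w assume w: "w \<in> S"
    have "((\<lambda>w. f w - M w) has_derivative (\<lambda>h. f' w h - M h)) (at w)"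
      by (intro derivative_intros f' w blinfun.bounded_linear_right bounded_linear_imp_has_derivative)
    then show "((\<lambda>w. f w - M w) has_derivative blinfun_apply (f' w - M)) (at w within S)"
      unfolding blinfun.diff_left[abs_def] by (rule has_derivative_at_withinI)
    show "onorm (blinfun_apply (f' w - M)) \<le> K" using K[OF w] by (simp add: norm_blinfun.rep_eq)
  qed
  then show ?thesis by (simp add: blinfun.diff_right algebra_simps)
qed

lemma dist_Pair_le: "dist (a, b) (c, d) \<le> dist a c + dist b d"
  by (simp add: dist_prod_def sqrt_sum_squares_le_sum)

context symmetrizable_pencil begin

lemma second_order:
  assumes seg: "\<And>\<tau>. 0 \<le> \<tau> \<Longrightarrow> \<tau> \<le> 1 \<Longrightarrow> u + \<tau> *\<^sub>R v \<in> ball Ub \<delta>"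
  obtains \<tau> where "0 \<le> \<tau>" "\<tau> \<le> 1" "k \<bullet> (G \<xi> (u + v) - G \<xi> u) =
    k \<bullet> L \<xi> u v + (k \<bullet> blinfun_apply (L2 \<xi> (u + \<tau> *\<^sub>R v) v) v) / 2"
proof -
  define diff :: "nat \<Rightarrow> real \<Rightarrow> real" where "diff m t = (if m = 0 then k \<bullet> G \<xi> (u + t *\<^sub>R v)
    else if m = 1 then k \<bullet> L \<xi> (u + t *\<^sub>R v) v else k \<bullet> blinfun_apply (L2 \<xi> (u + t *\<^sub>R v) v) v)" for m t
  have "\<exists>t>0. t < 1 \<and> diff 0 1 = (\<Sum>m<2. diff m 0 / fact m * 1 ^ m) + diff 2 t / fact 2 * 1 ^ 2"
  proof (rule Maclaurin)
    show "\<forall>m t. m < 2 \<and> 0 \<le> t \<and> t \<le> 1 \<longrightarrow> (diff m has_real_derivative diff (Suc m) t) (at t)"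
    proof (intro allI impI)
      fix m t assume mt: "m < (2::nat) \<and> 0 \<le> t \<and> t \<le> (1::real)"
      then have b: "u + t *\<^sub>R v \<in> ball Ub \<delta>" using seg by blast
      have "((\<lambda>t. k \<bullet> G \<xi> (u + t *\<^sub>R v)) has_real_derivative k \<bullet> L \<xi> (u + t *\<^sub>R v) v + 0 \<bullet> G \<xi> (u + t *\<^sub>R v)) (at t)"
        by (intro has_real_derivative_inner line_has_vector_derivative G b) auto
      moreover have "((\<lambda>y. L \<xi> y v) has_derivative (\<lambda>h. blinfun_apply (L2 \<xi> (u + t *\<^sub>R v) h) v)) (at (u + t *\<^sub>R v))"
        using L[OF b] by (auto intro!: derivative_eq_intros)
      then have "((\<lambda>t. k \<bullet> L \<xi> (u + t *\<^sub>R v) v) has_real_derivative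
          k \<bullet> blinfun_apply (L2 \<xi> (u + t *\<^sub>R v) v) v + 0 \<bullet> L \<xi> (u + t *\<^sub>R v) v) (at t)"
        by (intro has_real_derivative_inner line_has_vector_derivative[where f = "\<lambda>y. blinfun_apply (L \<xi> y) v"]) auto
      moreover have "m = 0 \<or> m = 1" using mt by auto
      ultimately show "(diff m has_real_derivative diff (Suc m) t) (at t)"
        by (auto simp: diff_def[abs_def])
    qed
  qed auto
  then obtain t where "t > 0" "t < 1" "diff 0 1 = (\<Sum>m<2. diff m 0 / fact m * 1 ^ m) + diff 2 t / fact 2 * 1 ^ 2" by blast
  then show ?thesis
    by (intro that[of t]) (auto simp: diff_def numeral_2_eq_2 inner_diff_right)
qed

text \<open>The entropy dissipation of a jump is the error of the trapezoidal rule for the integral of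
  \<open>n\<close> against \<open>dG\<close>; the products of first derivatives cancel in its second derivative.\<close>

lemma trapezoid:
  assumes seg: "\<And>\<tau>. 0 \<le> \<tau> \<Longrightarrow> \<tau> \<le> 1 \<Longrightarrow> u + \<tau> *\<^sub>R v \<in> ball Ub \<delta>"
    and k: "\<And>\<tau>. 0 \<le> \<tau> \<Longrightarrow> \<tau> \<le> 1 \<Longrightarrow> 2 * k * \<tau> \<le>
      s * ((n (u + \<tau> *\<^sub>R v) - n u) \<bullet> blinfun_apply (L2 \<xi> (u + \<tau> *\<^sub>R v) v) v
        - blinfun_apply (N2 (u + \<tau> *\<^sub>R v) v) v \<bullet> (G \<xi> (u + \<tau> *\<^sub>R v) - G \<xi> u))"
  shows "k / 6 \<le> s * (H \<xi> (u + v) - H \<xi> u - (n u + n (u + v)) \<bullet> (G \<xi> (u + v) - G \<xi> u) / 2)"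
proof -
  let ?u = "\<lambda>\<tau>. u + \<tau> *\<^sub>R v"
  define T where "T \<tau> = H \<xi> (?u \<tau>) - H \<xi> u - ((n u + n (?u \<tau>)) \<bullet> (G \<xi> (?u \<tau>) - G \<xi> u)) / 2" for \<tau>
  define T' where "T' \<tau> = ((n (?u \<tau>) - n u) \<bullet> L \<xi> (?u \<tau>) v - N (?u \<tau>) v \<bullet> (G \<xi> (?u \<tau>) - G \<xi> u)) / 2" for \<tau>
  define T'' where "T'' \<tau> = ((n (?u \<tau>) - n u) \<bullet> blinfun_apply (L2 \<xi> (?u \<tau>) v) v
      - blinfun_apply (N2 (?u \<tau>) v) v \<bullet> (G \<xi> (?u \<tau>) - G \<xi> u)) / 2" for \<tau>
  have dT: "(T has_real_derivative T' \<tau>) (at \<tau>)" and dT': "(T' has_real_derivative T'' \<tau>) (at \<tau>)"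
    if "0 \<le> \<tau>" "\<tau> \<le> 1" for \<tau>
  proof -
    have b: "?u \<tau> \<in> ball Ub \<delta>" using seg that by blast
    have dH: "((\<lambda>\<tau>. H \<xi> (?u \<tau>)) has_real_derivative n (?u \<tau>) \<bullet> L \<xi> (?u \<tau>) v) (at \<tau>)"
      using line_has_vector_derivative[OF H[OF b]] by (simp add: has_real_derivative_iff_has_vector_derivative)
    have dn: "((\<lambda>\<tau>. n u + n (?u \<tau>)) has_vector_derivative N (?u \<tau>) v) (at \<tau>)"
      "((\<lambda>\<tau>. n (?u \<tau>) - n u) has_vector_derivative N (?u \<tau>) v) (at \<tau>)"
      using line_has_vector_derivative[OF n[OF b]] by (auto intro!: derivative_eq_intros)
    have dG: "((\<lambda>\<tau>. G \<xi> (?u \<tau>) - G \<xi> u) has_vector_derivative L \<xi> (?u \<tau>) v) (at \<tau>)"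
      using line_has_vector_derivative[OF G[OF b]] by (auto intro!: derivative_eq_intros)
    have "((\<lambda>y. L \<xi> y v) has_derivative (\<lambda>h. blinfun_apply (L2 \<xi> (?u \<tau>) h) v)) (at (?u \<tau>))"
      using L[OF b] by (auto intro!: derivative_eq_intros)
    then have dL: "((\<lambda>\<tau>. L \<xi> (?u \<tau>) v) has_vector_derivative blinfun_apply (L2 \<xi> (?u \<tau>) v) v) (at \<tau>)"
      by (rule line_has_vector_derivative[where f = "\<lambda>y. blinfun_apply (L \<xi> y) v"])
    have "((\<lambda>y. N y v) has_derivative (\<lambda>h. blinfun_apply (N2 (?u \<tau>) h) v)) (at (?u \<tau>))"
      using N[OF b] by (auto intro!: derivative_eq_intros)
    then have dN: "((\<lambda>\<tau>. N (?u \<tau>) v) has_vector_derivative blinfun_apply (N2 (?u \<tau>) v) v) (at \<tau>)"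
      by (rule line_has_vector_derivative[where f = "\<lambda>y. blinfun_apply (N y) v"])
    have "(T has_real_derivative n (?u \<tau>) \<bullet> L \<xi> (?u \<tau>) v - 0 -
        ((n u + n (?u \<tau>)) \<bullet> L \<xi> (?u \<tau>) v + N (?u \<tau>) v \<bullet> (G \<xi> (?u \<tau>) - G \<xi> u)) / 2) (at \<tau>)"
      unfolding T_def by (intro DERIV_diff DERIV_cdivide dH has_real_derivative_inner[OF dn(1) dG] DERIV_const)
    then show "(T has_real_derivative T' \<tau>) (at \<tau>)"
      by (rule DERIV_cong) (simp add: T'_def inner_add_left inner_diff_left field_simps)
    have "(T' has_real_derivative (((n (?u \<tau>) - n u) \<bullet> blinfun_apply (L2 \<xi> (?u \<tau>) v) v + N (?u \<tau>) v \<bullet> L \<xi> (?u \<tau>) v)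
      - (N (?u \<tau>) v \<bullet> L \<xi> (?u \<tau>) v + blinfun_apply (N2 (?u \<tau>) v) v \<bullet> (G \<xi> (?u \<tau>) - G \<xi> u))) / 2) (at \<tau>)"
      unfolding T'_def by (intro DERIV_diff DERIV_cdivide has_real_derivative_inner[OF dn(2) dL] has_real_derivative_inner[OF dN dG])
    then show "(T' has_real_derivative T'' \<tau>) (at \<tau>)"
      by (rule DERIV_cong) (simp add: T''_def)
  qed
  \<comment> \<open>\<open>T\<close> and \<open>T'\<close> vanish at 0, so the lower bound
    \<open>k * \<tau>\<close> for \<open>s * T''\<close> integrates twice to \<open>k / 6\<close> at
    1.\<close>
  have k': "0 \<le> s * T'' \<tau> - k * \<tau>" if "0 \<le> \<tau>" "\<tau> \<le> 1" for \<tau>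
    using k[OF that] by (simp add: T''_def field_simps)
  have P: "0 \<le> s * T' \<tau> - k * \<tau> ^ 2 / 2" if "0 \<le> \<tau>" "\<tau> \<le> 1" for \<tau>
  proof -
    have "s * T' 0 - k * 0 ^ 2 / 2 \<le> s * T' \<tau> - k * \<tau> ^ 2 / 2"
    proof (rule DERIV_nonneg_imp_nondecreasing[OF that(1)])
      fix x assume x: "0 \<le> x" "x \<le> \<tau>"
      have "((\<lambda>x. s * T' x - k * x ^ 2 / 2) has_real_derivative s * T'' x - k * x) (at x)"
        using dT'[of x] x that by (auto intro!: derivative_eq_intros)
      then show "\<exists>y. ((\<lambda>x. s * T' x - k * x ^ 2 / 2) has_real_derivative y) (at x) \<and> 0 \<le> y"
        using k'[of x] x that by auto
    qed
    then show ?thesis by (simp add: T'_def)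
  qed
  have "s * T 0 - k * 0 ^ 3 / 6 \<le> s * T 1 - k * 1 ^ 3 / 6"
  proof (rule DERIV_nonneg_imp_nondecreasing[where f = "\<lambda>x. s * T x - k * x ^ 3 / 6", OF zero_le_one])
    fix x :: real assume x: "0 \<le> x" "x \<le> 1"
    have "((\<lambda>x. s * T x - k * x ^ 3 / 6) has_real_derivative s * T' x - k * x ^ 2 / 2) (at x)"
      using dT[of x] x by (auto intro!: derivative_eq_intros)
    then show "\<exists>y. ((\<lambda>x. s * T x - k * x ^ 3 / 6) has_real_derivative y) (at x) \<and> 0 \<le> y"
      using P[of x] x by auto
  qed
  then show ?thesis by (simp add: T_def)
qed

end

section \<open>Jumps in a genuinely nonlinear field\<close>

context pencil_eigenvalue begin

text \<open>At \<open>Ub\<close>, with \<open>\<xi> = l Ub\<close>, \<open>r = w = r0\<close> and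
  \<open>e1 = e2 = 0\<close>, all three expressions equal
  \<open>N Ub r0 \<bullet> X Ub r0 > 0\<close>; the rest is continuity. They will be the first and
  second order coefficients of a jump and the third order coefficient of its entropy
  dissipation.\<close>

lemma nonlinear_near:
  assumes r0: "r0 \<in> E Ub" "Dl Ub r0 = 1"
  obtains \<mu> where "\<mu> > 0"
    "\<And>u v \<xi> r w e1 e2. \<lbrakk>dist u Ub \<le> \<mu>; dist v Ub \<le> \<mu>; dist \<xi> (l Ub) \<le> \<mu>; dist r r0 \<le> \<mu>; dist w r0 \<le> \<mu>; norm e1 \<le> \<mu>; norm e2 \<le> \<mu>\<rbrakk> \<Longrightarrow>
      \<bar>N u r \<bullet> X u w - N Ub r0 \<bullet> X Ub r0\<bar> < (N Ub r0 \<bullet> X Ub r0) / 2 \<and>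
      \<bar>N u r \<bullet> blinfun_apply (L2 \<xi> v w) w - N Ub r0 \<bullet> X Ub r0\<bar> < (N Ub r0 \<bullet> X Ub r0) / 2 \<and>
      \<bar>(N Ub w + e1) \<bullet> blinfun_apply (L2 \<xi> v w) w - blinfun_apply (N2 v w) w \<bullet> (L (l Ub) Ub w + e2)
        - N Ub r0 \<bullet> X Ub r0\<bar> < (N Ub r0 \<bullet> X Ub r0) / 2"
proof -
  let ?S = "N Ub r0 \<bullet> X Ub r0"
  have "r0 \<noteq> 0" using r0(2) by (auto simp: blinfun.zero_right)
  then have S: "?S > 0" by (rule pos)
  let ?p = "(Ub, Ub, l Ub, r0, r0, 0::'a, 0::'a)"
  define f1 where "f1 = (\<lambda>(u::'a, v::'a, \<xi>::real, r::'a, w::'a, e1::'a, e2::'a). N u r \<bullet> X u w)"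
  define f2 where "f2 = (\<lambda>(u::'a, v::'a, \<xi>::real, r::'a, w::'a, e1::'a, e2::'a). N u r \<bullet> blinfun_apply (L2 \<xi> v w) w)"
  define f3 where "f3 = (\<lambda>(u::'a, v::'a, \<xi>::real, r::'a, w::'a, e1::'a, e2::'a). (N Ub w + e1) \<bullet> blinfun_apply (L2 \<xi> v w) w - blinfun_apply (N2 v w) w \<bullet> (L (l Ub) Ub w + e2))"
  note D = isCont_data[OF center]
  have cN: "isCont (\<lambda>p::'a \<times> 'a \<times> real \<times> 'a \<times> 'a \<times> 'a \<times> 'a. N (fst p)) ?p" by (rule isCont_o2) (use D in auto)
  have cX: "isCont (\<lambda>p::'a \<times> 'a \<times> real \<times> 'a \<times> 'a \<times> 'a \<times> 'a. X (fst p)) ?p" by (rule isCont_o2) (use D in auto)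
  have cX2: "isCont (\<lambda>p::'a \<times> 'a \<times> real \<times> 'a \<times> 'a \<times> 'a \<times> 'a. X2 (fst (snd p))) ?p" by (rule isCont_o2) (use D in \<open>auto intro!: continuous_intros\<close>)
  have cY2: "isCont (\<lambda>p::'a \<times> 'a \<times> real \<times> 'a \<times> 'a \<times> 'a \<times> 'a. Y2 (fst (snd p))) ?p" by (rule isCont_o2) (use D in \<open>auto intro!: continuous_intros\<close>)
  have cN2: "isCont (\<lambda>p::'a \<times> 'a \<times> real \<times> 'a \<times> 'a \<times> 'a \<times> 'a. N2 (fst (snd p))) ?p" by (rule isCont_o2) (use D in \<open>auto intro!: continuous_intros\<close>)
  have c1: "isCont f1 ?p" unfolding f1_def case_prod_beta by (intro continuous_intros cN cX)
  have c2: "isCont f2 ?p" unfolding f2_def case_prod_beta L2_def by (intro continuous_intros cN cX2 cY2)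
  have c3: "isCont f3 ?p" unfolding f3_def case_prod_beta L2_def by (intro continuous_intros cN2 cX2 cY2)
  \<comment> \<open>The normalization \<open>Dl Ub r0 = 1\<close> makes the second derivative along
    \<open>r0\<close> equal to the pairing with \<open>X\<close>.\<close>
  have I: "N Ub r0 \<bullet> blinfun_apply (L2 (l Ub) Ub r0) r0 = ?S"
    using eigenvalue_derivative[OF center r0(1) r0(1), of r0] r0(2) by simp
  have L0: "L (l Ub) Ub r0 = 0" using r0(1) by (simp add: E_def)
  have v: "f1 ?p = ?S" "f2 ?p = ?S" "f3 ?p = ?S" by (simp_all add: f1_def f2_def f3_def I L0)
  have "\<forall>\<^sub>F p in nhds ?p. dist (f1 p) ?S < ?S / 2 \<and> dist (f2 p) ?S < ?S / 2 \<and> dist (f3 p) ?S < ?S / 2"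
    using isCont_eventually_dist[OF c1, of "?S / 2"] isCont_eventually_dist[OF c2, of "?S / 2"]
      isCont_eventually_dist[OF c3, of "?S / 2"] S unfolding v by (intro eventually_conj) auto
  then obtain d where d: "d > 0" "\<And>p. dist p ?p < d \<Longrightarrow> dist (f1 p) ?S < ?S / 2 \<and> dist (f2 p) ?S < ?S / 2 \<and> dist (f3 p) ?S < ?S / 2"
    unfolding eventually_nhds_metric by blast
  \<comment> \<open>Seven coordinates, each off by at most \<open>d / 8\<close>.\<close>
  show ?thesis
  proof (rule that[of "d / 8"])
    fix u v r w e1 e2 :: 'a and \<xi> :: real
    assume *: "dist u Ub \<le> d / 8" "dist v Ub \<le> d / 8" "dist \<xi> (l Ub) \<le> d / 8" "dist r r0 \<le> d / 8" "dist w r0 \<le> d / 8" "norm e1 \<le> d / 8" "norm e2 \<le> d / 8"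
    have "dist (u, v, \<xi>, r, w, e1, e2) ?p \<le> dist u Ub + (dist v Ub + (dist \<xi> (l Ub) + (dist r r0 + (dist w r0 + (dist e1 0 + dist e2 0)))))"
      by (intro order_trans[OF dist_Pair_le] add_left_mono order_refl)
    also have "\<dots> < d" using * d(1) by simp
    finally have "dist (u, v, \<xi>, r, w, e1, e2) ?p < d" .
    from d(2)[OF this] show "\<bar>N u r \<bullet> X u w - ?S\<bar> < ?S / 2 \<and> \<bar>N u r \<bullet> blinfun_apply (L2 \<xi> v w) w - ?S\<bar> < ?S / 2 \<and>
      \<bar>(N Ub w + e1) \<bullet> blinfun_apply (L2 \<xi> v w) w - blinfun_apply (N2 v w) w \<bullet> (L (l Ub) Ub w + e2) - ?S\<bar> < ?S / 2"
      by (simp add: f1_def f2_def f3_def dist_real_def)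
  qed (use d in auto)
qed

end

context pencil_eigenvalue begin

lemma L_near:
  assumes "w > 0"
  obtains e where "e > 0" "\<And>u \<xi>. dist u Ub < e \<Longrightarrow> \<bar>\<xi> - l Ub\<bar> < e \<Longrightarrow> norm (L \<xi> u - L (l Ub) Ub) \<le> w"
proof -
  note D = isCont_data[OF center]
  have "isCont (\<lambda>p::'a \<times> real. X (fst p)) (Ub, l Ub)" by (rule isCont_o2) (use D in auto)
  moreover have "isCont (\<lambda>p::'a \<times> real. Y (fst p)) (Ub, l Ub)" by (rule isCont_o2) (use D in auto)
  ultimately have "isCont (\<lambda>p. L (snd p) (fst p)) (Ub, l Ub)" unfolding L_def by (intro continuous_intros)
  from isCont_eventually_dist[OF this assms]
  obtain d where d: "d > 0" "\<And>p. dist p (Ub, l Ub) < d \<Longrightarrow> dist (L (snd p) (fst p)) (L (l Ub) Ub) < w"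
    unfolding eventually_nhds_metric by auto
  show ?thesis
  proof (rule that[of "d / 2"])
    fix u \<xi> assume "dist u Ub < d / 2" "\<bar>\<xi> - l Ub\<bar> < d / 2"
    then have "dist (u, \<xi>) (Ub, l Ub) < d"
      using dist_Pair_le[of u \<xi> Ub "l Ub"] by (simp add: dist_real_def)
    from d(2)[OF this] show "norm (L \<xi> u - L (l Ub) Ub) \<le> w" by (simp add: dist_norm)
  qed (use d in auto)
qed

text \<open>Tested with the left null vector \<open>N u0 r\<close>, the linear term of a jump in
  direction \<open>w\<close> reduces to a multiple of \<open>l u0 - \<xi>\<close>, and the quadratic
  term is positive. The dissipation is cubic in \<open>t\<close> by \<open>trapezoid\<close>, with
  its sign decided by \<open>s * t\<close>.\<close>

lemma nonlinear_directional:
  assumes near: "\<And>u v \<xi> r w e1 e2. \<lbrakk>dist u Ub \<le> \<mu>; dist v Ub \<le> \<mu>; dist \<xi> (l Ub) \<le> \<mu>; dist r r0 \<le> \<mu>; dist w r0 \<le> \<mu>; norm e1 \<le> \<mu>; norm e2 \<le> \<mu>\<rbrakk> \<Longrightarrow>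
      \<bar>N u r \<bullet> X u w - S\<bar> < S / 2 \<and>
      \<bar>N u r \<bullet> blinfun_apply (L2 \<xi> v w) w - S\<bar> < S / 2 \<and>
      \<bar>(N Ub w + e1) \<bullet> blinfun_apply (L2 \<xi> v w) w - blinfun_apply (N2 v w) w \<bullet> (L (l Ub) Ub w + e2) - S\<bar> < S / 2"
    and e: "e \<le> \<mu>" "e < \<delta>" and u0: "u0 \<in> cball Ub e" "u0 + t *\<^sub>R w \<in> cball Ub e"
    and \<xi>: "dist \<xi> (l Ub) \<le> \<mu>" and r: "r \<in> E u0" "dist r r0 \<le> \<mu>" and w: "dist w r0 \<le> \<mu>"
    and lin: "\<And>z. z \<in> cball Ub e \<Longrightarrow> norm (N z - N Ub) \<le> \<kappa>" "\<And>z. z \<in> cball Ub e \<Longrightarrow> norm (L \<xi> z - L (l Ub) Ub) \<le> \<kappa>"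
      "\<kappa> * norm w \<le> \<mu>" and S: "S > 0"
  shows "\<exists>q1 q2. \<bar>q1 - S\<bar> < S / 2 \<and> \<bar>q2 - S\<bar> < S / 2 \<and>
      N u0 r \<bullet> (G \<xi> (u0 + t *\<^sub>R w) - G \<xi> u0) = (l u0 - \<xi>) * t * q1 + t ^ 2 * q2 / 2" (is ?A)
    and "\<bar>s\<bar> = 1 \<Longrightarrow> s * t > 0 \<Longrightarrow> S * \<bar>t\<bar> ^ 3 / 24 \<le>
      s * (H \<xi> (u0 + t *\<^sub>R w) - H \<xi> u0 - (n u0 + n (u0 + t *\<^sub>R w)) \<bullet> (G \<xi> (u0 + t *\<^sub>R w) - G \<xi> u0) / 2)" (is "_ \<Longrightarrow> _ \<Longrightarrow> ?B")
proof -
  have \<mu>: "\<mu> \<ge> 0" using w zero_le_dist order_trans by blast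
  have in_cball: "u0 + (\<tau> * t) *\<^sub>R w \<in> cball Ub e" if "0 \<le> \<tau>" "\<tau> \<le> 1" for \<tau>
  proof -
    have "(1 - \<tau>) *\<^sub>R u0 + \<tau> *\<^sub>R (u0 + t *\<^sub>R w) \<in> cball Ub e"
      by (rule convexD_alt[OF convex_cball u0]) (use that in auto)
    then show ?thesis by (simp add: algebra_simps)
  qed
  have seg: "u0 + \<tau> *\<^sub>R (t *\<^sub>R w) \<in> ball Ub \<delta>" if "0 \<le> \<tau>" "\<tau> \<le> 1" for \<tau>
    using in_cball[OF that] e by simp
  have cb: "z \<in> ball Ub \<delta>" "dist z Ub \<le> \<mu>" if "z \<in> cball Ub e" for z
    using that e by (auto simp: dist_commute)
  show ?A
  proof -
    obtain \<tau> where \<tau>: "0 \<le> \<tau>" "\<tau> \<le> 1" "N u0 r \<bullet> (G \<xi> (u0 + t *\<^sub>R w) - G \<xi> u0) =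
      N u0 r \<bullet> L \<xi> u0 (t *\<^sub>R w) + (N u0 r \<bullet> blinfun_apply (L2 \<xi> (u0 + \<tau> *\<^sub>R (t *\<^sub>R w)) (t *\<^sub>R w)) (t *\<^sub>R w)) / 2"
      using second_order[OF seg] by blast
    have "L \<xi> u0 w = L (l u0) u0 w + (l u0 - \<xi>) *\<^sub>R X u0 w"
      by (simp add: L_def blinfun.diff_left blinfun.scaleR_left algebra_simps)
    then have "N u0 r \<bullet> L \<xi> u0 w = (l u0 - \<xi>) * (N u0 r \<bullet> X u0 w)"
      using left_null[OF cb(1)[OF u0(1)] r(1), of w] by (simp add: inner_add_right)
    then have "N u0 r \<bullet> (G \<xi> (u0 + t *\<^sub>R w) - G \<xi> u0) = (l u0 - \<xi>) * t * (N u0 r \<bullet> X u0 w) +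
       t ^ 2 * (N u0 r \<bullet> blinfun_apply (L2 \<xi> (u0 + (\<tau> * t) *\<^sub>R w) w) w) / 2"
      unfolding \<tau>(3) by (simp add: blinfun.scaleR_right blinfun.scaleR_left power2_eq_square)
    moreover have "\<bar>N u0 r \<bullet> X u0 w - S\<bar> < S / 2 \<and> \<bar>N u0 r \<bullet> blinfun_apply (L2 \<xi> (u0 + (\<tau> * t) *\<^sub>R w) w) w - S\<bar> < S / 2"
      using near[of u0 "u0 + (\<tau> * t) *\<^sub>R w" \<xi> r w 0 0] cb(2)[OF u0(1)] cb(2)[OF in_cball[OF \<tau>(1,2)]] \<xi> r w \<mu> by simp
    ultimately show ?thesis by blast
  qed
  assume s: "\<bar>s\<bar> = 1" "s * t > 0"
  have t: "t \<noteq> 0" using s by auto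
  have st: "s * t ^ 3 = \<bar>t\<bar> ^ 3"
  proof (cases "s = 1")
    case True
    then show ?thesis using s by simp
  next
    case False
    then have "s = -1" using s(1) by linarith
    then show ?thesis using s by (simp add: power3_eq_cube abs_if)
  qed
  \<comment> \<open>The third expression in \<open>near\<close> is at least \<open>S / 2\<close>,
    and the hypothesis of \<open>trapezoid\<close> carries a factor 2; hence
    \<open>S / 4\<close>.\<close>
  have "(S * \<bar>t\<bar> ^ 3 / 4) / 6 \<le> s * (H \<xi> (u0 + t *\<^sub>R w) - H \<xi> u0 - (n u0 + n (u0 + t *\<^sub>R w)) \<bullet> (G \<xi> (u0 + t *\<^sub>R w) - G \<xi> u0) / 2)"
  proof (rule trapezoid[OF seg])
    fix \<tau> :: real assume \<tau>: "0 \<le> \<tau>" "\<tau> \<le> 1"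
    let ?z = "u0 + (\<tau> * t) *\<^sub>R w"
    have zc: "?z \<in> cball Ub e" by (rule in_cball[OF \<tau>])
    show "2 * (S * \<bar>t\<bar> ^ 3 / 4) * \<tau> \<le> s *
      ((n (u0 + \<tau> *\<^sub>R (t *\<^sub>R w)) - n u0) \<bullet> blinfun_apply (L2 \<xi> (u0 + \<tau> *\<^sub>R (t *\<^sub>R w)) (t *\<^sub>R w)) (t *\<^sub>R w)
        - blinfun_apply (N2 (u0 + \<tau> *\<^sub>R (t *\<^sub>R w)) (t *\<^sub>R w)) (t *\<^sub>R w) \<bullet> (G \<xi> (u0 + \<tau> *\<^sub>R (t *\<^sub>R w)) - G \<xi> u0))"
    proof (cases "\<tau> = 0")
      case False
      then have \<tau>t: "\<tau> * t \<noteq> 0" using t by simp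
      \<comment> \<open>\<open>e1\<close> and \<open>e2\<close> are the relative errors of replacing
        the increments of \<open>n\<close> and \<open>G \<xi>\<close> by linearizations at
        \<open>Ub\<close>; both are at most \<open>\<kappa> * norm w\<close>.\<close>
      define e1 where "e1 = inverse (\<tau> * t) *\<^sub>R (n ?z - n u0) - N Ub w"
      define e2 where "e2 = inverse (\<tau> * t) *\<^sub>R (G \<xi> ?z - G \<xi> u0) - L (l Ub) Ub w"
      have scale: "norm (inverse (\<tau> * t) *\<^sub>R y - blinfun_apply M w) \<le> \<mu>"
        if "norm (y - blinfun_apply M (?z - u0)) \<le> \<kappa> * norm (?z - u0)" for y and M :: "'a \<Rightarrow>\<^sub>L 'a"
      proof -
        have zu: "?z - u0 = (\<tau> * t) *\<^sub>R w" by simp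
        have "inverse c *\<^sub>R y - blinfun_apply M w = inverse c *\<^sub>R (y - blinfun_apply M (c *\<^sub>R w))" if "c \<noteq> 0" for c
          using that by (simp add: blinfun.scaleR_right scaleR_diff_right)
        from this[OF \<tau>t] have "inverse (\<tau> * t) *\<^sub>R y - blinfun_apply M w = inverse (\<tau> * t) *\<^sub>R (y - blinfun_apply M (?z - u0))"
          unfolding zu .
        also have "norm \<dots> \<le> \<bar>inverse (\<tau> * t)\<bar> * (\<kappa> * norm (?z - u0))"
          unfolding norm_scaleR using that by (rule mult_left_mono) simp
        also have "\<dots> = \<kappa> * norm w"
        proof -
          have "\<bar>inverse c\<bar> * (\<kappa> * norm (c *\<^sub>R w)) = \<kappa> * norm w" if "c \<noteq> 0" for c using that by simp
          from this[OF \<tau>t] show ?thesis unfolding zu .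
        qed
        finally show ?thesis using lin(3) by simp
      qed
      have e1: "norm e1 \<le> \<mu>" unfolding e1_def
        by (intro scale linearization[OF convex_cball u0(1) zc]) (use n cb(1) lin(1) in auto)
      have e2: "norm e2 \<le> \<mu>" unfolding e2_def
        by (intro scale linearization[OF convex_cball u0(1) zc]) (use G cb(1) lin(2) in auto)
      let ?K = "(N Ub w + e1) \<bullet> blinfun_apply (L2 \<xi> ?z w) w - blinfun_apply (N2 ?z w) w \<bullet> (L (l Ub) Ub w + e2)"
      have K: "\<bar>?K - S\<bar> < S / 2"
        using near[of u0 ?z \<xi> r w e1 e2] cb(2)[OF u0(1)] cb(2)[OF zc] \<xi> r w e1 e2 by blast
      have 1: "n ?z - n u0 = (\<tau> * t) *\<^sub>R (N Ub w + e1)" "G \<xi> ?z - G \<xi> u0 = (\<tau> * t) *\<^sub>R (L (l Ub) Ub w + e2)"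
      proof -
        have "c *\<^sub>R (b + (inverse c *\<^sub>R a - b)) = a" if "c \<noteq> 0" for c and a b :: 'a using that by simp
        from this[OF \<tau>t] show "n ?z - n u0 = (\<tau> * t) *\<^sub>R (N Ub w + e1)" "G \<xi> ?z - G \<xi> u0 = (\<tau> * t) *\<^sub>R (L (l Ub) Ub w + e2)"
          unfolding e1_def e2_def by simp_all
      qed
      have "(n ?z - n u0) \<bullet> blinfun_apply (L2 \<xi> ?z (t *\<^sub>R w)) (t *\<^sub>R w)
          - blinfun_apply (N2 ?z (t *\<^sub>R w)) (t *\<^sub>R w) \<bullet> (G \<xi> ?z - G \<xi> u0) = \<tau> * t ^ 3 * ?K"
        unfolding 1 by (simp add: blinfun.scaleR_right blinfun.scaleR_left power3_eq_cube algebra_simps)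
      then have "s * ((n ?z - n u0) \<bullet> blinfun_apply (L2 \<xi> ?z (t *\<^sub>R w)) (t *\<^sub>R w)
          - blinfun_apply (N2 ?z (t *\<^sub>R w)) (t *\<^sub>R w) \<bullet> (G \<xi> ?z - G \<xi> u0)) = \<tau> * (s * t ^ 3) * ?K" by simp
      also have "\<dots> \<ge> \<tau> * (s * t ^ 3) * (S / 2)"
      proof (rule mult_left_mono)
        show "S / 2 \<le> ?K" using K by linarith
      qed (use \<tau> in \<open>simp add: st\<close>)
      finally show ?thesis unfolding st by (simp add: algebra_simps)
    qed simp
  qed
  then show ?B by simp
qed

end

context pencil_eigenvalue begin

text \<open>If \<open>\<rho>\<close> dominates the jump, all three estimates are immediate.
  Otherwise the jump is nearly \<open>t *\<^sub>R r0\<close>, and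
  \<open>nonlinear_directional\<close> applies; its expansion contains the second estimate. For the
  first, either the linear and quadratic terms have the same sign, so \<open>t ^ 2\<close> is of
  order \<open>\<rho>\<close>, or the condition on \<open>l u0 - \<xi>\<close> forces
  \<open>s * t > 0\<close>, and the dissipation makes \<open>\<bar>t\<bar> ^ 3\<close> of order
  \<open>\<rho>\<close>. The third holds because \<open>l\<close> has slope 1 along
  \<open>r0\<close>.\<close>

lemma nonlinear_pair:
  assumes r0: "r0 \<in> E Ub" "Dl Ub r0 = 1" and p: "p = 1"
  shows "\<exists>e \<kappa> C. 0 < e \<and> e < \<delta> \<and> 0 < \<kappa> \<and> 0 < C \<and>
    (\<forall>u0\<in>cball Ub e. \<forall>u\<in>cball Ub e. \<forall>\<xi> \<rho>. \<bar>\<xi> - l Ub\<bar> \<le> \<kappa> \<longrightarrow> norm (G \<xi> u - G \<xi> u0) \<le> \<rho> \<longrightarrow>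
      (\<forall>s. \<bar>s\<bar> = 1 \<longrightarrow> s * (H \<xi> u - H \<xi> u0) \<le> \<rho> \<longrightarrow> s * (l u0 - \<xi>) \<le> 0 \<longrightarrow> norm (u - u0) ^ 3 \<le> C * \<rho>) \<and>
      \<bar>l u0 - \<xi>\<bar> * norm (u - u0) \<le> C * norm (u - u0) ^ 2 + C * \<rho> \<and>
      norm (u - u0) \<le> C * (\<bar>l u - l u0\<bar> + \<rho>))"
proof -
  define S where "S = N Ub r0 \<bullet> X Ub r0"
  define R where "R = norm r0"
  have "r0 \<noteq> 0" using r0(2) by (auto simp: blinfun.zero_right)
  then have S: "S > 0" and R: "R > 0" by (auto simp: S_def R_def pos)
  obtain \<mu>' where \<mu>': "\<mu>' > 0"
    "\<And>u v \<xi> r w e1 e2. \<lbrakk>dist u Ub \<le> \<mu>'; dist v Ub \<le> \<mu>'; dist \<xi> (l Ub) \<le> \<mu>'; dist r r0 \<le> \<mu>'; dist w r0 \<le> \<mu>'; norm e1 \<le> \<mu>'; norm e2 \<le> \<mu>'\<rbrakk> \<Longrightarrow>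
      \<bar>N u r \<bullet> X u w - S\<bar> < S / 2 \<and> \<bar>N u r \<bullet> blinfun_apply (L2 \<xi> v w) w - S\<bar> < S / 2 \<and>
      \<bar>(N Ub w + e1) \<bullet> blinfun_apply (L2 \<xi> v w) w - blinfun_apply (N2 v w) w \<bullet> (L (l Ub) Ub w + e2) - S\<bar> < S / 2"
    unfolding S_def by (rule nonlinear_near[OF r0]) blast
  \<comment> \<open>\<open>R / 2\<close> keeps \<open>norm w\<close> comparable with
    \<open>norm r0\<close>, and the last entry keeps \<open>Dl Ub w\<close> at least 1/2 in absolute
    value.\<close>
  define \<mu> where "\<mu> = min \<mu>' (min (R / 2) (min 1 (1 / (2 * (norm (Dl Ub) + 1)))))"
  have DlU: "norm (Dl Ub) + 1 > 0" by (simp add: add_nonneg_pos)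
  have \<mu>: "\<mu> > 0" "\<mu> \<le> \<mu>'" "\<mu> \<le> R / 2" "\<mu> \<le> 1" "\<mu> \<le> 1 / (2 * (norm (Dl Ub) + 1))"
  proof -
    show "\<mu> > 0" unfolding \<mu>_def using \<mu>'(1) R DlU by simp
    show "\<mu> \<le> \<mu>'" "\<mu> \<le> R / 2" "\<mu> \<le> 1" "\<mu> \<le> 1 / (2 * (norm (Dl Ub) + 1))" unfolding \<mu>_def by linarith+
  qed
  have near: "\<bar>N u r \<bullet> X u w - S\<bar> < S / 2 \<and> \<bar>N u r \<bullet> blinfun_apply (L2 \<xi> v w) w - S\<bar> < S / 2 \<and>
      \<bar>(N Ub w + e1) \<bullet> blinfun_apply (L2 \<xi> v w) w - blinfun_apply (N2 v w) w \<bullet> (L (l Ub) Ub w + e2) - S\<bar> < S / 2"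
    if "dist u Ub \<le> \<mu>" "dist v Ub \<le> \<mu>" "dist \<xi> (l Ub) \<le> \<mu>" "dist r r0 \<le> \<mu>" "dist w r0 \<le> \<mu>" "norm e1 \<le> \<mu>" "norm e2 \<le> \<mu>"
    for u v \<xi> r w e1 e2
    by (rule \<mu>'(2)) (use that \<mu>(2) in linarith)+
  have Dl\<mu>: "norm (Dl Ub) * \<mu> \<le> 1 / 2"
  proof -
    have "norm (Dl Ub) * \<mu> \<le> (norm (Dl Ub) + 1) * (1 / (2 * (norm (Dl Ub) + 1)))"
      using \<mu> by (intro mult_mono) auto
    also have "\<dots> = 1 / 2" using DlU by simp
    finally show ?thesis .
  qed
  obtain c where c: "c > 0" "\<And>b. b \<in> Ec Ub \<Longrightarrow> c * norm b \<le> norm (blinfun_apply (L (l Ub) Ub) b)"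
    by (rule coercive[of Ub]) blast
  define A where "A = R + 1"
  have A: "A > 0" using R by (simp add: A_def)
  \<comment> \<open>The entries serve in turn for \<open>norm b \<le> d / 2\<close>,
    \<open>norm b \<le> \<mu> * \<bar>t\<bar>\<close> and
    \<open>\<omega> * norm w \<le> \<mu>\<close>.\<close>
  define \<omega> where "\<omega> = min (c / 4) (min (\<mu> * c / (4 * R)) (\<mu> / A))"
  have \<omega>: "\<omega> > 0" "2 * \<omega> / c \<le> 1 / 2" "4 * \<omega> * R / c \<le> \<mu>" "\<omega> * A \<le> \<mu>"
  proof -
    show "\<omega> > 0" using c(1) \<mu>(1) R A by (simp add: \<omega>_def)
    have "\<omega> \<le> c / 4" "\<omega> \<le> \<mu> * c / (4 * R)" "\<omega> \<le> \<mu> / A" unfolding \<omega>_def by linarith+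
    then show "2 * \<omega> / c \<le> 1 / 2" "4 * \<omega> * R / c \<le> \<mu>" "\<omega> * A \<le> \<mu>" using c(1) R A by (simp_all add: field_simps)
  qed
  obtain eL where eL: "eL > 0" "\<And>u \<xi>. dist u Ub < eL \<Longrightarrow> \<bar>\<xi> - l Ub\<bar> < eL \<Longrightarrow> norm (L \<xi> u - L (l Ub) Ub) \<le> \<omega>"
    by (rule L_near[OF \<omega>(1)]) blast
  note D = isCont_data[OF center] isCont_l[OF center]
  have "\<forall>\<^sub>F u in nhds Ub. dist (N u) (N Ub) < \<omega> \<and> (\<forall>r\<in>E Ub. \<exists>r'\<in>E u. r' - r \<in> Ec Ub \<and> norm (r' - r) \<le> \<mu> / R * norm r) \<and>
      dist (Dl u) (Dl Ub) < 1 / (4 * A) \<and> dist (n u) (n Ub) < 1 \<and> dist (l u) (l Ub) < 1 / 2"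
    by (intro eventually_conj isCont_eventually_dist D eigenspace_continuous) (use \<omega> \<mu> R A \<delta> in auto)
  then obtain e where e: "e > 0" "e < min \<delta> (min eL (min \<mu> 1))" and
    ev: "\<And>u. u \<in> cball Ub e \<Longrightarrow> dist (N u) (N Ub) < \<omega> \<and> (\<forall>r\<in>E Ub. \<exists>r'\<in>E u. r' - r \<in> Ec Ub \<and> norm (r' - r) \<le> \<mu> / R * norm r) \<and>
      dist (Dl u) (Dl Ub) < 1 / (4 * A) \<and> dist (n u) (n Ub) < 1 \<and> dist (l u) (l Ub) < 1 / 2"
    by (rule eventually_nhds_cball[where d = "min \<delta> (min eL (min \<mu> 1))"]) (use \<delta> eL(1) \<mu>(1) in auto)
  define \<kappa> where "\<kappa> = min (eL / 2) (min \<mu> (1 / 2))"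
  have \<kappa>: "\<kappa> > 0" "\<kappa> < eL" "\<kappa> \<le> \<mu>" "\<kappa> \<le> 1 / 2" using eL(1) \<mu>(1) unfolding \<kappa>_def by (simp, linarith+)
  define B where "B = (norm (N Ub) + \<omega>) * A + norm (n Ub) + 1"
  have NA: "(norm (N Ub) + \<omega>) * A \<ge> 0" using \<omega>(1) A by simp
  have B: "B \<ge> 1" "norm (n Ub) + 1 \<le> B" "(norm (N Ub) + \<omega>) * A \<le> B" using NA by (auto simp: B_def)
  \<comment> \<open>\<open>C1\<close> belongs to the case of dominating \<open>\<rho>\<close>,
    \<open>C2\<close> and \<open>C3\<close> to the second estimate, \<open>C4\<close> and
    \<open>C5\<close> to the two sign cases of the first, \<open>C6\<close> to the third.\<close>
  define C1 where "C1 = 4 / \<omega>"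
  define C2 where "C2 = A * (2 * B / S)"
  define C3 where "C3 = 8 * A / R ^ 2"
  define C4 where "C4 = 8 * A ^ 2 * B / S"
  define C5 where "C5 = 24 * A ^ 3 * (1 + B) / S"
  define C6 where "C6 = 4 * A"
  have Cpos: "C1 > 0" "C2 > 0" "C3 > 0" "C4 > 0" "C5 > 0" "C6 > 0"
    using \<omega>(1) A B(1) S R by (auto simp: C1_def C2_def C3_def C4_def C5_def C6_def)
  define C where "C = C1 + C2 + C3 + C4 + C5 + C6"
  have C: "C > 0" "C1 \<le> C" "C2 \<le> C" "C3 \<le> C" "C4 \<le> C" "C5 \<le> C" "C6 \<le> C" using Cpos by (auto simp: C_def)
  have main: "(\<forall>s. \<bar>s\<bar> = 1 \<longrightarrow> s * (H \<xi> u - H \<xi> u0) \<le> \<rho> \<longrightarrow> s * (l u0 - \<xi>) \<le> 0 \<longrightarrow> norm (u - u0) ^ 3 \<le> C * \<rho>) \<and>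
      \<bar>l u0 - \<xi>\<bar> * norm (u - u0) \<le> C * norm (u - u0) ^ 2 + C * \<rho> \<and>
      norm (u - u0) \<le> C * (\<bar>l u - l u0\<bar> + \<rho>)"
    if u0: "u0 \<in> cball Ub e" and u: "u \<in> cball Ub e" and \<xi>: "\<bar>\<xi> - l Ub\<bar> \<le> \<kappa>" and \<rho>: "norm (G \<xi> u - G \<xi> u0) \<le> \<rho>" for u0 u \<xi> \<rho>
  proof -
    define d where "d = norm (u - u0)"
    have d0: "d \<ge> 0" by (simp add: d_def)
    have \<rho>0: "\<rho> \<ge> 0" using \<rho> norm_ge_zero order_trans by blast
    have "d \<le> dist Ub u + dist Ub u0" unfolding d_def using dist_triangle3[of u u0 Ub] by (simp add: dist_norm)
    then have d2: "d \<le> 2" using u0 u e(2) by simp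
    have d3: "d ^ 3 \<le> 2 * d ^ 2" "d ^ 3 \<le> 4 * d"
    proof -
      have "d ^ 3 = d * d ^ 2" by (simp add: power3_eq_cube power2_eq_square)
      also have "\<dots> \<le> 2 * d ^ 2" using d2 by (intro mult_right_mono) auto
      finally show "d ^ 3 \<le> 2 * d ^ 2" .
      also have "\<dots> \<le> 2 * (2 * d)" using d2 d0 by (simp add: power2_eq_square mult_right_mono)
      finally show "d ^ 3 \<le> 4 * d" by simp
    qed
    have \<theta>1: "\<bar>l u0 - \<xi>\<bar> \<le> 1"
    proof -
      have "\<bar>l u0 - l Ub\<bar> < 1 / 2" using ev[OF u0] by (simp add: dist_real_def)
      then show ?thesis using \<xi> \<kappa>(4) by linarith
    qed
    have C\<rho>: "Ci * \<rho> \<le> C * \<rho>" if "Ci \<le> C" for Ci using that \<rho>0 by (rule mult_right_mono)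
    have Cd: "Ci * d ^ 2 \<le> C * d ^ 2" if "Ci \<le> C" for Ci using that by (rule mult_right_mono) simp
    have "(\<forall>s. \<bar>s\<bar> = 1 \<longrightarrow> s * (H \<xi> u - H \<xi> u0) \<le> \<rho> \<longrightarrow> s * (l u0 - \<xi>) \<le> 0 \<longrightarrow> d ^ 3 \<le> C * \<rho>) \<and>
      \<bar>l u0 - \<xi>\<bar> * d \<le> C * d ^ 2 + C * \<rho> \<and> d \<le> C * (\<bar>l u - l u0\<bar> + \<rho>)"
    proof (cases "\<rho> > \<omega> * d \<or> d = 0")
      case True
      then have "4 * d \<le> C1 * \<rho>" using \<omega>(1) \<rho>0 by (auto simp: C1_def field_simps)
      then have d: "4 * d \<le> C * \<rho>" using C\<rho>[OF C(2)] by linarith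
      have "\<bar>l u0 - \<xi>\<bar> * d \<le> d" using mult_right_mono[OF \<theta>1 d0] by simp
      moreover have "C * d ^ 2 \<ge> 0" "C * \<bar>l u - l u0\<bar> \<ge> 0" using C(1) by auto
      ultimately show ?thesis using d d0 d3(2) unfolding distrib_left by linarith
    next
      case False
      then have F: "\<rho> \<le> \<omega> * d" "d > 0" using d0 by auto
      obtain a b where ab: "a \<in> E Ub" "b \<in> Ec Ub" "u - u0 = a + b" by (rule decomp)
      have "span {r0} \<subseteq> E Ub" using r0(1) subspace_E by (intro span_minimal) auto
      moreover have "dim (span {r0}) = 1" using \<open>r0 \<noteq> 0\<close> by (simp add: dim_span dim_eq_card_independent dim_singleton)
      ultimately have "span {r0} = E Ub" using dim_E[OF center] p by (intro subspace_dim_equal subspace_span subspace_E) auto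
      then obtain t where t: "a = t *\<^sub>R r0" using ab(1) by (auto simp: span_singleton)
      have sub: "\<And>z. z \<in> cball Ub e \<Longrightarrow> z \<in> ball Ub \<delta>" using e(2) by auto
      have LL: "norm (L \<xi> z - L (l Ub) Ub) \<le> \<omega>" if "z \<in> cball Ub e" for z
        by (rule eL(2)) (use that e(2) \<xi> \<kappa>(2) in \<open>auto simp: dist_commute\<close>)
      have "norm (G \<xi> u - G \<xi> u0 - L (l Ub) Ub (u - u0)) \<le> \<omega> * norm (u - u0)"
        by (rule linearization[OF convex_cball u0 u]) (use G sub LL in auto)
      then have "norm (L (l Ub) Ub (u - u0)) \<le> \<rho> + \<omega> * d"
        using norm_triangle_ineq4[of "G \<xi> u - G \<xi> u0" "G \<xi> u - G \<xi> u0 - L (l Ub) Ub (u - u0)"] \<rho> by (simp add: d_def)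
      moreover have "L (l Ub) Ub (u - u0) = L (l Ub) Ub b" using ab by (simp add: blinfun.add_right E_def)
      ultimately have "c * norm b \<le> 2 * \<omega> * d" using c(2)[OF ab(2)] F(1) by simp
      then have b1: "norm b \<le> (2 * \<omega> / c) * d" using c(1) by (simp add: field_simps)
      also have "\<dots> \<le> 1 / 2 * d" using \<omega>(2) d0 by (rule mult_right_mono)
      finally have b2: "norm b \<le> d / 2" by simp
      have "d \<le> \<bar>t\<bar> * R + norm b" unfolding d_def ab(3) t R_def using norm_triangle_ineq[of "t *\<^sub>R r0" b] by simp
      then have dt: "d \<le> 2 * (\<bar>t\<bar> * R)" using b2 by linarith
      then have t0: "t \<noteq> 0" using F(2) by auto
      have "(2 * \<omega> / c) * d \<le> (2 * \<omega> / c) * (2 * (\<bar>t\<bar> * R))" using dt \<omega>(1) c(1) by (intro mult_left_mono) auto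
      also have "\<dots> = (4 * \<omega> * R / c) * \<bar>t\<bar>" by (simp add: field_simps)
      also have "\<dots> \<le> \<mu> * \<bar>t\<bar>" using \<omega>(3) by (rule mult_right_mono) simp
      finally have b3: "norm b \<le> \<mu> * \<bar>t\<bar>" using b1 by linarith
      \<comment> \<open>The complementary part is absorbed into the direction, so \<open>u\<close>
        lies on a straight line from \<open>u0\<close> whose direction is still within
        \<open>\<mu>\<close> of \<open>r0\<close>.\<close>
      define w where "w = r0 + inverse t *\<^sub>R b"
      have uw: "u = u0 + t *\<^sub>R w" using ab(3) t t0 by (simp add: w_def scaleR_add_right algebra_simps)
      have wr: "dist w r0 \<le> \<mu>" using b3 t0 by (simp add: w_def dist_norm divide_inverse_commute[symmetric] field_simps)
      have wn: "norm w \<le> A" "R / 2 \<le> norm w"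
        using norm_triangle_ineq2[of w r0] norm_triangle_ineq2[of r0 w] wr \<mu>(3,4)
        by (auto simp: A_def R_def dist_norm norm_minus_commute)
      have dw: "d = \<bar>t\<bar> * norm w" by (simp add: d_def uw)
      have dA: "d \<le> A * \<bar>t\<bar>" unfolding dw using mult_left_mono[OF wn(1), of "\<bar>t\<bar>"] by (simp add: mult.commute)
      have dR: "\<bar>t\<bar> * (R / 2) \<le> d" unfolding dw using wn(2) by (intro mult_left_mono) auto
      obtain r where r: "r \<in> E u0" "dist r r0 \<le> \<mu>"
      proof -
        obtain r where "r \<in> E u0" "norm (r - r0) \<le> \<mu> / R * norm r0" using ev[OF u0] r0(1) by blast
        then show ?thesis using that[of r] R by (simp add: R_def dist_norm)
      qed
      have NN: "norm (N z - N Ub) \<le> \<omega>" if "z \<in> cball Ub e" for z using ev[OF that] by (simp add: dist_norm)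
      have \<omega>w: "\<omega> * norm w \<le> \<mu>" by (rule order_trans[OF mult_left_mono[OF wn(1) less_imp_le[OF \<omega>(1)]] \<omega>(4)])
      have \<xi>\<mu>: "dist \<xi> (l Ub) \<le> \<mu>" using \<xi> \<kappa>(3) by (simp add: dist_real_def)
      have e\<mu>: "e \<le> \<mu>" "e < \<delta>" using e(2) by auto
      have uw': "u0 + t *\<^sub>R w \<in> cball Ub e" using u uw by simp
      note dir = nonlinear_directional[OF near e\<mu> u0 uw' \<xi>\<mu> r wr NN LL \<omega>w S, folded uw]
      obtain q1 q2 where q: "\<bar>q1 - S\<bar> < S / 2" "\<bar>q2 - S\<bar> < S / 2"
        and eq: "N u0 r \<bullet> (G \<xi> u - G \<xi> u0) = (l u0 - \<xi>) * t * q1 + t ^ 2 * q2 / 2"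
        using dir(1) by blast
      have q': "S / 2 \<le> q1" "S / 2 \<le> q2" "q2 \<le> 2 * S" using q by linarith+
      have kR: "\<bar>N u0 r \<bullet> (G \<xi> u - G \<xi> u0)\<bar> \<le> B * \<rho>"
      proof -
        have "norm (N u0) \<le> norm (N Ub) + \<omega>" using NN[OF u0] norm_triangle_sub[of "N u0" "N Ub"] by linarith
        moreover have "norm r \<le> A" using r(2) \<mu>(4) norm_triangle_ineq2[of r r0] by (simp add: A_def R_def dist_norm)
        ultimately have "norm (N u0) * norm r \<le> (norm (N Ub) + \<omega>) * A" using \<omega>(1) by (intro mult_mono) auto
        then have "norm (N u0 r) \<le> B" using norm_blinfun[of "N u0" r] B(3) by linarith
        then have "norm (N u0 r) * norm (G \<xi> u - G \<xi> u0) \<le> B * \<rho>" using \<rho> B(1) by (intro mult_mono) auto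
        then show ?thesis using Cauchy_Schwarz_ineq2 order_trans by blast
      qed
      define \<theta> where "\<theta> = l u0 - \<xi>"
      have t2: "t ^ 2 * (R / 2) ^ 2 \<le> d ^ 2"
        using power_mono[OF dR, of 2] R by (simp add: power_mult_distrib power_divide)
      have A2: "d ^ 2 \<le> A ^ 2 * t ^ 2" using power_mono[OF dA d0, of 2] by (simp add: power_mult_distrib)
      have two: "\<bar>\<theta>\<bar> * d \<le> C * d ^ 2 + C * \<rho>"
      proof -
        have "\<bar>\<theta>\<bar> * \<bar>t\<bar> * (S / 2) \<le> \<bar>\<theta>\<bar> * \<bar>t\<bar> * q1" using q'(1) by (intro mult_left_mono) auto
        also have "\<dots> = \<bar>\<theta> * t * q1\<bar>" using q'(1) S by (simp add: abs_mult)
        also have "\<dots> \<le> B * \<rho> + t ^ 2 * q2 / 2"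
        proof -
          have "0 \<le> t ^ 2 * q2 / 2" using q'(2) S by simp
          then show ?thesis using kR eq by (simp add: \<theta>_def abs_le_iff)
        qed
        also have "\<dots> \<le> B * \<rho> + t ^ 2 * S" using mult_left_mono[OF q'(3), of "t ^ 2"] by simp
        finally have "\<bar>\<theta>\<bar> * \<bar>t\<bar> \<le> (2 * B / S) * \<rho> + 2 * t ^ 2" using S by (simp add: field_simps)
        then have "A * (\<bar>\<theta>\<bar> * \<bar>t\<bar>) \<le> A * ((2 * B / S) * \<rho> + 2 * t ^ 2)" using A by (intro mult_left_mono) auto
        also have "\<dots> = C2 * \<rho> + 2 * A * t ^ 2" by (simp add: C2_def algebra_simps)
        also have "2 * A * t ^ 2 \<le> C3 * d ^ 2"
        proof -
          have "2 * A * t ^ 2 = C3 * (t ^ 2 * (R / 2) ^ 2)" using R by (simp add: C3_def power_divide)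
          also have "\<dots> \<le> C3 * d ^ 2" using t2 Cpos(3) by (intro mult_left_mono) auto
          finally show ?thesis .
        qed
        finally have "A * (\<bar>\<theta>\<bar> * \<bar>t\<bar>) \<le> C * \<rho> + C * d ^ 2" using C\<rho>[OF C(3)] Cd[OF C(4)] by linarith
        moreover have "\<bar>\<theta>\<bar> * d \<le> \<bar>\<theta>\<bar> * (A * \<bar>t\<bar>)" using dA by (intro mult_left_mono) auto
        ultimately show ?thesis by (simp add: algebra_simps)
      qed
      have three: "d \<le> C * (\<bar>l u - l u0\<bar> + \<rho>)"
      proof -
        have "norm (l u - l u0 - Dl Ub (u - u0)) \<le> 1 / (4 * A) * norm (u - u0)"
        proof (rule linearization[OF convex_cball u0 u])
          show "norm (Dl z - Dl Ub) \<le> 1 / (4 * A)" if "z \<in> cball Ub e" for z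
            using ev[OF that] by (simp add: dist_norm)
        qed (use l sub in auto)
        also have "\<dots> \<le> 1 / (4 * A) * (A * \<bar>t\<bar>)" using dA A unfolding d_def by (intro mult_left_mono) auto
        also have "\<dots> = \<bar>t\<bar> / 4" using A by simp
        finally have 1: "\<bar>l u - l u0 - Dl Ub (u - u0)\<bar> \<le> \<bar>t\<bar> / 4" by simp
        have "Dl Ub w = 1 + Dl Ub (w - r0)" using r0(2) by (simp add: blinfun.diff_right)
        moreover have "\<bar>Dl Ub (w - r0)\<bar> \<le> norm (Dl Ub) * \<mu>"
          using norm_blinfun[of "Dl Ub" "w - r0"] mult_left_mono[OF wr, of "norm (Dl Ub)"] by (simp add: dist_norm)
        ultimately have "1 / 2 \<le> \<bar>Dl Ub w\<bar>" using Dl\<mu> by linarith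
        then have "\<bar>t\<bar> * (1 / 2) \<le> \<bar>t\<bar> * \<bar>Dl Ub w\<bar>" by (intro mult_left_mono) auto
        also have "\<dots> = \<bar>Dl Ub (u - u0)\<bar>" by (simp add: uw blinfun.scaleR_right abs_mult)
        finally have "\<bar>t\<bar> / 2 \<le> \<bar>Dl Ub (u - u0)\<bar>" by simp
        also have "\<bar>Dl Ub (u - u0)\<bar> \<le> \<bar>l u - l u0\<bar> + \<bar>l u - l u0 - Dl Ub (u - u0)\<bar>"
          using abs_triangle_ineq4[of "l u - l u0" "l u - l u0 - Dl Ub (u - u0)"] by simp
        also have "\<dots> \<le> \<bar>l u - l u0\<bar> + \<bar>t\<bar> / 4" using 1 by simp
        finally have "\<bar>t\<bar> \<le> 4 * \<bar>l u - l u0\<bar>" by simp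
        then have "A * \<bar>t\<bar> \<le> A * (4 * \<bar>l u - l u0\<bar>)" using A by (intro mult_left_mono) auto
        then have "d \<le> C6 * \<bar>l u - l u0\<bar>" using dA by (simp add: C6_def)
        also have "\<dots> \<le> C * \<bar>l u - l u0\<bar>" using C(7) by (intro mult_right_mono) auto
        also have "\<dots> \<le> C * (\<bar>l u - l u0\<bar> + \<rho>)" using C(1) \<rho>0 by (intro mult_left_mono) auto
        finally show ?thesis .
      qed
      have one: "d ^ 3 \<le> C * \<rho>" if s: "\<bar>s\<bar> = 1" "s * (H \<xi> u - H \<xi> u0) \<le> \<rho>" "s * (l u0 - \<xi>) \<le> 0" for s
      proof (cases "\<theta> * t \<ge> 0")
        case True
        have "0 \<le> \<theta> * t * q1" by (rule mult_nonneg_nonneg[OF True]) (use q'(1) S in linarith)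
        then have "t ^ 2 * q2 / 2 \<le> B * \<rho>" using eq kR by (simp add: \<theta>_def abs_le_iff)
        moreover have "t ^ 2 * (S / 2) \<le> t ^ 2 * q2" using q'(2) by (intro mult_left_mono) auto
        ultimately have "t ^ 2 * S \<le> 4 * B * \<rho>" by simp
        then have "t ^ 2 \<le> 4 * B * \<rho> / S" using S by (simp add: field_simps)
        then have "2 * (A ^ 2 * t ^ 2) \<le> 2 * (A ^ 2 * (4 * B * \<rho> / S))" by (intro mult_left_mono) auto
        also have "\<dots> = C4 * \<rho>" by (simp add: C4_def)
        finally show ?thesis using d3(1) A2 C\<rho>[OF C(5)] by linarith
      next
        case False
        have st: "s * t > 0"
        proof (cases "s = 1")
          case True
          then have "\<theta> \<le> 0" using s(3) by (simp add: \<theta>_def)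
          then have "t > 0" using False mult_nonpos_nonpos[of \<theta> t] by linarith
          then show ?thesis using True by simp
        next
          case sF: False
          then have "s = -1" using s(1) by linarith
          then have "\<theta> \<ge> 0" using s(3) by (simp add: \<theta>_def)
          then have "t < 0" using False mult_nonneg_nonneg[of \<theta> t] by linarith
          then show ?thesis using \<open>s = -1\<close> by simp
        qed
        let ?nG = "(n u0 + n u) \<bullet> (G \<xi> u - G \<xi> u0) / 2"
        have "\<bar>s * ?nG\<bar> = \<bar>?nG\<bar>" unfolding abs_mult[of s] s(1) by simp
        moreover have "\<bar>(n u0 + n u) \<bullet> (G \<xi> u - G \<xi> u0)\<bar> \<le> (2 * B) * \<rho>"
        proof -
          have "norm (n u0) \<le> B" "norm (n u) \<le> B"
            using ev[OF u0] ev[OF u] B(2) norm_triangle_sub[of "n u0" "n Ub"] norm_triangle_sub[of "n u" "n Ub"]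
            by (auto simp: dist_norm)
          then have "norm (n u0 + n u) \<le> 2 * B" using norm_triangle_ineq[of "n u0" "n u"] by linarith
          then have "norm (n u0 + n u) * norm (G \<xi> u - G \<xi> u0) \<le> (2 * B) * \<rho>" using \<rho> B(1) by (intro mult_mono) auto
          then show ?thesis using Cauchy_Schwarz_ineq2 order_trans by blast
        qed
        ultimately have "\<bar>s * ?nG\<bar> \<le> B * \<rho>" by simp
        moreover have "S * \<bar>t\<bar> ^ 3 / 24 \<le> s * (H \<xi> u - H \<xi> u0 - ?nG)"
          by (rule dir(2)) (use s(1) st in auto)
        then have "S * \<bar>t\<bar> ^ 3 / 24 \<le> s * (H \<xi> u - H \<xi> u0) - s * ?nG"
          by (simp only: right_diff_distrib)
        ultimately have "S * \<bar>t\<bar> ^ 3 / 24 \<le> \<rho> + B * \<rho>" using s(2) by linarith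
        then have "S * \<bar>t\<bar> ^ 3 / 24 \<le> (1 + B) * \<rho>" by (simp only: distrib_right mult_1_left)
        then have "\<bar>t\<bar> ^ 3 \<le> 24 * (1 + B) * \<rho> / S" using S by (simp add: field_simps)
        then have "A ^ 3 * \<bar>t\<bar> ^ 3 \<le> A ^ 3 * (24 * (1 + B) * \<rho> / S)" using A by (intro mult_left_mono) auto
        also have "\<dots> = C5 * \<rho>" by (simp add: C5_def)
        finally show ?thesis using power_mono[OF dA d0, of 3] C\<rho>[OF C(6)] by (simp add: power_mult_distrib)
      qed
      show ?thesis using one two three by (simp add: \<theta>_def)
    qed
    then show ?thesis by (simp add: d_def)
  qed
  show ?thesis
    by (rule exI[of _ e], rule exI[of _ \<kappa>], rule exI[of _ C]) (use e \<kappa>(1) C(1) main in auto)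
qed

end

section \<open>Jumps near one eigenvalue\<close>

text \<open>A Gronwall argument for functions without continuity: on steps of length
  \<open>h'\<close>, where \<open>C * h' \<le> 1 / 2\<close>, any bound for the deviation from
  \<open>v\<close> may be halved, starting from the a priori bound \<open>K\<close>. The deviation
  is therefore zero, and finitely many steps cover the interval.\<close>

lemma constancy_propagates:
  fixes u :: "real \<Rightarrow> 'a::real_normed_vector"
  assumes bd: "\<And>x. p \<le> x \<Longrightarrow> x \<le> q \<Longrightarrow> norm (u x - v) \<le> K"
    and h: "h > 0" and C: "C \<ge> 0"
    and step: "\<And>x y M. \<lbrakk>p \<le> x; x < y; y \<le> q; y - x \<le> h; u x = v;
       \<And>z. x \<le> z \<Longrightarrow> z \<le> y \<Longrightarrow> norm (u z - v) \<le> M\<rbrakk> \<Longrightarrow> norm (u y - v) \<le> C * M * (y - x)"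
    and "u p = v" "p \<le> x" "x \<le> q"
  shows "u x = v"
proof -
  define h' where "h' = min h (1 / (2 * (C + 1)))"
  have h': "h' > 0" "h' \<le> h" using h C by (auto simp: h'_def)
  have Ch': "C * h' \<le> 1 / 2"
  proof -
    have "C * h' \<le> C * (1 / (2 * (C + 1)))" using C by (intro mult_left_mono) (auto simp: h'_def)
    also have "\<dots> \<le> 1 / 2" using C by (simp add: field_simps)
    finally show ?thesis .
  qed
  have one: "u y = v" if x: "p \<le> x" "u x = v" and y: "x \<le> y" "y \<le> q" "y - x \<le> h'" for x y
  proof -
    have *: "norm (u z - v) \<le> K * (1/2) ^ n" if "x \<le> z" "z \<le> y" for n z
      using that
    proof (induction n arbitrary: z)
      case 0
      then show ?case using bd[of z] x y by simp
    next
      case (Suc n)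
      have K: "0 \<le> K * (1/2) ^ n" using Suc.IH[of x] x y norm_ge_zero order_trans by fastforce
      show ?case
      proof (cases "z = x")
        case True
        then show ?thesis using x K by simp
      next
        case False
        have "norm (u z - v) \<le> C * (K * (1/2) ^ n) * (z - x)"
          by (rule step) (use Suc x y h' False in auto)
        also have "\<dots> = (C * (z - x)) * (K * (1/2) ^ n)" by simp
        also have "\<dots> \<le> (C * h') * (K * (1/2) ^ n)"
          using Suc.prems y C K by (intro mult_right_mono mult_left_mono) auto
        also have "\<dots> \<le> 1/2 * (K * (1/2) ^ n)" using Ch' K by (rule mult_right_mono)
        finally show ?thesis by simp
      qed
    qed
    have "(\<lambda>n. K * (1/2) ^ n) \<longlonglongrightarrow> K * 0" by (intro tendsto_intros) auto
    then have "norm (u y - v) \<le> K * 0"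
      by (rule LIMSEQ_le_const) (use * y in auto)
    then show ?thesis by simp
  qed
  have *: "u y = v" if "p \<le> y" "y \<le> q" "y \<le> p + real n * h'" for n y
    using that
  proof (induction n arbitrary: y)
    case 0
    then show ?case using \<open>u p = v\<close> by simp
  next
    case (Suc n)
    let ?x = "min y (p + real n * h')"
    have "u ?x = v" by (rule Suc.IH) (use Suc.prems h' in auto)
    then show ?case
      by (rule one[of ?x, rotated]) (use Suc.prems h' in \<open>auto simp: algebra_simps min_def\<close>)
  qed
  obtain n where "x - p < real n * h'" using reals_Archimedean3[OF h'(1)] by blast
  then show ?thesis using assms(6,7) by (intro *[of x n]) auto
qed

text \<open>The local counterpart of \<open>jump_control\<close>, with \<open>B\<close> bounding the
  total mass; the atoms vanish outside \<open>{c..d}\<close>, so that those of several intervals can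
  be added.\<close>

definition jump_bound :: "real \<Rightarrow> real \<Rightarrow> real \<Rightarrow> real \<Rightarrow> (real \<Rightarrow> 'a::real_normed_vector) \<Rightarrow> bool" where
  "jump_bound C B c d u \<longleftrightarrow> (\<exists>a b. a summable_on UNIV \<and> b summable_on UNIV \<and>
     (\<forall>s. 0 \<le> a s) \<and> (\<forall>s. 0 \<le> b s) \<and> infsum a UNIV + infsum b UNIV \<le> B \<and>
     (\<forall>s. s \<notin> {c..d} \<longrightarrow> a s = 0 \<and> b s = 0) \<and>
     (\<forall>x y. c \<le> x \<and> x < y \<and> y \<le> d \<longrightarrow>
        norm (u y - u x) \<le> C * (y - x) + infsum a {x<..y} + infsum b {x..<y}))"

lemma infsum_ge_member:
  fixes f :: "'b \<Rightarrow> real"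
  assumes "f summable_on UNIV" "\<And>x. 0 \<le> f x" "s \<in> S"
  shows "f s \<le> infsum f S"
  using infsum_mono2[of f "{s}" S] assms by (auto intro: summable_on_subset_banach)

text \<open>\<open>u\<close> is constant to the left of any point with
  \<open>\<Lambda> x > x\<close> and to the right of any point with \<open>\<Lambda> x < x\<close>.
  Hence it is constant before the supremum \<open>p\<close> of the former and after the infimum
  \<open>q\<close> of the latter; strictly between \<open>p\<close> and \<open>q\<close> only fixed
  points of \<open>\<Lambda>\<close> remain, and there \<open>lip\<close> applies.\<close>

lemma jump_bound_two_jumps:
  fixes u :: "real \<Rightarrow> 'a::real_normed_vector"
  assumes K: "\<And>x y. x \<in> {c..d} \<Longrightarrow> y \<in> {c..d} \<Longrightarrow> norm (u y - u x) \<le> K"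
    and const: "\<And>x y. \<lbrakk>x \<in> {c..d}; y \<in> {c..d}; \<Lambda> x < x; x \<le> y\<rbrakk> \<Longrightarrow> u y = u x"
      "\<And>x y. \<lbrakk>x \<in> {c..d}; y \<in> {c..d}; \<Lambda> x > x; y \<le> x\<rbrakk> \<Longrightarrow> u y = u x"
    and lip: "\<And>x y. \<lbrakk>x \<in> {c..d}; y \<in> {c..d}; \<Lambda> x = x; \<Lambda> y = y\<rbrakk> \<Longrightarrow> norm (u y - u x) \<le> C * \<bar>y - x\<bar>"
    and "C \<ge> 0" "c \<le> d"
  shows "jump_bound C (4 * K) c d u"
proof -
  \<comment> \<open>The endpoints are inserted so that supremum and infimum make sense when no point
    of the kind exists.\<close>
  define L where "L = insert c {x \<in> {c..d}. \<Lambda> x > x}"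
  define R where "R = insert d {x \<in> {c..d}. \<Lambda> x < x}"
  define p where "p = Sup L"
  define q where "q = Inf R"
  have L: "L \<noteq> {}" "bdd_above L" and R: "R \<noteq> {}" "bdd_below R"
    using \<open>c \<le> d\<close> by (auto simp: L_def R_def intro: bdd_aboveI[of _ d] bdd_belowI[of _ c])
  have pq: "p \<in> {c..d}" "q \<in> {c..d}"
    unfolding p_def q_def using \<open>c \<le> d\<close> L R
    by (auto intro!: cSup_upper2[of c] cInf_lower2[of d] cSup_least cInf_greatest simp: L_def R_def)
  have K0: "K \<ge> 0" using K[of c c] \<open>c \<le> d\<close> by simp
  \<comment> \<open>Mass \<open>K\<close> at \<open>p\<close> and at \<open>q\<close>; the function
    serves both for jumps into a point and out of it, hence \<open>4 * K\<close> in total.\<close>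
  define a where "a s = (if s \<in> {p} then K else 0) + (if s \<in> {q} then K else 0)" for s :: real
  have hs: "((\<lambda>s. if s \<in> {r} then K else 0) has_sum K) UNIV" for r :: real
    using has_sum_finite[of "{r}" "\<lambda>s. K"] by (subst has_sum_cong_neutral[where T = "{r}" and g = "\<lambda>s. K"]) auto
  have a: "(a has_sum (K + K)) UNIV" unfolding a_def by (intro has_sum_add hs)
  have a0: "a s \<ge> 0" for s using K0 by (simp add: a_def)
  have sa: "a summable_on S" for S
    using summable_on_subset_banach[of a UNIV S] a by (auto simp: summable_on_def)
  have "norm (u y - u x) \<le> C * (y - x) + infsum a {x<..y} + infsum a {x..<y}"
    if xy: "c \<le> x" "x < y" "y \<le> d" for x y
  proof -
    have nn: "infsum a S \<ge> 0" for S by (intro infsum_nonneg a0)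
    have C0: "C * (y - x) \<ge> 0" using xy \<open>C \<ge> 0\<close> by simp
    have ge: "K \<le> infsum a {x<..y} + infsum a {x..<y}" if "r \<in> {x..y}" "r = p \<or> r = q" for r
    proof -
      have "K \<le> a r" using that(2) K0 by (auto simp: a_def)
      moreover have "a r \<le> infsum a {x<..y} \<or> a r \<le> infsum a {x..<y}"
        using infsum_ge_member[OF sa a0, of r "{x<..y}"] infsum_ge_member[OF sa a0, of r "{x..<y}"]
          that(1) xy by (cases "r = x") auto
      ultimately show ?thesis using nn[of "{x<..y}"] nn[of "{x..<y}"] by linarith
    qed
    consider "p \<in> {x..y} \<or> q \<in> {x..y}" | "y < p" | "q < x" | "p < x" "y < q" by fastforce
    then show ?thesis
    proof cases
      case 1
      then show ?thesis using ge K[of x y] xy C0 by fastforce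
    next
      case 2
      then obtain l where l: "l \<in> L" "y < l" unfolding p_def using less_cSup_iff[OF L] by blast
      then have "l \<in> {c..d}" "\<Lambda> l > l" using xy by (auto simp: L_def)
      then have "u y = u l" "u x = u l" using const(2)[of l y] const(2)[of l x] l xy by auto
      then show ?thesis using nn C0 by (simp add: add_nonneg_nonneg)
    next
      case 3
      then obtain l where l: "l \<in> R" "l < x" unfolding q_def using cInf_less_iff[OF R] by blast
      then have "l \<in> {c..d}" "\<Lambda> l < l" using xy by (auto simp: R_def)
      then have "u y = u l" "u x = u l" using const(1)[of l y] const(1)[of l x] l xy by auto
      then show ?thesis using nn C0 by (simp add: add_nonneg_nonneg)
    next
      case 4
      have "z \<notin> L" if "p < z" for z using that cSup_upper[OF _ L(2)] unfolding p_def by force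
      moreover have "z \<notin> R" if "z < q" for z using that cInf_lower[OF _ R(2)] unfolding q_def by force
      ultimately have "x \<notin> L" "x \<notin> R" "y \<notin> L" "y \<notin> R" using 4 xy by auto
      then have "\<Lambda> x = x" "\<Lambda> y = y" using xy by (auto simp: L_def R_def)
      then show ?thesis using lip[of x y] xy nn[of "{x<..y}"] nn[of "{x..<y}"] by auto
    qed
  qed
  moreover have "infsum a UNIV = 2 * K" using a infsumI by fastforce
  ultimately show ?thesis
    unfolding jump_bound_def using sa a0 pq
    by (intro exI[of _ a] conjI allI impI) (auto simp: a_def)
qed

text \<open>The structure of a field of shocks of the "wrong" sign: the flow is constant between \<open>x\<close> and
  \<open>\<Lambda> x\<close>, so \<open>\<Lambda>\<close> is monotone and its jumps absorb everything that is not a rarefaction.\<close>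

locale centered_shocks =
  fixes c d :: real and u :: "real \<Rightarrow> 'a::real_normed_vector" and l :: "'a \<Rightarrow> real" and \<Lambda> :: "real \<Rightarrow> real" and C :: real
  assumes cd: "c \<le> d" and C: "C \<ge> 0"
    and \<Lambda>: "\<And>x. \<Lambda> x = l (u x)"
    and range: "\<And>x. x \<in> {c..d} \<Longrightarrow> \<Lambda> x \<in> {c..d}"
    and const_right: "\<And>x y. \<lbrakk>x \<in> {c..d}; x \<le> y; y \<le> \<Lambda> x\<rbrakk> \<Longrightarrow> u y = u x"
    and const_left: "\<And>x y. \<lbrakk>x \<in> {c..d}; y \<le> x; \<Lambda> x \<le> y\<rbrakk> \<Longrightarrow> u y = u x"
    and lip: "\<And>x y. \<lbrakk>x \<in> {c..d}; y \<in> {c..d}; \<Lambda> x = x; \<Lambda> y = y\<rbrakk> \<Longrightarrow> norm (u y - u x) \<le> C * \<bar>y - x\<bar>"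
begin

lemma eq_\<Lambda>: "u x = u y \<Longrightarrow> \<Lambda> x = \<Lambda> y" by (simp add: \<Lambda>)

lemma u_\<Lambda>: "x \<in> {c..d} \<Longrightarrow> u (\<Lambda> x) = u x"
  using const_right[of x "\<Lambda> x"] const_left[of x "\<Lambda> x"] by fastforce

text \<open>If \<open>\<Lambda>\<close> decreased from \<open>x\<close> to \<open>y\<close>, the
  intervals of constancy between \<open>x\<close> and \<open>\<Lambda> x\<close> and between
  \<open>y\<close> and \<open>\<Lambda> y\<close> would overlap, and \<open>u x = u y\<close> would
  follow.\<close>

lemma mono: "\<lbrakk>x \<in> {c..d}; y \<in> {c..d}; x \<le> y\<rbrakk> \<Longrightarrow> \<Lambda> x \<le> \<Lambda> y"
proof (rule ccontr)
  assume xy: "x \<in> {c..d}" "y \<in> {c..d}" "x \<le> y" and "\<not> \<Lambda> x \<le> \<Lambda> y"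
  then have less: "\<Lambda> y < \<Lambda> x" by simp
  have "u x = u y"
  proof (cases "\<Lambda> x \<le> x")
    case True
    then show ?thesis using const_left[of y x] xy less by simp
  next
    case False
    show ?thesis
    proof (cases "y \<le> \<Lambda> x")
      case True
      then show ?thesis using const_right[of x y] xy by simp
    next
      case False
      then show ?thesis using const_left[of y "\<Lambda> x"] xy less u_\<Lambda>[of x] by simp
    qed
  qed
  then show False using less eq_\<Lambda>[of x y] by simp
qed

text \<open>\<open>\<Lambda> x\<close> and \<open>\<Lambda> y\<close> are fixed points of
  \<open>\<Lambda>\<close> at which \<open>u\<close> takes the values \<open>u x\<close> and
  \<open>u y\<close>, so \<open>lip\<close> applies to them.\<close>

lemma lipschitz_\<Lambda>: "\<lbrakk>x \<in> {c..d}; y \<in> {c..d}\<rbrakk> \<Longrightarrow> norm (u y - u x) \<le> C * \<bar>\<Lambda> y - \<Lambda> x\<bar>"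
  using lip[of "\<Lambda> x" "\<Lambda> y"] range[of x] range[of y] u_\<Lambda>[of x] u_\<Lambda>[of y] eq_\<Lambda>[of "\<Lambda> x" x] eq_\<Lambda>[of "\<Lambda> y" y]
  by simp

text \<open>\<open>upper\<close> and \<open>lower\<close> are the right and left limits of the
  monotone function \<open>\<Lambda>\<close>; the inserted endpoint gives the value of
  \<open>\<Lambda>\<close> itself at \<open>d\<close> and at \<open>c\<close>.\<close>

definition upper where "upper s = Inf (\<Lambda> ` insert d {s<..d})"
definition lower where "lower s = Sup (\<Lambda> ` insert c {c..<s})"
definition jump where "jump s = (if s \<in> {c..d} then upper s - lower s else 0)"

lemma bdd: "S \<subseteq> {c..d} \<Longrightarrow> bdd_below (\<Lambda> ` S)" "S \<subseteq> {c..d} \<Longrightarrow> bdd_above (\<Lambda> ` S)"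
  using range by (auto intro!: bdd_belowI[of _ c] bdd_aboveI[of _ d] simp: subset_iff)

lemma upper_le: "\<lbrakk>s < y; c \<le> s; y \<le> d\<rbrakk> \<Longrightarrow> upper s \<le> \<Lambda> y"
  unfolding upper_def using cd by (intro cInf_lower bdd) auto

lemma upper_le_end: "c \<le> s \<Longrightarrow> upper s \<le> \<Lambda> d"
  unfolding upper_def using cd by (intro cInf_lower bdd) auto

lemma le_upper: "(\<And>y. s < y \<Longrightarrow> y \<le> d \<Longrightarrow> t \<le> \<Lambda> y) \<Longrightarrow> t \<le> \<Lambda> d \<Longrightarrow> t \<le> upper s"
  unfolding upper_def by (intro cInf_greatest) auto

lemma le_lower: "\<lbrakk>y < s; c \<le> y; s \<le> d\<rbrakk> \<Longrightarrow> \<Lambda> y \<le> lower s"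
  unfolding lower_def using cd by (intro cSup_upper bdd) auto

lemma le_lower_end: "s \<le> d \<Longrightarrow> \<Lambda> c \<le> lower s"
  unfolding lower_def using cd by (intro cSup_upper bdd) auto

lemma lower_le: "(\<And>y. c \<le> y \<Longrightarrow> y < s \<Longrightarrow> \<Lambda> y \<le> t) \<Longrightarrow> \<Lambda> c \<le> t \<Longrightarrow> lower s \<le> t"
  unfolding lower_def by (intro cSup_least) auto

lemma lower_le_\<Lambda>: "s \<in> {c..d} \<Longrightarrow> lower s \<le> \<Lambda> s"
  by (rule lower_le) (auto intro: mono)

lemma \<Lambda>_le_upper: "s \<in> {c..d} \<Longrightarrow> \<Lambda> s \<le> upper s"
  by (rule le_upper) (auto intro: mono)

lemma jump_nonneg: "0 \<le> jump s"
  using lower_le_\<Lambda>[of s] \<Lambda>_le_upper[of s] by (auto simp: jump_def)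

text \<open>Jumps at different points occupy disjoint parts of the range of
  \<open>\<Lambda>\<close>; adding points in increasing order makes the sum telescope.\<close>

lemma sum_jump_less:
  assumes "finite T" "T \<subseteq> {c..d}" "x \<in> {c..d}" "\<And>t. t \<in> T \<Longrightarrow> t < x"
  shows "sum jump T \<le> lower x - \<Lambda> c"
  using assms
proof (induction T arbitrary: x rule: finite_linorder_max_induct)
  case empty
  then show ?case using le_lower_end[of x] by simp
next
  case (insert m T)
  then have m: "m \<in> {c..d}" "m < x" by auto
  have "sum jump T \<le> lower m - \<Lambda> c" by (rule insert.IH) (use insert m in auto)
  \<comment> \<open>The midpoint of \<open>m\<close> and \<open>x\<close> separates the two
    one-sided limits.\<close>
  moreover have "upper m \<le> lower x"
    using upper_le[of m "(m + x)/2"] le_lower[of "(m + x)/2" x] m insert.prems by auto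
  moreover have "sum jump (insert m T) = jump m + sum jump T"
    using insert.hyps by (intro sum.insert) auto
  moreover have "jump m = upper m - lower m" using m by (simp add: jump_def)
  ultimately show ?case by linarith
qed

lemma sum_jump:
  assumes "finite T"
  shows "sum jump T \<le> d - c"
proof -
  have "sum jump T = sum jump (T \<inter> {c..d})"
    using assms by (intro sum.mono_neutral_right) (auto simp: jump_def)
  \<comment> \<open>The endpoint \<open>d\<close> is split off because \<open>sum_jump_less\<close>
    counts only points to the left of its bound.\<close>
  also have "\<dots> \<le> sum jump (insert d ((T \<inter> {c..d}) - {d}))"
    using assms by (intro sum_mono2 jump_nonneg) auto
  also have "\<dots> = jump d + sum jump ((T \<inter> {c..d}) - {d})"
    using assms by (subst sum.insert) auto
  also have "sum jump ((T \<inter> {c..d}) - {d}) \<le> lower d - \<Lambda> c"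
    using assms cd by (intro sum_jump_less) auto
  also have "jump d \<le> \<Lambda> d - lower d"
    using upper_le_end[of d] cd by (simp add: jump_def)
  finally show ?thesis using range[of c] range[of d] cd by simp
qed

lemma jump_summable: "jump summable_on S"
proof (rule nonneg_bdd_above_summable_on)
  show "bdd_above (sum jump ` {F. F \<subseteq> S \<and> finite F})"
    by (rule bdd_aboveI[of _ "d - c"]) (use sum_jump in auto)
qed (rule jump_nonneg)

lemma jump_infsum: "infsum jump UNIV \<le> d - c"
  by (rule infsum_le_finite_sums[OF jump_summable]) (rule sum_jump)

lemma jump_le_infsum: "s \<in> S \<Longrightarrow> jump s \<le> infsum jump S"
  by (rule infsum_ge_member) (auto intro: jump_summable jump_nonneg)

text \<open>If \<open>\<Lambda> x < x\<close>, let \<open>s\<close> be the end of the stretch from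
  \<open>x\<close> on which \<open>\<Lambda>\<close> keeps its value. If \<open>s = y\<close>, the
  jump at \<open>y\<close> contains the whole increase. Otherwise \<open>\<Lambda>\<close> jumps at
  \<open>s\<close> from at most \<open>\<Lambda> x\<close> to at least \<open>s\<close>, which makes
  up for the deficit \<open>x - \<Lambda> x\<close>.\<close>

lemma escape_left:
  assumes xy: "c \<le> x" "x < y" "y \<le> d"
  shows "x \<le> \<Lambda> x + infsum jump {x..<y} \<or> \<Lambda> y - \<Lambda> x \<le> infsum jump {x<..y}"
proof (cases "x \<le> \<Lambda> x")
  case True
  then show ?thesis using infsum_nonneg[of "{x..<y}" jump] jump_nonneg by auto
next
  case False
  define Z where "Z = {z \<in> {x..y}. \<Lambda> z = \<Lambda> x}"
  define s where "s = Sup Z"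
  have Z: "x \<in> Z" "bdd_above Z" using xy by (auto simp: Z_def intro: bdd_aboveI[of _ y])
  have xs: "x \<le> s" "s \<le> y"
    unfolding s_def using Z by (auto intro!: cSup_upper cSup_least simp: Z_def)
  have low: "lower s \<le> \<Lambda> x"
  proof (rule lower_le)
    fix z assume z: "c \<le> z" "z < s"
    then obtain z' where "z' \<in> Z" "z < z'" unfolding s_def using less_cSup_iff[of Z] Z by blast
    then show "\<Lambda> z \<le> \<Lambda> x" using mono[of z z'] z xs xy by (auto simp: Z_def)
  qed (use mono[of c x] xy in auto)
  show ?thesis
  proof (cases "s < y")
    case True
    \<comment> \<open>If \<open>\<Lambda> z < s\<close>, the interval of constancy from
      \<open>\<Lambda> z\<close> to \<open>z\<close> would reach back into the stretch and prolong
      it beyond \<open>s\<close>.\<close>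
    have near: "s \<le> \<Lambda> z" if z: "s < z" "z \<le> y" for z
    proof (rule ccontr)
      assume "\<not> s \<le> \<Lambda> z"
      then obtain z' where z': "z' \<in> Z" "\<Lambda> z < z'" unfolding s_def using less_cSup_iff[of Z] Z
        by (metis empty_iff not_le)
      then have "z' \<le> z" using cSup_upper[OF z'(1) Z(2)] z by (simp add: s_def)
      then have "u z' = u z" using const_left[of z z'] z z' xy xs by (auto simp: Z_def)
      then have "z \<in> Z" using z z'(1) xs eq_\<Lambda>[of z' z] by (auto simp: Z_def)
      then show False using cSup_upper[OF _ Z(2), of z] z by (simp add: s_def)
    qed
    have "s \<le> upper s"
    proof (rule le_upper)
      fix z assume z: "s < z" "z \<le> d"
      show "s \<le> \<Lambda> z"
        using near[of z] near[of y] mono[of y z] z xy xs True by (cases "z \<le> y") auto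
    next
      show "s \<le> \<Lambda> d" using near[of y] mono[of y d] True xy by auto
    qed
    then have "s - \<Lambda> x \<le> jump s" using low xs xy by (simp add: jump_def)
    then show ?thesis using jump_le_infsum[of s "{x..<y}"] True xs by auto
  next
    case False
    then have "s = y" using xs by simp
    then have "\<Lambda> y - \<Lambda> x \<le> jump y" using low \<Lambda>_le_upper[of y] xy by (simp add: jump_def)
    then show ?thesis using jump_le_infsum[of y "{x<..y}"] xy by auto
  qed
qed

text \<open>The mirror image of \<open>escape_left\<close>, with the beginning of the stretch on
  which \<open>\<Lambda>\<close> equals \<open>\<Lambda> y\<close>.\<close>

lemma escape_right:
  assumes xy: "c \<le> x" "x < y" "y \<le> d"
  shows "\<Lambda> y - infsum jump {x<..y} \<le> y \<or> \<Lambda> y - \<Lambda> x \<le> infsum jump {x..<y}"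
proof (cases "\<Lambda> y \<le> y")
  case True
  then show ?thesis using infsum_nonneg[of "{x<..y}" jump] jump_nonneg by auto
next
  case False
  define Z where "Z = {z \<in> {x..y}. \<Lambda> z = \<Lambda> y}"
  define s where "s = Inf Z"
  have Z: "y \<in> Z" "bdd_below Z" using xy by (auto simp: Z_def intro: bdd_belowI[of _ x])
  have xs: "x \<le> s" "s \<le> y"
    unfolding s_def using Z by (auto intro!: cInf_lower cInf_greatest simp: Z_def)
  have up: "\<Lambda> y \<le> upper s"
  proof (rule le_upper)
    fix z assume z: "s < z" "z \<le> d"
    then obtain z' where "z' \<in> Z" "z' < z" unfolding s_def using cInf_less_iff[of Z] Z by blast
    then show "\<Lambda> y \<le> \<Lambda> z" using mono[of z' z] z xs xy by (auto simp: Z_def)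
  qed (use mono[of y d] xy in auto)
  show ?thesis
  proof (cases "x < s")
    case True
    have near: "\<Lambda> z \<le> s" if z: "x \<le> z" "z < s" for z
    proof (rule ccontr)
      assume "\<not> \<Lambda> z \<le> s"
      then obtain z' where z': "z' \<in> Z" "z' < \<Lambda> z" unfolding s_def using cInf_less_iff[of Z] Z
        by (metis empty_iff not_le)
      then have "z \<le> z'" using cInf_lower[OF z'(1) Z(2)] z by (simp add: s_def)
      then have "u z' = u z" using const_right[of z z'] z z' xy xs by (auto simp: Z_def)
      then have "z \<in> Z" using z z'(1) xs eq_\<Lambda>[of z' z] by (auto simp: Z_def)
      then show False using cInf_lower[OF _ Z(2), of z] z by (simp add: s_def)
    qed
    have "lower s \<le> s"
    proof (rule lower_le)
      fix z assume z: "c \<le> z" "z < s"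
      show "\<Lambda> z \<le> s"
        using near[of z] near[of x] mono[of z x] z xy xs True by (cases "x \<le> z") auto
    next
      show "\<Lambda> c \<le> s" using near[of x] mono[of c x] True xy by auto
    qed
    then have "\<Lambda> y - s \<le> jump s" using up xs xy by (simp add: jump_def)
    then show ?thesis using jump_le_infsum[of s "{x<..y}"] True xs by auto
  next
    case False
    then have "s = x" using xs by simp
    then have "\<Lambda> y - \<Lambda> x \<le> jump x" using up lower_le_\<Lambda>[of x] xy by (simp add: jump_def)
    then show ?thesis using jump_le_infsum[of x "{x..<y}"] xy by auto
  qed
qed

text \<open>By the two escape lemmas \<open>\<Lambda>\<close> follows the identity up to its jumps,
  so its increments are at most \<open>y - x\<close> plus jumps; \<open>lipschitz_\<Lambda>\<close>
  hands this over to \<open>u\<close>. The jumps are charged on both sides of a point, whence the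
  factor 2.\<close>

lemma jump_bound: "jump_bound C (2 * C * (d - c)) c d u"
proof -
  define a where "a s = C * jump s" for s
  have sa: "a summable_on UNIV" unfolding a_def by (intro summable_on_cmult_right jump_summable)
  have ia: "infsum a S = C * infsum jump S" for S
    unfolding a_def by (intro infsum_cmult_right jump_summable)
  have "infsum a UNIV + infsum a UNIV \<le> 2 * C * (d - c)"
    unfolding ia using mult_left_mono[OF jump_infsum C] by simp
  moreover have "norm (u y - u x) \<le> C * (y - x) + infsum a {x<..y} + infsum a {x..<y}"
    if xy: "c \<le> x" "x < y" "y \<le> d" for x y
  proof -
    have "infsum jump {x<..y} \<ge> 0" "infsum jump {x..<y} \<ge> 0" by (auto intro!: infsum_nonneg jump_nonneg)
    then have "\<Lambda> y - \<Lambda> x \<le> (y - x) + infsum jump {x<..y} + infsum jump {x..<y}"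
      using escape_left[OF xy] escape_right[OF xy] xy by linarith
    moreover have "norm (u y - u x) \<le> C * (\<Lambda> y - \<Lambda> x)"
      using lipschitz_\<Lambda>[of x y] mono[of x y] xy by auto
    ultimately show ?thesis
      using mult_left_mono[OF _ C, of "\<Lambda> y - \<Lambda> x" "(y - x) + infsum jump {x<..y} + infsum jump {x..<y}"]
      by (simp add: ia algebra_simps)
  qed
  ultimately show ?thesis
    unfolding jump_bound_def using sa C jump_nonneg
    by (intro exI[of _ a] conjI allI impI) (auto simp: a_def jump_def)
qed

end

text \<open>\<open>u\<close> is a trajectory near one eigenvalue \<open>l\<close>; \<open>M\<close> is a bound for the oscillation of \<open>u\<close>
  between \<open>x\<close> and \<open>y\<close> that multiplies all error terms, which is what makes constancy propagate.\<close>

locale eigenvalue_trajectory =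
  fixes c d :: real and u :: "real \<Rightarrow> 'a::real_normed_vector" and l :: "'a \<Rightarrow> real" and C K :: real
  assumes cd: "c \<le> d" and C: "C > 0"
    and K: "\<And>x y. \<lbrakk>x \<in> {c..d}; y \<in> {c..d}\<rbrakk> \<Longrightarrow> norm (u y - u x) \<le> K"
    and lip: "\<And>x y. \<lbrakk>x \<in> {c..d}; y \<in> {c..d}; l (u x) = x; l (u y) = y\<rbrakk> \<Longrightarrow> norm (u y - u x) \<le> C * \<bar>y - x\<bar>"

text \<open>In contrast to the nonlinear case, \<open>pair\<close> contains no term quadratic in the
  jump, so constancy follows from it in both directions without the entropy.\<close>

locale degenerate_trajectory = eigenvalue_trajectory +
  assumes pair: "\<And>x y M. \<lbrakk>x \<in> {c..d}; y \<in> {c..d}; x \<noteq> y; \<And>z. z \<in> closed_segment x y \<Longrightarrow> norm (u z - u x) \<le> M\<rbrakk>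
     \<Longrightarrow> \<bar>l (u x) - y\<bar> * norm (u y - u x) \<le> C * M * \<bar>y - x\<bar>"
begin

lemma reflect: "degenerate_trajectory (- d) (- c) (\<lambda>x. u (- x)) (\<lambda>v. - l v) C K"
proof
  show "norm (u (- y) - u (- x)) \<le> C * \<bar>y - x\<bar>"
    if "x \<in> {- d..- c}" "y \<in> {- d..- c}" "- l (u (- x)) = x" "- l (u (- y)) = y" for x y
    using lip[of "- x" "- y"] that by (auto simp: abs_minus_commute)
  show "\<bar>- l (u (- x)) - y\<bar> * norm (u (- y) - u (- x)) \<le> C * M * \<bar>y - x\<bar>"
    if "x \<in> {- d..- c}" "y \<in> {- d..- c}" "x \<noteq> y"
      and M: "\<And>z. z \<in> closed_segment x y \<Longrightarrow> norm (u (- z) - u (- x)) \<le> M" for x y M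
  proof -
    have "norm (u z - u (- x)) \<le> M" if "z \<in> closed_segment (- x) (- y)" for z
      using M[of "- z"] that by (auto simp: closed_segment_eq_real_ivl split: if_splits)
    then have "\<bar>l (u (- x)) - - y\<bar> * norm (u (- y) - u (- x)) \<le> C * M * \<bar>- y - - x\<bar>"
      by (intro pair) (use that in auto)
    moreover have "\<bar>- l (u (- x)) - y\<bar> = \<bar>l (u (- x)) - - y\<bar>" "\<bar>- y - - x\<bar> = \<bar>y - x\<bar>" by linarith+
    ultimately show ?thesis by simp
  qed
qed (use cd C K in auto)

text \<open>While \<open>u\<close> keeps its value, the moving point only gets farther from
  \<open>l (u x)\<close>, so the factor in \<open>pair\<close> stays at least \<open>w\<close> and
  can be divided out.\<close>

lemma const_right:
  assumes x: "x \<in> {c..d}" "y \<in> {c..d}" "l (u x) < x" "x \<le> y"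
  shows "u y = u x"
proof -
  define w where "w = x - l (u x)"
  have w: "w > 0" using x by (simp add: w_def)
  show ?thesis
  proof (rule constancy_propagates[where p = x and q = d and h = 1 and C = "C / w" and K = K])
    fix p q M assume pq: "x \<le> p" "p < q" "q \<le> d" and u: "u p = u x"
      and M: "\<And>z. p \<le> z \<Longrightarrow> z \<le> q \<Longrightarrow> norm (u z - u x) \<le> M"
    have "w * norm (u q - u p) \<le> \<bar>l (u p) - q\<bar> * norm (u q - u p)"
      using pq by (intro mult_right_mono) (auto simp: u w_def)
    also have "\<dots> \<le> C * M * \<bar>q - p\<bar>"
      by (rule pair) (use x pq M u in \<open>auto simp: closed_segment_eq_real_ivl\<close>)
    finally show "norm (u q - u x) \<le> C / w * M * (q - p)"
      using w pq by (simp add: u field_simps)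
  qed (use x C w K in auto)
qed

lemma const_left:
  assumes "x \<in> {c..d}" "y \<in> {c..d}" "l (u x) > x" "y \<le> x"
  shows "u y = u x"
  using degenerate_trajectory.const_right[OF reflect, of "- x" "- y"] assms by simp

lemma jump_bound: "jump_bound C (4 * K) c d u"
proof (rule jump_bound_two_jumps[where \<Lambda> = "\<lambda>x. l (u x)"])
  show "u y = u x" if "x \<in> {c..d}" "y \<in> {c..d}" "l (u x) < x" "x \<le> y" for x y
    by (rule const_right) (use that in auto)
  show "u y = u x" if "x \<in> {c..d}" "y \<in> {c..d}" "l (u x) > x" "y \<le> x" for x y
    by (rule const_left) (use that in auto)
qed (use K lip C cd in auto)

end

text \<open>Here \<open>\<sigma>\<close> is the direction of time; shocks are Lax shocks for \<open>\<sigma> = 1\<close> and reversed Lax shocks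
  for \<open>\<sigma> = -1\<close>.\<close>

locale nonlinear_trajectory = eigenvalue_trajectory +
  fixes \<sigma> :: real
  assumes pair_entropy: "\<And>x y M. \<lbrakk>x \<in> {c..d}; y \<in> {c..d}; x \<noteq> y; \<And>z. z \<in> closed_segment x y \<Longrightarrow> norm (u z - u x) \<le> M;
     \<sigma> * sgn (y - x) * (l (u x) - y) \<le> 0\<rbrakk> \<Longrightarrow> norm (u y - u x) ^ 3 \<le> C * M * \<bar>y - x\<bar>"
    and pair: "\<And>x y M. \<lbrakk>x \<in> {c..d}; y \<in> {c..d}; x \<noteq> y; \<And>z. z \<in> closed_segment x y \<Longrightarrow> norm (u z - u x) \<le> M\<rbrakk>
     \<Longrightarrow> \<bar>l (u x) - y\<bar> * norm (u y - u x) \<le> C * norm (u y - u x) ^ 2 + C * M * \<bar>y - x\<bar>"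
begin

lemma reflect: "nonlinear_trajectory (- d) (- c) (\<lambda>x. u (- x)) (\<lambda>v. - l v) C K \<sigma>"
proof
  show "norm (u (- y) - u (- x)) \<le> C * \<bar>y - x\<bar>"
    if "x \<in> {- d..- c}" "y \<in> {- d..- c}" "- l (u (- x)) = x" "- l (u (- y)) = y" for x y
    using lip[of "- x" "- y"] that by (auto simp: abs_minus_commute)
  have seg: "norm (u z - u (- x)) \<le> M"
    if "\<And>z. z \<in> closed_segment x y \<Longrightarrow> norm (u (- z) - u (- x)) \<le> M" "z \<in> closed_segment (- x) (- y)" for x y z M
    using that(1)[of "- z"] that(2) by (auto simp: closed_segment_eq_real_ivl split: if_splits)
  show "\<bar>- l (u (- x)) - y\<bar> * norm (u (- y) - u (- x)) \<le> C * norm (u (- y) - u (- x)) ^ 2 + C * M * \<bar>y - x\<bar>"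
    if "x \<in> {- d..- c}" "y \<in> {- d..- c}" "x \<noteq> y"
      and M: "\<And>z. z \<in> closed_segment x y \<Longrightarrow> norm (u (- z) - u (- x)) \<le> M" for x y M
  proof -
    have "\<bar>l (u (- x)) - - y\<bar> * norm (u (- y) - u (- x)) \<le> C * norm (u (- y) - u (- x)) ^ 2 + C * M * \<bar>- y - - x\<bar>"
      by (rule pair) (use that seg[OF M] in auto)
    moreover have "\<bar>- l (u (- x)) - y\<bar> = \<bar>l (u (- x)) - - y\<bar>" "\<bar>- y - - x\<bar> = \<bar>y - x\<bar>" by linarith+
    ultimately show ?thesis by simp
  qed
  show "norm (u (- y) - u (- x)) ^ 3 \<le> C * M * \<bar>y - x\<bar>"
    if "x \<in> {- d..- c}" "y \<in> {- d..- c}" "x \<noteq> y"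
      and M: "\<And>z. z \<in> closed_segment x y \<Longrightarrow> norm (u (- z) - u (- x)) \<le> M"
      and s: "\<sigma> * sgn (y - x) * (- l (u (- x)) - y) \<le> 0" for x y M
  proof -
    have "sgn (- y - - x) = - sgn (y - x)" by (simp add: sgn_if)
    then have "\<sigma> * sgn (- y - - x) * (l (u (- x)) - - y) = \<sigma> * sgn (y - x) * (- l (u (- x)) - y)"
      by (simp add: algebra_simps)
    then have "\<sigma> * sgn (- y - - x) * (l (u (- x)) - - y) \<le> 0" using s by (simp only:)
    then have "norm (u (- y) - u (- x)) ^ 3 \<le> C * M * \<bar>- y - - x\<bar>"
      by (rule pair_entropy[rotated 4]) (use that(1-3) seg[OF M] in auto)
    moreover have "\<bar>- y - - x\<bar> = \<bar>y - x\<bar>" by linarith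
    ultimately show ?thesis by simp
  qed
qed (use cd C K in auto)

text \<open>The quadratic term of \<open>pair\<close> has to be absorbed first: the entropy estimate
  makes jumps over short steps so small that this term is at most \<open>w / 2\<close> times the
  jump. What is left is the hypothesis of \<open>constancy_propagates\<close>.\<close>

lemma const_right:
  assumes x: "x \<in> {c..d}" "q \<le> d" and w: "w > 0" and sep: "\<And>y. x \<le> y \<Longrightarrow> y \<le> q \<Longrightarrow> \<sigma> * (l (u x) - y) \<le> - w"
    and \<sigma>: "\<bar>\<sigma>\<bar> = 1" and y: "x \<le> y" "y \<le> q"
  shows "u y = u x"
proof -
  have K0: "K \<ge> 0" using K[OF x(1) x(1)] by simp
  \<comment> \<open>Steps of this length give \<open>norm (u r - u p) \<le> w / (2 * C)\<close>
    through the cubic entropy estimate.\<close>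
  define h where "h = (w / (2 * C)) ^ 3 / (C * (K + 1))"
  have h: "h > 0" using w C K0 by (simp add: h_def)
  show ?thesis
  proof (rule constancy_propagates[where p = x and q = q and h = h and C = "2 * C / w" and K = K])
    fix p r M assume pr: "x \<le> p" "p < r" "r \<le> q" "r - p \<le> h" and u: "u p = u x"
      and M: "\<And>z. p \<le> z \<Longrightarrow> z \<le> r \<Longrightarrow> norm (u z - u x) \<le> M"
    have pd: "p \<in> {c..d}" "r \<in> {c..d}" "p \<noteq> r" using pr x by auto
    have sep': "\<sigma> * (l (u p) - r) \<le> - w" using sep[of r] pr u by simp
    let ?D = "norm (u r - u p)"
    have "?D ^ 3 \<le> C * K * \<bar>r - p\<bar>"
    proof (rule pair_entropy[OF pd])
      show "norm (u z - u p) \<le> K" if "z \<in> closed_segment p r" for z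
        using that pr x by (intro K) (auto simp: closed_segment_eq_real_ivl)
      show "\<sigma> * sgn (r - p) * (l (u p) - r) \<le> 0" using sep' w pr by simp
    qed
    also have "\<dots> \<le> C * (K + 1) * h" using pr K0 C by (intro mult_mono) auto
    also have "\<dots> = (w / (2 * C)) ^ 3" using C K0 by (simp add: h_def)
    finally have "?D \<le> w / (2 * C)" by (rule power_le_imp_le_base[of _ 2, simplified]) (use w C in simp)
    then have "C * ?D \<le> w / 2" using C by (simp add: field_simps)
    then have "C * ?D * ?D \<le> w / 2 * ?D" by (rule mult_right_mono) simp
    moreover have "w * ?D \<le> \<bar>l (u p) - r\<bar> * ?D"
    proof (rule mult_right_mono)
      have "w \<le> \<bar>\<sigma> * (l (u p) - r)\<bar>" using sep' by linarith
      then show "w \<le> \<bar>l (u p) - r\<bar>" using \<sigma> by (simp add: abs_mult)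
    qed simp
    moreover have "\<bar>l (u p) - r\<bar> * ?D \<le> C * ?D ^ 2 + C * M * \<bar>r - p\<bar>"
      by (rule pair[OF pd]) (use pr M u in \<open>auto simp: closed_segment_eq_real_ivl\<close>)
    ultimately have "w / 2 * ?D \<le> C * M * (r - p)" using pr by (simp add: power2_eq_square)
    then show "norm (u r - u x) \<le> 2 * C / w * M * (r - p)" using w by (simp add: u field_simps)
  qed (use x h C w K y in auto)
qed

lemma const_left:
  assumes x: "x \<in> {c..d}" "c \<le> q" and w: "w > 0" and sep: "\<And>y. q \<le> y \<Longrightarrow> y \<le> x \<Longrightarrow> \<sigma> * (y - l (u x)) \<le> - w"
    and \<sigma>: "\<bar>\<sigma>\<bar> = 1" and y: "q \<le> y" "y \<le> x"
  shows "u y = u x"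
proof -
  interpret R: nonlinear_trajectory "- d" "- c" "\<lambda>x. u (- x)" "\<lambda>v. - l v" C K \<sigma> by (rule reflect)
  have "\<sigma> * (- l (u (- (- x))) - y) \<le> - w" if "- x \<le> y" "y \<le> - q" for y
    using sep[of "- y"] that by (simp add: algebra_simps)
  then show ?thesis using R.const_right[of "- x" "- q" w "- y"] assms by auto
qed

text \<open>For \<open>\<sigma> = 1\<close> constancy runs away from the eigenvalue, where the
  separation only grows, so it reaches the end of the interval.\<close>

lemma jump_bound_forward:
  assumes "\<sigma> = 1"
  shows "jump_bound C (4 * K) c d u"
proof (rule jump_bound_two_jumps[where \<Lambda> = "\<lambda>x. l (u x)"])
  show "u y = u x" if "x \<in> {c..d}" "y \<in> {c..d}" "l (u x) < x" "x \<le> y" for x y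
    by (rule const_right[where w = "x - l (u x)" and q = d]) (use that assms in auto)
  show "u y = u x" if "x \<in> {c..d}" "y \<in> {c..d}" "l (u x) > x" "y \<le> x" for x y
    by (rule const_left[where w = "l (u x) - x" and q = c]) (use that assms in auto)
qed (use K lip C cd in auto)

text \<open>At \<open>y = l (u x)\<close> the separation has shrunk to zero, so
  \<open>const_right\<close> stops short of \<open>y\<close>. The cubic entropy estimate from points
  \<open>z\<close> close to \<open>y\<close> closes the gap.\<close>

lemma const_end:
  assumes x: "x \<in> {c..d}" "x < y" "y \<in> {c..d}" "l (u x) = y" and const: "\<And>z. x \<le> z \<Longrightarrow> z < y \<Longrightarrow> u z = u x"
  shows "u y = u x"
proof -
  have K0: "K \<ge> 0" using K[OF x(1) x(1)] by simp
  have *: "norm (u y - u x) ^ 3 \<le> C * K * (y - z)" if z: "x \<le> z" "z < y" for z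
  proof -
    have "norm (u y - u z) ^ 3 \<le> C * K * \<bar>y - z\<bar>"
    proof (rule pair_entropy)
      show "norm (u r - u z) \<le> K" if "r \<in> closed_segment z y" for r
        using that z x by (intro K) (auto simp: closed_segment_eq_real_ivl)
      show "\<sigma> * sgn (y - z) * (l (u z) - y) \<le> 0" using const[OF z] x by simp
    qed (use x z in auto)
    then show ?thesis using const[OF z] z by simp
  qed
  have "norm (u y - u x) ^ 3 \<le> 0 + e" if "e > 0" for e
  proof -
    define z where "z = max x (y - e / (C * (K + 1)))"
    have "C * K * (y - z) \<le> C * (K + 1) * (e / (C * (K + 1)))"
      using x K0 C that by (intro mult_mono) (auto simp: z_def)
    also have "\<dots> = e" using C K0 by simp
    finally show ?thesis using *[of z] x C K0 that by (auto simp: z_def)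
  qed
  then have "norm (u y - u x) ^ 3 \<le> 0" by (rule field_le_epsilon)
  then show ?thesis by (simp add: power_le_zero_eq)
qed

text \<open>For \<open>\<sigma> = -1\<close> the sign condition holds on the way from
  \<open>x\<close> towards \<open>l (u x)\<close>, with a separation that is positive until the end;
  \<open>const_end\<close> adds the endpoint.\<close>

lemma const_to_eigenvalue:
  assumes \<sigma>: "\<sigma> = -1" and range: "\<And>x. x \<in> {c..d} \<Longrightarrow> l (u x) \<in> {c..d}"
    and x: "x \<in> {c..d}" and y: "x \<le> y" "y \<le> l (u x)"
  shows "u y = u x"
proof -
  have part: "u z = u x" if "x \<le> z" "z < l (u x)" for z
    by (rule const_right[where w = "l (u x) - z" and q = z]) (use that x range[OF x] \<sigma> in auto)
  show ?thesis
  proof (cases "y = l (u x) \<and> x < y")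
    case True
    show ?thesis
    proof (rule const_end[OF x])
      show "u z = u x" if "x \<le> z" "z < y" for z by (rule part) (use that True in auto)
    qed (use True range[OF x] in auto)
  next
    case False
    then show ?thesis using part[of y] y by (cases "y = x") auto
  qed
qed

end

text \<open>\<open>range\<close> keeps the interval between a point and its eigenvalue inside
  \<open>{c..d}\<close>, which turns constancy in both directions into a case of
  \<open>centered_shocks\<close>.\<close>

lemma (in nonlinear_trajectory) jump_bound_backward:
  assumes \<sigma>: "\<sigma> = -1" and range: "\<And>x. x \<in> {c..d} \<Longrightarrow> l (u x) \<in> {c..d}"
  shows "jump_bound C (2 * C * (d - c)) c d u"
proof -
  interpret R: nonlinear_trajectory "- d" "- c" "\<lambda>x. u (- x)" "\<lambda>v. - l v" C K \<sigma> by (rule reflect)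
  interpret centered_shocks c d u l "\<lambda>x. l (u x)" C
  proof
    show "u y = u x" if "x \<in> {c..d}" "x \<le> y" "y \<le> l (u x)" for x y
      using const_to_eigenvalue[OF \<sigma> range] that by blast
    have "- l (u (- x)) \<in> {- d..- c}" if "x \<in> {- d..- c}" for x
      using range[of "- x"] that by auto
    then show "u y = u x" if "x \<in> {c..d}" "y \<le> x" "l (u x) \<le> y" for x y
      using R.const_to_eigenvalue[OF \<sigma>, of "- x" "- y"] that by auto
  qed (use cd C lip range in auto)
  show ?thesis by (rule jump_bound)
qed

section \<open>Degenerate and nonlinear fields\<close>

context pencil_eigenvalue begin

text \<open>Euler polygons along the eigenspaces stay, up to errors that vanish with the mesh, on a level
  set of \<open>l\<close> and of \<open>G (l u0)\<close>; a minimizer of the error over a compact set does so exactly.  This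
  replaces an integral manifold of the eigenspaces.\<close>

lemma degenerate_path:
  assumes e1: "e1 < \<delta>" and deg: "\<And>z v. z \<in> cball Ub e1 \<Longrightarrow> v \<in> E z \<Longrightarrow> Dl z v = 0"
    and ev: "\<And>z r. z \<in> cball Ub e1 \<Longrightarrow> r \<in> E Ub \<Longrightarrow> \<exists>r'\<in>E z. r' - r \<in> Ec Ub \<and> norm (r' - r) \<le> w * norm r"
    and w: "0 \<le> w" "w \<le> 1" and a: "a \<in> E Ub" and u0: "norm (u0 - Ub) + 2 * norm a \<le> e1"
  shows "\<exists>u'\<in>cball Ub e1. u' - u0 - a \<in> Ec Ub \<and> norm (u' - u0 - a) \<le> w * norm a \<and> l u' = l u0 \<and> G (l u0) u' = G (l u0) u0"
proof -
  let ?lam = "l u0"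
  have sub: "\<And>z. z \<in> cball Ub e1 \<Longrightarrow> z \<in> ball Ub \<delta>" using e1 by auto
  have near: "z \<in> cball Ub e1" if "norm (z - u0 - t *\<^sub>R a) \<le> t * (w * norm a)" "0 \<le> t" "t \<le> 1" for z t
  proof -
    have "t * (w * norm a) \<le> 1 * (1 * norm a)" using that w by (intro mult_mono) auto
    moreover have "norm (t *\<^sub>R a) \<le> norm a" using that by (simp add: mult_left_le_one_le)
    moreover have "z - Ub = (z - u0 - t *\<^sub>R a) + (u0 - Ub) + t *\<^sub>R a" by simp
    then have "norm (z - Ub) \<le> norm (z - u0 - t *\<^sub>R a) + norm (u0 - Ub) + norm (t *\<^sub>R a)"
      by (metis norm_triangle_le norm_triangle_ineq add_right_mono)
    ultimately have "norm (z - Ub) \<le> e1" using that(1) u0 by linarith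
    then show ?thesis by (simp add: dist_norm norm_minus_commute)
  qed
  \<comment> \<open>Candidates for the endpoint: \<open>u0 + a\<close> corrected within the
    complement \<open>Ec Ub\<close>. The set is compact, so the least error is attained.\<close>
  define K where "K = (\<lambda>y. u0 + a + y) ` (Ec Ub \<inter> cball 0 (w * norm a))"
  have K: "z \<in> K \<longleftrightarrow> z - u0 - a \<in> Ec Ub \<and> norm (z - u0 - a) \<le> w * norm a" for z
    unfolding K_def by (auto simp: image_iff algebra_simps intro!: bexI[of _ "z - u0 - a"])
  have Kc: "compact K" unfolding K_def
    by (intro compact_continuous_image continuous_intros closed_Int_compact closed_subspace subspace_Ec compact_cball)
  have "u0 + a \<in> K" using subspace_0[OF subspace_Ec] w by (simp add: K)
  then have Kne: "K \<noteq> {}" by blast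
  have Kb: "z \<in> cball Ub e1" if "z \<in> K" for z using near[of z 1] that by (simp add: K)
  define h where "h z = norm (G ?lam z - G ?lam u0) + \<bar>l z - l u0\<bar>" for z
  have Gc: "continuous_on (cball Ub e1) (G ?lam)" and lc: "continuous_on (cball Ub e1) l"
    using has_derivative_continuous[OF G] isCont_l sub by (auto intro!: continuous_at_imp_continuous_on)
  have "continuous_on K h" unfolding h_def
    by (intro continuous_intros continuous_on_subset[OF Gc] continuous_on_subset[OF lc] subsetI Kb)
  then obtain u' where u': "u' \<in> K" "\<And>z. z \<in> K \<Longrightarrow> h u' \<le> h z"
    using continuous_attains_inf[OF Kc Kne] by blast
  have Dlc: "continuous_on (cball Ub e1) Dl" using Dl sub continuous_on_subset by blast
  have Lc: "continuous_on (cball Ub e1) (L ?lam)"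
    using has_derivative_continuous[OF L] sub by (auto intro!: continuous_at_imp_continuous_on)
  have "continuous_on (cball Ub e1) X" using isCont_data sub by (auto intro!: continuous_at_imp_continuous_on)
  then have "bounded (X ` cball Ub e1)" by (intro compact_imp_bounded compact_continuous_image compact_cball)
  then obtain Bx where Bx: "Bx > 0" "\<And>z. z \<in> cball Ub e1 \<Longrightarrow> norm (X z) \<le> Bx" unfolding bounded_pos by auto
  define Q where "Q = 2 * norm a + (2 * norm a + 2 * norm a * Bx * (2 * norm a))"
  have Q: "Q \<ge> 0" using Bx(1) by (simp add: Q_def)
  have small: "h u' \<le> \<eta> * Q" if \<eta>: "\<eta> > 0" for \<eta>
  proof -
    obtain d1 where d1: "d1 > 0" "\<And>x y. \<lbrakk>x \<in> cball Ub e1; y \<in> cball Ub e1; dist y x < d1\<rbrakk> \<Longrightarrow> dist (Dl y) (Dl x) < \<eta>"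
      using compact_uniformly_continuous[OF Dlc compact_cball] \<eta> unfolding uniformly_continuous_on_def by metis
    obtain d2 where d2: "d2 > 0" "\<And>x y. \<lbrakk>x \<in> cball Ub e1; y \<in> cball Ub e1; dist y x < d2\<rbrakk> \<Longrightarrow> dist (L ?lam y) (L ?lam x) < \<eta>"
      using compact_uniformly_continuous[OF Lc compact_cball] \<eta> unfolding uniformly_continuous_on_def by metis
    define d where "d = min d1 d2"
    have d: "d > 0" "d \<le> d1" "d \<le> d2" using d1 d2 by (auto simp: d_def)
    obtain M where M: "2 * norm a / d < real M" using reals_Archimedean2 by blast
    define m where "m = Suc M"
    have m: "real m > 0" "2 * norm a < d * real m"
    proof -
      have "2 * norm a < d * real M" using M d(1) by (simp add: field_simps)
      also have "\<dots> \<le> d * real m" using d(1) by (intro mult_left_mono) (auto simp: m_def)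
      finally show "2 * norm a < d * real m" .
    qed (simp add: m_def)
    \<comment> \<open>\<open>A1\<close> bounds the drift of \<open>l\<close> along the whole polygon
      and \<open>A2\<close> that of \<open>G ?lam\<close>. The second part of \<open>A2\<close>
      arises because \<open>L ?lam\<close> meets eigenvectors that belong to the slightly different
      value \<open>l z\<close>.\<close>
    define A1 where "A1 = \<eta> * (2 * norm a)"
    define A2 where "A2 = \<eta> * (2 * norm a) + A1 * Bx * (2 * norm a)"
    have A1: "A1 \<ge> 0" using \<eta> by (simp add: A1_def)
    have "\<exists>z. z - u0 - (real k / real m) *\<^sub>R a \<in> Ec Ub \<and> norm (z - u0 - (real k / real m) *\<^sub>R a) \<le> (real k / real m) * (w * norm a) \<and>
       \<bar>l z - l u0\<bar> \<le> (real k / real m) * A1 \<and> norm (G ?lam z - G ?lam u0) \<le> (real k / real m) * A2" if "k \<le> m" for k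
      using that
    proof (induction k)
      case 0
      show ?case by (rule exI[of _ u0]) (simp add: subspace_0[OF subspace_Ec])
    next
      case (Suc k)
      let ?s = "real k / real m"
      have s: "0 \<le> ?s" "?s \<le> 1" "real (Suc k) / real m = ?s + 1 / real m" "?s + 1 / real m \<le> 1"
        using Suc.prems m(1) by (auto simp: field_simps)
      obtain z where z: "z - u0 - ?s *\<^sub>R a \<in> Ec Ub" "norm (z - u0 - ?s *\<^sub>R a) \<le> ?s * (w * norm a)"
        "\<bar>l z - l u0\<bar> \<le> ?s * A1" "norm (G ?lam z - G ?lam u0) \<le> ?s * A2"
        using Suc.IH Suc.prems by auto
      have zb: "z \<in> cball Ub e1" by (rule near[OF z(2) s(1,2)])
      obtain r where r: "r \<in> E z" "r - a \<in> Ec Ub" "norm (r - a) \<le> w * norm a" using ev[OF zb a] by blast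
      have "w * norm a \<le> norm a" using w by (simp add: mult_left_le_one_le)
      then have rn: "norm r \<le> 2 * norm a" using r(3) norm_triangle_sub[of r a] by linarith
      define v where "v = (1 / real m) *\<^sub>R r"
      have vn: "norm v \<le> (1 / real m) * (2 * norm a)" unfolding v_def using rn m(1) by (simp add: divide_right_mono)
      also have "\<dots> < d" using m by (simp add: field_simps)
      finally have vd: "norm v < d" .
      have vE: "v \<in> E z" unfolding v_def by (rule subspace_mul[OF subspace_E r(1)])
      let ?z = "z + v"
      have zeq: "?z - u0 - (?s + 1 / real m) *\<^sub>R a = (z - u0 - ?s *\<^sub>R a) + (1 / real m) *\<^sub>R (r - a)"
        by (simp add: v_def algebra_simps)
      have 1: "?z - u0 - (?s + 1 / real m) *\<^sub>R a \<in> Ec Ub"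
        unfolding zeq by (intro subspace_add subspace_mul subspace_Ec z r)
      have "norm (?z - u0 - (?s + 1 / real m) *\<^sub>R a) \<le> norm (z - u0 - ?s *\<^sub>R a) + norm ((1 / real m) *\<^sub>R (r - a))"
        unfolding zeq by (rule norm_triangle_ineq)
      also have "\<dots> \<le> ?s * (w * norm a) + (1 / real m) * (w * norm a)"
        using z(2) r(3) m(1) by (intro add_mono) (auto simp: divide_right_mono)
      finally have 2: "norm (?z - u0 - (?s + 1 / real m) *\<^sub>R a) \<le> (?s + 1 / real m) * (w * norm a)"
        by (simp only: distrib_right)
      have zb': "?z \<in> cball Ub e1" by (rule near[OF 2]) (use s m in auto)
      let ?S = "cball Ub e1 \<inter> ball z d"
      have S: "convex ?S" "z \<in> ?S" "?z \<in> ?S" using zb zb' vd d(1) by (auto simp: dist_norm intro: convex_Int)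
      have "norm (l ?z - l z - Dl z (?z - z)) \<le> \<eta> * norm (?z - z)"
      proof (rule linearization[OF S])
        show "norm (Dl y - Dl z) \<le> \<eta>" if "y \<in> ?S" for y
          using d1(2)[OF zb, of y] that d(2) by (auto simp: dist_norm norm_minus_commute)
      qed (use l sub in auto)
      then have l1: "\<bar>l ?z - l z\<bar> \<le> \<eta> * norm v" using deg[OF zb vE] by simp
      have \<eta>v: "\<eta> * norm v \<le> (1 / real m) * (\<eta> * (2 * norm a))" using mult_left_mono[OF vn, of \<eta>] \<eta> by simp
      have 3: "\<bar>l ?z - l u0\<bar> \<le> (?s + 1 / real m) * A1"
        using l1 \<eta>v z(3) unfolding A1_def distrib_right by linarith
      have "norm (G ?lam ?z - G ?lam z - L ?lam z (?z - z)) \<le> \<eta> * norm (?z - z)"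
      proof (rule linearization[OF S])
        show "norm (L ?lam y - L ?lam z) \<le> \<eta>" if "y \<in> ?S" for y
          using d2(2)[OF zb, of y] that d(3) by (auto simp: dist_norm norm_minus_commute)
      qed (use G sub in auto)
      then have G1: "norm (G ?lam ?z - G ?lam z - L ?lam z v) \<le> \<eta> * norm v" by simp
      have "L ?lam z v = (l z - ?lam) *\<^sub>R X z v"
        using vE by (simp add: E_iff L_def blinfun.diff_left blinfun.scaleR_left algebra_simps)
      then have "norm (L ?lam z v) = \<bar>l z - ?lam\<bar> * norm (X z v)" by simp
      also have "\<dots> \<le> A1 * (Bx * ((1 / real m) * (2 * norm a)))"
      proof (intro mult_mono)
        show "\<bar>l z - ?lam\<bar> \<le> A1" using z(3) mult_right_mono[OF s(2) A1] by simp
        show "norm (X z v) \<le> Bx * ((1 / real m) * (2 * norm a))"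
          using norm_blinfun[of "X z" v] mult_mono[OF Bx(2)[OF zb] vn] Bx(1) by fastforce
      qed (use A1 in auto)
      also have "\<dots> = (1 / real m) * (A1 * Bx * (2 * norm a))" by simp
      finally have L1: "norm (L ?lam z v) \<le> (1 / real m) * (A1 * Bx * (2 * norm a))" .
      have "G ?lam ?z - G ?lam u0 = (G ?lam ?z - G ?lam z - L ?lam z v) + L ?lam z v + (G ?lam z - G ?lam u0)" by simp
      then have "norm (G ?lam ?z - G ?lam u0) \<le> norm (G ?lam ?z - G ?lam z - L ?lam z v) + norm (L ?lam z v) + norm (G ?lam z - G ?lam u0)"
        by (metis norm_triangle_le norm_triangle_ineq add_right_mono)
      then have 4: "norm (G ?lam ?z - G ?lam u0) \<le> (?s + 1 / real m) * A2"
        using G1 \<eta>v L1 z(4) unfolding A2_def distrib_right distrib_left[of "1 / real m"] by linarith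
      show ?case unfolding s(3) using 1 2 3 4 by blast
    qed
    from this[of m] obtain z where z: "z - u0 - a \<in> Ec Ub" "norm (z - u0 - a) \<le> w * norm a"
      "\<bar>l z - l u0\<bar> \<le> A1" "norm (G ?lam z - G ?lam u0) \<le> A2" using m(1) by auto
    have "h u' \<le> h z" using z by (intro u'(2)) (simp add: K)
    also have "\<dots> \<le> A2 + A1" using z by (simp add: h_def)
    also have "\<dots> = \<eta> * Q" by (simp add: A1_def A2_def Q_def algebra_simps)
    finally show ?thesis .
  qed
  have "h u' \<le> 0 + e" if "e > 0" for e
  proof -
    have "h u' \<le> e / (Q + 1) * Q" using that Q by (intro small) simp
    also have "\<dots> \<le> e" using that Q by (simp add: field_simps)
    finally show ?thesis by simp
  qed
  then have "h u' \<le> 0" by (rule field_le_epsilon)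
  then have "G ?lam u' = G ?lam u0" "l u' = l u0"
    using norm_ge_zero[of "G ?lam u' - G ?lam u0"] abs_ge_zero[of "l u' - l u0"] unfolding h_def
    by (auto simp: add_nonneg_eq_0_iff dest: antisym)
  then show ?thesis using u'(1) Kb[OF u'(1)] by (intro bexI[of _ u']) (auto simp: K)
qed

text \<open>\<open>degenerate_path\<close> leads from \<open>u0\<close> to a state \<open>u'\<close>
  with the same \<open>l\<close> and the same \<open>G (l u0)\<close>, such that
  \<open>u - u'\<close> lies in the complement. At speed \<open>\<xi>\<close> the first part of the
  jump costs only \<open>\<theta> = l u0 - \<xi>\<close> times the increment of \<open>fx\<close>.
  Testing with a left null vector separates this from the second part, and both are of order
  \<open>\<rho>\<close>.\<close>

lemma degenerate_pair:
  assumes deg: "\<forall>\<^sub>F z in nhds Ub. \<forall>v\<in>E z. Dl z v = 0"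
  shows "\<exists>e \<kappa> C. 0 < e \<and> e < \<delta> \<and> 0 < \<kappa> \<and> 0 < C \<and>
    (\<forall>u0\<in>cball Ub e. \<forall>u\<in>cball Ub e. \<forall>\<xi> \<rho>. \<bar>\<xi> - l Ub\<bar> \<le> \<kappa> \<longrightarrow> norm (G \<xi> u - G \<xi> u0) \<le> \<rho> \<longrightarrow>
      \<bar>l u0 - \<xi>\<bar> * norm (u - u0) \<le> C * \<rho> \<and> \<bar>l u - l u0\<bar> \<le> C * \<rho>)"
proof -
  obtain s0 where s0: "s0 > 0" "\<And>v. s0 * norm v ^ 2 \<le> N Ub v \<bullet> X Ub v" by (rule positive_definite) blast
  obtain c where c: "c > 0" "\<And>b. b \<in> Ec Ub \<Longrightarrow> c * norm b \<le> norm (blinfun_apply (L (l Ub) Ub) b)"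
    by (rule coercive[of Ub]) blast
  define B where "B = norm (N Ub) + norm (X Ub) + norm (Dl Ub) + 2"
  have B: "B \<ge> 2" "norm (N Ub) \<le> B" "norm (X Ub) \<le> B" "norm (Dl Ub) + 1 \<le> B" by (auto simp: B_def)
  \<comment> \<open>The entries serve in turn for absorbing \<open>norm d\<close> by coercivity,
    applying \<open>degenerate_path\<close>, the positive pairing with \<open>P\<close>, absorbing
    \<open>norm d\<close> in the estimate of \<open>\<theta>\<close>, and the bound of
    \<open>P\<close>.\<close>
  define \<omega> where "\<omega> = min (min (c / 2) 1) (min (s0 / (2 * B * (B + 2))) (min (s0 * c / (16 * B ^ 2)) (B / (B + 2))))"
  have \<omega>0: "\<omega> > 0" unfolding \<omega>_def using c(1) s0(1) B(1) by simp
  have "\<omega> \<le> c / 2" "\<omega> \<le> 1" "\<omega> \<le> s0 / (2 * B * (B + 2))" "\<omega> \<le> s0 * c / (16 * B ^ 2)" "\<omega> \<le> B / (B + 2)"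
    unfolding \<omega>_def by linarith+
  note \<omega>' = this
  have "2 * B * (B + 2) > 0" using B(1) by simp
  then have "\<omega> * (2 * B * (B + 2)) \<le> s0" using \<omega>'(3) by (simp only: pos_le_divide_eq)
  then have \<omega>3: "B * ((B + 2) * \<omega>) \<le> s0 / 2" by (simp add: algebra_simps)
  have \<omega>: "\<omega> \<le> c / 2" "\<omega> \<le> 1" "B * ((B + 2) * \<omega>) \<le> s0 / 2" "B * \<omega> * (2 / c) * (2 * B) \<le> s0 / 4" "(B + 2) * \<omega> \<le> B"
    using \<omega>'(1,2,4,5) \<omega>3 B(1) c(1) by (simp_all add: field_simps power2_eq_square)
  obtain eL where eL: "eL > 0" "\<And>u \<xi>. dist u Ub < eL \<Longrightarrow> \<bar>\<xi> - l Ub\<bar> < eL \<Longrightarrow> norm (L \<xi> u - L (l Ub) Ub) \<le> \<omega>"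
    by (rule L_near[OF \<omega>0]) blast
  note D = isCont_data[OF center] isCont_l[OF center]
  have "\<forall>\<^sub>F u in nhds Ub. dist (X u) (X Ub) < \<omega> \<and> (\<forall>r\<in>E Ub. \<exists>r'\<in>E u. r' - r \<in> Ec Ub \<and> norm (r' - r) \<le> \<omega> * norm r) \<and>
      dist (Dl u) (Dl Ub) < 1 \<and> dist (l u) (l Ub) < 1 / 2 \<and> (\<forall>v\<in>E u. Dl u v = 0)"
    by (intro eventually_conj isCont_eventually_dist D eigenspace_continuous deg) (use \<omega>0 \<delta> in auto)
  then obtain e1 where e1: "e1 > 0" "e1 < min \<delta> eL" and
    ev: "\<And>u. u \<in> cball Ub e1 \<Longrightarrow> dist (X u) (X Ub) < \<omega> \<and> (\<forall>r\<in>E Ub. \<exists>r'\<in>E u. r' - r \<in> Ec Ub \<and> norm (r' - r) \<le> \<omega> * norm r) \<and>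
      dist (Dl u) (Dl Ub) < 1 \<and> dist (l u) (l Ub) < 1 / 2 \<and> (\<forall>v\<in>E u. Dl u v = 0)"
    by (rule eventually_nhds_cball[where d = "min \<delta> eL"]) (use \<delta> eL(1) in auto)
  \<comment> \<open>With \<open>norm a \<le> 2 * e\<close> the path stays inside:
    \<open>norm (u0 - Ub) + 2 * norm a \<le> 5 * e\<close>.\<close>
  define e where "e = e1 / 8"
  define \<kappa> where "\<kappa> = min (eL / 2) (1 / 2)"
  have \<kappa>: "\<kappa> > 0" "\<kappa> < eL" "\<kappa> \<le> 1 / 2" unfolding \<kappa>_def using eL(1) by (simp, linarith+)
  define K1 where "K1 = (4 / s0) * (B + s0 / 4)"
  define K2 where "K2 = (2 / c) * (1 + 2 * B * K1)"
  have "4 / s0 > 0" "2 / c > 0" "B > 0" "B + s0 / 4 > 0" using s0(1) c(1) B(1) by (simp_all add: add_pos_pos)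
  then have K1: "K1 > 0" unfolding K1_def by (intro mult_pos_pos)
  have "2 * B * K1 > 0" using K1 \<open>B > 0\<close> by simp
  then have "1 + 2 * B * K1 > 0" by linarith
  with \<open>2 / c > 0\<close> have "K2 > 0" unfolding K2_def by (rule mult_pos_pos)
  note K = K1 this
  define C where "C = 2 * K1 + K2 + B * K2"
  have BK: "B * K2 > 0" using B(1) K(2) by simp
  then have C: "C > 0" "2 * K1 + K2 \<le> C" "B * K2 \<le> C" using K by (auto simp: C_def)
  have main: "\<bar>l u0 - \<xi>\<bar> * norm (u - u0) \<le> C * \<rho> \<and> \<bar>l u - l u0\<bar> \<le> C * \<rho>"
    if u0: "u0 \<in> cball Ub e" and u: "u \<in> cball Ub e" and \<xi>: "\<bar>\<xi> - l Ub\<bar> \<le> \<kappa>" and \<rho>: "norm (G \<xi> u - G \<xi> u0) \<le> \<rho>" for u0 u \<xi> \<rho>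
  proof -
    have \<rho>0: "\<rho> \<ge> 0" using \<rho> norm_ge_zero order_trans by blast
    have u1: "u0 \<in> cball Ub e1" "u \<in> cball Ub e1" using u0 u e1(1) by (auto simp: e_def)
    have sub: "\<And>z. z \<in> cball Ub e1 \<Longrightarrow> z \<in> ball Ub \<delta>" using e1 by auto
    obtain a b where ab: "a \<in> E Ub" "b \<in> Ec Ub" "u - u0 = a + b" by (rule decomp)
    have "norm a \<le> norm (u - u0)" unfolding ab(3) by (rule norm_decomp_le[OF ab(1,2)])
    also have "\<dots> \<le> dist Ub u + dist Ub u0" using dist_triangle3[of u u0 Ub] by (simp add: dist_norm)
    also have "\<dots> \<le> 2 * e" using u0 u by simp
    finally have an: "norm a \<le> 2 * e" .
    have "norm (u0 - Ub) \<le> e" using u0 by (simp add: dist_norm norm_minus_commute)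
    then have len: "norm (u0 - Ub) + 2 * norm a \<le> e1" using an e1(1) by (simp add: e_def)
    have "\<exists>u'\<in>cball Ub e1. u' - u0 - a \<in> Ec Ub \<and> norm (u' - u0 - a) \<le> \<omega> * norm a \<and> l u' = l u0 \<and> G (l u0) u' = G (l u0) u0"
    proof (rule degenerate_path)
      show "Dl z v = 0" if "z \<in> cball Ub e1" "v \<in> E z" for z v using ev[OF that(1)] that(2) by blast
      show "\<exists>r'\<in>E z. r' - r \<in> Ec Ub \<and> norm (r' - r) \<le> \<omega> * norm r" if "z \<in> cball Ub e1" "r \<in> E Ub" for z r
        using ev[OF that(1)] that(2) by blast
    qed (use e1 \<omega>0 \<omega>(2) ab(1) len in auto)
    then obtain u' where u': "u' \<in> cball Ub e1" "u' - u0 - a \<in> Ec Ub" "norm (u' - u0 - a) \<le> \<omega> * norm a"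
      "l u' = l u0" "G (l u0) u' = G (l u0) u0" by blast
    define d where "d = u - u'"
    have "d = b - (u' - u0 - a)" unfolding d_def using ab(3) by (simp add: algebra_simps)
    then have dE: "d \<in> Ec Ub" using subspace_diff[OF subspace_Ec ab(2) u'(2)] by simp
    define \<theta> where "\<theta> = l u0 - \<xi>"
    define P where "P = fx u' - fx u0"
    define Q where "Q = G \<xi> u - G \<xi> u'"
    have R: "G \<xi> u - G \<xi> u0 = Q + \<theta> *\<^sub>R P"
      using u'(5) by (simp add: Q_def \<theta>_def P_def G_def algebra_simps)
    let ?L0 = "L (l Ub) Ub"
    have "norm (G \<xi> u - G \<xi> u' - ?L0 (u - u')) \<le> \<omega> * norm (u - u')"
    proof (rule linearization[OF convex_cball u'(1) u1(2)])
      show "norm (L \<xi> z - ?L0) \<le> \<omega>" if "z \<in> cball Ub e1" for z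
        by (rule eL(2)) (use that e1(2) \<xi> \<kappa>(2) in \<open>auto simp: dist_commute\<close>)
    qed (use G sub in auto)
    then have Q1: "norm (Q - ?L0 d) \<le> \<omega> * norm d" by (simp add: Q_def d_def)
    have "\<omega> * norm a \<le> norm a" using \<omega>(2) by (simp add: mult_left_le_one_le \<omega>0 less_imp_le)
    then have u'n: "norm (u' - u0) \<le> 2 * norm a" using u'(3) norm_triangle_sub[of "u' - u0" a] by linarith
    have "norm (fx u' - fx u0 - X Ub (u' - u0)) \<le> \<omega> * norm (u' - u0)"
    proof (rule linearization[OF convex_cball u1(1) u'(1)])
      show "norm (X z - X Ub) \<le> \<omega>" if "z \<in> cball Ub e1" for z using ev[OF that] by (simp add: dist_norm)
    qed (use fx sub in auto)
    also have "\<dots> \<le> \<omega> * (2 * norm a)" using u'n \<omega>0 by (intro mult_left_mono) auto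
    finally have "norm (P - X Ub (u' - u0)) \<le> \<omega> * (2 * norm a)" by (simp add: P_def)
    moreover have "norm (X Ub (u' - u0 - a)) \<le> B * (\<omega> * norm a)"
      using norm_blinfun[of "X Ub" "u' - u0 - a"] mult_mono[OF B(3) u'(3)] B(1) by fastforce
    moreover have "P - X Ub a = (P - X Ub (u' - u0)) + X Ub (u' - u0 - a)" by (simp add: blinfun.diff_right)
    ultimately have "norm (P - X Ub a) \<le> \<omega> * (2 * norm a) + B * (\<omega> * norm a)"
      by (metis norm_triangle_le add_mono)
    then have P1: "norm (P - X Ub a) \<le> ((B + 2) * \<omega>) * norm a" by (simp add: algebra_simps)
    also have "\<dots> \<le> B * norm a" using \<omega>(5) by (rule mult_right_mono) simp
    finally have "norm (P - X Ub a) \<le> B * norm a" .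
    moreover have "norm (X Ub a) \<le> B * norm a"
      using norm_blinfun[of "X Ub" a] mult_right_mono[OF B(3) norm_ge_zero[of a]] by linarith
    ultimately have P2: "norm P \<le> 2 * B * norm a" using norm_triangle_sub[of P "X Ub a"] by linarith
    have "norm Q = norm ((G \<xi> u - G \<xi> u0) - \<theta> *\<^sub>R P)" unfolding R by simp
    also have "\<dots> \<le> \<rho> + \<bar>\<theta>\<bar> * norm P"
      using norm_triangle_ineq4[of "G \<xi> u - G \<xi> u0" "\<theta> *\<^sub>R P"] \<rho> by simp
    also have "\<bar>\<theta>\<bar> * norm P \<le> \<bar>\<theta>\<bar> * (2 * B * norm a)" by (rule mult_left_mono[OF P2]) simp
    finally have Qn: "norm Q \<le> \<rho> + 2 * B * (\<bar>\<theta>\<bar> * norm a)" by (simp add: mult_ac)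
    have "c * norm d \<le> norm (?L0 d)" by (rule c(2)[OF dE])
    also have "\<dots> \<le> norm Q + \<omega> * norm d" using Q1 norm_triangle_sub[of "?L0 d" Q] by (simp add: norm_minus_commute)
    also have "\<omega> * norm d \<le> c / 2 * norm d" using \<omega>(1) by (rule mult_right_mono) simp
    finally have "c / 2 * norm d \<le> \<rho> + 2 * B * (\<bar>\<theta>\<bar> * norm a)" using Qn by simp
    then have d1: "norm d \<le> (2 / c) * (\<rho> + 2 * B * (\<bar>\<theta>\<bar> * norm a))" using c(1) by (simp add: field_simps)
    have \<theta>a: "\<bar>\<theta>\<bar> * norm a \<le> K1 * \<rho>"
    proof (cases "a = 0")
      case True
      then show ?thesis using K(1) \<rho>0 by simp
    next
      case False
      \<comment> \<open>This left null vector removes the linear part of \<open>Q\<close> and pairs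
        with \<open>P\<close> to at least \<open>s0 / 2 * norm a ^ 2\<close>.\<close>
      let ?k = "N Ub a"
      have kn: "norm ?k \<le> B * norm a"
        using norm_blinfun[of "N Ub" a] mult_right_mono[OF B(2) norm_ge_zero[of a]] by linarith
      have "?k \<bullet> ?L0 d = 0" by (rule left_null[OF center ab(1)])
      then have "\<bar>?k \<bullet> Q\<bar> = \<bar>?k \<bullet> (Q - ?L0 d)\<bar>" by (simp add: inner_diff_right)
      also have "\<dots> \<le> norm ?k * norm (Q - ?L0 d)" by (rule Cauchy_Schwarz_ineq2)
      also have "\<dots> \<le> B * norm a * (\<omega> * norm d)" using kn Q1 B(1) by (intro mult_mono) auto
      finally have kQ: "\<bar>?k \<bullet> Q\<bar> \<le> B * norm a * (\<omega> * norm d)" .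
      have "\<bar>?k \<bullet> (G \<xi> u - G \<xi> u0)\<bar> \<le> norm ?k * norm (G \<xi> u - G \<xi> u0)" by (rule Cauchy_Schwarz_ineq2)
      also have "\<dots> \<le> B * norm a * \<rho>" using kn \<rho> B(1) by (intro mult_mono) auto
      finally have kR: "\<bar>?k \<bullet> (G \<xi> u - G \<xi> u0)\<bar> \<le> B * norm a * \<rho>" .
      have "\<bar>?k \<bullet> (P - X Ub a)\<bar> \<le> norm ?k * norm (P - X Ub a)" by (rule Cauchy_Schwarz_ineq2)
      also have "\<dots> \<le> B * norm a * (((B + 2) * \<omega>) * norm a)" using kn P1 B(1) by (intro mult_mono) auto
      also have "\<dots> = B * ((B + 2) * \<omega>) * norm a ^ 2" by (simp add: power2_eq_square)
      also have "\<dots> \<le> s0 / 2 * norm a ^ 2" using \<omega>(3) by (rule mult_right_mono) simp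
      finally have "\<bar>?k \<bullet> P - ?k \<bullet> X Ub a\<bar> \<le> s0 / 2 * norm a ^ 2" by (simp add: inner_diff_right)
      moreover have "s0 * norm a ^ 2 = s0 / 2 * norm a ^ 2 + s0 / 2 * norm a ^ 2" by simp
      ultimately have kP: "s0 / 2 * norm a ^ 2 \<le> ?k \<bullet> P" using s0(2)[of a] by linarith
      have "\<bar>\<theta>\<bar> * (s0 / 2 * norm a ^ 2) \<le> \<bar>\<theta>\<bar> * (?k \<bullet> P)" by (rule mult_left_mono[OF kP]) simp
      also have "\<dots> \<le> \<bar>\<theta> * (?k \<bullet> P)\<bar>" by (simp add: abs_mult mult_left_mono)
      also have "\<theta> * (?k \<bullet> P) = ?k \<bullet> (G \<xi> u - G \<xi> u0) - ?k \<bullet> Q" unfolding R by (simp add: inner_add_right)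
      also have "\<bar>\<dots>\<bar> \<le> B * norm a * \<rho> + B * norm a * (\<omega> * norm d)" using kR kQ by linarith
      finally have "norm a * (s0 / 2 * (\<bar>\<theta>\<bar> * norm a)) \<le> norm a * (B * \<rho> + B * \<omega> * norm d)"
        by (simp add: power2_eq_square algebra_simps)
      then have "s0 / 2 * (\<bar>\<theta>\<bar> * norm a) \<le> B * \<rho> + B * \<omega> * norm d" using False by simp
      also have "B * \<omega> * norm d \<le> B * \<omega> * ((2 / c) * (\<rho> + 2 * B * (\<bar>\<theta>\<bar> * norm a)))"
        using B(1) \<omega>0 by (intro mult_left_mono[OF d1]) simp
      also have "\<dots> = B * \<omega> * (2 / c) * \<rho> + (B * \<omega> * (2 / c) * (2 * B)) * (\<bar>\<theta>\<bar> * norm a)" by (simp add: algebra_simps)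
      also have "\<dots> \<le> s0 / 4 * \<rho> + s0 / 4 * (\<bar>\<theta>\<bar> * norm a)"
      proof (intro add_mono mult_right_mono)
        have "B * \<omega> * (2 / c) * 1 \<le> B * \<omega> * (2 / c) * (2 * B)" using B(1) \<omega>0 c(1) by (intro mult_left_mono) auto
        then show "B * \<omega> * (2 / c) \<le> s0 / 4" using \<omega>(4) by linarith
      qed (use \<omega>(4) \<rho>0 in auto)
      finally have "s0 / 4 * (\<bar>\<theta>\<bar> * norm a) \<le> (B + s0 / 4) * \<rho>" by (simp add: algebra_simps)
      then have "(4 / s0) * (s0 / 4 * (\<bar>\<theta>\<bar> * norm a)) \<le> (4 / s0) * ((B + s0 / 4) * \<rho>)"
        using s0(1) by (intro mult_left_mono) auto
      moreover have "(4 / s0) * (s0 / 4 * (\<bar>\<theta>\<bar> * norm a)) = \<bar>\<theta>\<bar> * norm a" using s0(1) by simp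
      moreover have "(4 / s0) * ((B + s0 / 4) * \<rho>) = K1 * \<rho>" unfolding K1_def by (simp only: mult.assoc)
      ultimately show ?thesis by linarith
    qed
    have "(2 / c) * (\<rho> + 2 * B * (\<bar>\<theta>\<bar> * norm a)) \<le> (2 / c) * (\<rho> + 2 * B * (K1 * \<rho>))"
      using \<theta>a c(1) B(1) by (intro mult_left_mono add_left_mono) auto
    also have "\<dots> = K2 * \<rho>" by (simp add: K2_def algebra_simps)
    finally have dK: "norm d \<le> K2 * \<rho>" using d1 by linarith
    have "\<bar>l u0 - l Ub\<bar> < 1 / 2" using ev[OF u1(1)] by (simp add: dist_real_def)
    then have \<theta>1: "\<bar>\<theta>\<bar> \<le> 1" using \<xi> \<kappa>(3) unfolding \<theta>_def by linarith
    have "norm (u - u0) = norm ((u' - u0) + d)" by (simp add: d_def)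
    then have "norm (u - u0) \<le> 2 * norm a + norm d" using u'n norm_triangle_ineq[of "u' - u0" d] by linarith
    then have "\<bar>\<theta>\<bar> * norm (u - u0) \<le> \<bar>\<theta>\<bar> * (2 * norm a + norm d)" by (rule mult_left_mono) simp
    also have "\<dots> = 2 * (\<bar>\<theta>\<bar> * norm a) + \<bar>\<theta>\<bar> * norm d" by (simp add: algebra_simps)
    also have "\<bar>\<theta>\<bar> * norm d \<le> norm d" using mult_right_mono[OF \<theta>1 norm_ge_zero[of d]] by simp
    finally have "\<bar>\<theta>\<bar> * norm (u - u0) \<le> (2 * K1 + K2) * \<rho>" using \<theta>a dK by (simp add: algebra_simps)
    also have "\<dots> \<le> C * \<rho>" using C(2) \<rho>0 by (rule mult_right_mono)
    finally have one: "\<bar>l u0 - \<xi>\<bar> * norm (u - u0) \<le> C * \<rho>" by (simp add: \<theta>_def)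
    \<comment> \<open>Linearizing with slope 0 gives a Lipschitz bound; since
      \<open>l u' = l u0\<close>, only \<open>d\<close> counts.\<close>
    have "norm (l u - l u' - blinfun_apply 0 (u - u')) \<le> B * norm (u - u')"
    proof (rule linearization[OF convex_cball u'(1) u1(2)])
      show "norm (Dl z - 0) \<le> B" if "z \<in> cball Ub e1" for z
        using ev[OF that] B(4) norm_triangle_sub[of "Dl z" "Dl Ub"] by (simp add: dist_norm)
    qed (use l sub in auto)
    then have "\<bar>l u - l u0\<bar> \<le> B * norm d" using u'(4) by (simp add: d_def)
    also have "\<dots> \<le> B * (K2 * \<rho>)" using dK B(1) by (intro mult_left_mono) auto
    also have "\<dots> \<le> C * \<rho>" using mult_right_mono[OF C(3) \<rho>0] by simp
    finally show ?thesis using one by simp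
  qed
  have "0 < e" "e < \<delta>" using e1 by (auto simp: e_def)
  then show ?thesis
    by (intro exI[of _ e] exI[of _ \<kappa>] exI[of _ C]) (use \<kappa>(1) C(1) main in auto)
qed

end

section \<open>Speeds away from the eigenvalues\<close>

context symmetrizable_pencil begin

text \<open>The lower bound of \<open>L \<xi> Ub\<close> has to grow like
  \<open>1 + \<bar>\<xi>\<bar>\<close>, because so does the error of freezing the state at
  \<open>Ub\<close>. For large \<open>\<xi>\<close> the invertible \<open>X Ub\<close> provides it,
  for bounded \<open>\<xi>\<close> in \<open>Z\<close> compactness does.\<close>

lemma gap_pair:
  assumes Z: "closed Z" and inj: "\<And>\<xi> v. \<xi> \<in> Z \<Longrightarrow> L \<xi> Ub v = 0 \<Longrightarrow> v = 0"
  shows "\<exists>e C. 0 < e \<and> e < \<delta> \<and> 0 < C \<and>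
    (\<forall>u0\<in>cball Ub e. \<forall>u\<in>cball Ub e. \<forall>\<xi>\<in>Z. norm (u - u0) \<le> C * norm (G \<xi> u - G \<xi> u0))"
proof -
  have "v = 0" if "X Ub v = 0" for v using pos[of v] that by auto
  then have "\<exists>e>0. \<forall>v\<in>UNIV. e * norm v \<le> norm (X Ub v)"
    by (intro injective_imp_isometric closed_UNIV subspace_UNIV blinfun.bounded_linear_right) blast
  then obtain c where c: "c > 0" "\<And>v. c * norm v \<le> norm (X Ub v)" by blast
  define B where "B = norm (Y Ub)"
  define \<Xi> where "\<Xi> = 2 * B / c + 1"
  have B: "B \<ge> 0" by (simp add: B_def)
  have \<Xi>: "\<Xi> \<ge> 1" "B \<le> \<Xi> * c / 2" using B c(1) by (simp_all add: \<Xi>_def field_simps)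
  have far: "c / 4 * (1 + \<bar>\<xi>\<bar>) * norm v \<le> norm (L \<xi> Ub v)" if "\<bar>\<xi>\<bar> \<ge> \<Xi>" for \<xi> v
  proof -
    have "\<bar>\<xi>\<bar> * (c * norm v) \<le> \<bar>\<xi>\<bar> * norm (X Ub v)" by (rule mult_left_mono[OF c(2)]) simp
    also have "\<dots> = norm (\<xi> *\<^sub>R X Ub v)" by simp
    also have "\<dots> \<le> norm (L \<xi> Ub v) + norm (Y Ub v)"
      using norm_triangle_sub[of "\<xi> *\<^sub>R X Ub v" "Y Ub v"] by (simp add: L_def blinfun.diff_left blinfun.scaleR_left norm_minus_commute)
    also have "norm (Y Ub v) \<le> B * norm v" unfolding B_def by (rule norm_blinfun)
    also have "B * norm v \<le> (\<bar>\<xi>\<bar> * c / 2) * norm v"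
    proof (rule mult_right_mono)
      have "\<Xi> * c / 2 \<le> \<bar>\<xi>\<bar> * c / 2" using that c(1) by (simp add: mult_right_mono)
      then show "B \<le> \<bar>\<xi>\<bar> * c / 2" using \<Xi>(2) by linarith
    qed simp
    finally have "(\<bar>\<xi>\<bar> * c / 2) * norm v \<le> norm (L \<xi> Ub v)" by (simp add: field_simps)
    moreover have "c / 4 * (1 + \<bar>\<xi>\<bar>) * norm v \<le> (\<bar>\<xi>\<bar> * c / 2) * norm v"
    proof (rule mult_right_mono)
      have "c / 4 * (1 + \<bar>\<xi>\<bar>) \<le> c / 4 * (2 * \<bar>\<xi>\<bar>)" using that \<Xi>(1) c(1) by (intro mult_left_mono) auto
      then show "c / 4 * (1 + \<bar>\<xi>\<bar>) \<le> \<bar>\<xi>\<bar> * c / 2" by (simp add: mult.commute)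
    qed simp
    ultimately show ?thesis by linarith
  qed
  obtain m where m: "m > 0" "\<And>\<xi> v. \<xi> \<in> Z \<Longrightarrow> \<bar>\<xi>\<bar> \<le> \<Xi> \<Longrightarrow> m * norm v \<le> norm (L \<xi> Ub v)"
  proof (cases "(Z \<inter> {-\<Xi>..\<Xi>}) \<times> sphere (0::'a) 1 = {}")
    case True
    have "1 * norm v \<le> norm (L \<xi> Ub v)" if "\<xi> \<in> Z" "\<bar>\<xi>\<bar> \<le> \<Xi>" for \<xi> v
    proof (cases "v = 0")
      case False
      then have "(\<xi>, v /\<^sub>R norm v) \<in> (Z \<inter> {-\<Xi>..\<Xi>}) \<times> sphere (0::'a) 1" using that by auto
      then show ?thesis using True by blast
    qed simp
    then show ?thesis by (intro that[of 1]) auto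
  next
    case False
    have "\<exists>q\<in>(Z \<inter> {-\<Xi>..\<Xi>}) \<times> sphere (0::'a) 1. \<forall>p\<in>(Z \<inter> {-\<Xi>..\<Xi>}) \<times> sphere 0 1.
        norm (Y Ub (snd q) - fst q *\<^sub>R X Ub (snd q)) \<le> norm (Y Ub (snd p) - fst p *\<^sub>R X Ub (snd p))"
      by (intro continuous_attains_inf compact_Times closed_Int_compact Z compact_Icc compact_sphere False continuous_intros)
    then obtain \<xi>0 v0 where q: "\<xi>0 \<in> Z" "norm v0 = 1"
      "\<And>\<xi> v. \<xi> \<in> Z \<Longrightarrow> \<bar>\<xi>\<bar> \<le> \<Xi> \<Longrightarrow> norm v = 1 \<Longrightarrow> norm (Y Ub v0 - \<xi>0 *\<^sub>R X Ub v0) \<le> norm (Y Ub v - \<xi> *\<^sub>R X Ub v)"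
      by (auto simp: abs_le_iff)
    have LY: "L \<xi> Ub v = Y Ub v - \<xi> *\<^sub>R X Ub v" for \<xi> v by (simp add: L_def blinfun.diff_left blinfun.scaleR_left)
    show ?thesis
    proof (rule that[of "norm (L \<xi>0 Ub v0)"])
      show "norm (L \<xi>0 Ub v0) > 0" using inj[OF q(1), of v0] q(2) by auto
      fix \<xi> v assume \<xi>: "\<xi> \<in> Z" "\<bar>\<xi>\<bar> \<le> \<Xi>"
      show "norm (L \<xi>0 Ub v0) * norm v \<le> norm (L \<xi> Ub v)"
      proof (cases "v = 0")
        case False
        have "norm (L \<xi>0 Ub v0) \<le> norm (L \<xi> Ub (v /\<^sub>R norm v))"
          unfolding LY by (rule q(3)[OF \<xi>]) (use False in simp)
        also have "\<dots> = norm (L \<xi> Ub v) / norm v" by (simp add: blinfun.scaleR_right divide_inverse)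
        finally show ?thesis using False by (simp add: field_simps)
      qed simp
    qed
  qed
  define c0 where "c0 = min (c / 4) (m / (1 + \<Xi>))"
  have c0: "c0 > 0" "c0 \<le> c / 4" "c0 \<le> m / (1 + \<Xi>)"
    unfolding c0_def using c(1) m(1) \<Xi>(1) by (simp, linarith+)
  have low: "c0 * (1 + \<bar>\<xi>\<bar>) * norm v \<le> norm (L \<xi> Ub v)" if "\<xi> \<in> Z" for \<xi> v
  proof (cases "\<bar>\<xi>\<bar> \<ge> \<Xi>")
    case True
    have "c0 * (1 + \<bar>\<xi>\<bar>) * norm v \<le> c / 4 * (1 + \<bar>\<xi>\<bar>) * norm v"
      using c0(2) by (intro mult_right_mono) auto
    then show ?thesis using far[OF True, of v] by linarith
  next
    case False
    have "c0 * (1 + \<bar>\<xi>\<bar>) \<le> m / (1 + \<Xi>) * (1 + \<Xi>)" using False c0 m(1) \<Xi>(1) by (intro mult_mono) auto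
    also have "\<dots> = m" using \<Xi>(1) by simp
    finally have "c0 * (1 + \<bar>\<xi>\<bar>) * norm v \<le> m * norm v" by (rule mult_right_mono) simp
    then show ?thesis using m(2)[OF that, of v] False by linarith
  qed
  have "\<forall>\<^sub>F u in nhds Ub. dist (X u) (X Ub) < c0 / 2 \<and> dist (Y u) (Y Ub) < c0 / 2"
    by (intro eventually_conj isCont_eventually_dist isCont_data center) (use c0 \<delta> in auto)
  then obtain e where e: "e > 0" "e < \<delta>" and
    ev: "\<And>u. u \<in> cball Ub e \<Longrightarrow> dist (X u) (X Ub) < c0 / 2 \<and> dist (Y u) (Y Ub) < c0 / 2"
    by (rule eventually_nhds_cball[OF _ \<delta>]) auto
  have "norm (u - u0) \<le> 2 / c0 * norm (G \<xi> u - G \<xi> u0)" if u: "u0 \<in> cball Ub e" "u \<in> cball Ub e" and \<xi>: "\<xi> \<in> Z" for u0 u \<xi>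
  proof -
    have "norm (G \<xi> u - G \<xi> u0 - L \<xi> Ub (u - u0)) \<le> (c0 / 2 * (1 + \<bar>\<xi>\<bar>)) * norm (u - u0)"
    proof (rule linearization[OF convex_cball u])
      fix z assume z: "z \<in> cball Ub e"
      then show "(G \<xi> has_derivative blinfun_apply (L \<xi> z)) (at z)" using e by (intro G) auto
      have "L \<xi> z - L \<xi> Ub = (Y z - Y Ub) - \<xi> *\<^sub>R (X z - X Ub)" by (simp add: L_def algebra_simps)
      then have "norm (L \<xi> z - L \<xi> Ub) \<le> norm (Y z - Y Ub) + norm (\<xi> *\<^sub>R (X z - X Ub))" by (simp only: norm_triangle_ineq4)
      also have "\<dots> \<le> c0 / 2 + \<bar>\<xi>\<bar> * (c0 / 2)"
        using ev[OF z] unfolding norm_scaleR dist_norm by (intro add_mono mult_left_mono) auto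
      finally show "norm (L \<xi> z - L \<xi> Ub) \<le> c0 / 2 * (1 + \<bar>\<xi>\<bar>)" by (simp add: algebra_simps)
    qed
    moreover have "c0 * (1 + \<bar>\<xi>\<bar>) * norm (u - u0) \<le> norm (L \<xi> Ub (u - u0))" by (rule low[OF \<xi>])
    moreover have "norm (L \<xi> Ub (u - u0)) \<le> norm (G \<xi> u - G \<xi> u0) + norm (G \<xi> u - G \<xi> u0 - L \<xi> Ub (u - u0))"
      using norm_triangle_ineq4[of "G \<xi> u - G \<xi> u0" "G \<xi> u - G \<xi> u0 - L \<xi> Ub (u - u0)"] by simp
    moreover have "c0 * (1 + \<bar>\<xi>\<bar>) * norm (u - u0) = c0 / 2 * (1 + \<bar>\<xi>\<bar>) * norm (u - u0) + c0 / 2 * (1 + \<bar>\<xi>\<bar>) * norm (u - u0)"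
      by (simp add: algebra_simps)
    ultimately have "c0 / 2 * (1 + \<bar>\<xi>\<bar>) * norm (u - u0) \<le> norm (G \<xi> u - G \<xi> u0)" by linarith
    moreover have "c0 / 2 * 1 * norm (u - u0) \<le> c0 / 2 * (1 + \<bar>\<xi>\<bar>) * norm (u - u0)"
      using c0(1) by (intro mult_right_mono mult_left_mono) auto
    ultimately have "c0 / 2 * norm (u - u0) \<le> norm (G \<xi> u - G \<xi> u0)" by simp
    then show ?thesis using c0(1) by (simp add: field_simps)
  qed
  then show ?thesis by (intro exI[of _ e] exI[of _ "2 / c0"]) (use e c0(1) in auto)
qed

end

section \<open>From the integral relations to a comparison of two points\<close>

lemma norm_integral_minus_const_le:
  fixes f :: "real \<Rightarrow> 'a::euclidean_space"
  assumes "f integrable_on {p..q}" "p \<le> q" "\<And>z. z \<in> {p..q} \<Longrightarrow> norm (f z - c) \<le> K"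
  shows "norm (integral {p..q} f - (q - p) *\<^sub>R c) \<le> K * (q - p)"
proof -
  have "((\<lambda>z. f z - c) has_integral (integral {p..q} f - (q - p) *\<^sub>R c)) {p..q}"
    using has_integral_diff[OF integrable_integral[OF assms(1)] has_integral_const_real[of c p q]] assms(2) by simp
  moreover have "norm (f p - c) \<le> K" using assms(2,3) by simp
  then have "0 \<le> K" using norm_ge_zero[of "f p - c"] by linarith
  ultimately have "norm (integral {p..q} f - (q - p) *\<^sub>R c) \<le> K * measure lborel {p..q}"
    by (intro has_integral_bound_real[where S = "{}"]) (use assms(3) in auto)
  then show ?thesis using assms(2) by simp
qed

context symmetrizable_pencil begin

text \<open>The speed is frozen at \<open>y\<close>, which leaves a relation between two states.
  \<open>x\<close> may lie on either side of \<open>y\<close>, and \<open>sgn\<close> orients the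
  entropy inequality accordingly. \<open>M\<close> is a parameter because it shrinks in the course
  of a constancy proof.\<close>

definition trajectory :: "real \<Rightarrow> real \<Rightarrow> real \<Rightarrow> (real \<Rightarrow> 'a) \<Rightarrow> bool" where
  "trajectory e C \<sigma> u \<longleftrightarrow> range u \<subseteq> cball Ub e \<and> \<bar>\<sigma>\<bar> = 1 \<and>
    (\<forall>x y M. x \<noteq> y \<longrightarrow> (\<forall>z\<in>closed_segment x y. norm (u z - u x) \<le> M) \<longrightarrow>
      norm (G y (u y) - G y (u x)) \<le> C * M * \<bar>y - x\<bar> \<and>
      \<sigma> * sgn (y - x) * (H y (u y) - H y (u x)) \<le> C * M * \<bar>y - x\<bar>)"

lemma trajectory_mono:
  assumes "trajectory e C \<sigma> u" "e \<le> e'"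
  shows "trajectory e' C \<sigma> u"
proof -
  have "range u \<subseteq> cball Ub e" using assms(1) by (simp only: trajectory_def)
  also have "\<dots> \<subseteq> cball Ub e'" using assms(2) by (rule subset_cball)
  finally have "range u \<subseteq> cball Ub e'" .
  then show ?thesis using assms(1) unfolding trajectory_def by (elim conjE) (intro conjI; assumption)
qed

lemma trajectoryD:
  assumes "trajectory e C \<sigma> u" "x \<noteq> y" "\<And>z. z \<in> closed_segment x y \<Longrightarrow> norm (u z - u x) \<le> M"
  shows "norm (G y (u y) - G y (u x)) \<le> C * M * \<bar>y - x\<bar>"
    "\<sigma> * sgn (y - x) * (H y (u y) - H y (u x)) \<le> C * M * \<bar>y - x\<bar>"
proof -
  have *: "\<forall>x y M. x \<noteq> y \<longrightarrow> (\<forall>z\<in>closed_segment x y. norm (u z - u x) \<le> M) \<longrightarrow>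
      norm (G y (u y) - G y (u x)) \<le> C * M * \<bar>y - x\<bar> \<and>
      \<sigma> * sgn (y - x) * (H y (u y) - H y (u x)) \<le> C * M * \<bar>y - x\<bar>"
    using assms(1) unfolding trajectory_def by (elim conjE)
  have M: "\<forall>z\<in>closed_segment x y. norm (u z - u x) \<le> M" using assms(3) by (intro ballI)
  note res = *[THEN spec, THEN spec, THEN spec, THEN mp, OF assms(2), THEN mp, OF M]
  from res show "norm (G y (u y) - G y (u x)) \<le> C * M * \<bar>y - x\<bar>" by (rule conjunct1)
  from res show "\<sigma> * sgn (y - x) * (H y (u y) - H y (u x)) \<le> C * M * \<bar>y - x\<bar>" by (rule conjunct2)
qed

text \<open>Replacing \<open>x\<close> by \<open>y\<close> in \<open>G x (u x)\<close> costs
  \<open>(y - x)\<close> times \<open>fx (u x)\<close>. Together with the integral relation this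
  leaves the integral of \<open>fx (u z) - fx (u x)\<close>, whose integrand is at most
  \<open>C * M\<close>; likewise for the entropy.\<close>

lemma trajectoryI:
  assumes range: "range u \<subseteq> cball Ub e" and \<sigma>: "\<bar>\<sigma>\<bar> = 1"
    and lip: "\<And>v w. \<lbrakk>v \<in> cball Ub e; w \<in> cball Ub e\<rbrakk> \<Longrightarrow> norm (fx v - fx w) \<le> C * norm (v - w)"
      "\<And>v w. \<lbrakk>v \<in> cball Ub e; w \<in> cball Ub e\<rbrakk> \<Longrightarrow> norm (\<psi>x v - \<psi>x w) \<le> C * norm (v - w)"
    and C: "C \<ge> 0"
    and int: "\<And>x y. (\<lambda>z. fx (u z)) integrable_on {x..y}" "\<And>x y. (\<lambda>z. \<psi>x (u z)) integrable_on {x..y}"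
    and eq: "\<And>x y. x < y \<Longrightarrow> G y (u y) - G x (u x) = - integral {x..y} (\<lambda>z. fx (u z))"
    and ineq: "\<And>x y. x < y \<Longrightarrow> \<sigma> * (H y (u y) - H x (u x)) \<le> \<sigma> * (- integral {x..y} (\<lambda>z. \<psi>x (u z)))"
  shows "trajectory e C \<sigma> u"
  unfolding trajectory_def
proof (intro conjI allI impI range \<sigma>)
  fix x y M assume xy: "x \<noteq> y" and M: "\<forall>z\<in>closed_segment x y. norm (u z - u x) \<le> M"
  have ub: "u z \<in> cball Ub e" for z using range by blast
  let ?p = "min x y" and ?q = "max x y"
  have pq: "?p \<le> ?q" "?q - ?p = \<bar>y - x\<bar>" by auto
  have seg: "z \<in> closed_segment x y" if "z \<in> {?p..?q}" for z
    using that by (auto simp: closed_segment_eq_real_ivl split: if_splits)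
  have 1: "norm (integral {?p..?q} (\<lambda>z. fx (u z)) - (?q - ?p) *\<^sub>R fx (u x)) \<le> C * M * (?q - ?p)"
  proof (rule norm_integral_minus_const_le[OF int(1) pq(1)])
    fix z assume "z \<in> {?p..?q}"
    then have "norm (u z - u x) \<le> M" using M seg by blast
    then show "norm (fx (u z) - fx (u x)) \<le> C * M"
      using lip(1)[OF ub ub, of z x] mult_left_mono[OF _ C] order_trans by blast
  qed
  have 2: "norm (integral {?p..?q} (\<lambda>z. \<psi>x (u z)) - (?q - ?p) *\<^sub>R \<psi>x (u x)) \<le> C * M * (?q - ?p)"
  proof (rule norm_integral_minus_const_le[OF int(2) pq(1)])
    fix z assume "z \<in> {?p..?q}"
    then have "norm (u z - u x) \<le> M" using M seg by blast
    then show "norm (\<psi>x (u z) - \<psi>x (u x)) \<le> C * M"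
      using lip(2)[OF ub ub, of z x] mult_left_mono[OF _ C] order_trans by blast
  qed
  have Gx: "G y (u x) = G x (u x) - (y - x) *\<^sub>R fx (u x)" by (simp add: G_def algebra_simps)
  have Hx: "H y (u x) = H x (u x) - (y - x) * \<psi>x (u x)" by (simp add: H_def algebra_simps)
  have \<sigma>12: "\<sigma> = 1 \<or> \<sigma> = -1" using \<sigma> by linarith
  show "norm (G y (u y) - G y (u x)) \<le> C * M * \<bar>y - x\<bar>"
  proof (cases "x < y")
    case True
    then have "G y (u y) - G y (u x) = - (integral {?p..?q} (\<lambda>z. fx (u z)) - (?q - ?p) *\<^sub>R fx (u x))"
      using eq[OF True] unfolding Gx by (simp add: algebra_simps)
    then show ?thesis using 1 True by (simp only: norm_minus_cancel pq(2))
  next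
    case False
    then have "y < x" using xy by simp
    then have "G y (u y) - G y (u x) = integral {?p..?q} (\<lambda>z. fx (u z)) - (?q - ?p) *\<^sub>R fx (u x)"
      using eq[OF \<open>y < x\<close>] unfolding Gx by (simp add: algebra_simps)
    then show ?thesis using 1 by (simp only: pq(2))
  qed
  let ?I = "integral {?p..?q} (\<lambda>z. \<psi>x (u z)) - (?q - ?p) * \<psi>x (u x)"
  have I: "\<bar>\<sigma> * ?I\<bar> \<le> C * M * \<bar>y - x\<bar>" using 2 \<sigma> unfolding pq(2) by (simp add: abs_mult)
  have "\<sigma> * sgn (y - x) * (H y (u y) - H y (u x)) \<le> - (\<sigma> * ?I)"
  proof (cases "x < y")
    case True
    have "\<sigma> * sgn (y - x) * (H y (u y) - H y (u x)) = \<sigma> * (H y (u y) - H x (u x)) + \<sigma> * ((y - x) * \<psi>x (u x))"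
      unfolding Hx using True by (simp add: algebra_simps)
    also have "\<dots> \<le> \<sigma> * (- integral {x..y} (\<lambda>z. \<psi>x (u z))) + \<sigma> * ((y - x) * \<psi>x (u x))"
      by (intro add_right_mono ineq True)
    finally show ?thesis using True by (simp add: algebra_simps)
  next
    case False
    then have "y < x" using xy by simp
    have "\<sigma> * sgn (y - x) * (H y (u y) - H y (u x)) = \<sigma> * (H x (u x) - H y (u y)) + \<sigma> * ((x - y) * \<psi>x (u x))"
      unfolding Hx using \<open>y < x\<close> by (simp add: algebra_simps)
    also have "\<dots> \<le> \<sigma> * (- integral {y..x} (\<lambda>z. \<psi>x (u z))) + \<sigma> * ((x - y) * \<psi>x (u x))"
      by (intro add_right_mono ineq \<open>y < x\<close>)
    finally show ?thesis using \<open>y < x\<close> by (simp add: algebra_simps)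
  qed
  then show "\<sigma> * sgn (y - x) * (H y (u y) - H y (u x)) \<le> C * M * \<bar>y - x\<bar>" using I by (simp add: abs_le_iff)
qed

lemma trajectory_norm: "trajectory e C \<sigma> u \<Longrightarrow> norm (u y - u x) \<le> 2 * e"
proof -
  assume "trajectory e C \<sigma> u"
  then have "u x \<in> cball Ub e" "u y \<in> cball Ub e" by (auto simp: trajectory_def image_subset_iff)
  then show ?thesis using dist_triangle3[of "u y" "u x" Ub] by (simp add: dist_norm)
qed

text \<open>By \<open>gap_pair\<close> the Rankine-Hugoniot defect bounds the jump itself, which is
  what \<open>constancy_propagates\<close> asks for.\<close>

lemma trajectory_gap:
  assumes "closed Z" "\<And>\<xi> v. \<xi> \<in> Z \<Longrightarrow> L \<xi> Ub v = 0 \<Longrightarrow> v = 0" and C: "C \<ge> 0"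
  obtains e where "0 < e" "e < \<delta>"
    "\<And>\<sigma> u x y. trajectory e C \<sigma> u \<Longrightarrow> {x..y} \<subseteq> Z \<Longrightarrow> x \<le> y \<Longrightarrow> u y = u x"
proof -
  have "\<exists>e D. 0 < e \<and> e < \<delta> \<and> 0 < D \<and>
    (\<forall>u0\<in>cball Ub e. \<forall>u\<in>cball Ub e. \<forall>\<xi>\<in>Z. norm (u - u0) \<le> D * norm (G \<xi> u - G \<xi> u0))"
    by (rule gap_pair[OF assms(1)]) (rule assms(2))
  then obtain e D where e: "0 < e" "e < \<delta>" "0 < D" and
    D': "\<forall>u0\<in>cball Ub e. \<forall>u\<in>cball Ub e. \<forall>\<xi>\<in>Z. norm (u - u0) \<le> D * norm (G \<xi> u - G \<xi> u0)"
    by - (elim exE conjE, rule that; assumption)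
  have D: "norm (u - u0) \<le> D * norm (G \<xi> u - G \<xi> u0)" if "u0 \<in> cball Ub e" "u \<in> cball Ub e" "\<xi> \<in> Z" for u0 u \<xi>
    by (rule D'[rule_format, OF that])
  show ?thesis
  proof (rule that[OF e(1,2)])
    fix \<sigma> u x y assume u: "trajectory e C \<sigma> u" and xy: "{x..y} \<subseteq> Z" "x \<le> y"
    show "u y = u x"
    proof (rule constancy_propagates[where p = x and q = y and h = 1 and C = "D * C" and K = "2 * e"])
      fix p q M assume pq: "x \<le> p" "p < q" "q \<le> y" "u p = u x" and M: "\<And>z. p \<le> z \<Longrightarrow> z \<le> q \<Longrightarrow> norm (u z - u x) \<le> M"
      have "norm (u q - u p) \<le> D * norm (G q (u q) - G q (u p))"
        using u pq xy by (intro D) (auto simp: trajectory_def image_subset_iff)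
      also have "\<dots> \<le> D * (C * M * \<bar>q - p\<bar>)"
      proof (rule mult_left_mono)
        show "norm (G q (u q) - G q (u p)) \<le> C * M * \<bar>q - p\<bar>"
          by (rule trajectoryD(1)[OF u]) (use M pq in \<open>auto simp: closed_segment_eq_real_ivl\<close>)
      qed (use e in simp)
      finally show "norm (u q - u x) \<le> D * C * M * (q - p)" using pq by simp
    qed (use trajectory_norm[OF u] e C xy in auto)
  qed
qed

end

section \<open>The sector around one eigenvalue\<close>

lemma jump_bound_mono: "jump_bound C B c d u \<Longrightarrow> B \<le> B' \<Longrightarrow> jump_bound C B' c d u"
  unfolding jump_bound_def by (meson order_trans)

context pencil_eigenvalue begin

text \<open>The pair estimates fix \<open>e\<close> and the constants; \<open>\<kappa>\<close> stays
  free below \<open>\<kappa>0\<close>, because it is chosen later in common for all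
  eigenvalues.\<close>

lemma sector:
  assumes C: "C \<ge> 1"
    and type: "(\<forall>\<^sub>F z in nhds Ub. \<forall>v\<in>E z. Dl z v = 0) \<or> (p = 1 \<and> (\<exists>r\<in>E Ub. Dl Ub r \<noteq> 0))"
  shows "\<exists>e \<kappa>0 D B. 0 < e \<and> e < \<delta> \<and> 0 < \<kappa>0 \<and> 0 \<le> D \<and> (\<forall>\<kappa> u \<sigma>. 0 < \<kappa> \<longrightarrow> \<kappa> \<le> \<kappa>0 \<longrightarrow> trajectory e C \<sigma> u \<longrightarrow>
     (\<forall>x. \<bar>l (u x) - l Ub\<bar> \<le> \<kappa>) \<longrightarrow> jump_bound D B (l Ub - \<kappa>) (l Ub + \<kappa>) u)"
  using type
proof
  assume "\<forall>\<^sub>F z in nhds Ub. \<forall>v\<in>E z. Dl z v = 0"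
  from degenerate_pair[OF this] obtain e' \<kappa>0 A where e': "0 < e'" "e' < \<delta>" "0 < \<kappa>0" "0 < A" and
    pair: "\<And>u0 u \<xi> \<rho>. \<lbrakk>u0 \<in> cball Ub e'; u \<in> cball Ub e'; \<bar>\<xi> - l Ub\<bar> \<le> \<kappa>0; norm (G \<xi> u - G \<xi> u0) \<le> \<rho>\<rbrakk> \<Longrightarrow>
      \<bar>l u0 - \<xi>\<bar> * norm (u - u0) \<le> A * \<rho> \<and> \<bar>l u - l u0\<bar> \<le> A * \<rho>" by blast
  \<comment> \<open>With this \<open>e\<close>, two points where the eigenvalue equals the point
    satisfy \<open>\<bar>y - x\<bar> \<le> \<bar>y - x\<bar> / 2\<close> by the second degenerate
    estimate, so they coincide and \<open>lip\<close> is trivial.\<close>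
  define e where "e = min e' (1 / (4 * (A * C)))"
  have AC: "A * C > 0" using e'(4) C by simp
  have e: "0 < e" "e \<le> e'" "e \<le> 1 / (4 * (A * C))" unfolding e_def using e'(1) AC by (simp, linarith+)
  have eAC: "A * C * (2 * e) \<le> 1 / 2"
  proof -
    have "A * C * (2 * e) \<le> A * C * (2 * (1 / (4 * (A * C))))" using e(3) AC by (intro mult_left_mono) auto
    also have "\<dots> = 1 / 2"
    proof -
      have "K * (2 * (1 / (4 * K))) = 1 / 2" if "K > 0" for K :: real using that by simp
      from this[OF AC] show ?thesis .
    qed
    finally show ?thesis .
  qed
  have "jump_bound (A * C) (4 * (2 * e)) (l Ub - \<kappa>) (l Ub + \<kappa>) u"
    if \<kappa>: "0 < \<kappa>" "\<kappa> \<le> \<kappa>0" and u: "trajectory e C \<sigma> u" for \<kappa> u \<sigma>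
  proof -
    have ub: "u x \<in> cball Ub e'" for x using trajectory_mono[OF u e(2)] by (auto simp: trajectory_def image_subset_iff)
    have p: "\<bar>l (u x) - y\<bar> * norm (u y - u x) \<le> A * (C * M * \<bar>y - x\<bar>) \<and> \<bar>l (u y) - l (u x)\<bar> \<le> A * (C * M * \<bar>y - x\<bar>)"
      if "y \<in> {l Ub - \<kappa>..l Ub + \<kappa>}" "x \<noteq> y" "\<And>z. z \<in> closed_segment x y \<Longrightarrow> norm (u z - u x) \<le> M" for x y M
    proof (rule pair[OF ub ub])
      show "\<bar>y - l Ub\<bar> \<le> \<kappa>0" using that(1) \<kappa> by auto
      show "norm (G y (u y) - G y (u x)) \<le> C * M * \<bar>y - x\<bar>" by (rule trajectoryD(1)[OF u that(2,3)])
    qed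
    interpret degenerate_trajectory "l Ub - \<kappa>" "l Ub + \<kappa>" u l "A * C" "2 * e"
    proof
      fix x y assume xy: "x \<in> {l Ub - \<kappa>..l Ub + \<kappa>}" "y \<in> {l Ub - \<kappa>..l Ub + \<kappa>}" "l (u x) = x" "l (u y) = y"
      show "norm (u y - u x) \<le> A * C * \<bar>y - x\<bar>"
      proof (cases "x = y")
        case False
        have "\<bar>y - x\<bar> \<le> A * (C * (2 * e) * \<bar>y - x\<bar>)"
          using p[OF xy(2) False, of "2 * e"] trajectory_norm[OF u] xy by auto
        also have "\<dots> \<le> 1 / 2 * \<bar>y - x\<bar>" using mult_right_mono[OF eAC abs_ge_zero[of "y - x"]] by (simp add: mult_ac)
        finally show ?thesis using False by simp
      qed simp
    next
      fix x y M assume "x \<in> {l Ub - \<kappa>..l Ub + \<kappa>}" "y \<in> {l Ub - \<kappa>..l Ub + \<kappa>}" "x \<noteq> y"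
        "\<And>z. z \<in> closed_segment x y \<Longrightarrow> norm (u z - u x) \<le> M"
      then show "\<bar>l (u x) - y\<bar> * norm (u y - u x) \<le> A * C * M * \<bar>y - x\<bar>" using p[of y x M] by (simp add: mult.assoc)
    qed (use \<kappa> AC trajectory_norm[OF u] in auto)
    show ?thesis by (rule jump_bound)
  qed
  note jb = this
  have "e < \<delta>" "0 \<le> A * C" using e(2) e'(2) AC by linarith+
  with jb e(1) e'(3) show ?thesis
    by - (rule exI[of _ e], rule exI[of _ \<kappa>0], rule exI[of _ "A * C"], rule exI[of _ "4 * (2 * e)"],
      intro conjI allI impI; (assumption | rule jb; assumption))
next
  assume "p = 1 \<and> (\<exists>r\<in>E Ub. Dl Ub r \<noteq> 0)"
  then obtain r where p1: "p = 1" and r: "r \<in> E Ub" "Dl Ub r \<noteq> 0" by blast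
  \<comment> \<open>Rescaling normalizes the slope of \<open>l\<close> along the eigenvector to
    1.\<close>
  have "(1 / Dl Ub r) *\<^sub>R r \<in> E Ub" "Dl Ub ((1 / Dl Ub r) *\<^sub>R r) = 1"
    using r subspace_mul[OF subspace_E] by (auto simp: blinfun.scaleR_right)
  from nonlinear_pair[OF this p1] obtain e \<kappa>0 A where e: "0 < e" "e < \<delta>" "0 < \<kappa>0" "0 < A" and
    pair': "\<forall>u0\<in>cball Ub e. \<forall>u\<in>cball Ub e. \<forall>\<xi> \<rho>. \<bar>\<xi> - l Ub\<bar> \<le> \<kappa>0 \<longrightarrow> norm (G \<xi> u - G \<xi> u0) \<le> \<rho> \<longrightarrow>
      (\<forall>s. \<bar>s\<bar> = 1 \<longrightarrow> s * (H \<xi> u - H \<xi> u0) \<le> \<rho> \<longrightarrow> s * (l u0 - \<xi>) \<le> 0 \<longrightarrow> norm (u - u0) ^ 3 \<le> A * \<rho>) \<and>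
      \<bar>l u0 - \<xi>\<bar> * norm (u - u0) \<le> A * norm (u - u0) ^ 2 + A * \<rho> \<and>
      norm (u - u0) \<le> A * (\<bar>l u - l u0\<bar> + \<rho>)" by - (elim exE conjE, rule that; assumption)
  have pair: "(\<forall>s. \<bar>s\<bar> = 1 \<longrightarrow> s * (H \<xi> u - H \<xi> u0) \<le> \<rho> \<longrightarrow> s * (l u0 - \<xi>) \<le> 0 \<longrightarrow> norm (u - u0) ^ 3 \<le> A * \<rho>) \<and>
      \<bar>l u0 - \<xi>\<bar> * norm (u - u0) \<le> A * norm (u - u0) ^ 2 + A * \<rho> \<and>
      norm (u - u0) \<le> A * (\<bar>l u - l u0\<bar> + \<rho>)"
    if "u0 \<in> cball Ub e" "u \<in> cball Ub e" "\<bar>\<xi> - l Ub\<bar> \<le> \<kappa>0" "norm (G \<xi> u - G \<xi> u0) \<le> \<rho>" for u0 u \<xi> \<rho>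
    by (rule pair'[THEN bspec, OF that(1), THEN bspec, OF that(2), THEN spec, THEN spec, THEN mp, OF that(3), THEN mp, OF that(4)])
  \<comment> \<open>The factor \<open>1 + 2 * e\<close> comes from \<open>lip\<close>, where the
    oscillation is bounded by \<open>2 * e\<close>.\<close>
  define D where "D = A * C * (1 + 2 * e)"
  have D: "A \<le> D" "A * C \<le> D" "0 < D"
  proof -
    have "A \<le> A * C" using mult_left_mono[OF C, of A] e(4) by simp
    moreover have "A * C * 1 \<le> D" unfolding D_def using e C by (intro mult_left_mono) auto
    then have "A * C \<le> D" by simp
    ultimately show "A \<le> D" "A * C \<le> D" "0 < D" using e(4) by linarith+
  qed
  have "jump_bound D (4 * (2 * e) + 4 * D * \<kappa>0) (l Ub - \<kappa>) (l Ub + \<kappa>) u"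
    if \<kappa>: "0 < \<kappa>" "\<kappa> \<le> \<kappa>0" and u: "trajectory e C \<sigma> u" and lu: "\<forall>x. \<bar>l (u x) - l Ub\<bar> \<le> \<kappa>" for \<kappa> u \<sigma>
  proof -
    have ub: "u x \<in> cball Ub e" for x using u by (auto simp: trajectory_def image_subset_iff)
    have \<sigma>: "\<bar>\<sigma>\<bar> = 1" using u by (simp add: trajectory_def)
    have p: "(\<sigma> * sgn (y - x) * (l (u x) - y) \<le> 0 \<longrightarrow> norm (u y - u x) ^ 3 \<le> A * (C * M * \<bar>y - x\<bar>)) \<and>
      \<bar>l (u x) - y\<bar> * norm (u y - u x) \<le> A * norm (u y - u x) ^ 2 + A * (C * M * \<bar>y - x\<bar>) \<and>
      norm (u y - u x) \<le> A * (\<bar>l (u y) - l (u x)\<bar> + C * M * \<bar>y - x\<bar>)"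
      if y: "y \<in> {l Ub - \<kappa>..l Ub + \<kappa>}" "x \<noteq> y" and M: "\<And>z. z \<in> closed_segment x y \<Longrightarrow> norm (u z - u x) \<le> M" for x y M
    proof -
      have "\<bar>y - l Ub\<bar> \<le> \<kappa>0" using y(1) \<kappa> by auto
      note \<kappa>y = this
      have t1: "norm (G y (u y) - G y (u x)) \<le> C * M * \<bar>y - x\<bar>"
        by (rule trajectoryD(1)[OF u y(2)]) (rule M)
      have t2: "\<sigma> * sgn (y - x) * (H y (u y) - H y (u x)) \<le> C * M * \<bar>y - x\<bar>"
        by (rule trajectoryD(2)[OF u y(2)]) (rule M)
      note pr = pair[of "u x" "u y" y "C * M * \<bar>y - x\<bar>", OF ub ub \<kappa>y t1]
      have s1: "\<bar>\<sigma> * sgn (y - x)\<bar> = 1" using \<sigma> y(2) by (simp add: abs_mult sgn_if)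
      show ?thesis
        using pr(1)[THEN conjunct1, THEN spec, THEN mp, OF s1, THEN mp, OF t2] pr(1)[THEN conjunct2]
        by (intro conjI; blast)
    qed
    interpret nonlinear_trajectory "l Ub - \<kappa>" "l Ub + \<kappa>" u l D "2 * e" \<sigma>
    proof
      fix x y assume xy: "x \<in> {l Ub - \<kappa>..l Ub + \<kappa>}" "y \<in> {l Ub - \<kappa>..l Ub + \<kappa>}" "l (u x) = x" "l (u y) = y"
      show "norm (u y - u x) \<le> D * \<bar>y - x\<bar>"
      proof (cases "x = y")
        case False
        have "norm (u y - u x) \<le> A * (\<bar>y - x\<bar> + C * (2 * e) * \<bar>y - x\<bar>)"
          using p[OF xy(2) False, of "2 * e"] trajectory_norm[OF u] xy by auto
        also have "\<dots> \<le> A * (C * \<bar>y - x\<bar> + C * (2 * e) * \<bar>y - x\<bar>)"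
          using mult_right_mono[OF C abs_ge_zero[of "y - x"]] e(4) by (intro mult_left_mono add_right_mono) auto
        also have "\<dots> = D * \<bar>y - x\<bar>" by (simp add: D_def algebra_simps)
        finally show ?thesis .
      qed simp
    next
      fix x y M assume y: "x \<in> {l Ub - \<kappa>..l Ub + \<kappa>}" "y \<in> {l Ub - \<kappa>..l Ub + \<kappa>}" "x \<noteq> y"
        and M: "\<And>z. z \<in> closed_segment x y \<Longrightarrow> norm (u z - u x) \<le> M"
      have "0 \<le> M" using M[of x] by simp
      then have "A * C * (M * \<bar>y - x\<bar>) \<le> D * (M * \<bar>y - x\<bar>)" using D(2) by (intro mult_right_mono) auto
      then have AD: "A * (C * M * \<bar>y - x\<bar>) \<le> D * M * \<bar>y - x\<bar>" by (simp add: mult.assoc)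
      show "norm (u y - u x) ^ 3 \<le> D * M * \<bar>y - x\<bar>" if "\<sigma> * sgn (y - x) * (l (u x) - y) \<le> 0"
        using p[OF y(2,3) M] that AD by linarith
      have "A * norm (u y - u x) ^ 2 \<le> D * norm (u y - u x) ^ 2" using D(1) by (rule mult_right_mono) simp
      then show "\<bar>l (u x) - y\<bar> * norm (u y - u x) \<le> D * norm (u y - u x) ^ 2 + D * M * \<bar>y - x\<bar>"
        using p[OF y(2,3) M] AD by linarith
    qed (use \<kappa> D trajectory_norm[OF u] in auto)
    have D\<kappa>: "D * \<kappa> \<le> D * \<kappa>0" "0 \<le> D * \<kappa>" using D(3) \<kappa> by auto
    show ?thesis
    proof (cases "\<sigma> = 1")
      case True
      have "4 * (2 * e) \<le> 4 * (2 * e) + 4 * D * \<kappa>0" using D\<kappa> by simp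
      with jump_bound_forward[OF True] show ?thesis by (rule jump_bound_mono)
    next
      case False
      then have "\<sigma> = -1" using \<sigma> by linarith
      moreover have "l (u x) \<in> {l Ub - \<kappa>..l Ub + \<kappa>}" for x using lu[rule_format, of x] by (auto simp: abs_le_iff)
      ultimately have "jump_bound D (2 * D * (l Ub + \<kappa> - (l Ub - \<kappa>))) (l Ub - \<kappa>) (l Ub + \<kappa>) u"
        by (intro jump_bound_backward)
      then show ?thesis by (rule jump_bound_mono) (use D\<kappa> e(1) in simp)
    qed
  qed
  note jb = this
  from e D(3)[THEN less_imp_le] show ?thesis
    by - (rule exI[of _ e], rule exI[of _ \<kappa>0], rule exI[of _ D], rule exI[of _ "4 * (2 * e) + 4 * D * \<kappa>0"],
      intro conjI allI impI; (assumption | rule jb; assumption))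
qed

end

section \<open>Assembling the sectors\<close>

lemma has_sum_finite_sum:
  fixes f :: "'i \<Rightarrow> 'b \<Rightarrow> 'a::real_normed_vector"
  assumes "finite I" "\<And>i. i \<in> I \<Longrightarrow> (f i has_sum s i) S"
  shows "((\<lambda>x. \<Sum>i\<in>I. f i x) has_sum (\<Sum>i\<in>I. s i)) S"
  using assms by (induction I rule: finite_induct) (auto intro: has_sum_add)

text \<open>Each sector brings its own atoms, and their sums serve for all sectors. The bound is
  additive over adjacent intervals, and \<open>u\<close> is constant between the sectors.\<close>

lemma jump_bound_glue:
  fixes \<mu> :: "nat \<Rightarrow> real" and u :: "real \<Rightarrow> 'a::real_normed_vector"
  assumes sep: "\<And>\<alpha> \<beta>. \<lbrakk>\<alpha> \<in> {1..n}; \<beta> \<in> {1..n}; \<alpha> < \<beta>\<rbrakk> \<Longrightarrow> \<mu> \<alpha> + \<kappa> \<le> \<mu> \<beta> - \<kappa>" and \<kappa>: "\<kappa> > 0" and C: "C \<ge> 0"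
    and jb: "\<And>\<alpha>. \<alpha> \<in> {1..n} \<Longrightarrow> jump_bound C B (\<mu> \<alpha> - \<kappa>) (\<mu> \<alpha> + \<kappa>) u"
    and const: "\<And>x y. \<lbrakk>x \<le> y; \<And>\<alpha>. \<alpha> \<in> {1..n} \<Longrightarrow> y \<le> \<mu> \<alpha> - \<kappa> \<or> \<mu> \<alpha> + \<kappa> \<le> x\<rbrakk> \<Longrightarrow> u y = u x"
  obtains a b where "a summable_on UNIV" "b summable_on UNIV" "\<And>s. 0 \<le> a s" "\<And>s. 0 \<le> b s"
    "infsum a UNIV + infsum b UNIV \<le> real n * B"
    "\<And>s. (\<And>\<alpha>. \<alpha> \<in> {1..n} \<Longrightarrow> s \<notin> {\<mu> \<alpha> - \<kappa>..\<mu> \<alpha> + \<kappa>}) \<Longrightarrow> a s = 0 \<and> b s = 0"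
    "\<And>x y. x < y \<Longrightarrow> norm (u y - u x) \<le> C * (y - x) + infsum a {x<..y} + infsum b {x..<y}"
proof -
  define P where "P \<alpha> a b \<longleftrightarrow> a summable_on UNIV \<and> b summable_on UNIV \<and> (\<forall>s. 0 \<le> a s) \<and> (\<forall>s. 0 \<le> b s) \<and> infsum a UNIV + infsum b UNIV \<le> B \<and>
     (\<forall>s. s \<notin> {\<mu> \<alpha> - \<kappa>..\<mu> \<alpha> + \<kappa>} \<longrightarrow> a s = 0 \<and> b s = 0) \<and>
     (\<forall>x y. \<mu> \<alpha> - \<kappa> \<le> x \<and> x < y \<and> y \<le> \<mu> \<alpha> + \<kappa> \<longrightarrow> norm (u y - u x) \<le> C * (y - x) + infsum a {x<..y} + infsum b {x..<y})"
    for \<alpha> and a b :: "real \<Rightarrow> real"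
  have "\<forall>\<alpha>\<in>{1..n}. \<exists>a. \<exists>b. P \<alpha> a b" using jb unfolding jump_bound_def P_def by (intro ballI)
  from bchoice[OF this] obtain a where "\<forall>\<alpha>\<in>{1..n}. \<exists>b. P \<alpha> (a \<alpha>) b" ..
  from bchoice[OF this] obtain b where P: "\<forall>\<alpha>\<in>{1..n}. P \<alpha> (a \<alpha>) (b \<alpha>)" ..
  have ab: "\<And>\<alpha>. \<alpha> \<in> {1..n} \<Longrightarrow> a \<alpha> summable_on UNIV" "\<And>\<alpha>. \<alpha> \<in> {1..n} \<Longrightarrow> b \<alpha> summable_on UNIV"
    "\<And>\<alpha> s. \<alpha> \<in> {1..n} \<Longrightarrow> 0 \<le> a \<alpha> s" "\<And>\<alpha> s. \<alpha> \<in> {1..n} \<Longrightarrow> 0 \<le> b \<alpha> s"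
    "\<And>\<alpha>. \<alpha> \<in> {1..n} \<Longrightarrow> infsum (a \<alpha>) UNIV + infsum (b \<alpha>) UNIV \<le> B"
    "\<And>\<alpha> s. \<alpha> \<in> {1..n} \<Longrightarrow> s \<notin> {\<mu> \<alpha> - \<kappa>..\<mu> \<alpha> + \<kappa>} \<Longrightarrow> a \<alpha> s = 0 \<and> b \<alpha> s = 0"
    "\<And>\<alpha> x y. \<alpha> \<in> {1..n} \<Longrightarrow> \<mu> \<alpha> - \<kappa> \<le> x \<Longrightarrow> x < y \<Longrightarrow> y \<le> \<mu> \<alpha> + \<kappa> \<Longrightarrow>
       norm (u y - u x) \<le> C * (y - x) + infsum (a \<alpha>) {x<..y} + infsum (b \<alpha>) {x..<y}"
    using P unfolding P_def by blast+
  define A where "A s = (\<Sum>\<alpha>\<in>{1..n}. a \<alpha> s)" for s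
  define B' where "B' s = (\<Sum>\<alpha>\<in>{1..n}. b \<alpha> s)" for s
  have sa: "a \<alpha> summable_on S" "b \<alpha> summable_on S" if "\<alpha> \<in> {1..n}" for \<alpha> S
    using ab(1,2)[OF that] by (auto intro: summable_on_subset_banach)
  have hA: "(A has_sum (\<Sum>\<alpha>\<in>{1..n}. infsum (a \<alpha>) S)) S" "(B' has_sum (\<Sum>\<alpha>\<in>{1..n}. infsum (b \<alpha>) S)) S" for S
    unfolding A_def B'_def by (intro has_sum_finite_sum finite_atLeastAtMost has_sum_infsum sa; assumption)+
  have iA: "infsum A S = (\<Sum>\<alpha>\<in>{1..n}. infsum (a \<alpha>) S)" "infsum B' S = (\<Sum>\<alpha>\<in>{1..n}. infsum (b \<alpha>) S)"
    and sA: "A summable_on S" "B' summable_on S" for S using hA[of S] by (auto simp: has_sum_iff)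
  have A0: "0 \<le> A s" "0 \<le> B' s" for s unfolding A_def B'_def by (intro sum_nonneg ab; assumption)+
  have leA: "infsum (a \<alpha>) S \<le> infsum A S" "infsum (b \<alpha>) S \<le> infsum B' S" if "\<alpha> \<in> {1..n}" for \<alpha> S
    unfolding iA using that ab(3,4) by (auto intro!: member_le_sum infsum_nonneg)
  define Q where "Q x y \<longleftrightarrow> norm (u y - u x) \<le> C * (y - x) + infsum A {x<..y} + infsum B' {x..<y}" for x y
  have Q_trans: "Q x z" if "x \<le> y" "y \<le> z" "Q x y" "Q y z" for x y z
  proof -
    have "infsum A {x<..z} = infsum A {x<..y} + infsum A {y<..z}"
      by (subst infsum_Un_disjoint[symmetric]) (use that sA in \<open>auto intro!: arg_cong[of _ _ "infsum A"]\<close>)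
    moreover have "infsum B' {x..<z} = infsum B' {x..<y} + infsum B' {y..<z}"
      by (subst infsum_Un_disjoint[symmetric]) (use that sA in \<open>auto intro!: arg_cong[of _ _ "infsum B'"]\<close>)
    moreover have "norm (u z - u x) \<le> norm (u z - u y) + norm (u y - u x)"
      using norm_triangle_ineq[of "u z - u y" "u y - u x"] by simp
    ultimately show ?thesis using that(3,4) unfolding Q_def by (simp add: algebra_simps)
  qed
  have Q_const: "Q x y" if "u y = u x" "x \<le> y" for x y
    unfolding Q_def using that C infsum_nonneg[of "{x<..y}" A] infsum_nonneg[of "{x..<y}" B'] A0 by simp
  have Q_sector: "Q x y" if "\<alpha> \<in> {1..n}" "\<mu> \<alpha> - \<kappa> \<le> x" "x \<le> y" "y \<le> \<mu> \<alpha> + \<kappa>" for \<alpha> x y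
  proof (cases "x = y")
    case False
    then have "x < y" using that by simp
    then show ?thesis unfolding Q_def using ab(7)[OF that(1,2) \<open>x < y\<close> that(4)] add_mono[OF leA(1)[OF that(1), of "{x<..y}"] leA(2)[OF that(1), of "{x..<y}"]] by linarith
  qed (simp add: Q_const)
  \<comment> \<open>Induction on the number of sectors that \<open>y\<close> may have entered: those
    with index above \<open>k\<close> lie to the right of \<open>y\<close>.\<close>
  have main: "Q x y" if "k \<le> n" "x \<le> y" "\<And>\<alpha>. \<alpha> \<in> {Suc k..n} \<Longrightarrow> y \<le> \<mu> \<alpha> - \<kappa>" for k x y
    using that
  proof (induction k arbitrary: x y)
    case 0
    then show ?case by (intro Q_const const) auto
  next
    case (Suc k)
    let ?\<alpha> = "Suc k"
    have \<alpha>: "?\<alpha> \<in> {1..n}" using Suc.prems by auto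
    let ?c = "\<mu> ?\<alpha> - \<kappa>" and ?d = "\<mu> ?\<alpha> + \<kappa>"
    have left: "Q x y" if "x \<le> y" "y \<le> ?c" for x y
    proof (rule Suc.IH)
      fix \<beta> assume \<beta>: "\<beta> \<in> {?\<alpha>..n}"
      show "y \<le> \<mu> \<beta> - \<kappa>" using sep[of ?\<alpha> \<beta>] \<alpha> \<beta> that \<kappa> by (cases "\<beta> = ?\<alpha>") auto
    qed (use Suc.prems that in auto)
    have right: "Q x y'" if "?d \<le> x" "x \<le> y'" "y' \<le> y" for x y'
    proof (intro Q_const const that)
      fix \<beta> assume \<beta>: "\<beta> \<in> {1..n}"
      consider "\<beta> < ?\<alpha>" | "\<beta> = ?\<alpha>" | "\<beta> \<in> {Suc ?\<alpha>..n}" using \<beta> by fastforce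
      then show "y' \<le> \<mu> \<beta> - \<kappa> \<or> \<mu> \<beta> + \<kappa> \<le> x"
      proof cases
        case 1
        then show ?thesis using sep[OF \<beta> \<alpha> 1] that(1) \<kappa> by linarith
      next
        case 2
        then show ?thesis using that(1) by simp
      next
        case 3
        then show ?thesis using Suc.prems(3)[OF 3] that(3) by linarith
      qed
    qed
    have upto_d: "Q x y" if "x \<le> y" "y \<le> ?d" for x y
    proof -
      consider "y \<le> ?c" | "?c \<le> x" | "x \<le> ?c" "?c \<le> y" by linarith
      then show ?thesis
        by cases (use left Q_sector[OF \<alpha>] Q_trans[of x ?c y] that in auto)
    qed
    consider "y \<le> ?d" | "?d \<le> x" | "x \<le> ?d" "?d \<le> y" by linarith
    then show ?case
    proof cases
      case 1
      then show ?thesis using upto_d Suc.prems(2) by blast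
    next
      case 2
      then show ?thesis by (rule right) (use Suc.prems(2) in auto)
    next
      case 3
      then show ?thesis by (intro Q_trans[of x ?d y] upto_d right order_refl)
    qed
  qed
  have "infsum A UNIV + infsum B' UNIV \<le> real n * B"
  proof -
    have "infsum A UNIV + infsum B' UNIV = (\<Sum>\<alpha>\<in>{1..n}. infsum (a \<alpha>) UNIV + infsum (b \<alpha>) UNIV)"
      unfolding iA by (simp add: sum.distrib)
    also have "\<dots> \<le> (\<Sum>\<alpha>\<in>{1..n}. B)" by (intro sum_mono ab(5))
    finally show ?thesis by simp
  qed
  moreover have "A s = 0 \<and> B' s = 0" if "\<And>\<alpha>. \<alpha> \<in> {1..n} \<Longrightarrow> s \<notin> {\<mu> \<alpha> - \<kappa>..\<mu> \<alpha> + \<kappa>}" for s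
    unfolding A_def B'_def using ab(6)[OF _ that] by (intro conjI sum.neutral ballI) blast+
  moreover have "norm (u y - u x) \<le> C * (y - x) + infsum A {x<..y} + infsum B' {x..<y}" if "x < y" for x y
    using main[of n x y] that unfolding Q_def by auto
  ultimately show ?thesis using that[of A B'] sA A0 by blast
qed

section \<open>Systems with a convex entropy\<close>

lemma Ck_on_subset:
  assumes "Ck_on k f S" "T \<subseteq> S"
  shows "Ck_on k f T"
  using assms by (induction k arbitrary: f) (auto intro: continuous_on_subset)

lemma jacobian_mult:
  fixes f :: "real^'m \<Rightarrow> real^'k"
  assumes "(f has_derivative f') (at x)"
  shows "jacobian f (at x) *v v = f' v"
proof -
  have "(f has_derivative (\<lambda>h. jacobian f (at x) *v h)) (at x)"
    using assms by (simp only: jacobian_works[symmetric]) (rule differentiableI)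
  then have "(\<lambda>h. jacobian f (at x) *v h) = f'" using assms by (rule has_derivative_unique)
  then show ?thesis by (rule fun_cong)
qed

text \<open>The real eigenvector, read as a complex one, lies in the kernel of the complex
  matrix.\<close>

lemma gen_eigenvaluesI:
  fixes A B :: "real^'m^'m"
  assumes "B *v v = \<xi> *\<^sub>R (A *v v)" "v \<noteq> 0"
  shows "complex_of_real \<xi> \<in> gen_eigenvalues A B"
proof -
  let ?M = "cmat B - (\<chi> i j. complex_of_real \<xi> * cmat A $ i $ j)"
  let ?v = "(\<chi> i. complex_of_real (v $ i)) :: complex^'m"
  have "(?M *v ?v) $ i = 0" for i
  proof -
    have "(?M *v ?v) $ i = complex_of_real (\<Sum>j\<in>UNIV. (B $ i $ j - \<xi> * A $ i $ j) * v $ j)"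
      by (simp add: matrix_vector_mult_def cmat_def)
    also have "(\<Sum>j\<in>UNIV. (B $ i $ j - \<xi> * A $ i $ j) * v $ j) = (B *v v) $ i - (\<xi> *\<^sub>R (A *v v)) $ i"
      by (simp add: matrix_vector_mult_def left_diff_distrib sum_subtractf sum_distrib_left mult.assoc)
    finally show ?thesis using assms(1) by simp
  qed
  then have M: "?M *v ?v = 0" by (simp add: vec_eq_iff)
  have v: "?v \<noteq> 0" using assms(2) by (simp add: vec_eq_iff)
  have "det ?M = 0"
  proof (rule ccontr)
    assume "det ?M \<noteq> 0"
    then have "\<exists>B. B ** ?M = mat 1" by (simp add: invertible_det_nz[symmetric] invertible_left_inverse)
    then have "\<forall>x. ?M *v x = 0 \<longrightarrow> x = 0" unfolding matrix_left_invertible_ker .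
    then show False using M v by blast
  qed
  then show ?thesis by (simp add: gen_eigenvalues_def)
qed

text \<open>The minimum of the Rayleigh quotient is an eigenvalue of \<open>X\<close>.\<close>

lemma symmetrized_positive_definite:
  fixes N X :: "'a::euclidean_space \<Rightarrow> 'a"
  assumes N: "linear N" and X: "linear X" and symN: "\<And>v w. N v \<bullet> w = N w \<bullet> v"
    and symX: "\<And>v w. N v \<bullet> X w = N w \<bullet> X v" and pd: "\<And>v. v \<noteq> 0 \<Longrightarrow> N v \<bullet> v > 0"
    and eigen: "\<And>\<xi> v. \<lbrakk>X v = \<xi> *\<^sub>R v; v \<noteq> 0\<rbrakk> \<Longrightarrow> \<xi> > 0" and v: "v \<noteq> 0"
  shows "N v \<bullet> X v > 0"
proof -
  interpret N: linear N by fact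
  interpret X: linear X by fact
  have c: "continuous_on S N" "continuous_on S X" for S
    using N X by (simp_all add: linear_continuous_on linear_conv_bounded_linear)
  have ne: "sphere (0::'a) 1 \<noteq> {}"
  proof -
    have "v /\<^sub>R norm v \<in> sphere 0 1" using v by simp
    then show ?thesis by blast
  qed
  have nz: "N v \<bullet> v \<noteq> 0" if "v \<in> sphere 0 1" for v using pd[of v] that by force
  have "\<exists>v0\<in>sphere 0 1. \<forall>v\<in>sphere 0 1. (N v0 \<bullet> X v0) / (N v0 \<bullet> v0) \<le> (N v \<bullet> X v) / (N v \<bullet> v)"
    by (intro continuous_attains_inf compact_sphere ne continuous_intros c) (use nz in blast)
  then obtain v0 where v0: "norm v0 = 1"
    "\<And>v. norm v = 1 \<Longrightarrow> (N v0 \<bullet> X v0) / (N v0 \<bullet> v0) \<le> (N v \<bullet> X v) / (N v \<bullet> v)" by auto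
  define m where "m = (N v0 \<bullet> X v0) / (N v0 \<bullet> v0)"
  have v00: "v0 \<noteq> 0" using v0(1) by auto
  have m0: "N v0 \<bullet> (X v0 - m *\<^sub>R v0) = 0"
    using pd[OF v00] by (simp add: m_def inner_diff_right)
  have m: "N w \<bullet> (X w - m *\<^sub>R w) \<ge> 0" for w
  proof (cases "w = 0")
    case False
    let ?w = "w /\<^sub>R norm w"
    have "m \<le> (N ?w \<bullet> X ?w) / (N ?w \<bullet> ?w)" unfolding m_def by (rule v0(2)) (use False in simp)
    also have "\<dots> = (N w \<bullet> X w) / (N w \<bullet> w)" using False by (simp add: N.scale X.scale)
    finally show ?thesis using pd[OF False] by (simp add: inner_diff_right field_simps)
  qed (simp add: N.zero)
  have "N w \<bullet> (X v0 - m *\<^sub>R v0) = 0" for w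
  proof (rule ccontr)
    let ?c = "N w \<bullet> (X v0 - m *\<^sub>R v0)" and ?d = "N w \<bullet> (X w - m *\<^sub>R w)"
    assume c: "?c \<noteq> 0"
    have d: "?d \<ge> 0" by (rule m)
    \<comment> \<open>Along \<open>v0 + t *\<^sub>R w\<close> the form equals
      \<open>2 * t * ?c + t * t * ?d\<close>; this \<open>t\<close> makes it negative, and
      \<open>?d + 1\<close> avoids a division by zero.\<close>
    define t where "t = - ?c / (?d + 1)"
    have e: "N v0 \<bullet> X w = N w \<bullet> X v0" "N v0 \<bullet> w = N w \<bullet> v0" by (rule symX symN)+
    have "N (v0 + t *\<^sub>R w) \<bullet> (X (v0 + t *\<^sub>R w) - m *\<^sub>R (v0 + t *\<^sub>R w)) = 2 * t * ?c + t * t * ?d"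
      using m0 by (simp add: N.add N.scale X.add X.scale inner_diff_right inner_add_left inner_add_right e algebra_simps)
    then have "0 \<le> 2 * t * ?c + t * t * ?d" using m[of "v0 + t *\<^sub>R w"] by simp
    also have "\<dots> = - ((?c * ?c) * (?d + 2) / ((?d + 1) * (?d + 1)))"
      using d by (simp add: t_def divide_simps) (simp add: algebra_simps)
    also have "\<dots> < 0"
    proof -
      have "0 < ?c * ?c" using c by (metis not_real_square_gt_zero)
      then have "0 < (?c * ?c) * (?d + 2)" using d by (intro mult_pos_pos[of "?c * ?c"]) simp_all
      moreover have "0 < (?d + 1) * (?d + 1)" using d by (intro mult_pos_pos) simp_all
      ultimately show ?thesis by (simp only: neg_less_0_iff_less divide_pos_pos)
    qed
    finally show False by simp
  qed
  from this[of "X v0 - m *\<^sub>R v0"] have "X v0 = m *\<^sub>R v0" using pd[of "X v0 - m *\<^sub>R v0"] by force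
  then have "m > 0" using v00 by (rule eigen)
  then have "0 < m * (N v \<bullet> v)" using pd[OF v] by simp
  also have "\<dots> \<le> N v \<bullet> X v" using m[of v] by (simp add: inner_diff_right)
  finally show ?thesis .
qed

text \<open>The second derivative of \<open>\<psi>\<close> is symmetric, and so is its part that
  contains the second derivative of \<open>f\<close>; what remains is the asserted symmetry.\<close>

lemma entropy_flux_symmetric:
  fixes f :: "'a::euclidean_space \<Rightarrow> 'a" and \<psi> :: "'a \<Rightarrow> real" and h1 :: "'a \<Rightarrow> 'a \<Rightarrow>\<^sub>L real"
  assumes S: "open S" "u \<in> S"
    and f: "\<And>y. y \<in> S \<Longrightarrow> (f has_derivative blinfun_apply (X y)) (at y)" "(X has_derivative X2) (at u)"
    and h: "(h1 has_derivative h2) (at u)"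
    and \<psi>: "\<And>y. y \<in> S \<Longrightarrow> (\<psi> has_derivative (\<lambda>v. h1 y (blinfun_apply (X y) v))) (at y)"
  shows "blinfun_apply (h2 v) (X u w) = blinfun_apply (h2 w) (X u v)"
proof -
  have "blinfun_apply ((h1 u o\<^sub>L X2 v) + (h2 v o\<^sub>L X u)) w = blinfun_apply ((h1 u o\<^sub>L X2 w) + (h2 w o\<^sub>L X u)) v"
  proof (rule symmetric_second_derivative_real[OF S])
    show "(\<psi> has_derivative blinfun_apply (h1 y o\<^sub>L X y)) (at y)" if "y \<in> S" for y
      using \<psi>[OF that] by (simp add: blinfun_compose.rep_eq comp_def)
    show "((\<lambda>y. h1 y o\<^sub>L X y) has_derivative (\<lambda>v. (h1 u o\<^sub>L X2 v) + (h2 v o\<^sub>L X u))) (at u)"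
      by (rule bounded_bilinear.FDERIV[OF bounded_bilinear_blinfun_compose h f(2)])
  qed
  then show ?thesis
    using symmetric_second_derivative[OF S f] by (simp add: blinfun.add_left)
qed

lemma entropy_system_pencil:
  fixes P :: "(real^'m) set"
  assumes sys: "entropy_system P fx fy \<eta> \<psi>x \<psi>y" and \<delta>: "\<delta> > 0" "ball Ub \<delta> \<subseteq> P"
    and positive: "\<forall>z\<in>gen_eigenvalues (mat 1) (jacobian fx (at Ub)). z \<in> \<real> \<and> Re z > 0"
  obtains n X Y N X2 Y2 N2 where "symmetrizable_pencil Ub \<delta> fx fy n X Y N X2 Y2 N2 \<psi>x \<psi>y"
proof -
  let ?S = "ball Ub \<delta>"
  have Ck: "Ck_on k fx ?S" "Ck_on k fy ?S" "Ck_on k \<eta> ?S" "Ck_on k \<psi>x ?S" "Ck_on k \<psi>y ?S" for k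
    by (rule Ck_on_subset[OF _ \<delta>(2)], use sys in \<open>simp add: entropy_system_def smooth_on_def\<close>)+
  obtain X X2 where X: "\<And>x. x \<in> ?S \<Longrightarrow> (fx has_derivative blinfun_apply (X x)) (at x)"
    "\<And>x. x \<in> ?S \<Longrightarrow> (X has_derivative blinfun_apply (X2 x)) (at x)" "continuous_on ?S X2"
    using Ck_on_2[OF Ck(1) open_ball] by metis
  obtain Y Y2 where Y: "\<And>x. x \<in> ?S \<Longrightarrow> (fy has_derivative blinfun_apply (Y x)) (at x)"
    "\<And>x. x \<in> ?S \<Longrightarrow> (Y has_derivative blinfun_apply (Y2 x)) (at x)" "continuous_on ?S Y2"
    using Ck_on_2[OF Ck(2) open_ball] by metis
  obtain h1 h2 h3 where h: "\<And>x. x \<in> ?S \<Longrightarrow> (\<eta> has_derivative blinfun_apply (h1 x)) (at x)"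
    "\<And>x. x \<in> ?S \<Longrightarrow> (h1 has_derivative blinfun_apply (h2 x)) (at x)"
    "\<And>x. x \<in> ?S \<Longrightarrow> (h2 has_derivative blinfun_apply (h3 x)) (at x)" "continuous_on ?S h3"
    using Ck_on_3[OF Ck(3) open_ball] by metis
  \<comment> \<open>Riesz representation; it turns the derivative of the entropy into the gradient
    \<open>n\<close> and its Hessian into the symmetrizer \<open>N\<close>.\<close>
  define J :: "((real^'m) \<Rightarrow>\<^sub>L real) \<Rightarrow> real^'m" where "J = (\<lambda>\<phi>. \<Sum>i\<in>Basis. blinfun_apply \<phi> i *\<^sub>R i)"
  have J: "bounded_linear J" unfolding J_def by (intro bounded_linear_intros)
  have J_inner: "J \<phi> \<bullet> v = blinfun_apply \<phi> v" for \<phi> v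
  proof -
    have "J \<phi> \<bullet> v = blinfun_apply \<phi> (\<Sum>i\<in>Basis. (v \<bullet> i) *\<^sub>R i)"
      by (simp only: J_def inner_sum_left blinfun.sum_right blinfun.scaleR_right) (simp add: inner_commute mult.commute)
    then show ?thesis by (simp add: euclidean_representation)
  qed
  have Jc: "bounded_linear (\<lambda>w. Blinfun J o\<^sub>L w)" by (intro bounded_linear_intros)
  define n where "n u = J (h1 u)" for u
  define N where "N u = Blinfun J o\<^sub>L h2 u" for u
  define N2 where "N2 u = Blinfun (\<lambda>w :: (real^'m) \<Rightarrow>\<^sub>L ((real^'m) \<Rightarrow>\<^sub>L real). Blinfun J o\<^sub>L w) o\<^sub>L h3 u" for u
  have N_apply: "blinfun_apply (N u) v = J (h2 u v)" for u v
    by (simp add: N_def bounded_linear_Blinfun_apply[OF J])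
  have N_inner: "blinfun_apply (N u) v \<bullet> w = blinfun_apply (h2 u v) w" for u v w
    by (simp add: N_apply J_inner)
  have pd: "blinfun_apply (h2 u v) v > 0" if "u \<in> ?S" "v \<noteq> 0" for u v
  proof -
    have "((\<lambda>W. blinfun_apply (h1 W) v) has_derivative (\<lambda>w. blinfun_apply (h2 u w) v)) (at u)"
      by (rule bounded_linear.has_derivative[OF blinfun.bounded_linear_left h(2)[OF that(1)]])
    then have "((\<lambda>W. frechet_derivative \<eta> (at W) v) has_derivative (\<lambda>w. blinfun_apply (h2 u w) v)) (at u)"
      by (rule has_derivative_transform_within_open[OF _ open_ball that(1)]) (simp add: frechet_derivative_at[OF h(1), symmetric])
    then have "frechet_derivative (\<lambda>W. frechet_derivative \<eta> (at W) v) (at u) = (\<lambda>w. blinfun_apply (h2 u w) v)"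
      by (rule frechet_derivative_at[symmetric])
    moreover have "frechet_derivative (\<lambda>W. frechet_derivative \<eta> (at W) v) (at u) v > 0"
      using sys \<delta>(2) that unfolding entropy_system_def by blast
    ultimately show ?thesis by simp
  qed
  have flux: "(\<psi> has_derivative (\<lambda>v. blinfun_apply (h1 u) (blinfun_apply (F u) v))) (at u)"
    if "u \<in> ?S" "(f has_derivative blinfun_apply (F u)) (at u)" "Ck_on (Suc 0) \<psi> ?S"
      "\<forall>U\<in>P. \<forall>v. frechet_derivative \<psi> (at U) v = frechet_derivative \<eta> (at U) (frechet_derivative f (at U) v)"
    for \<psi> and f :: "real^'m \<Rightarrow> real^'m" and F u
  proof -
    have "(\<psi> has_derivative frechet_derivative \<psi> (at u)) (at u)"
      using that(1,3) by (simp add: frechet_derivative_works[symmetric])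
    moreover have "u \<in> P" using that(1) \<delta>(2) by blast
    moreover from this have "frechet_derivative \<psi> (at u) = (\<lambda>v. blinfun_apply (h1 u) (blinfun_apply (F u) v))"
      using that(4) frechet_derivative_at[OF h(1)[OF that(1)]] frechet_derivative_at[OF that(2)] by (simp add: fun_eq_iff)
    ultimately show ?thesis by simp
  qed
  have \<psi>: "(\<psi>x has_derivative (\<lambda>v. blinfun_apply (h1 u) (blinfun_apply (X u) v))) (at u)"
    "(\<psi>y has_derivative (\<lambda>v. blinfun_apply (h1 u) (blinfun_apply (Y u) v))) (at u)" if "u \<in> ?S" for u
    using sys unfolding entropy_system_def by (auto intro!: flux that X(1) Y(1) simp only: Ck)
  have sym: "blinfun_apply (h2 u v) (X u w) = blinfun_apply (h2 u w) (X u v)"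
    "blinfun_apply (h2 u v) (Y u w) = blinfun_apply (h2 u w) (Y u v)" if "u \<in> ?S" for u v w
    by (rule entropy_flux_symmetric[OF open_ball that X(1) X(2) h(2) \<psi>(1)] entropy_flux_symmetric[OF open_ball that Y(1) Y(2) h(2) \<psi>(2)]; use that in simp)+
  have c: "Ub \<in> ?S" using \<delta>(1) by simp
  have "symmetrizable_pencil Ub \<delta> fx fy n X Y N X2 Y2 N2 \<psi>x \<psi>y"
  proof
    show "(n has_derivative blinfun_apply (N u)) (at u)" if "u \<in> ?S" for u
      using bounded_linear.has_derivative[OF J h(2)[OF that]] by (simp add: n_def[abs_def] N_apply[abs_def])
    show "(N has_derivative blinfun_apply (N2 u)) (at u)" if "u \<in> ?S" for u
      using bounded_linear.has_derivative[OF Jc h(3)[OF that]]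
      by (simp add: N_def[abs_def] N2_def bounded_linear_Blinfun_apply[OF Jc] blinfun_compose.rep_eq comp_def)
    show "continuous_on ?S N2"
      unfolding N2_def by (intro bounded_bilinear.continuous_on[OF bounded_bilinear_blinfun_compose] continuous_intros h(4))
    show "(\<psi>x has_derivative (\<lambda>v. n u \<bullet> blinfun_apply (X u) v)) (at u)"
      "(\<psi>y has_derivative (\<lambda>v. n u \<bullet> blinfun_apply (Y u) v)) (at u)" if "u \<in> ?S" for u
      using \<psi>[OF that] by (simp_all add: n_def J_inner)
    show "blinfun_apply (N u) v \<bullet> blinfun_apply (X u) w = blinfun_apply (N u) w \<bullet> blinfun_apply (X u) v"
      "blinfun_apply (N u) v \<bullet> blinfun_apply (Y u) w = blinfun_apply (N u) w \<bullet> blinfun_apply (Y u) v"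
      if "u \<in> ?S" for u v w using sym[OF that] by (simp_all add: N_inner)
    fix v :: "real^'m" assume v: "v \<noteq> 0"
    show "blinfun_apply (N Ub) v \<bullet> blinfun_apply (X Ub) v > 0"
    proof (rule symmetrized_positive_definite[OF _ _ _ _ _ _ v])
      show "linear (blinfun_apply (N Ub))" "linear (blinfun_apply (X Ub))"
        by (simp_all add: blinfun.bounded_linear_right bounded_linear.linear)
      show "blinfun_apply (N Ub) v \<bullet> w = blinfun_apply (N Ub) w \<bullet> v" for v w
        using symmetric_second_derivative_real[OF open_ball c h(1) h(2)[OF c], of v w] by (simp add: N_inner)
      show "blinfun_apply (N Ub) v \<bullet> blinfun_apply (X Ub) w = blinfun_apply (N Ub) w \<bullet> blinfun_apply (X Ub) v" for v w
        using sym(1)[OF c] by (simp add: N_inner)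
      show "blinfun_apply (N Ub) v \<bullet> v > 0" if "v \<noteq> 0" for v using pd[OF c that] by (simp add: N_inner)
      fix \<xi> and v :: "real^'m" assume v: "blinfun_apply (X Ub) v = \<xi> *\<^sub>R v" "v \<noteq> 0"
      have "complex_of_real \<xi> \<in> gen_eigenvalues (mat 1) (jacobian fx (at Ub))"
        by (rule gen_eigenvaluesI[OF _ v(2)]) (simp add: jacobian_mult[OF X(1)[OF c]] v(1))
      then show "\<xi> > 0" using positive by force
    qed
  qed (use \<delta> X Y in blast)+
  then show thesis by (rule that)
qed

lemma jump_bound_mono_rate:
  assumes "jump_bound C B c d u" "C \<le> C'"
  shows "jump_bound C' B c d u"
proof -
  obtain a b where ab: "a summable_on UNIV" "b summable_on UNIV" "\<forall>s. 0 \<le> a s" "\<forall>s. 0 \<le> b s"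
    "infsum a UNIV + infsum b UNIV \<le> B" "\<forall>s. s \<notin> {c..d} \<longrightarrow> a s = 0 \<and> b s = 0"
    and *: "\<forall>x y. c \<le> x \<and> x < y \<and> y \<le> d \<longrightarrow> norm (u y - u x) \<le> C * (y - x) + infsum a {x<..y} + infsum b {x..<y}"
    using assms(1) unfolding jump_bound_def by (elim exE conjE)
  have "norm (u y - u x) \<le> C' * (y - x) + infsum a {x<..y} + infsum b {x..<y}" if "c \<le> x \<and> x < y \<and> y \<le> d" for x y
    using *[THEN spec, THEN spec, THEN mp, OF that] mult_right_mono[OF assms(2), of "y - x"] that by linarith
  then show ?thesis
    unfolding jump_bound_def by - (rule exI[of _ a], rule exI[of _ b], intro conjI allI impI; use ab in blast)
qed

lemma finite_positive_lower_bound: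
  fixes f :: "'i \<Rightarrow> real"
  assumes "finite I" "\<And>i. i \<in> I \<Longrightarrow> 0 < f i"
  obtains m where "0 < m" "\<And>i. i \<in> I \<Longrightarrow> m \<le> f i"
proof
  show "0 < Min (insert 1 (f ` I))" using assms by (subst Min_gr_iff) auto
  show "Min (insert 1 (f ` I)) \<le> f i" if "i \<in> I" for i using assms(1) that by (intro Min_le) auto
qed

lemma finite_upper_bound:
  fixes f :: "'i \<Rightarrow> real"
  assumes "finite I"
  obtains m where "0 \<le> m" "\<And>i. i \<in> I \<Longrightarrow> f i \<le> m"
proof
  show "0 \<le> Max (insert 0 (f ` I))" using assms by (intro Max_ge) auto
  show "f i \<le> Max (insert 0 (f ` I))" if "i \<in> I" for i using assms(1) that by (intro Max_ge) auto
qed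

section \<open>Uniform constants for a system of constant multiplicity\<close>

locale constant_multiplicity_pencil =
  symmetrizable_pencil Ub \<delta> fx fy n X Y N X2 Y2 N2 \<psi>x \<psi>y
  for Ub :: "real^'m" and \<delta> fx fy n X Y N X2 Y2 N2 \<psi>x \<psi>y +
  fixes k :: nat and lam :: "nat \<Rightarrow> real^'m \<Rightarrow> real" and p :: "nat \<Rightarrow> nat"
  assumes mult: "constant_multiplicity fx fy Ub \<delta> k lam p"
    and fields: "\<forall>\<alpha>\<in>{1..k}. p \<alpha> = 1 \<longrightarrow>
          genuinely_nonlinear (in_V fx Ub \<delta> fy) (lam \<alpha>) (fx ` ball Ub \<delta>) \<or>
          linearly_degenerate (in_V fx Ub \<delta> fy) (lam \<alpha>) (fx ` ball Ub \<delta>)"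
begin

lemma jacobian_X: "u \<in> ball Ub \<delta> \<Longrightarrow> jacobian fx (at u) *v v = blinfun_apply (X u) v"
  and jacobian_Y: "u \<in> ball Ub \<delta> \<Longrightarrow> jacobian fy (at u) *v v = blinfun_apply (Y u) v"
  by (simp_all add: jacobian_mult[OF fx] jacobian_mult[OF fy])

lemma inj_fx: "inj_on fx (ball Ub \<delta>)"
  using mult by (simp add: constant_multiplicity_def)

lemma X_eq_0:
  assumes "u \<in> ball Ub \<delta>" "blinfun_apply (X u) v = 0"
  shows "v = 0"
proof -
  have "det (jacobian fx (at u)) \<noteq> 0"
    using mult assms(1) unfolding constant_multiplicity_def by blast
  then have "\<exists>B. B ** jacobian fx (at u) = mat 1" by (simp add: invertible_det_nz[symmetric] invertible_left_inverse)
  then show ?thesis unfolding matrix_left_invertible_ker using assms by (simp add: jacobian_X)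
qed

lemma inverse_derivative:
  assumes u: "u \<in> ball Ub \<delta>"
  obtains g' where "(inv_into (ball Ub \<delta>) fx has_derivative g') (at (fx u))" "\<And>v. g' (blinfun_apply (X u) v) = v"
proof -
  have lin: "linear (blinfun_apply (X z))" for z by (simp add: blinfun.bounded_linear_right bounded_linear.linear)
  have "inj (blinfun_apply (X u))"
    using X_eq_0[OF u] by (subst linear_injective_0[OF lin]) blast
  from linear_injective_isomorphism[OF lin this] obtain g' where
    g': "linear g'" "\<forall>v. g' (blinfun_apply (X u) v) = v" "\<forall>v. blinfun_apply (X u) (g' v) = v" by blast
  have "(inv_into (ball Ub \<delta>) fx has_derivative g') (at (fx u))"
  proof (rule has_derivative_inverse_strong[OF open_ball u])
    show "continuous_on (ball Ub \<delta>) fx" using isCont_data(1) by (simp add: continuous_at_imp_continuous_on)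
    show "inv_into (ball Ub \<delta>) fx (fx x) = x" if "x \<in> ball Ub \<delta>" for x
      using inv_into_f_f[OF inj_fx that] .
    show "(fx has_derivative blinfun_apply (X u)) (at u)" by (rule fx[OF u])
    show "blinfun_apply (X u) \<circ> g' = id" using g'(3) by (simp add: fun_eq_iff)
  qed
  then show thesis using that g'(2) by blast
qed

text \<open>The Jacobian of the flux in the variable V is \<open>Y u\<close> composed with the
  inverse of \<open>X u\<close>, so \<open>X u\<close> carries null vectors of the pencil to
  eigenvectors.\<close>

lemma eigenspace_in_V:
  assumes u: "u \<in> ball Ub \<delta>" and v: "blinfun_apply (Y u) v = l (fx u) *\<^sub>R blinfun_apply (X u) v"
  shows "blinfun_apply (X u) v \<in> eigenspace (in_V fx Ub \<delta> fy) l (fx u)"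
proof -
  obtain g' where g': "(inv_into (ball Ub \<delta>) fx has_derivative g') (at (fx u))" "\<And>v. g' (blinfun_apply (X u) v) = v"
    by (rule inverse_derivative[OF u]) blast
  have "inv_into (ball Ub \<delta>) fx (fx u) = u" using inv_into_f_f[OF inj_fx u] .
  then have "(fy has_derivative blinfun_apply (Y u)) (at (inv_into (ball Ub \<delta>) fx (fx u)))" using fy[OF u] by simp
  from has_derivative_compose[OF g'(1) this]
  have "(in_V fx Ub \<delta> fy has_derivative (\<lambda>h. blinfun_apply (Y u) (g' h))) (at (fx u))"
    by (simp add: in_V_def[abs_def])
  from fun_cong[OF frechet_derivative_at[OF this], of "blinfun_apply (X u) v"]
  show ?thesis using v g'(2) by (simp add: eigenspace_def)
qed

text \<open>By the chain rule, differentiating along \<open>v\<close> in U means differentiating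
  along \<open>X u v\<close> in V; this is how the type of a field is transferred.\<close>

lemma pencil_eigenvalue_lam:
  assumes \<alpha>: "\<alpha> \<in> {1..k}"
  obtains Dl lam1 where "pencil_eigenvalue Ub \<delta> fx fy n X Y N X2 Y2 N2 \<psi>x \<psi>y (\<lambda>u. lam \<alpha> (fx u)) Dl (p \<alpha>)"
    "\<And>u. u \<in> ball Ub \<delta> \<Longrightarrow> frechet_derivative (lam \<alpha>) (at (fx u)) = blinfun_apply (lam1 u)"
    "\<And>u v. blinfun_apply (Dl u) v = blinfun_apply (lam1 u) (blinfun_apply (X u) v)"
proof -
  have "Ck_on 1 (lam \<alpha>) (fx ` ball Ub \<delta>)"
    using mult \<alpha> unfolding constant_multiplicity_def smooth_on_def by blast
  then obtain f1 where f1: "\<And>V. V \<in> fx ` ball Ub \<delta> \<Longrightarrow> (lam \<alpha> has_derivative blinfun_apply (f1 V)) (at V)"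
    "continuous_on (fx ` ball Ub \<delta>) f1" by (rule Ck_on_1) blast
  have cont: "continuous_on (ball Ub \<delta>) fx" "continuous_on (ball Ub \<delta>) X"
    using isCont_data(1,4) by (simp_all add: continuous_at_imp_continuous_on)
  define Dl where "Dl u = f1 (fx u) o\<^sub>L X u" for u
  have "pencil_eigenvalue Ub \<delta> fx fy n X Y N X2 Y2 N2 \<psi>x \<psi>y (\<lambda>u. lam \<alpha> (fx u)) Dl (p \<alpha>)"
  proof
    fix u assume u: "u \<in> ball Ub \<delta>"
    show "((\<lambda>u. lam \<alpha> (fx u)) has_derivative blinfun_apply (Dl u)) (at u)"
      using has_derivative_compose[OF fx[OF u] f1(1)[OF imageI[OF u]]]
      by (simp add: Dl_def blinfun_compose.rep_eq comp_def)
    have "dim (gen_eigenspace (jacobian fx (at u)) (jacobian fy (at u)) (lam \<alpha> (fx u))) = p \<alpha>"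
      using mult \<alpha> u unfolding constant_multiplicity_def by blast
    then show "dim {v. blinfun_apply (Y u) v = lam \<alpha> (fx u) *\<^sub>R blinfun_apply (X u) v} = p \<alpha>"
      by (simp add: gen_eigenspace_def jacobian_X[OF u] jacobian_Y[OF u])
  next
    show "continuous_on (ball Ub \<delta>) Dl"
      unfolding Dl_def by (intro bounded_bilinear.continuous_on[OF bounded_bilinear_blinfun_compose]
        continuous_on_compose2[OF f1(2)] cont) auto
  qed
  then show thesis
    by (rule that[of Dl "\<lambda>u. f1 (fx u)"]) (simp_all add: Dl_def frechet_derivative_at[OF f1(1), symmetric])
qed

text \<open>For multiplicity at least 2 degeneracy comes from
  \<open>multiple_imp_degenerate\<close>. For simple eigenvalues the hypothesis on the field is
  moved to U by \<open>eigenspace_in_V\<close>, where invertibility of \<open>X Ub\<close> keeps the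
  image of an eigenvector nonzero.\<close>

lemma sector_lam:
  assumes \<alpha>: "\<alpha> \<in> {1..k}" and C: "C \<ge> 1"
  shows "\<exists>e \<kappa>0 D B. 0 < e \<and> e < \<delta> \<and> 0 < \<kappa>0 \<and> 0 \<le> D \<and> (\<forall>\<kappa> u \<sigma>. 0 < \<kappa> \<longrightarrow> \<kappa> \<le> \<kappa>0 \<longrightarrow> trajectory e C \<sigma> u \<longrightarrow>
     (\<forall>x. \<bar>lam \<alpha> (fx (u x)) - lam \<alpha> (fx Ub)\<bar> \<le> \<kappa>) \<longrightarrow>
     jump_bound D B (lam \<alpha> (fx Ub) - \<kappa>) (lam \<alpha> (fx Ub) + \<kappa>) u)"
proof -
  obtain Dl lam1 where pe: "pencil_eigenvalue Ub \<delta> fx fy n X Y N X2 Y2 N2 \<psi>x \<psi>y (\<lambda>u. lam \<alpha> (fx u)) Dl (p \<alpha>)"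
    and lam1: "\<And>u. u \<in> ball Ub \<delta> \<Longrightarrow> frechet_derivative (lam \<alpha>) (at (fx u)) = blinfun_apply (lam1 u)"
    and Dl: "\<And>u v. blinfun_apply (Dl u) v = blinfun_apply (lam1 u) (blinfun_apply (X u) v)"
    by (rule pencil_eigenvalue_lam[OF \<alpha>]) blast
  interpret E: pencil_eigenvalue Ub \<delta> fx fy n X Y N X2 Y2 N2 \<psi>x \<psi>y "\<lambda>u. lam \<alpha> (fx u)" Dl "p \<alpha>" by (rule pe)
  have near: "\<forall>\<^sub>F z in nhds Ub. z \<in> ball Ub \<delta>" by (rule eventually_nhds_in_open[OF open_ball center])
  have type: "(\<forall>\<^sub>F z in nhds Ub. \<forall>v\<in>E.E z. blinfun_apply (Dl z) v = 0) \<or>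
    (p \<alpha> = 1 \<and> (\<exists>r\<in>E.E Ub. blinfun_apply (Dl Ub) r \<noteq> 0))"
  proof -
    consider "p \<alpha> = 0" | "p \<alpha> \<ge> 2"
      | "p \<alpha> = 1" "linearly_degenerate (in_V fx Ub \<delta> fy) (lam \<alpha>) (fx ` ball Ub \<delta>)"
      | "p \<alpha> = 1" "genuinely_nonlinear (in_V fx Ub \<delta> fy) (lam \<alpha>) (fx ` ball Ub \<delta>)"
      using fields \<alpha> by (metis less_2_cases not_le One_nat_def)
    then show ?thesis
    proof cases
      case 1
      have "\<forall>\<^sub>F z in nhds Ub. \<forall>v\<in>E.E z. blinfun_apply (Dl z) v = 0"
        using near
      proof eventually_elim
        case (elim z)
        have "E.E z \<subseteq> {0}" using E.dim_E[OF elim] 1 by (simp add: dim_eq_0)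
        then show ?case by (auto simp: blinfun.zero_right)
      qed
      then show ?thesis ..
    next
      case 2
      have "\<forall>\<^sub>F z in nhds Ub. \<forall>v\<in>E.E z. blinfun_apply (Dl z) v = 0"
        using E.pos_near
      proof eventually_elim
        case (elim z)
        then show ?case using E.multiple_imp_degenerate[of z] 2 by blast
      qed
      then show ?thesis ..
    next
      case 3
      have "\<forall>\<^sub>F z in nhds Ub. \<forall>v\<in>E.E z. blinfun_apply (Dl z) v = 0"
        using near
      proof eventually_elim
        case (elim z)
        have "frechet_derivative (lam \<alpha>) (at (fx z)) (blinfun_apply (X z) v) = 0" if "v \<in> E.E z" for v
          using 3(2) eigenspace_in_V[OF elim, of v "lam \<alpha>"] that elim unfolding linearly_degenerate_def E.E_iff by blast
        then show ?case by (simp add: Dl lam1[OF elim])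
      qed
      then show ?thesis ..
    next
      case 4
      have "\<not> E.E Ub \<subseteq> {0}" using E.dim_E[OF center] 4(1) by (metis dim_eq_0 zero_neq_one)
      then obtain r where r: "r \<in> E.E Ub" "r \<noteq> 0" by blast
      have "blinfun_apply (X Ub) r \<noteq> 0" using X_eq_0[OF center] r(2) by blast
      then have "frechet_derivative (lam \<alpha>) (at (fx Ub)) (blinfun_apply (X Ub) r) \<noteq> 0"
        using 4(2) eigenspace_in_V[OF center, of r "lam \<alpha>"] r(1) center unfolding genuinely_nonlinear_def E.E_iff by blast
      then show ?thesis using r(1) 4(1) by (auto simp: Dl lam1[OF center])
    qed
  qed
  show ?thesis by (rule E.sector[OF C type])
qed

lemma isCont_lam: "\<alpha> \<in> {1..k} \<Longrightarrow> isCont (\<lambda>u. lam \<alpha> (fx u)) Ub"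
proof -
  assume \<alpha>: "\<alpha> \<in> {1..k}"
  obtain Dl lam1 where pe: "pencil_eigenvalue Ub \<delta> fx fy n X Y N X2 Y2 N2 \<psi>x \<psi>y (\<lambda>u. lam \<alpha> (fx u)) Dl (p \<alpha>)"
    by (rule pencil_eigenvalue_lam[OF \<alpha>]) blast
  show ?thesis by (rule has_derivative_continuous[OF pencil_eigenvalue.l[OF pe center]])
qed

lemma lam_less: "\<lbrakk>\<alpha> \<in> {1..k}; \<beta> \<in> {1..k}; \<alpha> < \<beta>\<rbrakk> \<Longrightarrow> lam \<alpha> (fx Ub) < lam \<beta> (fx Ub)"
  using mult center unfolding constant_multiplicity_def strict_mono_on_def by blast

lemma L_eq_0:
  assumes "\<And>\<alpha>. \<alpha> \<in> {1..k} \<Longrightarrow> \<xi> \<noteq> lam \<alpha> (fx Ub)" "blinfun_apply (L \<xi> Ub) v = 0"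
  shows "v = 0"
proof (rule ccontr)
  assume v: "v \<noteq> 0"
  have "complex_of_real \<xi> \<in> gen_eigenvalues (jacobian fx (at Ub)) (jacobian fy (at Ub))"
    by (rule gen_eigenvaluesI[OF _ v]) (use assms(2) in \<open>simp add: jacobian_X[OF center] jacobian_Y[OF center] L_def blinfun.diff_left blinfun.scaleR_left\<close>)
  also have "\<dots> = (\<lambda>\<alpha>. complex_of_real (lam \<alpha> (fx Ub))) ` {1..k}"
    using mult center unfolding constant_multiplicity_def by blast
  finally obtain \<alpha> where "\<alpha> \<in> {1..k}" "\<xi> = lam \<alpha> (fx Ub)" by auto
  then show False using assms(1) by blast
qed

text \<open>There are finitely many eigenvalues, so minima and maxima of their constants exist. The
  width \<open>\<kappa>\<close> of the sectors is chosen before the radius \<open>e\<close>, which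
  has to keep the eigenvalues of the solution inside their sectors.\<close>

lemma uniform_jump_bound:
  assumes C: "C \<ge> 1"
  obtains e D B M where "0 < e" "e < \<delta>" "0 \<le> D" "0 \<le> B" "0 \<le> M"
    "\<forall>\<sigma> u. trajectory e C \<sigma> u \<longrightarrow>
      (\<exists>a b. a summable_on UNIV \<and> b summable_on UNIV \<and> (\<forall>s. 0 \<le> a s) \<and> (\<forall>s. 0 \<le> b s) \<and>
        infsum a UNIV + infsum b UNIV \<le> B \<and> (\<forall>s. \<not> (- M < s \<and> s < M) \<longrightarrow> a s = 0 \<and> b s = 0) \<and>
        (\<forall>x y. x < y \<longrightarrow> norm (u y - u x) \<le> D * (y - x) + infsum a {x<..y} + infsum b {x..<y})) \<and>
      (\<forall>x. x \<le> - M \<longrightarrow> u x = u (- M)) \<and> (\<forall>x. M \<le> x \<longrightarrow> u x = u M)"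
proof -
  let ?\<mu> = "\<lambda>\<alpha>. lam \<alpha> (fx Ub)"
  let ?I = "{1..k}"
  define Q where "Q \<alpha> e \<kappa>0 D B \<longleftrightarrow> 0 < e \<and> e < \<delta> \<and> 0 < \<kappa>0 \<and> 0 \<le> D \<and> (\<forall>\<kappa> u \<sigma>. 0 < \<kappa> \<longrightarrow> \<kappa> \<le> \<kappa>0 \<longrightarrow> trajectory e C \<sigma> u \<longrightarrow>
     (\<forall>x. \<bar>lam \<alpha> (fx (u x)) - ?\<mu> \<alpha>\<bar> \<le> \<kappa>) \<longrightarrow> jump_bound D B (?\<mu> \<alpha> - \<kappa>) (?\<mu> \<alpha> + \<kappa>) u)" for \<alpha> e \<kappa>0 D B
  have 1: "\<forall>\<alpha>\<in>?I. \<exists>e. \<exists>\<kappa>0. \<exists>D. \<exists>B. Q \<alpha> e \<kappa>0 D B" unfolding Q_def by (intro ballI sector_lam[OF _ C])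
  from bchoice[OF 1] obtain e1 where 2: "\<forall>\<alpha>\<in>?I. \<exists>\<kappa>0. \<exists>D. \<exists>B. Q \<alpha> (e1 \<alpha>) \<kappa>0 D B" ..
  from bchoice[OF 2] obtain \<kappa>1 where 3: "\<forall>\<alpha>\<in>?I. \<exists>D. \<exists>B. Q \<alpha> (e1 \<alpha>) (\<kappa>1 \<alpha>) D B" ..
  from bchoice[OF 3] obtain D1 where 4: "\<forall>\<alpha>\<in>?I. \<exists>B. Q \<alpha> (e1 \<alpha>) (\<kappa>1 \<alpha>) (D1 \<alpha>) B" ..
  from bchoice[OF 4] obtain B1 where 5: "\<forall>\<alpha>\<in>?I. Q \<alpha> (e1 \<alpha>) (\<kappa>1 \<alpha>) (D1 \<alpha>) (B1 \<alpha>)" ..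
  have Q1: "0 < e1 \<alpha>" if "\<alpha> \<in> ?I" for \<alpha> using 5[THEN bspec, OF that] unfolding Q_def by (elim conjE)
  have Q2: "0 < \<kappa>1 \<alpha>" if "\<alpha> \<in> ?I" for \<alpha> using 5[THEN bspec, OF that] unfolding Q_def by (elim conjE)
  have Qj: "jump_bound (D1 \<alpha>) (B1 \<alpha>) (?\<mu> \<alpha> - \<kappa>) (?\<mu> \<alpha> + \<kappa>) u"
    if "\<alpha> \<in> ?I" "0 < \<kappa>" "\<kappa> \<le> \<kappa>1 \<alpha>" "trajectory (e1 \<alpha>) C \<sigma> u" "\<And>x. \<bar>lam \<alpha> (fx (u x)) - ?\<mu> \<alpha>\<bar> \<le> \<kappa>" for \<alpha> \<kappa> \<sigma> u
  proof -
    have *: "\<forall>\<kappa> u \<sigma>. 0 < \<kappa> \<longrightarrow> \<kappa> \<le> \<kappa>1 \<alpha> \<longrightarrow> trajectory (e1 \<alpha>) C \<sigma> u \<longrightarrow>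
     (\<forall>x. \<bar>lam \<alpha> (fx (u x)) - ?\<mu> \<alpha>\<bar> \<le> \<kappa>) \<longrightarrow> jump_bound (D1 \<alpha>) (B1 \<alpha>) (?\<mu> \<alpha> - \<kappa>) (?\<mu> \<alpha> + \<kappa>) u"
      using 5[THEN bspec, OF that(1)] unfolding Q_def by (elim conjE)
    have **: "\<forall>x. \<bar>lam \<alpha> (fx (u x)) - ?\<mu> \<alpha>\<bar> \<le> \<kappa>" using that(5) by (intro allI)
    show ?thesis
      by (rule *[THEN spec, THEN spec, THEN spec, THEN mp, OF that(2), THEN mp, OF that(3), THEN mp, OF that(4), THEN mp, OF **])
  qed
  obtain e2 where e2: "0 < e2" "\<And>\<alpha>. \<alpha> \<in> ?I \<Longrightarrow> e2 \<le> e1 \<alpha>"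
    by (rule finite_positive_lower_bound[OF finite_atLeastAtMost, of 1 k e1], erule Q1, blast)
  obtain \<kappa>2 where \<kappa>2: "0 < \<kappa>2" "\<And>\<alpha>. \<alpha> \<in> ?I \<Longrightarrow> \<kappa>2 \<le> \<kappa>1 \<alpha>"
    by (rule finite_positive_lower_bound[OF finite_atLeastAtMost, of 1 k \<kappa>1], erule Q2, blast)
  have "finite {(\<alpha>, \<beta>). \<alpha> \<in> ?I \<and> \<beta> \<in> ?I \<and> \<alpha> < \<beta>}" by (rule finite_subset[of _ "?I \<times> ?I"]) auto
  then obtain \<kappa>3 where \<kappa>3: "0 < \<kappa>3" "\<And>i. i \<in> {(\<alpha>, \<beta>). \<alpha> \<in> ?I \<and> \<beta> \<in> ?I \<and> \<alpha> < \<beta>} \<Longrightarrow> \<kappa>3 \<le> (\<lambda>(\<alpha>, \<beta>). (?\<mu> \<beta> - ?\<mu> \<alpha>) / 2) i"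
    by (rule finite_positive_lower_bound[of _ "\<lambda>(\<alpha>, \<beta>). (?\<mu> \<beta> - ?\<mu> \<alpha>) / 2"], use lam_less in force, blast)
  \<comment> \<open>\<open>\<kappa>3\<close> is at most half of every gap between eigenvalues, so
    the sectors do not overlap.\<close>
  define \<kappa> where "\<kappa> = min \<kappa>2 \<kappa>3"
  have \<kappa>: "0 < \<kappa>" "\<And>\<alpha>. \<alpha> \<in> ?I \<Longrightarrow> \<kappa> \<le> \<kappa>1 \<alpha>"
    using \<kappa>2(1) \<kappa>3(1) order_trans[OF min.cobounded1[of \<kappa>2 \<kappa>3] \<kappa>2(2)] by (simp_all add: \<kappa>_def)
  have sep: "?\<mu> \<alpha> + \<kappa> \<le> ?\<mu> \<beta> - \<kappa>" if "\<alpha> \<in> ?I" "\<beta> \<in> ?I" "\<alpha> < \<beta>" for \<alpha> \<beta>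
  proof -
    have "\<kappa>3 \<le> (?\<mu> \<beta> - ?\<mu> \<alpha>) / 2" using \<kappa>3(2)[of "(\<alpha>, \<beta>)"] that by simp
    then have "2 * \<kappa>3 \<le> ?\<mu> \<beta> - ?\<mu> \<alpha>" by simp
    moreover have "2 * \<kappa> \<le> 2 * \<kappa>3" by (simp add: \<kappa>_def)
    ultimately have "2 * \<kappa> \<le> ?\<mu> \<beta> - ?\<mu> \<alpha>" by (rule order_trans[rotated])
    then show ?thesis by (simp add: algebra_simps)
  qed
  \<comment> \<open>The speeds outside the open sectors. The set is closed and unbounded, as
    \<open>gap_pair\<close> admits.\<close>
  define Z where "Z = (\<Inter>\<alpha>\<in>?I. {\<xi>. \<kappa> \<le> \<bar>\<xi> - ?\<mu> \<alpha>\<bar>})"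
  have Z: "closed Z" unfolding Z_def
    by (intro closed_INT ballI closed_Collect_le continuous_intros)
  obtain e3 where e3: "0 < e3" "e3 < \<delta>"
    "\<And>\<sigma> u x y. trajectory e3 C \<sigma> u \<Longrightarrow> {x..y} \<subseteq> Z \<Longrightarrow> x \<le> y \<Longrightarrow> u y = u x"
  proof (rule trajectory_gap[OF Z, of C])
    show "v = 0" if "\<xi> \<in> Z" "blinfun_apply (L \<xi> Ub) v = 0" for \<xi> v
      by (rule L_eq_0[OF _ that(2)]) (use that(1) \<kappa>(1) in \<open>force simp: Z_def\<close>)
    show "0 \<le> C" using C by simp
    fix e assume e: "0 < e" "e < \<delta>" and h: "\<And>\<sigma> u x y. trajectory e C \<sigma> u \<Longrightarrow> {x..y} \<subseteq> Z \<Longrightarrow> x \<le> y \<Longrightarrow> u y = u x"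
    show thesis by (rule that[OF e]) (rule h; assumption)
  qed
  have "\<forall>\<^sub>F u in nhds Ub. \<forall>\<alpha>\<in>?I. dist (lam \<alpha> (fx u)) (?\<mu> \<alpha>) < \<kappa>"
    by (intro eventually_ball_finite ballI isCont_eventually_dist[OF isCont_lam \<kappa>(1)]) auto
  then obtain e4 where e4: "0 < e4" "e4 < \<delta>" "\<And>u. u \<in> cball Ub e4 \<Longrightarrow> \<forall>\<alpha>\<in>?I. dist (lam \<alpha> (fx u)) (?\<mu> \<alpha>) < \<kappa>"
    by (rule eventually_nhds_cball[OF _ \<delta>]) blast
  \<comment> \<open>\<open>e2\<close> serves the sectors and \<open>e3\<close> the gaps between
    them; \<open>e4\<close> keeps each eigenvalue within \<open>\<kappa>\<close> of its background
    value.\<close>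
  define e where "e = min e2 (min e3 e4)"
  have e: "e \<le> e2" "e \<le> e3" "e \<le> e4" by (auto simp: e_def)
  obtain D where D: "0 \<le> D" "\<And>\<alpha>. \<alpha> \<in> ?I \<Longrightarrow> D1 \<alpha> \<le> D" by (rule finite_upper_bound[OF finite_atLeastAtMost, of 1 k D1], blast)
  obtain B where B: "0 \<le> B" "\<And>\<alpha>. \<alpha> \<in> ?I \<Longrightarrow> B1 \<alpha> \<le> B" by (rule finite_upper_bound[OF finite_atLeastAtMost, of 1 k B1], blast)
  obtain M1 where M1: "0 \<le> M1" "\<And>\<alpha>. \<alpha> \<in> ?I \<Longrightarrow> \<bar>?\<mu> \<alpha>\<bar> \<le> M1" by (rule finite_upper_bound[OF finite_atLeastAtMost, of 1 k "\<lambda>\<alpha>. \<bar>?\<mu> \<alpha>\<bar>"], blast)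
  define M where "M = M1 + \<kappa> + 1"
  have M: "- M < ?\<mu> \<alpha> - \<kappa>" "?\<mu> \<alpha> + \<kappa> < M" if "\<alpha> \<in> ?I" for \<alpha> using M1(2)[OF that] by (auto simp: M_def)
  have const: "u y = u x" if u: "trajectory e C \<sigma> u" and xy: "x \<le> y" "\<And>\<alpha>. \<alpha> \<in> ?I \<Longrightarrow> y \<le> ?\<mu> \<alpha> - \<kappa> \<or> ?\<mu> \<alpha> + \<kappa> \<le> x" for \<sigma> u x y
  proof (rule e3(3)[OF trajectory_mono[OF u e(2)] _ xy(1)])
    show "{x..y} \<subseteq> Z" unfolding Z_def
    proof (intro INT_greatest subsetI)
      fix \<alpha> \<xi> assume "\<alpha> \<in> ?I" "\<xi> \<in> {x..y}"
      then show "\<xi> \<in> {\<xi>. \<kappa> \<le> \<bar>\<xi> - ?\<mu> \<alpha>\<bar>}" using xy(2)[of \<alpha>] \<kappa>(1) by auto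
    qed
  qed
  show thesis
  proof (rule that[of e D "real k * B" M])
    show "0 < e" "e < \<delta>" using e2(1) e3 e4 by (auto simp: e_def)
    show "0 \<le> D" "0 \<le> real k * B" by (use D B in auto)
    show "0 \<le> M" using M1(1) \<kappa>(1) by (simp add: M_def)
  next
    show "\<forall>\<sigma> u. trajectory e C \<sigma> u \<longrightarrow>
      (\<exists>a b. a summable_on UNIV \<and> b summable_on UNIV \<and> (\<forall>s. 0 \<le> a s) \<and> (\<forall>s. 0 \<le> b s) \<and>
        infsum a UNIV + infsum b UNIV \<le> real k * B \<and> (\<forall>s. \<not> (- M < s \<and> s < M) \<longrightarrow> a s = 0 \<and> b s = 0) \<and>
        (\<forall>x y. x < y \<longrightarrow> norm (u y - u x) \<le> D * (y - x) + infsum a {x<..y} + infsum b {x..<y})) \<and>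
      (\<forall>x. x \<le> - M \<longrightarrow> u x = u (- M)) \<and> (\<forall>x. M \<le> x \<longrightarrow> u x = u M)"
    proof (intro allI impI conjI)
    fix \<sigma> u assume u: "trajectory e C \<sigma> u"
    show "u x = u (- M)" if "x \<le> - M" for x
      by (rule const[OF u that, symmetric]) (use M in force)
    show "u x = u M" if "M \<le> x" for x
      by (rule const[OF u that]) (use M in force)
    have range: "range u \<subseteq> cball Ub e" using u unfolding trajectory_def by (elim conjE)
    have close: "\<bar>lam \<alpha> (fx (u x)) - ?\<mu> \<alpha>\<bar> \<le> \<kappa>" if "\<alpha> \<in> ?I" for \<alpha> x
    proof -
      have "u x \<in> cball Ub e4" using range subset_cball[OF e(3)] by blast
      from e4(3)[OF this] that show ?thesis by (auto simp: dist_real_def less_imp_le)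
    qed
    have jb: "jump_bound D B (?\<mu> \<alpha> - \<kappa>) (?\<mu> \<alpha> + \<kappa>) u" if \<alpha>: "\<alpha> \<in> ?I" for \<alpha>
    proof -
      have "e \<le> e1 \<alpha>" using e(1) e2(2)[OF \<alpha>] by linarith
      then have t: "trajectory (e1 \<alpha>) C \<sigma> u" by (rule trajectory_mono[OF u])
      have "jump_bound (D1 \<alpha>) (B1 \<alpha>) (?\<mu> \<alpha> - \<kappa>) (?\<mu> \<alpha> + \<kappa>) u"
        by (rule Qj[OF \<alpha> \<kappa>(1) \<kappa>(2)[OF \<alpha>] t close[OF \<alpha>]])
      then show ?thesis by (rule jump_bound_mono_rate[OF jump_bound_mono[OF _ B(2)[OF \<alpha>]] D(2)[OF \<alpha>]])
    qed
    show "\<exists>a b. a summable_on UNIV \<and> b summable_on UNIV \<and> (\<forall>s. 0 \<le> a s) \<and> (\<forall>s. 0 \<le> b s) \<and>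
        infsum a UNIV + infsum b UNIV \<le> real k * B \<and> (\<forall>s. \<not> (- M < s \<and> s < M) \<longrightarrow> a s = 0 \<and> b s = 0) \<and>
        (\<forall>x y. x < y \<longrightarrow> norm (u y - u x) \<le> D * (y - x) + infsum a {x<..y} + infsum b {x..<y})"
    proof (rule jump_bound_glue[of k ?\<mu> \<kappa> D B u])
      show "?\<mu> \<alpha> + \<kappa> \<le> ?\<mu> \<beta> - \<kappa>" if "\<alpha> \<in> ?I" "\<beta> \<in> ?I" "\<alpha> < \<beta>" for \<alpha> \<beta> by (rule sep[OF that])
      show "0 < \<kappa>" "0 \<le> D" by (rule \<kappa>(1) D(1))+
      show "jump_bound D B (?\<mu> \<alpha> - \<kappa>) (?\<mu> \<alpha> + \<kappa>) u" if "\<alpha> \<in> ?I" for \<alpha> by (rule jb[OF that])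
      show "u y = u x" if "x \<le> y" "\<And>\<alpha>. \<alpha> \<in> ?I \<Longrightarrow> y \<le> ?\<mu> \<alpha> - \<kappa> \<or> ?\<mu> \<alpha> + \<kappa> \<le> x" for x y
        by (rule const[OF u that(1)]) (rule that(2))
      fix a b :: "real \<Rightarrow> real"
      assume ab: "a summable_on UNIV" "b summable_on UNIV" "\<And>s. 0 \<le> a s" "\<And>s. 0 \<le> b s"
        "infsum a UNIV + infsum b UNIV \<le> real k * B"
        and outside: "\<And>s. (\<And>\<alpha>. \<alpha> \<in> ?I \<Longrightarrow> s \<notin> {?\<mu> \<alpha> - \<kappa>..?\<mu> \<alpha> + \<kappa>}) \<Longrightarrow> a s = 0 \<and> b s = 0"
        and control: "\<And>x y. x < y \<Longrightarrow> norm (u y - u x) \<le> D * (y - x) + infsum a {x<..y} + infsum b {x..<y}"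
      have "a s = 0 \<and> b s = 0" if "\<not> (- M < s \<and> s < M)" for s
        by (rule outside) (use M that in force)
      then show ?thesis
        by - (rule exI[of _ a], rule exI[of _ b], intro conjI allI impI; use ab control in blast)
    qed
    qed
  qed
qed

end

section \<open>From a version in a half-plane to a trajectory\<close>

lemma Ck_on_lipschitz:
  fixes f :: "'a::euclidean_space \<Rightarrow> 'b::real_normed_vector"
  assumes "Ck_on 1 f S" "cball a r \<subseteq> S"
  obtains C where "0 \<le> C" "\<And>v w. \<lbrakk>v \<in> cball a r; w \<in> cball a r\<rbrakk> \<Longrightarrow> norm (f v - f w) \<le> C * norm (v - w)"
proof -
  obtain f1 :: "'a \<Rightarrow> 'a \<Rightarrow>\<^sub>L 'b" where f1: "\<And>x. x \<in> S \<Longrightarrow> (f has_derivative blinfun_apply (f1 x)) (at x)" "continuous_on S f1"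
    using Ck_on_1[OF assms(1)] by blast
  have "compact (f1 ` cball a r)" by (intro compact_continuous_image compact_cball continuous_on_subset[OF f1(2) assms(2)])
  then obtain C where C: "0 < C" "\<And>x. x \<in> cball a r \<Longrightarrow> norm (f1 x) \<le> C"
    using compact_imp_bounded bounded_pos by (metis imageI)
  have "norm (f v - f w) \<le> C * norm (v - w)" if "v \<in> cball a r" "w \<in> cball a r" for v w
  proof (rule differentiable_bound[OF convex_cball _ _ that, of f "\<lambda>x. blinfun_apply (f1 x)" C])
  qed (use C(2) assms(2) in \<open>auto simp: norm_blinfun.rep_eq[symmetric] intro!: has_derivative_at_withinI f1(1)\<close>)
  then show thesis using C(1) by (intro that[of C]) auto
qed

lemma bounded_measurable_integrable_on:
  fixes f :: "real \<Rightarrow> 'a::euclidean_space"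
  assumes "f \<in> borel_measurable lebesgue" "\<And>z. norm (f z) \<le> K"
  shows "f integrable_on {x..y}"
  by (rule measurable_bounded_by_integrable_imp_integrable[where g = "\<lambda>_. K"])
    (use assms in \<open>auto intro: measurable_restrict_space1\<close>)

lemma measurable_compose_continuous_on:
  assumes "V \<in> borel_measurable M" "range V \<subseteq> K" "continuous_on K h"
  shows "(\<lambda>z. h (V z)) \<in> borel_measurable M"
proof -
  have "V \<in> measurable M (restrict_space borel K)" using assms(1,2) by (intro measurable_restrict_space2) auto
  from measurable_compose[OF this borel_measurable_continuous_on_restrict[OF assms(3)]] show ?thesis .
qed

context constant_multiplicity_pencil begin

text \<open>Inverting \<open>fx\<close> on the ball expresses both integral relations through
  \<open>u\<close>, and then \<open>trajectoryI\<close> applies.\<close>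

lemma version_trajectory:
  assumes \<epsilon>: "0 < \<epsilon>" "\<epsilon> < \<delta>" and \<sigma>: "\<bar>\<sigma>\<bar> = 1" and C: "0 \<le> C"
    and lip: "\<And>v w. \<lbrakk>v \<in> cball Ub \<epsilon>; w \<in> cball Ub \<epsilon>\<rbrakk> \<Longrightarrow> norm (fx v - fx w) \<le> C * norm (v - w)"
      "\<And>v w. \<lbrakk>v \<in> cball Ub \<epsilon>; w \<in> cball Ub \<epsilon>\<rbrakk> \<Longrightarrow> norm (\<psi>x v - \<psi>x w) \<le> C * norm (v - w)"
    and V: "version_in_half_plane fx (in_V fx Ub \<delta> fy) (in_V fx Ub \<delta> \<psi>x) (in_V fx Ub \<delta> \<psi>y) (fx ` cball Ub \<epsilon>) U \<sigma> V"
  obtains u where "trajectory \<epsilon> C \<sigma> u" "\<And>\<xi>. V \<xi> = fx (u \<xi>)"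
proof -
  let ?S = "ball Ub \<delta>" and ?K = "fx ` cball Ub \<epsilon>"
  define u where "u \<xi> = inv_into ?S fx (V \<xi>)" for \<xi>
  have sub: "cball Ub \<epsilon> \<subseteq> ?S" using \<epsilon>(2) by auto
  have meas: "V \<in> borel_measurable lebesgue" using V unfolding version_in_half_plane_def by (elim conjE)
  have range: "range V \<subseteq> ?K" using V unfolding version_in_half_plane_def by (elim conjE)
  have eqs: "\<forall>\<xi>\<^sub>1 \<xi>\<^sub>2. \<xi>\<^sub>1 < \<xi>\<^sub>2 \<longrightarrow>
        (fy (u \<xi>\<^sub>2) - \<xi>\<^sub>2 *\<^sub>R V \<xi>\<^sub>2) - (fy (u \<xi>\<^sub>1) - \<xi>\<^sub>1 *\<^sub>R V \<xi>\<^sub>1) = - integral {\<xi>\<^sub>1..\<xi>\<^sub>2} V \<and>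
        \<sigma> * ((\<psi>y (u \<xi>\<^sub>2) - \<xi>\<^sub>2 * \<psi>x (u \<xi>\<^sub>2)) - (\<psi>y (u \<xi>\<^sub>1) - \<xi>\<^sub>1 * \<psi>x (u \<xi>\<^sub>1))) \<le>
          \<sigma> * (- integral {\<xi>\<^sub>1..\<xi>\<^sub>2} (\<lambda>\<xi>. \<psi>x (u \<xi>)))"
    using V unfolding version_in_half_plane_def in_V_def u_def by (elim conjE)
  have inv: "inv_into ?S fx (fx w) = w" if "w \<in> cball Ub \<epsilon>" for w
    using inv_into_f_f[OF inj_fx] that sub by blast
  have u: "u \<xi> \<in> cball Ub \<epsilon>" "V \<xi> = fx (u \<xi>)" for \<xi>
  proof -
    obtain w where w: "w \<in> cball Ub \<epsilon>" "V \<xi> = fx w" using range by blast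
    then have "u \<xi> = w" using inv by (simp add: u_def)
    then show "u \<xi> \<in> cball Ub \<epsilon>" "V \<xi> = fx (u \<xi>)" using w by simp_all
  qed
  have Vfx: "V = (\<lambda>z. fx (u z))" using u(2) by (rule ext)
  have cfx: "continuous_on (cball Ub \<epsilon>) fx"
    using isCont_data(1) sub by (intro continuous_at_imp_continuous_on) blast
  have c\<psi>: "continuous_on (cball Ub \<epsilon>) \<psi>x"
    using has_derivative_continuous[OF \<psi>x] sub by (intro continuous_at_imp_continuous_on) blast
  \<comment> \<open>A continuous injective map on a compact ball has a continuous inverse; this
    gives the measurability of the entropy flux along \<open>u\<close>.\<close>
  have cinv: "continuous_on ?K (inv_into ?S fx)"
    by (rule continuous_on_inv[OF cfx compact_cball]) (use inv in blast)
  have "continuous_on ?K (\<lambda>v. \<psi>x (inv_into ?S fx v))"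
    by (rule continuous_on_compose2[OF c\<psi> cinv]) (use inv in auto)
  from measurable_compose_continuous_on[OF meas range this]
  have meas\<psi>: "(\<lambda>z. \<psi>x (u z)) \<in> borel_measurable lebesgue" by (simp only: u_def)
  have bound: "\<exists>K. \<forall>w\<in>cball Ub \<epsilon>. norm (h w) \<le> K" if "continuous_on (cball Ub \<epsilon>) h" for h :: "real^'m \<Rightarrow> 'c::real_normed_vector"
    using compact_imp_bounded[OF compact_continuous_image[OF that compact_cball]] by (auto simp: bounded_iff)
  obtain K1 where K1: "\<forall>w\<in>cball Ub \<epsilon>. norm (fx w) \<le> K1" using bound[OF cfx] ..
  obtain K2 where K2: "\<forall>w\<in>cball Ub \<epsilon>. norm (\<psi>x w) \<le> K2" using bound[OF c\<psi>] ..
  have int: "(\<lambda>z. fx (u z)) integrable_on {x..y}" "(\<lambda>z. \<psi>x (u z)) integrable_on {x..y}" for x y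
    using meas K1 K2 u(1) Vfx meas\<psi> by (auto intro!: bounded_measurable_integrable_on)
  have "trajectory \<epsilon> C \<sigma> u"
  proof (rule trajectoryI[OF _ \<sigma> lip C int])
    show "range u \<subseteq> cball Ub \<epsilon>" using u(1) by blast
    fix x y :: real assume xy: "x < y"
    note * = eqs[THEN spec, THEN spec, THEN mp, OF xy]
    show "G y (u y) - G x (u x) = - integral {x..y} (\<lambda>z. fx (u z))"
      using *[THEN conjunct1] unfolding G_def u(2)[of x] u(2)[of y] Vfx .
    show "\<sigma> * (H y (u y) - H x (u x)) \<le> \<sigma> * (- integral {x..y} (\<lambda>z. \<psi>x (u z)))"
      using *[THEN conjunct2] unfolding H_def .
  qed
  then show thesis using u(2) by (rule that)
qed

end

theorem theorem8:
  fixes P :: "(real^'m) set"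
    and fx fy :: "real^'m \<Rightarrow> real^'m"
    and \<eta> \<psi>x \<psi>y :: "real^'m \<Rightarrow> real"
    and Ub :: "real^'m" and \<delta> :: real
    and n :: nat and lam :: "nat \<Rightarrow> real^'m \<Rightarrow> real" and p :: "nat \<Rightarrow> nat"
  assumes system: "entropy_system P fx fy \<eta> \<psi>x \<psi>y"
    and ball: "\<delta> > 0" "ball Ub \<delta> \<subseteq> P"
    and mult: "constant_multiplicity fx fy Ub \<delta> n lam p" "n < CARD('m)"
    and fields: "\<forall>\<alpha>\<in>{1..n}. p \<alpha> = 1 \<longrightarrow>
          genuinely_nonlinear (in_V fx Ub \<delta> fy) (lam \<alpha>) (fx ` ball Ub \<delta>) \<or>
          linearly_degenerate (in_V fx Ub \<delta> fy) (lam \<alpha>) (fx ` ball Ub \<delta>)"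
    and positive: "\<forall>z\<in>gen_eigenvalues (mat 1) (jacobian fx (at Ub)). z \<in> \<real> \<and> Re z > 0"
  shows "\<exists>\<epsilon>\<^sub>0. 0 < \<epsilon>\<^sub>0 \<and> \<epsilon>\<^sub>0 < \<delta> \<and> (\<forall>\<epsilon>. 0 < \<epsilon> \<and> \<epsilon> \<le> \<epsilon>\<^sub>0 \<longrightarrow>
    (\<exists>C\<^sub>S C\<^sub>L :: real. \<forall>U \<sigma> V.
       entropy_solution P fx fy \<eta> \<psi>x \<psi>y U \<and> steady U \<and> self_similar U \<and>
       (AE z in lebesgue. U z \<in> cball Ub \<epsilon>) \<and>
       \<sigma> \<in> {1, -1} \<and>
       version_in_half_plane fx (in_V fx Ub \<delta> fy) (in_V fx Ub \<delta> \<psi>x) (in_V fx Ub \<delta> \<psi>y)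
         (fx ` cball Ub \<epsilon>) U \<sigma> V
       \<longrightarrow> bounded_variation V \<and>
           special_bounded_variation V \<and>
           (\<exists>V\<^sub>S V\<^sub>L. (\<forall>\<xi>. V \<xi> = V\<^sub>S \<xi> + V\<^sub>L \<xi>) \<and>
              saltus V\<^sub>S \<and> total_variation V\<^sub>S \<le> ennreal C\<^sub>S \<and>
              C\<^sub>L-lipschitz_on UNIV V\<^sub>L)))"
proof -
  obtain g X Y N X2 Y2 N2 where pencil: "symmetrizable_pencil Ub \<delta> fx fy g X Y N X2 Y2 N2 \<psi>x \<psi>y"
    by (rule entropy_system_pencil[OF system ball positive])
  interpret constant_multiplicity_pencil Ub \<delta> fx fy g X Y N X2 Y2 N2 \<psi>x \<psi>y n lam p
    by (intro constant_multiplicity_pencil.intro pencil constant_multiplicity_pencil_axioms.intro mult(1) fields)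
  have sub: "cball Ub (\<delta> / 2) \<subseteq> P" using ball by (intro order_trans[OF _ ball(2)]) auto
  have smooth: "Ck_on 1 fx P" "Ck_on 1 \<psi>x P"
    using system unfolding entropy_system_def smooth_on_def by blast+
  obtain C1 where C1: "\<And>v w. \<lbrakk>v \<in> cball Ub (\<delta> / 2); w \<in> cball Ub (\<delta> / 2)\<rbrakk> \<Longrightarrow> norm (fx v - fx w) \<le> C1 * norm (v - w)"
    by (rule Ck_on_lipschitz[OF smooth(1) sub]) blast
  obtain C2 where C2: "\<And>v w. \<lbrakk>v \<in> cball Ub (\<delta> / 2); w \<in> cball Ub (\<delta> / 2)\<rbrakk> \<Longrightarrow> norm (\<psi>x v - \<psi>x w) \<le> C2 * norm (v - w)"
    by (rule Ck_on_lipschitz[OF smooth(2) sub]) blast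
  \<comment> \<open>One constant for both Lipschitz bounds; \<open>sector\<close> asks for at least
    1.\<close>
  define C where "C = max 1 (max C1 C2)"
  have C: "1 \<le> C" "C1 \<le> C" "C2 \<le> C" by (auto simp: C_def)
  obtain e D B M where e: "0 < e" "e < \<delta>" and D: "0 \<le> D" and B: "0 \<le> B" and M: "0 \<le> M"
    and jumps: "\<forall>\<sigma> u. trajectory e C \<sigma> u \<longrightarrow>
      (\<exists>a b. a summable_on UNIV \<and> b summable_on UNIV \<and> (\<forall>s. 0 \<le> a s) \<and> (\<forall>s. 0 \<le> b s) \<and>
        infsum a UNIV + infsum b UNIV \<le> B \<and> (\<forall>s. \<not> (- M < s \<and> s < M) \<longrightarrow> a s = 0 \<and> b s = 0) \<and>
        (\<forall>x y. x < y \<longrightarrow> norm (u y - u x) \<le> D * (y - x) + infsum a {x<..y} + infsum b {x..<y})) \<and>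
      (\<forall>x. x \<le> - M \<longrightarrow> u x = u (- M)) \<and> (\<forall>x. M \<le> x \<longrightarrow> u x = u M)"
    by - (rule uniform_jump_bound[OF C(1)], rule that; assumption)
  \<comment> \<open>\<open>C * B\<close> and \<open>C * D\<close> are fixed before
    \<open>\<epsilon>\<close>, \<open>U\<close>, \<open>\<sigma>\<close> and \<open>V\<close>
    enter.\<close>
  have main: "bounded_variation V \<and> special_bounded_variation V \<and>
           (\<exists>V\<^sub>S V\<^sub>L. (\<forall>\<xi>. V \<xi> = V\<^sub>S \<xi> + V\<^sub>L \<xi>) \<and>
              saltus V\<^sub>S \<and> total_variation V\<^sub>S \<le> ennreal (C * B) \<and> (C * D)-lipschitz_on UNIV V\<^sub>L)"
    if \<epsilon>: "0 < \<epsilon>" "\<epsilon> \<le> min e (\<delta> / 2)" and \<sigma>: "\<sigma> \<in> {1, -1}"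
      and V: "version_in_half_plane fx (in_V fx Ub \<delta> fy) (in_V fx Ub \<delta> \<psi>x) (in_V fx Ub \<delta> \<psi>y)
         (fx ` cball Ub \<epsilon>) U \<sigma> V" for \<epsilon> U \<sigma> V
  proof -
    have \<epsilon>': "\<epsilon> \<le> e" "\<epsilon> \<le> \<delta> / 2" "\<epsilon> < \<delta>" using \<epsilon> ball(1) by auto
    have in_half: "v \<in> cball Ub \<epsilon> \<Longrightarrow> v \<in> cball Ub (\<delta> / 2)" for v using \<epsilon>'(2) by auto
    have lip: "norm (fx v - fx w) \<le> C * norm (v - w)" "norm (\<psi>x v - \<psi>x w) \<le> C * norm (v - w)"
      if "v \<in> cball Ub \<epsilon>" "w \<in> cball Ub \<epsilon>" for v w
      using C1[OF in_half in_half, OF that] C2[OF in_half in_half, OF that]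
        mult_right_mono[OF C(2), of "norm (v - w)"] mult_right_mono[OF C(3), of "norm (v - w)"] by auto
    have abs_\<sigma>: "\<bar>\<sigma>\<bar> = 1" using \<sigma> by auto
    have C0: "0 \<le> C" using C(1) by simp
    obtain u where u: "trajectory \<epsilon> C \<sigma> u" "\<And>\<xi>. V \<xi> = fx (u \<xi>)"
      by (rule version_trajectory[OF \<epsilon>(1) \<epsilon>'(3) abs_\<sigma> C0 lip V]) blast+
    have t: "trajectory e C \<sigma> u" by (rule trajectory_mono[OF u(1) \<epsilon>'(1)])
    note t' = jumps[THEN spec, THEN spec, THEN mp, OF t]
    obtain a b where ab: "a summable_on UNIV" "b summable_on UNIV" "\<forall>s. 0 \<le> a s" "\<forall>s. 0 \<le> b s"
      "infsum a UNIV + infsum b UNIV \<le> B" "\<forall>s. \<not> (- M < s \<and> s < M) \<longrightarrow> a s = 0 \<and> b s = 0"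
      "\<forall>x y. x < y \<longrightarrow> norm (u y - u x) \<le> D * (y - x) + infsum a {x<..y} + infsum b {x..<y}"
      using t'[THEN conjunct1] by (elim exE conjE)
    have range: "u x \<in> cball Ub \<epsilon>" for x
    proof -
      have "range u \<subseteq> cball Ub \<epsilon>" using u(1) unfolding trajectory_def by (elim conjE)
      then show ?thesis by blast
    qed
    \<comment> \<open>Passing from \<open>u\<close> to \<open>V = fx (u)\<close> multiplies the rate
      and the atoms by the Lipschitz constant of \<open>fx\<close>.\<close>
    interpret J: jump_control_euclidean "C * D" "\<lambda>s. C * a s" "\<lambda>s. C * b s" V
    proof
      show "0 \<le> C * D" using C0 D by simp
      show "(\<lambda>s. C * a s) summable_on UNIV" "(\<lambda>s. C * b s) summable_on UNIV"
        using ab(1,2) by (simp_all add: summable_on_cmult_right)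
      show "0 \<le> C * a s" "0 \<le> C * b s" for s using ab(3,4) C0 by simp_all
      fix x y :: real assume xy: "x < y"
      have "norm (V y - V x) \<le> C * norm (u y - u x)" unfolding u(2) by (rule lip(1)[OF range range])
      also have "\<dots> \<le> C * (D * (y - x) + infsum a {x<..y} + infsum b {x..<y})"
        by (rule mult_left_mono[OF ab(7)[THEN spec, THEN spec, THEN mp, OF xy] C0])
      also have "\<dots> = C * D * (y - x) + infsum (\<lambda>s. C * a s) {x<..y} + infsum (\<lambda>s. C * b s) {x..<y}"
        by (simp add: infsum_cmult_right' distrib_left mult.assoc)
      finally show "norm (V y - V x) \<le> C * D * (y - x) + infsum (\<lambda>s. C * a s) {x<..y} + infsum (\<lambda>s. C * b s) {x..<y}" .
    qed
    have VM: "V x = V (- M)" if "x \<le> - M" for x using t'[THEN conjunct2, THEN conjunct1, THEN spec, THEN mp, OF that] u(2) by simp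
    have VM': "V x = V M" if "x \<ge> M" for x using t'[THEN conjunct2, THEN conjunct2, THEN spec, THEN mp, OF that] u(2) by simp
    let ?J = "jump_function J.left_jump J.right_jump"
    have "infsum (\<lambda>s. C * a s) UNIV + infsum (\<lambda>s. C * b s) UNIV = C * (infsum a UNIV + infsum b UNIV)"
      by (simp add: infsum_cmult_right' distrib_left)
    also have "\<dots> \<le> C * B" by (rule mult_left_mono[OF ab(5) C0])
    finally have tv: "total_variation ?J \<le> ennreal (C * B)"
      by (intro order_trans[OF J.total_variation_jump_function] ennreal_leI)
    have "bounded_variation V" by (rule J.bounded_variation[OF M VM VM'])
    moreover have "special_bounded_variation V"
      by (rule J.special_bounded_variation[OF M VM VM']) (use ab(6) in auto)
    moreover have "\<exists>V\<^sub>S V\<^sub>L. (\<forall>\<xi>. V \<xi> = V\<^sub>S \<xi> + V\<^sub>L \<xi>) \<and>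
              saltus V\<^sub>S \<and> total_variation V\<^sub>S \<le> ennreal (C * B) \<and> (C * D)-lipschitz_on UNIV V\<^sub>L"
      by (rule exI[of _ ?J], rule exI[of _ "\<lambda>\<xi>. V \<xi> - ?J \<xi>"])
        (intro conjI J.saltus_jump_function tv J.lipschitz_part; simp)
    ultimately show ?thesis by (intro conjI)
  qed
  show ?thesis
  proof (rule exI[of _ "min e (\<delta> / 2)"], intro conjI allI impI)
    show "0 < min e (\<delta> / 2)" "min e (\<delta> / 2) < \<delta>" using e ball(1) by auto
    fix \<epsilon> assume \<epsilon>: "0 < \<epsilon> \<and> \<epsilon> \<le> min e (\<delta> / 2)"
    show "\<exists>C\<^sub>S C\<^sub>L :: real. \<forall>U \<sigma> V.
       entropy_solution P fx fy \<eta> \<psi>x \<psi>y U \<and> steady U \<and> self_similar U \<and>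
       (AE z in lebesgue. U z \<in> cball Ub \<epsilon>) \<and>
       \<sigma> \<in> {1, -1} \<and>
       version_in_half_plane fx (in_V fx Ub \<delta> fy) (in_V fx Ub \<delta> \<psi>x) (in_V fx Ub \<delta> \<psi>y)
         (fx ` cball Ub \<epsilon>) U \<sigma> V
       \<longrightarrow> bounded_variation V \<and>
           special_bounded_variation V \<and>
           (\<exists>V\<^sub>S V\<^sub>L. (\<forall>\<xi>. V \<xi> = V\<^sub>S \<xi> + V\<^sub>L \<xi>) \<and>
              saltus V\<^sub>S \<and> total_variation V\<^sub>S \<le> ennreal C\<^sub>S \<and>
              C\<^sub>L-lipschitz_on UNIV V\<^sub>L)"
      by (rule exI[of _ "C * B"], rule exI[of _ "C * D"], intro allI impI, elim conjE)
        (rule main; use \<epsilon> in simp)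
  qed
qed

end
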